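(* Let $\Omega$ be a compact 2-dimensional Riemannian manifold without boundary, with a mesh $\mathcal M_h$ and local polynomial spaces satisfying hypotheses (H) and (T) of the context, let $r\ge0$, $T>0$, and let $\widetilde J$ be a given time-dependent 1-form on $\Omega$ (continuous in time and space on $[0,T]\times\Omega$). Let $(\underline{\mathbf E}_h,\underline{\mathbf B}'_h)\in C^1([0,T];\underline X^1_{r,h}\times\underline X^2_{r,h})$ be a solution of the semi-discrete scheme: for all $(\underline v^1_h,\underline v_h^2)\in\underline X^1_{r,h}\times\underline X^2_{r,h}$ and all $t\in(0,T)$, $$\langle\underline{\mathrm d}^1_{r,h}\underline{\mathbf E}_h(t),\underline v^2_h\rangle=-\langle\partial_t\underline{\mathbf B}'_h(t),\underline v_h^2\rangle,$$ $$\langle\underline{\mathbf B}'_h(t),\underline{\mathrm d}^1_{r,h}\underline v^1_h\rangle=\langle\underline I^1_{r,h}\widetilde J(t),\underline v^1_h\rangle+\langle\partial_t\underline{\mathbf E}_h(t),\underline v^1_h\rangle.$$ Let $\rho_h\in C^1([0,T];\underline X^0_{r,h})$ be the discrete electric charge density defined by $$\langle\rho_h(t),\underline v^0_h\rangle=-\langle\underline{\mathbf E}_h(0),\underline{\mathrm d}^0_{r,h}\underline v^0_h\rangle+\int_0^t\langle\underline I^1_{r,h}\widetilde J(s),\underline{\mathrm d}^0_{r,h}\underline v^0_h\rangle\,ds\qquad\forall t\in[0,T],\ \forall\underline v^0_h\in\underline X^0_{r,h}.$$ Then $$\langle\underline{\mathbf E}_h(t),\underline{\mathrm d}^0_{r,h}\underline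 v^0_h\rangle=-\langle\rho_h(t),\underline v^0_h\rangle\qquad\forall t\in[0,T],\ \forall\underline v^0_h\in\underline X^0_{r,h}.$$
   Context: Here $n=2$ is the dimension of $\Omega$. $\mathrm d$ is the exterior derivative, $\operatorname{tr}_{f'}$ the trace (pullback by inclusion) of forms on $f'$. **Mesh.** $\mathcal M_h$ is a finite collection of pairwise disjoint (oriented) submanifolds ("cells") of dimensions $0,\dots,n$, covering $\Omega$; $\Delta_d(\mathcal M_h)$ is the set of $d$-dimensional cells ($d$-cells). If $f$ is a $d$-cell, $d\ge1$, and $f'$ is a $d'$-cell with $d'<d$ and $f'\cap\overline f\ne\emptyset$, then $f'\subset\partial f$. For $d'<d$, $\Delta_{d'}(f)$ is the set of $d'$-cells contained in $\partial f$, and $\Delta_d(f)=\{f\}$. For $d\ge1$, $h_f:=|f|^{1/d}$. **Polynomial spaces.** For every $d$-cell $f$ we are given finite-dimensional spaces $\mathcal P_r\Lambda^l(f)$ ($r,l\in\mathbb Z$) of $l$-forms of class $C^1$ on $f$ (up to the boundary, so that traces make sense), with $\mathrm d\mathcal P_r\Lambda^l(f)\subset\mathcal P_{r-1}\Lambda^{l+1}(f)$, and a linear graded map $\kappa=\kappa_f$ with $\kappa\mathcal P_r\Lambda^l(f)\subset\mathcal P_{r+1}\Lambda^{l-1}(f)$ and $\kappa\circ\kappa=0$. (Forms of degree $<0$ or $>d$ on $f$ are zero.) **(H) Homogeneous polynomials.** For all $d\in[0,n]$ and $f\in\Delta_d(\mathcal M_h)$: (a) there are spaces $\mathcal H_s\Lambda^l(f)$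 ($s,l\in\mathbb Z$), with $\mathcal H_s\Lambda^l(f)=\{0\}$ for $s<0$, such that $\mathcal P_r\Lambda^l(f)=\bigoplus_{s\le r}\mathcal H_s\Lambda^l(f)$, and real numbers $\lambda_{s,l}$ such that $(\mathrm d\kappa+\kappa\mathrm d)p=\lambda_{s,l}\,p$ for all $p\in\mathcal H_s\Lambda^l(f)$; for $s<0$ one fixes $\lambda_{s,l}=\lambda_{s+l,0}$, with $\lambda_{s+l,0}=0$ if $s+l<0$; (b) if $d>0$, $l\in[0,d]$, $s,s'\ge0$ and $\lambda_{s,l}=\lambda_{s',l}$, then $s=s'$; moreover, for $s\ge0$ (and $l\in[0,d]$), $\lambda_{s,l}=0$ iff $(s,l)=(0,0)$; (c) $\mathrm d\mathcal H_s\Lambda^l(f)\ne\{0\}$ when $s>0$ and $l<d$. **Trimmed spaces.** For $r\ge0$: $\mathcal P^-_r\Lambda^0(f):=\mathcal P_r\Lambda^0(f)$ and $\mathcal P^-_r\Lambda^l(f):=\mathrm d\mathcal P_r\Lambda^{l-1}(f)\oplus\kappa\mathcal P_{r-1}\Lambda^{l+1}(f)$ for $l\ge1$. **(T)** For all $l\in\mathbb Z$, $d\in[0,n]$, $f\in\Delta_d(\mathcal M_h)$, $d'\in[0,d]$, $r\ge0$ and $f'\in\Delta_{d'}(f)$: $\operatorname{tr}_{f'}\mathcal P^-_r\Lambda^l(f)\subset\mathcal P^-_r\Lambda^l(f')$. **Hodge star and projector.** On a $d$-cell $f$ with the induced metric, $\star$ maps $k$-forms to $(d-k)$-forms via $\langle\star\omega,\mu\rangle\,\mathrm{vol}=\omega\wedge\mu$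 for all $(d-k)$-forms $\mu$. $\pi^{-,l}_{r,f}$ is the $L^2$-orthogonal projector from $L^2\Lambda^l(f)$ onto $\mathcal P^-_r\Lambda^l(f)$. **Discrete spaces, interpolator.** $\underline X^k_{r,h}:=\prod_{d=k}^{n}\prod_{f\in\Delta_d(\mathcal M_h)}\star^{-1}\mathcal P^-_r\Lambda^{d-k}(f)$, with elements $\underline\omega_h=(\omega_f)_f$; $\underline\omega_f=(\omega_{f'})_{f'\in\Delta_{d'}(f),\,d'\in[k,d]}$ denotes restriction to a $d$-cell $f$, and $\underline X^k_{r,f}$ the space of such restrictions. The interpolator on $C^0\Lambda^k(\Omega)$ is $\underline I^k_{r,h}\omega:=(\star^{-1}\pi^{-,d-k}_{r,f}\star\operatorname{tr}_f\omega)_{f\in\Delta_d(\mathcal M_h),\,d\in[k,n]}$. **Local discrete exterior derivative and potential.** For $f\in\Delta_d(\mathcal M_h)$, $\mathrm d^k_{r,f}:\underline X^k_{r,f}\to\star^{-1}\mathcal P_r\Lambda^{d-k-1}(f)$ and $P^k_{r,f}:\underline X^k_{r,f}\to\star^{-1}\mathcal P_r\Lambda^{d-k}(f)$ are defined by induction on $d$. If $d=k$: $P^k_{r,f}\underline\omega_f:=\omega_f$. If $d\ge k+1$: for all $\mu_f\in\mathcal P_r\Lambda^{d-k-1}(f)$, $$\int_f\mathrm d^k_{r,f}\underline\omega_f\wedge\mu_f=(-1)^{k+1}\int_f\omega_f\wedge\mathrm d\mu_f+\int_{\partial f}P^k_{r,\partial f}\underline\omega_f\wedge\operatorname{tr}_{\partial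 f}\mu_f,$$ where $P^k_{r,\partial f}\underline\omega_f$ equals $P^k_{r,f'}\underline\omega_{f'}$ on each $f'\in\Delta_{d-1}(f)$ and $\partial f$ has the orientation induced by $f$; and for all $\mu_f\in\kappa\mathcal P_r\Lambda^{d-k}(f)$, $\nu_f\in\kappa\mathcal P_{r-1}\Lambda^{d-k+1}(f)$, $$(-1)^{k+1}\int_fP^k_{r,f}\underline\omega_f\wedge(\mathrm d\mu_f+\nu_f)=\int_f\mathrm d^k_{r,f}\underline\omega_f\wedge\mu_f-\int_{\partial f}P^k_{r,\partial f}\underline\omega_f\wedge\operatorname{tr}_{\partial f}\mu_f+(-1)^{k+1}\int_f\omega_f\wedge\nu_f.$$ **Global discrete exterior derivative.** $\underline{\mathrm d}^k_{r,h}:\underline X^k_{r,h}\to\underline X^{k+1}_{r,h}$, $\underline{\mathrm d}^k_{r,h}\underline\omega_h:=(\star^{-1}\pi^{-,d-k-1}_{r,f}\star\mathrm d^k_{r,f}\underline\omega_f)_{f\in\Delta_d(\mathcal M_h),\,d\in[k+1,n]}$. **Discrete $L^2$-like inner product** on $\underline X^k_{r,h}$: $$\langle\underline\omega_h,\underline\mu_h\rangle=\sum_{f\in\Delta_n(\mathcal M_h)}\Big(\int_fP^k_{r,f}\underline\omega_f\wedge\star P^k_{r,f}\underline\mu_f+\sum_{d=k}^{n-1}h_f^{n-d}\sum_{f'\in\Delta_d(f)}\int_{f'}(P^k_{r,f'}\underline\omega_{f'}-\operatorname{tr}_{f'}P^k_{r,f}\underline\omega_f)\wedge\star(P^k_{r,f'}\underline\mu_{f'}-\operatorname{tr}_{f'}P^k_{r,f}\underline\mu_f)\Big).$$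 *)

theory Defs
  imports "HOL-Analysis.Analysis" "HOL-Library.Function_Algebras"
begin

instantiation "fun" :: (type, real_vector) real_vector
begin

definition scaleR_fun :: "real \<Rightarrow> ('a \<Rightarrow> 'b) \<Rightarrow> 'a \<Rightarrow> 'b"
  where "scaleR_fun a f = (\<lambda>x. a *\<^sub>R f x)"

instance
  by standard (simp_all add: scaleR_fun_def plus_fun_def scaleR_add_right scaleR_add_left)

end

section \<open>Alternating multilinear forms\<close>

text \<open>An \<open>l\<close>-linear alternating form on a subspace \<open>T\<close> takes the list of its arguments and is
  extended by \<open>0\<close> to all lists that do not consist of \<open>l\<close> vectors of \<open>T\<close>, so that equality
  of forms is equality of functions. For \<open>l < 0\<close> and for \<open>l > dim T\<close> only \<open>0\<close> remains.\<close>

definition alt_forms :: "int \<Rightarrow> 'v::real_vector set \<Rightarrow> ('v list \<Rightarrow> real) set" where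
  "alt_forms l T = {a.
     (\<forall>vs. a vs \<noteq> 0 \<longrightarrow> int (length vs) = l \<and> set vs \<subseteq> T \<and> distinct vs) \<and>
     (\<forall>us ws. \<forall>v\<in>T. \<forall>w\<in>T. \<forall>s. a (us @ (s *\<^sub>R v + w) # ws) = s * a (us @ v # ws) + a (us @ w # ws))}"

definition restr_alt :: "'v set \<Rightarrow> ('v list \<Rightarrow> real) \<Rightarrow> 'v list \<Rightarrow> real" where
  "restr_alt T a = (\<lambda>vs. if set vs \<subseteq> T then a vs else 0)"

text \<open>Sum over shuffles: \<open>S\<close> is the set of positions of the arguments given to the first factor.
  No degrees are needed since forms vanish on lists of the wrong length.\<close>

definition alt_wedge :: "('v list \<Rightarrow> real) \<Rightarrow> ('v list \<Rightarrow> real) \<Rightarrow> 'v list \<Rightarrow> real" where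
  "alt_wedge a b = (\<lambda>vs. \<Sum>S\<in>Pow {..<length vs}.
     (-1) ^ card {(i, j). i \<in> S \<and> j \<in> {..<length vs} - S \<and> j < i}
       * a (nths vs S) * b (nths vs ({..<length vs} - S)))"


section \<open>Riemannian surfaces\<close>

text \<open>A chart is a pair \<open>(U, \<phi>)\<close>; only the values of \<open>\<phi>\<close> on \<open>U\<close> matter. A tangent vector at a
  point is the family of its components in all charts of the maximal atlas around the point
  (\<open>0\<close> for all other charts).\<close>

type_synonym 'p chart = "'p set \<times> ('p \<Rightarrow> real^2)"
type_synonym 'p tvec = "'p chart \<Rightarrow> real^2"
type_synonym 'p form = "'p \<Rightarrow> 'p tvec list \<Rightarrow> real"

abbreviation chart_inv :: "'p chart \<Rightarrow> real^2 \<Rightarrow> 'p" where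
  "chart_inv c \<equiv> inv_into (fst c) (snd c)"

abbreviation chart_image :: "'p chart \<Rightarrow> 'p set \<Rightarrow> (real^2) set" where
  "chart_image c A \<equiv> snd c ` (fst c \<inter> A)"

abbreviation chart_range :: "'p chart \<Rightarrow> (real^2) set" where
  "chart_range c \<equiv> snd c ` fst c"

text \<open>Meant for open \<open>S\<close>.\<close>

primrec Ck_on :: "nat \<Rightarrow> (real^2 \<Rightarrow> 'b::real_normed_vector) \<Rightarrow> (real^2) set \<Rightarrow> bool" where
  "Ck_on 0 F S \<longleftrightarrow> continuous_on S F"
| "Ck_on (Suc m) F S \<longleftrightarrow>
     F differentiable_on S \<and> (\<forall>u. Ck_on m (\<lambda>y. frechet_derivative F (at y) u) S)"

definition smooth_on :: "(real^2 \<Rightarrow> 'b::real_normed_vector) \<Rightarrow> (real^2) set \<Rightarrow> bool" where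
  "smooth_on F S \<longleftrightarrow> (\<forall>m. Ck_on m F S)"

record 'p surface =
  pts :: "'p set"
  charts :: "'p chart set"
  metric :: "'p \<Rightarrow> 'p tvec \<Rightarrow> 'p tvec \<Rightarrow> real"

definition is_chart :: "'p::t2_space set \<Rightarrow> 'p chart \<Rightarrow> bool" where
  "is_chart X c \<longleftrightarrow> openin (top_of_set X) (fst c) \<and> open (chart_range c) \<and>
     homeomorphism (fst c) (chart_range c) (snd c) (chart_inv c)"

definition smoothly_compatible :: "'p chart \<Rightarrow> 'p chart \<Rightarrow> bool" where
  "smoothly_compatible c c' \<longleftrightarrow>
     smooth_on (snd c' \<circ> chart_inv c) (chart_image c (fst c')) \<and>
     smooth_on (snd c \<circ> chart_inv c') (chart_image c' (fst c))"

definition maximal_smooth_atlas :: "'p::t2_space set \<Rightarrow> 'p chart set \<Rightarrow> bool" where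
  "maximal_smooth_atlas X \<A> \<longleftrightarrow>
     (\<forall>c\<in>\<A>. is_chart X c) \<and> X \<subseteq> (\<Union>c\<in>\<A>. fst c) \<and>
     (\<forall>c\<in>\<A>. \<forall>c'\<in>\<A>. smoothly_compatible c c') \<and>
     (\<forall>c. is_chart X c \<and> (\<forall>c'\<in>\<A>. smoothly_compatible c c') \<longrightarrow> c \<in> \<A>)"

text \<open>The tangent vector at \<open>x\<close> with components \<open>u\<close> in the chart \<open>c\<close>.\<close>

definition tvec_of :: "('p, 'z) surface_scheme \<Rightarrow> 'p chart \<Rightarrow> 'p \<Rightarrow> real^2 \<Rightarrow> 'p tvec" where
  "tvec_of M c x u = (\<lambda>c'. if c' \<in> charts M \<and> x \<in> fst c'
     then frechet_derivative (snd c' \<circ> chart_inv c) (at (snd c x)) u else 0)"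

definition tspace :: "('p, 'z) surface_scheme \<Rightarrow> 'p \<Rightarrow> 'p tvec set" where
  "tspace M x = {tvec_of M c x u | c u. c \<in> charts M \<and> x \<in> fst c}"

definition riemannian_surface :: "('p::t2_space, 'z) surface_scheme \<Rightarrow> bool" where
  "riemannian_surface M \<longleftrightarrow> maximal_smooth_atlas (pts M) (charts M) \<and>
     (\<forall>x\<in>pts M. \<forall>v\<in>tspace M x. \<forall>w\<in>tspace M x.
        metric M x v w = metric M x w v \<and>
        (v \<noteq> 0 \<longrightarrow> metric M x v v > 0) \<and>
        (\<forall>v'\<in>tspace M x. \<forall>s. metric M x (s *\<^sub>R v + v') w = s * metric M x v w + metric M x v' w)) \<and>
     (\<forall>c\<in>charts M. \<forall>u w. smooth_on (\<lambda>y. let x = chart_inv c y in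
        metric M x (tvec_of M c x u) (tvec_of M c x w)) (chart_range c))"


section \<open>Meshes\<close>

text \<open>\<open>flat d\<close> is the coordinate subspace spanned by the first \<open>d\<close> vectors \<open>ebasis d\<close>.\<close>

definition flat :: "nat \<Rightarrow> (real^2) set" where
  "flat d = {y. \<forall>i\<in>{d<..2}. y $ of_nat i = 0}"

definition ebasis :: "nat \<Rightarrow> (real^2) list" where
  "ebasis d = map (\<lambda>i. axis (of_nat i) 1) [1..<Suc d]"

text \<open>\<open>orient f\<close> is the positive unit volume form of the oriented cell \<open>f\<close>.\<close>

record 'p meshed_surface = "'p surface" +
  cells :: "'p set set"
  cdim :: "'p set \<Rightarrow> nat"
  orient :: "'p set \<Rightarrow> 'p form"

definition cells_of_dim :: "('p, 'z) meshed_surface_scheme \<Rightarrow> nat \<Rightarrow> 'p set set" where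
  "cells_of_dim M d = {f \<in> cells M. cdim M f = d}"

definition bdry :: "'p::t2_space set \<Rightarrow> 'p set" where
  "bdry f = closure f - f"

definition faces :: "('p::t2_space, 'z) meshed_surface_scheme \<Rightarrow> nat \<Rightarrow> 'p set \<Rightarrow> 'p set set" where
  "faces M d f = (if d < cdim M f then {f' \<in> cells_of_dim M d. f' \<subseteq> bdry f}
     else if d = cdim M f then {f} else {})"

definition submanifold :: "('p, 'z) surface_scheme \<Rightarrow> nat \<Rightarrow> 'p set \<Rightarrow> bool" where
  "submanifold M d f \<longleftrightarrow> f \<subseteq> pts M \<and>
     (\<forall>x\<in>f. \<exists>c\<in>charts M. x \<in> fst c \<and> chart_image c f = chart_range c \<inter> flat d)"

text \<open>A chart of \<open>M\<close> whose first \<open>cdim M f\<close> coordinates are a chart of \<open>f\<close>.\<close>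

definition cell_chart :: "('p, 'z) meshed_surface_scheme \<Rightarrow> 'p set \<Rightarrow> 'p chart \<Rightarrow> bool" where
  "cell_chart M f c \<longleftrightarrow> c \<in> charts M \<and> openin (top_of_set (flat (cdim M f))) (chart_image c f)"

definition cell_tspace :: "('p, 'z) meshed_surface_scheme \<Rightarrow> 'p set \<Rightarrow> 'p \<Rightarrow> 'p tvec set" where
  "cell_tspace M f x = {tvec_of M c x u | c u. cell_chart M f c \<and> x \<in> fst c \<and> u \<in> flat (cdim M f)}"

definition cell_forms :: "('p, 'z) meshed_surface_scheme \<Rightarrow> 'p set \<Rightarrow> int \<Rightarrow> 'p form set" where
  "cell_forms M f l = {\<omega>. \<forall>x. (x \<in> f \<longrightarrow> \<omega> x \<in> alt_forms l (cell_tspace M f x)) \<and> (x \<notin> f \<longrightarrow> \<omega> x = 0)}"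

text \<open>Scalar product of alternating forms on the tangent space of \<open>f\<close> at \<open>x\<close>, summing over the
  increasing sublists of an orthonormal basis (those of the wrong length contribute \<open>0\<close>).\<close>

definition orthonormal_frame :: "('p, 'z) meshed_surface_scheme \<Rightarrow> 'p set \<Rightarrow> 'p \<Rightarrow> 'p tvec list \<Rightarrow> bool" where
  "orthonormal_frame M f x es \<longleftrightarrow> length es = cdim M f \<and> set es \<subseteq> cell_tspace M f x \<and>
     (\<forall>i<length es. \<forall>j<length es. metric M x (es ! i) (es ! j) = (if i = j then 1 else 0))"

definition form_inner :: "('p, 'z) meshed_surface_scheme \<Rightarrow> 'p set \<Rightarrow> 'p \<Rightarrow>
    ('p tvec list \<Rightarrow> real) \<Rightarrow> ('p tvec list \<Rightarrow> real) \<Rightarrow> real" where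
  "form_inner M f x a b = (\<Sum>I\<leftarrow>subseqs (SOME es. orthonormal_frame M f x es). a I * b I)"

definition oriented_cell :: "('p, 'z) meshed_surface_scheme \<Rightarrow> 'p set \<Rightarrow> bool" where
  "oriented_cell M f \<longleftrightarrow> orient M f \<in> cell_forms M f (int (cdim M f)) \<and>
     (\<forall>x\<in>f. form_inner M f x (orient M f x) (orient M f x) = 1) \<and>
     (\<forall>c. cell_chart M f c \<longrightarrow> continuous_on (chart_image c f)
        (\<lambda>y. let x = chart_inv c y in orient M f x (map (tvec_of M c x) (ebasis (cdim M f)))))"

text \<open>For a facet \<open>f'\<close> of \<open>f\<close>: a chart in which \<open>f \<union> f'\<close> is a half space of \<open>flat (cdim M f)\<close> with
  boundary \<open>f'\<close> and outward vector minus the last basis vector.\<close>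

definition bdry_chart :: "('p, 'z) meshed_surface_scheme \<Rightarrow> 'p set \<Rightarrow> 'p set \<Rightarrow> 'p chart \<Rightarrow> bool" where
  "bdry_chart M f f' c \<longleftrightarrow> c \<in> charts M \<and>
     chart_image c f = chart_range c \<inter> {y \<in> flat (cdim M f). 0 < y $ of_nat (cdim M f)} \<and>
     chart_image c f' = chart_range c \<inter> flat (cdim M f - 1)"

text \<open>The last two conditions say that \<open>\<partial>f\<close> is made of lower-dimensional cells and that the
  closure of \<open>f\<close> is a manifold with boundary along each facet, so that the facets carry an induced
  orientation. Nothing is required at the vertices of a 2-cell.\<close>

definition mesh :: "('p::t2_space, 'z) meshed_surface_scheme \<Rightarrow> bool" where
  "mesh M \<longleftrightarrow> finite (cells M) \<and> disjoint (cells M) \<and> \<Union>(cells M) = pts M \<and>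
     (\<forall>f\<in>cells M. f \<noteq> {} \<and> connected f \<and> cdim M f \<le> 2 \<and>
        submanifold M (cdim M f) f \<and> oriented_cell M f) \<and>
     (\<forall>f\<in>cells M. \<forall>f'\<in>cells M. cdim M f' < cdim M f \<and> f' \<inter> closure f \<noteq> {} \<longrightarrow> f' \<subseteq> bdry f) \<and>
     (\<forall>f\<in>cells M. bdry f \<subseteq> \<Union>{f' \<in> cells M. cdim M f' < cdim M f}) \<and>
     (\<forall>f\<in>cells M. \<forall>f'\<in>cells M. cdim M f = Suc (cdim M f') \<and> f' \<subseteq> bdry f \<longrightarrow>
        (\<forall>x\<in>f'. \<exists>c. bdry_chart M f f' c \<and> x \<in> fst c))"

text \<open>Sign (\<open>1\<close> or \<open>-1\<close>) of the orientation of \<open>f'\<close> relative to the one induced by \<open>f\<close>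
  (outward vector first).\<close>

definition rel_orient :: "('p::t2_space, 'z) meshed_surface_scheme \<Rightarrow> 'p set \<Rightarrow> 'p set \<Rightarrow> real" where
  "rel_orient M f f' = (THE s. \<forall>x\<in>f'. \<forall>c. bdry_chart M f f' c \<and> x \<in> fst c \<longrightarrow>
     (\<forall>\<^sub>F z in at x within f.
        s = sgn (orient M f z (map (tvec_of M c z)
              (- axis (of_nat (cdim M f)) 1 # ebasis (cdim M f'))))
          * sgn (orient M f' x (map (tvec_of M c x) (ebasis (cdim M f'))))))"


section \<open>Calculus of differential forms on cells\<close>

text \<open>\<open>l\<close>-forms of class \<open>C\<^sup>m\<close> on an open subset \<open>W\<close> of the surface.\<close>

definition Ck_forms :: "('p, 'z) surface_scheme \<Rightarrow> nat \<Rightarrow> 'p set \<Rightarrow> int \<Rightarrow> 'p form set" where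
  "Ck_forms M m W l = {\<omega>. (\<forall>x. (x \<in> W \<longrightarrow> \<omega> x \<in> alt_forms l (tspace M x)) \<and> (x \<notin> W \<longrightarrow> \<omega> x = 0)) \<and>
     (\<forall>c\<in>charts M. \<forall>us. Ck_on m (\<lambda>y. let x = chart_inv c y in \<omega> x (map (tvec_of M c x) us))
        (chart_image c W))}"

definition pullback :: "('p, 'z) meshed_surface_scheme \<Rightarrow> 'p set \<Rightarrow> 'p form \<Rightarrow> 'p form" where
  "pullback M f \<omega> = (\<lambda>x. if x \<in> f then restr_alt (cell_tspace M f x) (\<omega> x) else 0)"

text \<open>Forms on \<open>f\<close> that are \<open>C\<^sup>m\<close> up to the boundary: around every point of the closure
  they are pullbacks of \<open>C\<^sup>m\<close> forms on an open set of the surface.\<close>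

definition Ck_cell_forms :: "('p::t2_space, 'z) meshed_surface_scheme \<Rightarrow> nat \<Rightarrow> 'p set \<Rightarrow> int \<Rightarrow> 'p form set" where
  "Ck_cell_forms M m f l = {\<omega> \<in> cell_forms M f l. \<forall>x\<in>closure f. \<exists>W \<eta>.
     openin (top_of_set (pts M)) W \<and> x \<in> W \<and> \<eta> \<in> Ck_forms M m W l \<and>
     (\<forall>z\<in>f \<inter> W. \<omega> z = pullback M f \<eta> z)}"

text \<open>Trace on \<open>f'\<close> of an \<open>l\<close>-form on \<open>f\<close>: extend continuously to the closure, then pull back.\<close>

definition trace :: "('p::t2_space, 'z) meshed_surface_scheme \<Rightarrow> int \<Rightarrow> 'p set \<Rightarrow> 'p set \<Rightarrow> 'p form \<Rightarrow> 'p form" where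
  "trace M l f f' \<omega> = (THE q. (\<forall>x. x \<notin> f' \<longrightarrow> q x = 0) \<and>
     (\<forall>x\<in>f'. \<exists>W \<eta>. openin (top_of_set (pts M)) W \<and> x \<in> W \<and> \<eta> \<in> Ck_forms M 0 W l \<and>
        (\<forall>z\<in>f \<inter> W. \<omega> z = pullback M f \<eta> z) \<and> q x = pullback M f' \<eta> x))"

text \<open>In a chart of \<open>f\<close> around \<open>x\<close>, the exterior derivative of \<open>\<omega>\<close> on tangent vectors with constant
  components \<open>u\<^sub>0, \<dots>, u\<^sub>l\<close> is the alternating sum of the derivatives along \<open>u\<^sub>i\<close> of
  \<open>\<omega>\<close> applied to the remaining ones.\<close>

definition ext_deriv :: "('p, 'z) meshed_surface_scheme \<Rightarrow> 'p set \<Rightarrow> 'p form \<Rightarrow> 'p form" where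
  "ext_deriv M f \<omega> = (\<lambda>x vs. if x \<in> f \<and> set vs \<subseteq> cell_tspace M f x
     then let c = (SOME c. cell_chart M f c \<and> x \<in> fst c); us = map (\<lambda>v. v c) vs in
       \<Sum>i<length us. (-1) ^ i * deriv (\<lambda>t. let z = chart_inv c (snd c x + t *\<^sub>R us ! i) in
         \<omega> z (map (tvec_of M c z) (take i us @ drop (Suc i) us))) 0
     else 0)"

definition wedge :: "'p form \<Rightarrow> 'p form \<Rightarrow> 'p form" where
  "wedge \<omega> \<mu> = (\<lambda>x. alt_wedge (\<omega> x) (\<mu> x))"

text \<open>\<open>star M f k\<close> and \<open>star_inv M f k\<close> are the star operator on \<open>k\<close>-forms on \<open>f\<close> and its inverse
  (with values in the \<open>k\<close>-forms).\<close>

definition star :: "('p, 'z) meshed_surface_scheme \<Rightarrow> 'p set \<Rightarrow> nat \<Rightarrow> 'p form \<Rightarrow> 'p form" where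
  "star M f k \<omega> = (THE \<eta>. \<eta> \<in> cell_forms M f (int (cdim M f) - int k) \<and>
     (\<forall>x\<in>f. \<forall>\<mu>\<in>alt_forms (int (cdim M f) - int k) (cell_tspace M f x).
        form_inner M f x (\<eta> x) \<mu> *\<^sub>R orient M f x = alt_wedge (\<omega> x) \<mu>))"

definition star_inv :: "('p, 'z) meshed_surface_scheme \<Rightarrow> 'p set \<Rightarrow> nat \<Rightarrow> 'p form \<Rightarrow> 'p form" where
  "star_inv M f k = inv_into (cell_forms M f (int k)) (star M f k)"

text \<open>The integral of a top-degree form on \<open>f\<close> is computed by cutting \<open>f\<close> into finitely many pieces,
  each relatively compact in the domain of a chart; by the change of variables formula it does not
  depend on the pieces and charts. The integral over \<open>flat 0\<close> is the value at the
  point \<open>0\<close>, and a chart that reverses the orientation contributes with a minus sign.\<close>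

definition flat_integral :: "nat \<Rightarrow> (real^2) set \<Rightarrow> (real^2 \<Rightarrow> real) \<Rightarrow> real" where
  "flat_integral d A h =
     (if d = 0 then \<Sum>y\<in>A. h y
      else if d = 1 then LINT s:{s. axis 1 s \<in> A}|lborel. h (axis 1 s)
      else LINT y:A|lborel. h y)"

definition cell_decomposition :: "('p::t2_space, 'z) meshed_surface_scheme \<Rightarrow> 'p set \<Rightarrow> ('p set \<times> 'p chart) set \<Rightarrow> bool" where
  "cell_decomposition M f D \<longleftrightarrow> finite D \<and> (\<Union>(A, c)\<in>D. A) = f \<and>
     (\<forall>p\<in>D. \<forall>q\<in>D. p \<noteq> q \<longrightarrow> fst p \<inter> fst q = {}) \<and>
     (\<forall>(A, c)\<in>D. cell_chart M f c \<and> (\<exists>K. compact K \<and> A \<subseteq> K \<and> K \<subseteq> fst c) \<and> snd c ` A \<in> sets borel)"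

definition cell_integral :: "('p::t2_space, 'z) meshed_surface_scheme \<Rightarrow> 'p set \<Rightarrow> 'p form \<Rightarrow> real" where
  "cell_integral M f \<omega> = (\<Sum>(A, c)\<in>(SOME D. cell_decomposition M f D).
     flat_integral (cdim M f) (snd c ` A)
       (\<lambda>y. let x = chart_inv c y; bs = map (tvec_of M c x) (ebasis (cdim M f)) in
          \<omega> x bs * sgn (orient M f x bs)))"

definition cell_size :: "('p::t2_space, 'z) meshed_surface_scheme \<Rightarrow> 'p set \<Rightarrow> real" where
  "cell_size M f = cell_integral M f (orient M f) powr (1 / real (cdim M f))"

definition L2_inner :: "('p::t2_space, 'z) meshed_surface_scheme \<Rightarrow> 'p set \<Rightarrow> 'p form \<Rightarrow> 'p form \<Rightarrow> real" where
  "L2_inner M f \<omega> \<mu> = cell_integral M f (\<lambda>x. form_inner M f x (\<omega> x) (\<mu> x) *\<^sub>R orient M f x)"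

text \<open>Integral of \<open>P \<and> tr \<mu>\<close> over \<open>\<partial>f\<close> with the orientation induced by \<open>f\<close>, for an \<open>l\<close>-form \<open>\<mu>\<close>
  on \<open>f\<close> and a family \<open>P\<close> of forms on the facets.\<close>

definition bdry_integral :: "('p::t2_space, 'z) meshed_surface_scheme \<Rightarrow> 'p set \<Rightarrow> ('p set \<Rightarrow> 'p form) \<Rightarrow>
    int \<Rightarrow> 'p form \<Rightarrow> real" where
  "bdry_integral M f P l \<mu> = (\<Sum>f'\<in>faces M (cdim M f - 1) f.
     rel_orient M f f' * cell_integral M f' (wedge (P f') (trace M l f f' \<mu>)))"


section \<open>Polynomial spaces\<close>

text \<open>\<open>poly M f r l\<close> is the space of polynomial \<open>l\<close>-forms of degree \<open>r\<close> on \<open>f\<close>; \<open>kosz M f\<close> is the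
  map \<open>\<kappa>\<close> on \<open>f\<close>, in all degrees at once.\<close>

record 'p ddr_surface = "'p meshed_surface" +
  poly :: "'p set \<Rightarrow> int \<Rightarrow> int \<Rightarrow> 'p form set"
  kosz :: "'p set \<Rightarrow> 'p form \<Rightarrow> 'p form"

definition polynomial_spaces :: "('p::t2_space, 'z) ddr_surface_scheme \<Rightarrow> bool" where
  "polynomial_spaces M \<longleftrightarrow> (\<forall>f\<in>cells M.
     (\<forall>r l. subspace (poly M f r l) \<and> (\<exists>B. finite B \<and> span B = poly M f r l) \<and>
        poly M f r l \<subseteq> Ck_cell_forms M 1 f l \<and>
        ext_deriv M f ` poly M f r l \<subseteq> poly M f (r - 1) (l + 1) \<and>
        kosz M f ` poly M f r l \<subseteq> poly M f (r + 1) (l - 1) \<and>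
        (\<forall>p\<in>poly M f r l. kosz M f (kosz M f p) = 0) \<and>
        (\<forall>p\<in>poly M f r l. \<forall>q\<in>poly M f r l. \<forall>s.
           kosz M f (s *\<^sub>R p + q) = s *\<^sub>R kosz M f p + kosz M f q)))"

text \<open>Direct sum of the spaces \<open>H s\<close>, \<open>s \<le> r\<close>, when \<open>H s = {0}\<close> for \<open>s < 0\<close>.\<close>

definition is_direct_sum_upto :: "'v::real_vector set \<Rightarrow> int \<Rightarrow> (int \<Rightarrow> 'v set) \<Rightarrow> bool" where
  "is_direct_sum_upto V r H \<longleftrightarrow>
     V = {\<Sum>s\<in>{0..r}. h s | h. \<forall>s\<in>{0..r}. h s \<in> H s} \<and>
     (\<forall>h. (\<forall>s\<in>{0..r}. h s \<in> H s) \<and> (\<Sum>s\<in>{0..r}. h s) = 0 \<longrightarrow> (\<forall>s\<in>{0..r}. h s = 0))"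

definition homogeneous_decomposition :: "('p::t2_space, 'z) ddr_surface_scheme \<Rightarrow> 'p set \<Rightarrow>
    (int \<Rightarrow> int \<Rightarrow> 'p form set) \<Rightarrow> (int \<Rightarrow> int \<Rightarrow> real) \<Rightarrow> bool" where
  "homogeneous_decomposition M f H ev \<longleftrightarrow>
     (\<forall>s l. subspace (H s l) \<and> (s < 0 \<longrightarrow> H s l = {0})) \<and>
     (\<forall>r l. is_direct_sum_upto (poly M f r l) r (\<lambda>s. H s l)) \<and>
     (\<forall>s l. \<forall>p\<in>H s l. ext_deriv M f (kosz M f p) + kosz M f (ext_deriv M f p) = ev s l *\<^sub>R p) \<and>
     (\<forall>s l. s < 0 \<longrightarrow> ev s l = (if s + l < 0 then 0 else ev (s + l) 0))"

definition hypothesis_H :: "('p::t2_space, 'z) ddr_surface_scheme \<Rightarrow> bool" where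
  "hypothesis_H M \<longleftrightarrow> (\<forall>f\<in>cells M. \<exists>H ev.
     homogeneous_decomposition M f H ev \<and>
     (cdim M f > 0 \<longrightarrow> (\<forall>l\<in>{0..int (cdim M f)}. \<forall>s\<ge>0. \<forall>s'\<ge>0. ev s l = ev s' l \<longrightarrow> s = s')) \<and>
     (\<forall>l\<in>{0..int (cdim M f)}. \<forall>s\<ge>0. ev s l = 0 \<longleftrightarrow> s = 0 \<and> l = 0) \<and>
     (\<forall>s>0. \<forall>l\<in>{0..<int (cdim M f)}. ext_deriv M f ` H s l \<noteq> {0}))"

text \<open>For \<open>l < 0\<close> this is \<open>{0}\<close>.\<close>

definition trimmed :: "('p::t2_space, 'z) ddr_surface_scheme \<Rightarrow> 'p set \<Rightarrow> int \<Rightarrow> int \<Rightarrow> 'p form set" where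
  "trimmed M f r l = (if l \<le> 0 then poly M f r l
     else {ext_deriv M f p + kosz M f q | p q. p \<in> poly M f r (l - 1) \<and> q \<in> poly M f (r - 1) (l + 1)})"

definition hypothesis_T :: "('p::t2_space, 'z) ddr_surface_scheme \<Rightarrow> bool" where
  "hypothesis_T M \<longleftrightarrow> (\<forall>l. \<forall>f\<in>cells M. \<forall>d'\<le>cdim M f. \<forall>r\<ge>0. \<forall>f'\<in>faces M d' f.
     trace M l f f' ` trimmed M f r l \<subseteq> trimmed M f' r l)"


section \<open>Discrete spaces and operators\<close>

definition trimmed_proj :: "('p::t2_space, 'z) ddr_surface_scheme \<Rightarrow> 'p set \<Rightarrow> int \<Rightarrow> int \<Rightarrow> 'p form \<Rightarrow> 'p form" where
  "trimmed_proj M f r l \<omega> =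
     (THE p. p \<in> trimmed M f r l \<and> (\<forall>q\<in>trimmed M f r l. L2_inner M f (\<omega> - p) q = 0))"

definition star_proj :: "('p::t2_space, 'z) ddr_surface_scheme \<Rightarrow> int \<Rightarrow> nat \<Rightarrow> 'p set \<Rightarrow> 'p form \<Rightarrow> 'p form" where
  "star_proj M r k f \<omega> =
     star_inv M f k (trimmed_proj M f r (int (cdim M f) - int k) (star M f k \<omega>))"

text \<open>Families indexed by the cells of dimension at least \<open>k\<close>, extended by \<open>0\<close>.\<close>

definition discrete_space :: "('p::t2_space, 'z) ddr_surface_scheme \<Rightarrow> nat \<Rightarrow> int \<Rightarrow> ('p set \<Rightarrow> 'p form) set" where
  "discrete_space M k r = {\<omega>. \<forall>f.
     if f \<in> cells M \<and> k \<le> cdim M f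
     then \<omega> f \<in> star_inv M f k ` trimmed M f r (int (cdim M f) - int k)
     else \<omega> f = 0}"

definition interpolator :: "('p::t2_space, 'z) ddr_surface_scheme \<Rightarrow> nat \<Rightarrow> int \<Rightarrow> 'p form \<Rightarrow> 'p set \<Rightarrow> 'p form" where
  "interpolator M k r \<omega> = (\<lambda>f. if f \<in> cells M \<and> k \<le> cdim M f
     then star_proj M r k f (pullback M f \<omega>) else 0)"

text \<open>The discrete exterior derivative on a cell \<open>f\<close> of dimension at least \<open>k + 1\<close>, given the potentials \<open>P\<close>
  on its facets, and the potentials of all cells of dimension \<open>d\<close>. Both depend only on the
  components of the family \<open>\<omega>\<close> on \<open>f\<close> and on the cells in its boundary.\<close>

definition local_deriv_from :: "('p::t2_space, 'z) ddr_surface_scheme \<Rightarrow> nat \<Rightarrow> int \<Rightarrow> 'p set \<Rightarrow>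
    ('p set \<Rightarrow> 'p form) \<Rightarrow> ('p set \<Rightarrow> 'p form) \<Rightarrow> 'p form" where
  "local_deriv_from M k r f P \<omega> = (let m = int (cdim M f) - int k - 1 in
     THE \<delta>. \<delta> \<in> star_inv M f (k + 1) ` poly M f r m \<and>
       (\<forall>\<mu>\<in>poly M f r m. cell_integral M f (wedge \<delta> \<mu>) =
          (-1) ^ (k + 1) * cell_integral M f (wedge (\<omega> f) (ext_deriv M f \<mu>))
          + bdry_integral M f P m \<mu>))"

primrec potential_dim :: "('p::t2_space, 'z) ddr_surface_scheme \<Rightarrow> nat \<Rightarrow> int \<Rightarrow> nat \<Rightarrow>
    ('p set \<Rightarrow> 'p form) \<Rightarrow> 'p set \<Rightarrow> 'p form" where
  "potential_dim M k r 0 \<omega> = (\<lambda>f. \<omega> f)"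
| "potential_dim M k r (Suc d) \<omega> = (\<lambda>f. if Suc d \<le> k then \<omega> f else
     (let m = int (Suc d) - int k; P = potential_dim M k r d \<omega> in
      THE p. p \<in> star_inv M f k ` poly M f r m \<and>
        (\<forall>\<mu>\<in>kosz M f ` poly M f r m. \<forall>\<nu>\<in>kosz M f ` poly M f (r - 1) (m + 1).
           (-1) ^ (k + 1) * cell_integral M f (wedge p (ext_deriv M f \<mu> + \<nu>)) =
             cell_integral M f (wedge (local_deriv_from M k r f P \<omega>) \<mu>)
             - bdry_integral M f P (m - 1) \<mu>
             + (-1) ^ (k + 1) * cell_integral M f (wedge (\<omega> f) \<nu>))))"

definition potential :: "('p::t2_space, 'z) ddr_surface_scheme \<Rightarrow> nat \<Rightarrow> int \<Rightarrow> 'p set \<Rightarrow>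
    ('p set \<Rightarrow> 'p form) \<Rightarrow> 'p form" where
  "potential M k r f \<omega> = potential_dim M k r (cdim M f) \<omega> f"

definition local_deriv :: "('p::t2_space, 'z) ddr_surface_scheme \<Rightarrow> nat \<Rightarrow> int \<Rightarrow> 'p set \<Rightarrow>
    ('p set \<Rightarrow> 'p form) \<Rightarrow> 'p form" where
  "local_deriv M k r f \<omega> = local_deriv_from M k r f (\<lambda>f'. potential M k r f' \<omega>) \<omega>"

definition discrete_deriv :: "('p::t2_space, 'z) ddr_surface_scheme \<Rightarrow> nat \<Rightarrow> int \<Rightarrow>
    ('p set \<Rightarrow> 'p form) \<Rightarrow> 'p set \<Rightarrow> 'p form" where
  "discrete_deriv M k r \<omega> = (\<lambda>f. if f \<in> cells M \<and> k + 1 \<le> cdim M f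
     then star_proj M r (k + 1) f (local_deriv M k r f \<omega>) else 0)"

definition discrete_inner :: "('p::t2_space, 'z) ddr_surface_scheme \<Rightarrow> nat \<Rightarrow> int \<Rightarrow>
    ('p set \<Rightarrow> 'p form) \<Rightarrow> ('p set \<Rightarrow> 'p form) \<Rightarrow> real" where
  "discrete_inner M k r \<omega> \<mu> = (\<Sum>f\<in>cells_of_dim M 2.
     cell_integral M f (wedge (potential M k r f \<omega>) (star M f k (potential M k r f \<mu>))) +
     (\<Sum>d\<in>{k..<2}. cell_size M f ^ (2 - d) * (\<Sum>f'\<in>faces M d f.
        cell_integral M f' (wedge
          (potential M k r f' \<omega> - trace M (int k) f f' (potential M k r f \<omega>))
          (star M f' k (potential M k r f' \<mu> - trace M (int k) f f' (potential M k r f \<mu>)))))))"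


section \<open>Time dependence\<close>

text \<open>\<open>u\<close> is a \<open>C\<^sup>1\<close> curve on \<open>[0, T]\<close> in the finite-dimensional space \<open>X\<close>, with derivative \<open>u'\<close>:
  its coordinates with respect to finitely many vectors are \<open>C\<^sup>1\<close>.\<close>

definition C1_curve :: "real \<Rightarrow> 'v::real_vector set \<Rightarrow> (real \<Rightarrow> 'v) \<Rightarrow> (real \<Rightarrow> 'v) \<Rightarrow> bool" where
  "C1_curve T X u u' \<longleftrightarrow> u ` {0..T} \<subseteq> X \<and> (\<exists>B a a'. finite B \<and> B \<subseteq> X \<and>
     (\<forall>b\<in>B. (\<forall>t\<in>{0..T}. (a b has_real_derivative a' b t) (at t within {0..T})) \<and>
        continuous_on {0..T} (a' b)) \<and>
     (\<forall>t\<in>{0..T}. u t = (\<Sum>b\<in>B. a b t *\<^sub>R b) \<and> u' t = (\<Sum>b\<in>B. a' b t *\<^sub>R b)))"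

definition continuous_time_forms :: "('p, 'z) surface_scheme \<Rightarrow> real \<Rightarrow> int \<Rightarrow> (real \<Rightarrow> 'p form) \<Rightarrow> bool" where
  "continuous_time_forms M T l J \<longleftrightarrow>
     (\<forall>t\<in>{0..T}. \<forall>x. (x \<in> pts M \<longrightarrow> J t x \<in> alt_forms l (tspace M x)) \<and> (x \<notin> pts M \<longrightarrow> J t x = 0)) \<and>
     (\<forall>c\<in>charts M. \<forall>us. continuous_on ({0..T} \<times> chart_range c)
        (\<lambda>(t, y). let x = chart_inv c y in J t x (map (tvec_of M c x) us)))"

end

theory Submission
  imports Defs
begin

text \<open>Since the scheme holds for all test families, inserting \<open>v = d\<^sup>0 v\<^sup>0\<close> into the second equation and integrating in time
  gives the claim as soon as \<open>d\<^sup>1 d\<^sup>0 = 0\<close> and the inner product is linear in its first argument.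
  Linearity follows from the unique solvability (Riesz) of the problems defining the discrete derivative and the
  potential; for the potential one inverts \<open>d\<kappa> + \<kappa>d\<close> on the 1-forms. For \<open>d\<^sup>1 d\<^sup>0 v = 0\<close> on a 2-cell \<open>f\<close> one tests
  with a 0-form \<open>\<mu>\<close>: as \<open>dd\<mu> = 0\<close> and traces commute with \<open>d\<close>, only
  \<open>\<Sum>\<^sub>e \<epsilon>(f,e) \<Sum>\<^sub>x \<epsilon>(e,x) v(x) \<mu>(x)\<close> over the edges \<open>e\<close> and vertices \<open>x\<close> remains. It vanishes because
  \<open>\<Sum>\<^sub>e \<epsilon>(f,e) \<epsilon>(e,x) = 0\<close> at every vertex, which is seen by following the orientation sign of \<open>f\<close> along a small circle
  around \<open>x\<close>: its jumps at the edges add up to \<open>0\<close>.\<close>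

text \<open>The operators are definite descriptions, and the integrals depend on chosen charts and
  decompositions. So no operator is known to be linear before existence and uniqueness are settled,
  and Riesz needs an L2 product that is definite for whatever decomposition was chosen. The delicate
  objects are the potentials on 2-cells. They are inverse stars of polynomial forms, and the star
  involves the orientation of the cell. The surface need not be orientable, so a 2-cell may reach a
  vertex in several sectors with opposite signs in one chart. Potentials therefore extend to the
  edges but not necessarily to the vertices. For this reason traces are studied at the points of the
  facet only, and integrability rests on boundedness instead of continuity up to the boundary.
  Solvability for the potential has an obstacle of its own: its right-hand side is a function of
  \<open>\<kappa> a\<close> and \<open>\<kappa> b\<close>, the test form is
  \<open>d \<kappa> a + \<kappa> b\<close>, and one must know that the test form determines both. In
  time, integrability of the source term is not proved separately; it is inherited from the
  derivative of the electric field through the scheme.\<close>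

lemma scaleR_fun_apply [simp]: "(s *\<^sub>R f) x = s *\<^sub>R f x"
  by (simp add: scaleR_fun_def)

definition lin_on :: "'v::real_vector set \<Rightarrow> ('v \<Rightarrow> 'w::real_vector) \<Rightarrow> bool" where
  "lin_on S F \<longleftrightarrow> (\<forall>p\<in>S. \<forall>q\<in>S. \<forall>s. F (s *\<^sub>R p + q) = s *\<^sub>R F p + F q)"

lemma lin_onD: "lin_on S F \<Longrightarrow> p \<in> S \<Longrightarrow> q \<in> S \<Longrightarrow> F (s *\<^sub>R p + q) = s *\<^sub>R F p + F q"
  by (simp add: lin_on_def)

lemma lin_on_mono: "lin_on S F \<Longrightarrow> S' \<subseteq> S \<Longrightarrow> lin_on S' F"
  by (auto simp: lin_on_def)

context
  fixes S :: "'v::real_vector set" and F :: "'v \<Rightarrow> 'w::real_vector"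
  assumes S: "subspace S" and F: "lin_on S F"
begin

lemma lin_on_add: "p \<in> S \<Longrightarrow> q \<in> S \<Longrightarrow> F (p + q) = F p + F q"
  using lin_onD[OF F, of p q 1] by simp

lemma lin_on_0: "F 0 = 0"
  using lin_on_add[of 0 0] subspace_0[OF S] by simp

lemma lin_on_scale: "p \<in> S \<Longrightarrow> F (s *\<^sub>R p) = s *\<^sub>R F p"
  using lin_onD[OF F, of p 0 s] lin_on_0 subspace_0[OF S] by simp

lemma lin_on_diff: "p \<in> S \<Longrightarrow> q \<in> S \<Longrightarrow> F (p - q) = F p - F q"
  using lin_onD[OF F, of q p "-1"] by simp

lemma lin_on_sum: "(\<And>i. i \<in> I \<Longrightarrow> p i \<in> S) \<Longrightarrow> F (\<Sum>i\<in>I. p i) = (\<Sum>i\<in>I. F (p i))"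
  by (induction I rule: infinite_finite_induct)
     (auto simp: lin_on_0 lin_on_add S subspace_sum)

lemma subspace_image_lin_on: "subspace (F ` S)"
proof -
  have "x + y \<in> F ` S" if "x \<in> F ` S" "y \<in> F ` S" for x y
    using that lin_on_add subspace_add[OF S] by (metis (no_types, lifting) imageE imageI)
  moreover have "s *\<^sub>R x \<in> F ` S" if "x \<in> F ` S" for x s
    using that lin_on_scale subspace_scale[OF S] by (metis (no_types, lifting) imageE imageI)
  moreover have "0 \<in> F ` S"
    using lin_on_0 subspace_0[OF S] by (metis imageI)
  ultimately show ?thesis
    by (simp add: subspace_def)
qed

end

lemma lin_on_combine:
  fixes F G :: "'v::real_vector \<Rightarrow> real"
  assumes "lin_on S F" "lin_on S G"
  shows "lin_on S (\<lambda>p. a * F p + b * G p)"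
  using assms by (auto simp: lin_on_def algebra_simps)

lemma lin_on_sum_fun:
  fixes F :: "'i \<Rightarrow> 'v::real_vector \<Rightarrow> real"
  assumes "\<And>i. i \<in> I \<Longrightarrow> lin_on S (F i)"
  shows "lin_on S (\<lambda>p. \<Sum>i\<in>I. a i * F i p)"
proof -
  have "(\<Sum>i\<in>I. a i * F i (s *\<^sub>R p + q)) = (\<Sum>i\<in>I. s * (a i * F i p) + a i * F i q)"
    if "p \<in> S" "q \<in> S" for p q s
    proof (intro sum.cong refl)
    fix i assume "i \<in> I"
    then show "a i * F i (s *\<^sub>R p + q) = s * (a i * F i p) + a i * F i q"
      using lin_onD[OF assms that, of i s] by (simp add: distrib_left)
  qed
  then show ?thesis
    by (simp add: lin_on_def sum.distrib sum_distrib_left)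
qed

lemma lin_on_comp: "lin_on S F \<Longrightarrow> lin_on S' G \<Longrightarrow> F ` S \<subseteq> S' \<Longrightarrow> lin_on S (\<lambda>p. G (F p))"
  unfolding lin_on_def by (simp add: image_subset_iff)

section \<open>Riesz representation on finite-dimensional spaces\<close>

text \<open>Gram-Schmidt by induction on the spanning set. The functional stays arbitrary because
  the induction hypothesis is used twice: for \<open>ip b\<close>, which gives the projection of the
  new vector, and for \<open>\<phi>\<close> itself. The ambient \<open>S\<close> is where the
  product is known to be definite.\<close>

lemma riesz_exists:
  fixes ip :: "'v::real_vector \<Rightarrow> 'v \<Rightarrow> real"
  assumes "finite B" and "B \<subseteq> S" and S: "subspace S"
    and lin: "\<And>q. q \<in> S \<Longrightarrow> lin_on S (\<lambda>p. ip p q)"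
    and sym: "\<And>p q. p \<in> S \<Longrightarrow> q \<in> S \<Longrightarrow> ip p q = ip q p"
    and pos: "\<And>p. p \<in> S \<Longrightarrow> p \<noteq> 0 \<Longrightarrow> ip p p > 0"
    and "lin_on S \<phi>"
  shows "\<exists>p\<in>span B. \<forall>q\<in>span B. ip p q = \<phi> q"
  using \<open>finite B\<close> \<open>B \<subseteq> S\<close> \<open>lin_on S \<phi>\<close>
proof (induction arbitrary: \<phi>)
  case empty
  have "ip 0 0 = 0" "\<phi> 0 = 0"
    using lin_on_0[OF S lin] lin_on_0[OF S] subspace_0[OF S] empty by auto
  then show ?case by simp
next
  case (insert b B)
  have sp: "span B \<subseteq> S"
    using insert.prems S span_minimal by blast
  have bS: "b \<in> S"
    using insert.prems by simp
  have lin2: "lin_on S (ip p)" if "p \<in> S" for p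
    unfolding lin_on_def
  proof (intro ballI allI)
    fix u v s assume "u \<in> S" "v \<in> S"
    then show "ip p (s *\<^sub>R u + v) = s *\<^sub>R ip p u + ip p v"
      using lin_onD[OF lin[OF that], of u v s] that S by (simp add: sym subspace_add subspace_scale)
  qed
  show ?case
  proof (cases "b \<in> span B")
    case True
    then show ?thesis
      using insert.IH[OF _ insert.prems(2)] insert.prems(1) by (simp add: span_redundant)
  next
    case False
    obtain p0 where p0: "p0 \<in> span B" "\<And>q. q \<in> span B \<Longrightarrow> ip p0 q = ip b q"
      using insert.IH[OF _ lin2[OF bS]] insert.prems(1) by auto
    obtain p1 where p1: "p1 \<in> span B" "\<And>q. q \<in> span B \<Longrightarrow> ip p1 q = \<phi> q"
      using insert.IH[OF _ insert.prems(2)] insert.prems(1) by auto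
    \<comment> \<open>\<open>p0\<close> is the orthogonal projection of \<open>b\<close> onto
      \<open>span B\<close>, so \<open>b'\<close> is orthogonal to \<open>span B\<close>.\<close>
    define b' where "b' = b - p0"
    have b': "b' \<in> S" "b' \<noteq> 0"
      using False p0(1) sp bS S by (auto simp: b'_def subspace_diff)
    have orth: "ip b' q = 0" "ip q b' = 0" if "q \<in> span B" for q
    proof -
      have qS: "q \<in> S" using that sp by blast
      have "ip b' q = ip b q - ip p0 q"
        unfolding b'_def using lin_on_diff[OF S lin[OF qS]] bS p0(1) sp by blast
      then show "ip b' q = 0" using p0(2)[OF that] by simp
      then show "ip q b' = 0" using sym[OF b'(1) qS] by simp
    qed
    have nz: "ip b' b' \<noteq> 0"
      using pos[OF b'] by simp
    \<comment> \<open>\<open>p1\<close> represents \<open>\<phi>\<close> on \<open>span B\<close>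
      and is orthogonal to \<open>b'\<close>; the coefficient along \<open>b'\<close> is then forced
      by the value \<open>\<phi> b'\<close>.\<close>
    define t where "t = \<phi> b' / ip b' b'"
    define p where "p = t *\<^sub>R b' + p1"
    have p1S: "p1 \<in> S" using p1 sp by blast
    have pS: "p \<in> S"
      unfolding p_def using b' p1S S by (simp add: subspace_add subspace_scale)
    have bspan: "b' \<in> span (insert b B)"
      unfolding b'_def using p0(1) by (meson insertI1 span_base span_diff span_mono subset_insertI subsetD)
    have p_span: "p \<in> span (insert b B)"
      unfolding p_def using bspan p1(1)
      by (meson span_add span_mono span_scale subset_insertI subsetD)
    have "ip p q = \<phi> q" if q: "q \<in> span (insert b B)" for q
    proof -
      obtain s where s: "q - s *\<^sub>R b \<in> span B"
        using q span_insert by blast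
      define q0 where "q0 = q - s *\<^sub>R b'"
      have "q0 = (q - s *\<^sub>R b) + s *\<^sub>R p0"
        by (simp add: q0_def b'_def algebra_simps)
      then have q0: "q0 \<in> span B"
        using s p0(1) by (simp add: span_add span_scale)
      have q0S: "q0 \<in> S" using q0 sp by blast
      have q_eq: "q = s *\<^sub>R b' + q0" by (simp add: q0_def)
      have "ip p q = s * ip p b' + ip p q0"
        unfolding q_eq using lin_onD[OF lin2[OF pS] b'(1) q0S] by simp
      also have "ip p b' = t * ip b' b'"
        unfolding p_def using lin_onD[OF lin[OF b'(1)] b'(1) p1S] orth[OF p1(1)] by simp
      also have "ip p q0 = \<phi> q0"
        unfolding p_def using lin_onD[OF lin[OF q0S] b'(1) p1S] orth[OF q0] p1(2)[OF q0] by simp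
      also have "s * (t * ip b' b') + \<phi> q0 = \<phi> q"
        unfolding q_eq using lin_onD[OF insert.prems(2) b'(1) q0S] nz by (simp add: t_def)
      finally show ?thesis .
    qed
    then show ?thesis using p_span by blast
  qed
qed

lemma riesz_finite_dim:
  fixes ip :: "'v::real_vector \<Rightarrow> 'v \<Rightarrow> real"
  assumes B: "finite B" "B \<subseteq> S" "S \<subseteq> span B" and S: "subspace S"
    and lin: "\<And>q. q \<in> S \<Longrightarrow> lin_on S (\<lambda>p. ip p q)"
    and sym: "\<And>p q. p \<in> S \<Longrightarrow> q \<in> S \<Longrightarrow> ip p q = ip q p"
    and pos: "\<And>p. p \<in> S \<Longrightarrow> p \<noteq> 0 \<Longrightarrow> ip p p > 0"
    and "lin_on S \<phi>"
  shows "\<exists>!p. p \<in> S \<and> (\<forall>q\<in>S. ip p q = \<phi> q)"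
proof -
  have eq: "span B = S"
    using B S span_minimal by blast
  have "p = p'" if "p \<in> S" "p' \<in> S" "\<And>q. q \<in> S \<Longrightarrow> ip p q = ip p' q" for p p'
  proof -
    have d: "p - p' \<in> S" using that S subspace_diff by blast
    have "ip (p - p') (p - p') = 0"
      using lin_on_diff[OF S lin[OF d] that(1,2)] that(3)[OF d] by simp
    then show ?thesis using pos[OF d] by fastforce
  qed
  then show ?thesis
    using riesz_exists[OF B(1,2) S lin sym pos assms(8)] unfolding eq by (intro ex_ex1I) auto
qed

text \<open>Riesz needs generators inside the space itself, where the product is controlled. For the
  trimmed spaces only a finite spanning set of the larger polynomial space is given.\<close>

lemma subspace_finite_basis:
  assumes "subspace S" "S \<subseteq> span B" "finite B"
  obtains C where "finite C" "C \<subseteq> S" "S \<subseteq> span C"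
proof -
  obtain C where "C \<subseteq> S" "independent C" "S \<subseteq> span C"
    using maximal_independent_subset by blast
  moreover then have "finite C"
    using assms(2,3) by (meson independent_span_bound subset_trans)
  ultimately show thesis using that by blast
qed

section \<open>Alternating forms on spaces of dimension at most two\<close>

lemma alt_forms_support:
  assumes "a \<in> alt_forms l T" "a vs \<noteq> 0"
  shows "int (length vs) = l" "set vs \<subseteq> T" "distinct vs"
  using assms by (auto simp: alt_forms_def)

lemma alt_forms_lin:
  assumes "a \<in> alt_forms l T" "v \<in> T" "w \<in> T"
  shows "a (us @ (s *\<^sub>R v + w) # ws) = s * a (us @ v # ws) + a (us @ w # ws)"
  using assms by (simp add: alt_forms_def)

lemma subspace_alt_forms: "subspace (alt_forms l T)"
  unfolding subspace_def
proof (intro conjI ballI allI)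
  show "0 \<in> alt_forms l T" by (simp add: alt_forms_def)
  show "a + b \<in> alt_forms l T" if "a \<in> alt_forms l T" "b \<in> alt_forms l T" for a b
  proof -
    have "int (length vs) = l \<and> set vs \<subseteq> T \<and> distinct vs" if "(a + b) vs \<noteq> 0" for vs
    proof -
      have "a vs \<noteq> 0 \<or> b vs \<noteq> 0" using that by auto
      then show ?thesis using alt_forms_support \<open>a \<in> alt_forms l T\<close> \<open>b \<in> alt_forms l T\<close> by blast
    qed
    moreover have "(a + b) (us @ (s *\<^sub>R v + w) # ws) = s * (a + b) (us @ v # ws) + (a + b) (us @ w # ws)"
      if "v \<in> T" "w \<in> T" for us ws v w s
      using alt_forms_lin[OF \<open>a \<in> alt_forms l T\<close> that] alt_forms_lin[OF \<open>b \<in> alt_forms l T\<close> that]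
      by (simp add: algebra_simps)
    ultimately show ?thesis
      unfolding alt_forms_def by blast
  qed
  show "s *\<^sub>R a \<in> alt_forms l T" if "a \<in> alt_forms l T" for s a
    using that unfolding alt_forms_def by (auto simp: algebra_simps)
qed

lemma alt_forms_0_apply: "a \<in> alt_forms 0 T \<Longrightarrow> a vs = (if vs = [] then a [] else 0)"
  using alt_forms_support(1)[of a 0 T vs] by auto

lemma alt_forms_negative: "l < 0 \<Longrightarrow> a \<in> alt_forms l T \<Longrightarrow> a = 0"
  using alt_forms_support(1)[of a l T] by (intro ext) (metis of_nat_less_0_iff zero_fun_apply)

context
  fixes T :: "'v::real_vector set" and a :: "'v list \<Rightarrow> real" and l :: int
  assumes T: "subspace T" and a: "a \<in> alt_forms l T"
begin

lemma alt_lin_comb: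
  assumes "v \<in> T" "w \<in> T"
  shows "a (us @ (x *\<^sub>R v + y *\<^sub>R w) # ws) = x * a (us @ v # ws) + y * a (us @ w # ws)"
proof -
  have 0: "a (us @ 0 # ws) = 0"
    using alt_forms_lin[OF a subspace_0[OF T] subspace_0[OF T], where s=1] by simp
  have "a (us @ (y *\<^sub>R w) # ws) = y * a (us @ w # ws)"
    using alt_forms_lin[OF a assms(2) subspace_0[OF T], where s=y] 0 by simp
  then show ?thesis
    using alt_forms_lin[OF a assms(1) subspace_scale[OF T assms(2)], where s=x] by simp
qed

lemma alt_forms_1_comb: "v \<in> T \<Longrightarrow> w \<in> T \<Longrightarrow> a [x *\<^sub>R v + y *\<^sub>R w] = x * a [v] + y * a [w]"
  using alt_lin_comb[where us="[]" and ws="[]"] by simp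

lemma alt_repeat: "a [v, v] = 0"
  using alt_forms_support(3)[OF a, of "[v, v]"] by auto

text \<open>Polarization: expand \<open>a [v + w, v + w] = 0\<close>. In \<open>alt_forms\<close>
  alternation is expressed only by vanishing on lists with repetitions.\<close>

lemma alt_swap:
  assumes "v \<in> T" "w \<in> T"
  shows "a [w, v] = - a [v, w]"
proof -
  have vw: "v + w \<in> T" using assms T by (simp add: subspace_add)
  have "a [v + w, v + w] = a [v, v + w] + a [w, v + w]"
    using alt_lin_comb[OF assms, of "[]" 1 1 "[v + w]"] by simp
  also have "a [v, v + w] = a [v, v] + a [v, w]"
    using alt_lin_comb[OF assms, of "[v]" 1 1 "[]"] by simp
  also have "a [w, v + w] = a [w, v] + a [w, w]"
    using alt_lin_comb[OF assms, of "[w]" 1 1 "[]"] by simp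
  finally show ?thesis by (simp add: alt_repeat)
qed

lemma alt_forms_2_comb:
  assumes "v \<in> T" "w \<in> T"
  shows "a [x *\<^sub>R v + y *\<^sub>R w, z *\<^sub>R v + u *\<^sub>R w] = (x * u - y * z) * a [v, w]"
proof -
  have "z *\<^sub>R v + u *\<^sub>R w \<in> T"
    using assms T by (simp add: subspace_add subspace_scale)
  then have "a [x *\<^sub>R v + y *\<^sub>R w, z *\<^sub>R v + u *\<^sub>R w]
      = x * a [v, z *\<^sub>R v + u *\<^sub>R w] + y * a [w, z *\<^sub>R v + u *\<^sub>R w]"
    using alt_lin_comb[OF assms, of "[]" x y "[z *\<^sub>R v + u *\<^sub>R w]"] by simp
  also have "a [v, z *\<^sub>R v + u *\<^sub>R w] = z * a [v, v] + u * a [v, w]"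
    using alt_lin_comb[OF assms, of "[v]" z u "[]"] by simp
  also have "a [w, z *\<^sub>R v + u *\<^sub>R w] = z * a [w, v] + u * a [w, w]"
    using alt_lin_comb[OF assms, of "[w]" z u "[]"] by simp
  finally show ?thesis
    by (simp add: alt_repeat alt_swap[OF assms] algebra_simps)
qed

end

lemma list_length_2: "length vs = 2 \<longleftrightarrow> (\<exists>v w. vs = [v, w])"
  by (auto simp: numeral_2_eq_2 length_Suc_conv)

lemma list_length_1: "length vs = 1 \<longleftrightarrow> (\<exists>v. vs = [v])"
  by (auto simp: length_Suc_conv)

lemma alt_forms_eqI:
  assumes a: "a \<in> alt_forms l T" and b: "b \<in> alt_forms l T"
    and eq: "\<And>vs. int (length vs) = l \<Longrightarrow> set vs \<subseteq> T \<Longrightarrow> a vs = b vs"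
  shows "a = b"
proof
  fix vs show "a vs = b vs"
    using eq[of vs] alt_forms_support[OF a, of vs] alt_forms_support[OF b, of vs] by fastforce
qed

lemma alt_forms_0_eqI:
  "a \<in> alt_forms 0 T \<Longrightarrow> b \<in> alt_forms 0 T \<Longrightarrow> a [] = b [] \<Longrightarrow> a = b"
  by (rule alt_forms_eqI) auto

context
  fixes T :: "'v::real_vector set" and b1 b2 :: 'v
  assumes T: "subspace T" and b: "b1 \<in> T" "b2 \<in> T"
    and ex: "\<And>v. v \<in> T \<Longrightarrow> \<exists>x y. v = x *\<^sub>R b1 + y *\<^sub>R b2"
begin

text \<open>With \<open>b1 = b2\<close> this also serves the one-dimensional tangent spaces of
  edges, since only spanning is asked of the two vectors.\<close>

lemma alt_forms_1_eqI:
  assumes "a \<in> alt_forms 1 T" "a' \<in> alt_forms 1 T" "a [b1] = a' [b1]" "a [b2] = a' [b2]"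
  shows "a = a'"
proof (rule alt_forms_eqI[OF assms(1,2)])
  fix vs :: "'v list" assume vs: "int (length vs) = 1" "set vs \<subseteq> T"
  then obtain v where v: "vs = [v]" "v \<in> T"
    using list_length_1[of vs] by auto
  then obtain x y where "v = x *\<^sub>R b1 + y *\<^sub>R b2"
    using ex by blast
  then show "a vs = a' vs"
    using v assms(3,4) alt_forms_1_comb[OF T assms(1) b] alt_forms_1_comb[OF T assms(2) b] by simp
qed

lemma alt_forms_2_eqI:
  assumes "a \<in> alt_forms 2 T" "a' \<in> alt_forms 2 T" "a [b1, b2] = a' [b1, b2]"
  shows "a = a'"
proof (rule alt_forms_eqI[OF assms(1,2)])
  fix vs :: "'v list" assume vs: "int (length vs) = 2" "set vs \<subseteq> T"
  then obtain v w where v: "vs = [v, w]" "v \<in> T" "w \<in> T"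
    using list_length_2[of vs] by auto
  then obtain x y z u where "v = x *\<^sub>R b1 + y *\<^sub>R b2" "w = z *\<^sub>R b1 + u *\<^sub>R b2"
    using ex by meson
  then show "a vs = a' vs"
    using v assms(3) alt_forms_2_comb[OF T assms(1) b] alt_forms_2_comb[OF T assms(2) b] by simp
qed

end

definition zero_form :: "real \<Rightarrow> 'v list \<Rightarrow> real" where
  "zero_form s vs = (if vs = [] then s else 0)"

definition one_form :: "'v set \<Rightarrow> ('v \<Rightarrow> real) \<Rightarrow> 'v list \<Rightarrow> real" where
  "one_form T F vs = (case vs of [v] \<Rightarrow> if v \<in> T then F v else 0 | _ \<Rightarrow> 0)"

lemma zero_form_Nil [simp]: "zero_form s [] = s"
  by (simp add: zero_form_def)

lemma zero_form_in: "zero_form s \<in> alt_forms 0 T"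
  by (simp add: alt_forms_def zero_form_def)

lemma one_form_apply: "v \<in> T \<Longrightarrow> one_form T F [v] = F v"
  by (simp add: one_form_def)

lemma one_form_in:
  assumes T: "subspace T" and F: "lin_on T F"
  shows "one_form T F \<in> alt_forms 1 T"
proof -
  have 1: "int (length vs) = 1 \<and> set vs \<subseteq> T \<and> distinct vs" if "one_form T F vs \<noteq> 0" for vs
    using that by (auto simp: one_form_def split: list.splits if_splits)
  have 2: "one_form T F (us @ (s *\<^sub>R v + w) # ws)
      = s * one_form T F (us @ v # ws) + one_form T F (us @ w # ws)"
    if "v \<in> T" "w \<in> T" for us ws v w s
  proof (cases "us = [] \<and> ws = []")
    case True
    then show ?thesis
      using that T lin_onD[OF F that] by (simp add: one_form_def subspace_add subspace_scale)
  next
    case False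
    then have "one_form T F (us @ z # ws) = 0" for z
      by (cases us) (auto simp: one_form_def split: list.splits)
    then show ?thesis by simp
  qed
  show ?thesis
    unfolding alt_forms_def using 1 2 by blast
qed

lemma alt_forms_restr:
  assumes a: "a \<in> alt_forms l T" and U: "subspace U" "U \<subseteq> T"
  shows "restr_alt U a \<in> alt_forms l U"
proof -
  have "restr_alt U a (us @ (s *\<^sub>R v + w) # ws)
      = s * restr_alt U a (us @ v # ws) + restr_alt U a (us @ w # ws)"
    if "v \<in> U" "w \<in> U" for us ws v w s
    using that U alt_forms_lin[OF a, of v w us s ws]
    by (auto simp: restr_alt_def subspace_add subspace_scale)
  then show ?thesis
    using alt_forms_support[OF a] unfolding alt_forms_def by (auto simp: restr_alt_def)
qed

lemma alt_wedge_0_right [simp]: "alt_wedge a 0 = 0"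
  by (simp add: alt_wedge_def fun_eq_iff)

lemma alt_wedge_add_left: "alt_wedge (s *\<^sub>R a + b) \<mu> = s *\<^sub>R alt_wedge a \<mu> + alt_wedge b \<mu>"
  by (simp add: alt_wedge_def fun_eq_iff sum.distrib sum_distrib_left algebra_simps)

lemma alt_wedge_add_right: "alt_wedge a (s *\<^sub>R \<mu> + \<nu>) = s *\<^sub>R alt_wedge a \<mu> + alt_wedge a \<nu>"
  by (simp add: alt_wedge_def fun_eq_iff sum.distrib sum_distrib_left algebra_simps)

lemma length_nths_subset: "S \<subseteq> {..<length vs} \<Longrightarrow> length (nths vs S) = card S"
  by (simp add: length_nths) (metis Collect_conj_eq Collect_mem_eq inf.absorb_iff2 lessThan_def)

text \<open>Only the shuffle \<open>S = {}\<close> survives, because a 0-form vanishes on nonempty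
  lists. For a 0-form on the right it is the full set of positions.\<close>

lemma alt_wedge_0_left_form:
  assumes "a \<in> alt_forms 0 T"
  shows "alt_wedge a \<mu> = a [] *\<^sub>R \<mu>"
proof
  fix vs
  have z: "a (nths vs S) = 0" if "S \<in> Pow {..<length vs} - {{}}" for S
  proof -
    have "card S \<noteq> 0" using that finite_subset[of S "{..<length vs}"] by auto
    then show ?thesis
      using alt_forms_support(1)[OF assms, of "nths vs S"] length_nths_subset[of S vs] that by auto
  qed
  have "alt_wedge a \<mu> vs = (\<Sum>S\<in>{{}}. (-1) ^ card {(i, j). i \<in> S \<and> j \<in> {..<length vs} - S \<and> j < i}
       * a (nths vs S) * \<mu> (nths vs ({..<length vs} - S)))"
    unfolding alt_wedge_def by (rule sum.mono_neutral_right) (use z in auto)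
  then show "alt_wedge a \<mu> vs = (a [] *\<^sub>R \<mu>) vs"
    by (simp add: nths_all)
qed

lemma alt_wedge_0_right_form:
  assumes "\<mu> \<in> alt_forms 0 T"
  shows "alt_wedge a \<mu> = \<mu> [] *\<^sub>R a"
proof
  fix vs
  have z: "\<mu> (nths vs ({..<length vs} - S)) = 0" if "S \<in> Pow {..<length vs} - {{..<length vs}}" for S
  proof -
    have "card ({..<length vs} - S) \<noteq> 0" using that by auto
    then show ?thesis
      using alt_forms_support(1)[OF assms, of "nths vs ({..<length vs} - S)"]
        length_nths_subset[of "{..<length vs} - S" vs] that by auto
  qed
  have "alt_wedge a \<mu> vs = (\<Sum>S\<in>{{..<length vs}}. (-1) ^ card {(i, j). i \<in> S \<and> j \<in> {..<length vs} - S \<and> j < i}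
       * a (nths vs S) * \<mu> (nths vs ({..<length vs} - S)))"
    unfolding alt_wedge_def by (rule sum.mono_neutral_right) (use z in auto)
  then show "alt_wedge a \<mu> vs = (\<mu> [] *\<^sub>R a) vs"
    by (simp add: nths_all)
qed

text \<open>On lists of length 2 the shuffles \<open>{0}\<close> and \<open>{1}\<close> remain, the
  second with one inversion. On other lengths no \<open>S\<close> has both itself and its complement
  of size 1.\<close>

lemma alt_wedge_1_1:
  assumes a: "a \<in> alt_forms 1 T" and \<mu>: "\<mu> \<in> alt_forms 1 T"
  shows "alt_wedge a \<mu> vs = (case vs of [v, w] \<Rightarrow> a [v] * \<mu> [w] - a [w] * \<mu> [v] | _ \<Rightarrow> 0)"
proof (cases "length vs = 2")
  case True
  then obtain v w where vs: "vs = [v, w]" using list_length_2 by metis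
  have P: "Pow {..<length vs} = {{}, {0}, {1}, {0, 1}}"
    unfolding vs by (auto simp: lessThan_Suc)
  have 0: "a [] = 0" "\<mu> [] = 0"
    using alt_forms_support(1)[OF a, of "[]"] alt_forms_support(1)[OF \<mu>, of "[]"] by auto
  have e: "{(i, j). i = 0 \<and> j < Suc (Suc 0) \<and> 0 < j \<and> j < i} = {}"
    "{(i, j). i = Suc 0 \<and> j < Suc (Suc 0) \<and> j \<noteq> Suc 0 \<and> j < i} = {(Suc 0, 0 :: nat)}"
    by auto
  have d: "{..<Suc (Suc 0)} - {Suc 0} = {0}" "{..<Suc (Suc 0)} - {0} = {Suc 0}" by auto
  show ?thesis
    unfolding alt_wedge_def P using d by (simp add: vs 0 nths_Cons e)
next
  case False
  have "a (nths vs S) * \<mu> (nths vs ({..<length vs} - S)) = 0" if "S \<subseteq> {..<length vs}" for S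
  proof (rule ccontr)
    assume "\<not> ?thesis"
    then have "card S = 1" "card ({..<length vs} - S) = 1"
      using alt_forms_support(1)[OF a, of "nths vs S"] length_nths_subset[of S vs] that
        alt_forms_support(1)[OF \<mu>, of "nths vs ({..<length vs} - S)"]
        length_nths_subset[of "{..<length vs} - S" vs] by auto
    moreover have "card S + card ({..<length vs} - S) = length vs"
      using that by (metis card_Diff_subset card_lessThan card_mono finite_lessThan finite_subset
          le_add_diff_inverse)
    ultimately show False using False by simp
  qed
  then have "alt_wedge a \<mu> vs = 0"
    by (auto simp: alt_wedge_def mult.assoc intro!: sum.neutral)
  then show ?thesis
    using False by (auto split: list.splits)
qed

section \<open>Charts and tangent spaces\<close>

lemma subspace_flat: "subspace (flat d)"
  by (auto simp: flat_def subspace_def)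

lemma flat_0: "flat 0 = {0}"
proof -
  have "y = 0" if "\<forall>i\<in>{0<..2::nat}. y $ of_nat i = 0" for y :: "real^2"
    using that[rule_format, of 1] that[rule_format, of 2] by (simp add: vec_eq_iff forall_2)
  then show ?thesis by (auto simp: flat_def)
qed

lemma flat_1: "flat (Suc 0) = {y. y $ 2 = 0}"
proof -
  have "{Suc 0<..2} = {2::nat}" by auto
  then show ?thesis by (simp add: flat_def)
qed

lemma flat_2: "flat 2 = UNIV" "flat (Suc (Suc 0)) = UNIV"
  by (simp_all add: flat_def)

lemma flat_mono: "d \<le> d' \<Longrightarrow> flat d \<subseteq> flat d'"
  by (auto simp: flat_def)

lemma flat_1_scale: "y \<in> flat (Suc 0) \<Longrightarrow> y = (y $ 1) *\<^sub>R axis 1 1"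
  by (simp add: flat_1 vec_eq_iff forall_2 axis_def)

lemma axis_1_flat: "axis 1 s \<in> flat (Suc 0)"
  by (simp add: flat_1 axis_def)

lemma vec2_decomp: "(y :: real^2) = (y $ 1) *\<^sub>R axis 1 1 + (y $ 2) *\<^sub>R axis 2 1"
  by (simp add: vec_eq_iff forall_2 axis_def)

lemma closed_flat: "closed (flat d)"
  by (rule closed_subspace[OF subspace_flat])

lemma ebasis_simps: "ebasis 0 = []" "ebasis (Suc 0) = [axis 1 1]" "ebasis 2 = [axis 1 1, axis 2 1]"
    "ebasis (Suc (Suc 0)) = [axis 1 1, axis 2 1]"
  by (simp_all add: ebasis_def upt_rec numeral_2_eq_2)

lemma eventually_line_openin:
  assumes "openin (top_of_set (flat d)) S" "y \<in> S" "u \<in> flat d"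
  shows "\<forall>\<^sub>F t in nhds (0::real). y + t *\<^sub>R u \<in> S"
proof -
  obtain U where U: "open U" "S = flat d \<inter> U"
    using assms(1) by (auto simp: openin_open)
  have "((\<lambda>t. y + t *\<^sub>R u) \<longlongrightarrow> y + 0 *\<^sub>R u) (nhds 0)"
    by (intro tendsto_intros filterlim_ident)
  then have "\<forall>\<^sub>F t in nhds 0. y + t *\<^sub>R u \<in> U"
    using U assms(2) by (intro topological_tendstoD) auto
  then show ?thesis
    by eventually_elim (use U assms subspace_flat in \<open>auto simp: subspace_add subspace_scale\<close>)
qed

text \<open>The Jacobian of the coordinate change from \<open>c\<close> to \<open>c'\<close>,
  attached to the point \<open>x\<close> of the surface instead of its coordinates, so that it can
  be composed and followed along the surface without naming chart images.\<close>

definition dtr :: "'p chart \<Rightarrow> 'p chart \<Rightarrow> 'p \<Rightarrow> real^2 \<Rightarrow> real^2" where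
  "dtr c c' x u = frechet_derivative (snd c' \<circ> chart_inv c) (at (snd c x)) u"

locale riem_surface =
  fixes M :: "('p::t2_space, 'z) ddr_surface_scheme"
  assumes riem: "riemannian_surface M"
begin

lemma atlas: "maximal_smooth_atlas (pts M) (charts M)"
  using riem by (simp add: riemannian_surface_def)

context
  fixes c assumes c: "c \<in> charts M"
begin

lemma chart_is_chart: "is_chart (pts M) c"
  using atlas c by (simp add: maximal_smooth_atlas_def)

lemma chart_openin: "openin (top_of_set (pts M)) (fst c)"
  using chart_is_chart by (simp add: is_chart_def)

lemma chart_open_range: "open (chart_range c)"
  using chart_is_chart by (simp add: is_chart_def)

lemma chart_homeo: "homeomorphism (fst c) (chart_range c) (snd c) (chart_inv c)"
  using chart_is_chart by (simp add: is_chart_def)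

lemma chart_subset: "fst c \<subseteq> pts M"
  using chart_openin openin_imp_subset by blast

lemma chart_inv_left [simp]: "x \<in> fst c \<Longrightarrow> chart_inv c (snd c x) = x"
  using chart_homeo by (simp add: homeomorphism_def)

lemma chart_inv_right [simp]: "y \<in> chart_range c \<Longrightarrow> snd c (chart_inv c y) = y"
  by (rule f_inv_into_f)

lemma chart_inv_in [simp]: "y \<in> chart_range c \<Longrightarrow> chart_inv c y \<in> fst c"
  by (rule inv_into_into)

lemma chart_inj: "x \<in> fst c \<Longrightarrow> z \<in> fst c \<Longrightarrow> snd c x = snd c z \<Longrightarrow> x = z"
  using chart_inv_left by metis

lemma chart_image_iff: "y \<in> chart_image c A \<longleftrightarrow> y \<in> chart_range c \<and> chart_inv c y \<in> A"
  using chart_inv_in chart_inv_right by (auto simp: image_iff)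

lemma chart_cont: "continuous_on (fst c) (snd c)"
  using chart_homeo by (simp add: homeomorphism_def)

lemma chart_inv_cont: "continuous_on (chart_range c) (chart_inv c)"
  using chart_homeo by (simp add: homeomorphism_def)

lemma chart_openin_image:
  assumes "openin (top_of_set (pts M)) W"
  shows "open (chart_image c W)"
proof -
  obtain U where "open U" "W = pts M \<inter> U"
    using assms by (auto simp: openin_open)
  then have "openin (top_of_set (fst c)) (fst c \<inter> W)"
    using chart_subset by (intro openin_open[THEN iffD2]) blast
  then have "openin (top_of_set (chart_range c)) (chart_image c W)"
    using homeomorphism_imp_open_map[OF chart_homeo] by blast
  then show ?thesis
    using chart_open_range openin_open_eq by blast
qed

lemma chart_openin_preimage:
  assumes "open U"
  shows "openin (top_of_set (pts M)) {x \<in> fst c. snd c x \<in> U}"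
proof -
  have "openin (top_of_set (fst c)) (fst c \<inter> snd c -` U)"
    using chart_cont assms continuous_openin_preimage_gen by blast
  then show ?thesis
    using openin_trans[OF _ chart_openin] by (simp add: vimage_def Int_def)
qed

text \<open>Moves continuity from coordinates to the surface. After this, functions are treated as
  functions of the point, which lets charts be compared on their overlaps.\<close>

lemma chart_cont_iff:
  "continuous_on (chart_image c A) (\<lambda>y. h (chart_inv c y)) \<longleftrightarrow> continuous_on (fst c \<inter> A) h"
proof
  assume L: "continuous_on (chart_image c A) (\<lambda>y. h (chart_inv c y))"
  have "continuous_on (fst c \<inter> A) (\<lambda>x. h (chart_inv c (snd c x)))"
    by (rule continuous_on_compose2[OF L continuous_on_subset[OF chart_cont]]) auto
  then show "continuous_on (fst c \<inter> A) h"
    by (rule continuous_on_eq) (use chart_inv_left in auto)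
next
  assume R: "continuous_on (fst c \<inter> A) h"
  show "continuous_on (chart_image c A) (\<lambda>y. h (chart_inv c y))"
    by (rule continuous_on_compose2[OF R continuous_on_subset[OF chart_inv_cont]])
       (use chart_image_iff in auto)
qed

end

lemma chart_exists: "x \<in> pts M \<Longrightarrow> \<exists>c\<in>charts M. x \<in> fst c"
proof -
  have "pts M \<subseteq> (\<Union>c\<in>charts M. fst c)"
    using atlas unfolding maximal_smooth_atlas_def by (elim conjE)
  then show "x \<in> pts M \<Longrightarrow> ?thesis" by blast
qed

context
  fixes c c' assumes c: "c \<in> charts M" and c': "c' \<in> charts M"
begin

lemma transition_smooth: "smooth_on (snd c' \<circ> chart_inv c) (chart_image c (fst c'))"
proof -
  have "\<forall>c\<in>charts M. \<forall>c'\<in>charts M. smoothly_compatible c c'"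
    using atlas unfolding maximal_smooth_atlas_def by (elim conjE)
  then show ?thesis
    using c c' by (simp add: smoothly_compatible_def)
qed

lemma transition_open: "open (chart_image c (fst c'))"
  using chart_openin_image[OF c chart_openin[OF c']] .

lemma dtr_has_derivative_at:
  assumes "y \<in> chart_image c (fst c')"
  shows "((snd c' \<circ> chart_inv c) has_derivative frechet_derivative (snd c' \<circ> chart_inv c) (at y)) (at y)"
proof -
  have "Ck_on (Suc 0) (snd c' \<circ> chart_inv c) (chart_image c (fst c'))"
    using transition_smooth unfolding smooth_on_def by (rule spec)
  then have "(snd c' \<circ> chart_inv c) differentiable_on chart_image c (fst c')"
    unfolding Ck_on.simps by (rule conjunct1)
  then have "(snd c' \<circ> chart_inv c) differentiable (at y within chart_image c (fst c'))"
    using assms unfolding differentiable_on_def by (rule bspec)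
  then have "(snd c' \<circ> chart_inv c) differentiable (at y)"
    unfolding at_within_open[OF assms transition_open] .
  then show ?thesis
    by (simp only: frechet_derivative_works[symmetric])
qed

lemma dtr_has_derivative:
  assumes "x \<in> fst c" "x \<in> fst c'"
  shows "((snd c' \<circ> chart_inv c) has_derivative dtr c c' x) (at (snd c x))"
  using dtr_has_derivative_at[of "snd c x"] assms unfolding dtr_def by auto

lemma dtr_linear: "x \<in> fst c \<Longrightarrow> x \<in> fst c' \<Longrightarrow> linear (dtr c c' x)"
  using dtr_has_derivative has_derivative_linear by blast

lemma dtr_continuous: "continuous_on (fst c \<inter> fst c') (\<lambda>x. dtr c c' x u)"
proof -
  have "Ck_on (Suc 0) (snd c' \<circ> chart_inv c) (chart_image c (fst c'))"
    using transition_smooth unfolding smooth_on_def by (rule spec)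
  then have 1: "continuous_on (chart_image c (fst c')) (\<lambda>y. frechet_derivative (snd c' \<circ> chart_inv c) (at y) u)"
    unfolding Ck_on.simps by blast
  show ?thesis
    unfolding dtr_def
    by (rule continuous_on_compose2[OF 1 continuous_on_subset[OF chart_cont[OF c]]]) auto
qed

lemma tvec_of_component: "x \<in> fst c' \<Longrightarrow> tvec_of M c x u c' = dtr c c' x u"
  using c' by (simp add: tvec_of_def dtr_def)

end

lemma dtr_trans:
  assumes c: "c \<in> charts M" and c': "c' \<in> charts M" and c'': "c'' \<in> charts M" and x: "x \<in> fst c" "x \<in> fst c'" "x \<in> fst c''"
  shows "dtr c' c'' x (dtr c c' x u) = dtr c c'' x u"
proof -
  have "((snd c'' \<circ> chart_inv c') has_derivative dtr c' c'' x) (at ((snd c' \<circ> chart_inv c) (snd c x)))"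
    using dtr_has_derivative[OF c' c'' x(2,3)] x c by simp
  then have "((snd c'' \<circ> chart_inv c') \<circ> (snd c' \<circ> chart_inv c) has_derivative
      dtr c' c'' x \<circ> dtr c c' x) (at (snd c x))"
    by (rule diff_chain_at[OF dtr_has_derivative[OF c c' x(1,2)]])
  then have "((snd c'' \<circ> chart_inv c) has_derivative dtr c' c'' x \<circ> dtr c c' x) (at (snd c x))"
  proof (rule has_derivative_transform_within_open[OF _ transition_open[OF c c']])
    show "snd c x \<in> chart_image c (fst c')" using x by blast
    show "((snd c'' \<circ> chart_inv c') \<circ> (snd c' \<circ> chart_inv c)) y = (snd c'' \<circ> chart_inv c) y"
      if "y \<in> chart_image c (fst c')" for y
      using that c c' by auto
  qed
  then have "frechet_derivative (snd c'' \<circ> chart_inv c) (at (snd c x)) = dtr c' c'' x \<circ> dtr c c' x"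
    by (rule frechet_derivative_at[symmetric])
  then show ?thesis
    by (simp add: dtr_def[of c c''])
qed

lemma dtr_self: "c \<in> charts M \<Longrightarrow> x \<in> fst c \<Longrightarrow> dtr c c x u = u"
proof -
  assume c: "c \<in> charts M" and x: "x \<in> fst c"
  have "((\<lambda>y. y) has_derivative (\<lambda>u. u)) (at (snd c x))" by (rule has_derivative_ident)
  then have "((snd c \<circ> chart_inv c) has_derivative (\<lambda>u. u)) (at (snd c x))"
    by (rule has_derivative_transform_within_open[OF _ chart_open_range[OF c]])
       (use c x in auto)
  then show ?thesis
    using frechet_derivative_at by (metis dtr_def)
qed

text \<open>A tangent vector is the family of all its components, so equality is checked in each
  chart, where it is the chain rule \<open>dtr_trans\<close>.\<close>

lemma tvec_change:
  assumes "c \<in> charts M" "c' \<in> charts M" "x \<in> fst c" "x \<in> fst c'"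
  shows "tvec_of M c x u = tvec_of M c' x (dtr c c' x u)"
proof
  fix c''
  show "tvec_of M c x u c'' = tvec_of M c' x (dtr c c' x u) c''"
  proof (cases "c'' \<in> charts M \<and> x \<in> fst c''")
    case True
    then show ?thesis
      using assms by (simp add: tvec_of_component dtr_trans)
  qed (simp only: tvec_of_def if_False)
qed

lemma tvec_comp_self [simp]:
  "c \<in> charts M \<Longrightarrow> x \<in> fst c \<Longrightarrow> tvec_of M c x u c = u"
  by (simp add: tvec_of_component dtr_self)

lemma tvec_add:
  assumes "c \<in> charts M" "x \<in> fst c"
  shows "tvec_of M c x (s *\<^sub>R u + w) = s *\<^sub>R tvec_of M c x u + tvec_of M c x w"
proof
  fix c'
  show "tvec_of M c x (s *\<^sub>R u + w) c' = (s *\<^sub>R tvec_of M c x u + tvec_of M c x w) c'"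
  proof (cases "c' \<in> charts M \<and> x \<in> fst c'")
    case True
    then show ?thesis
      using assms dtr_linear[of c c' x]
      by (simp add: tvec_of_component linear_add linear_scale)
  qed (simp only: tvec_of_def if_False plus_fun_apply scaleR_fun_apply, simp)
qed

lemma tvec_linear: "c \<in> charts M \<Longrightarrow> x \<in> fst c \<Longrightarrow> linear (tvec_of M c x)"
proof (rule linearI)
  assume c: "c \<in> charts M" "x \<in> fst c"
  show "tvec_of M c x (u + w) = tvec_of M c x u + tvec_of M c x w" for u w
    using tvec_add[OF c, of 1] by simp
  have "tvec_of M c x 0 = 0"
    using tvec_add[OF c, of 1 0 0] by simp
  then show "tvec_of M c x (s *\<^sub>R u) = s *\<^sub>R tvec_of M c x u" for s u
    using tvec_add[OF c, of s u 0] by simp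
qed

lemma tspace_eq: "c \<in> charts M \<Longrightarrow> x \<in> fst c \<Longrightarrow> tspace M x = range (tvec_of M c x)"
proof -
  assume c: "c \<in> charts M" "x \<in> fst c"
  show ?thesis
  proof (intro equalityI subsetI)
    fix v assume "v \<in> tspace M x"
    then obtain c' u where "v = tvec_of M c' x u" "c' \<in> charts M" "x \<in> fst c'"
      unfolding tspace_def by blast
    then show "v \<in> range (tvec_of M c x)"
      using tvec_change[of c' c x u] c by simp
  next
    fix v assume "v \<in> range (tvec_of M c x)"
    then show "v \<in> tspace M x"
      unfolding tspace_def using c by blast
  qed
qed

lemma tvec_in_tspace: "c \<in> charts M \<Longrightarrow> x \<in> fst c \<Longrightarrow> tvec_of M c x u \<in> tspace M x"
  unfolding tspace_def by blast

lemma subspace_tspace: "x \<in> pts M \<Longrightarrow> subspace (tspace M x)"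
  using chart_exists[of x] tspace_eq tvec_linear linear_subspace_image subspace_UNIV by metis

definition gm :: "'p chart \<Rightarrow> real^2 \<Rightarrow> real^2 \<Rightarrow> 'p \<Rightarrow> real" where
  "gm c u w x = metric M x (tvec_of M c x u) (tvec_of M c x w)"

lemma gm_continuous: "c \<in> charts M \<Longrightarrow> continuous_on (fst c) (gm c u w)"
proof -
  assume c: "c \<in> charts M"
  have "\<forall>c\<in>charts M. \<forall>u w. smooth_on (\<lambda>y. let x = chart_inv c y in
      metric M x (tvec_of M c x u) (tvec_of M c x w)) (chart_range c)"
    using conjunct2[OF conjunct2[OF riem[unfolded riemannian_surface_def]]] .
  then have "Ck_on 0 (\<lambda>y. let x = chart_inv c y in metric M x (tvec_of M c x u) (tvec_of M c x w)) (chart_range c)"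
    using c unfolding smooth_on_def by blast
  then have "continuous_on (chart_image c UNIV) (\<lambda>y. gm c u w (chart_inv c y))"
    by (simp add: Let_def gm_def)
  then show ?thesis
    using chart_cont_iff[OF c, of UNIV "gm c u w"] by simp
qed

lemma metric_sym: "x \<in> pts M \<Longrightarrow> v \<in> tspace M x \<Longrightarrow> w \<in> tspace M x \<Longrightarrow> metric M x v w = metric M x w v"
  using riem by (simp add: riemannian_surface_def)

lemma metric_pos: "x \<in> pts M \<Longrightarrow> v \<in> tspace M x \<Longrightarrow> v \<noteq> 0 \<Longrightarrow> metric M x v v > 0"
  using riem by (simp add: riemannian_surface_def)

lemma metric_lin: "x \<in> pts M \<Longrightarrow> v \<in> tspace M x \<Longrightarrow> w \<in> tspace M x \<Longrightarrow> v' \<in> tspace M x \<Longrightarrow>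
    metric M x (s *\<^sub>R v + v') w = s * metric M x v w + metric M x v' w"
  using riem by (simp add: riemannian_surface_def)

lemma cell_chart_in: "cell_chart M f c \<Longrightarrow> c \<in> charts M"
  by (simp add: cell_chart_def)

text \<open>A short segment in a flat direction stays in the image of \<open>f\<close>, hence its
  image under the coordinate change stays in \<open>flat (cdim M f)\<close>. The normal coordinates
  vanish along it, and so do their derivatives.\<close>

lemma dtr_flat:
  assumes c: "cell_chart M f c" and c': "cell_chart M f c'"
    and x: "x \<in> f" "x \<in> fst c" "x \<in> fst c'" and u: "u \<in> flat (cdim M f)"
  shows "dtr c c' x u \<in> flat (cdim M f)"
proof -
  let ?d = "cdim M f" and ?F = "snd c' \<circ> chart_inv c" and ?y = "snd c x"
  have cM: "c \<in> charts M" "c' \<in> charts M"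
    using c c' cell_chart_in by auto
  have op: "openin (top_of_set (flat ?d)) (chart_image c f \<inter> chart_image c (fst c'))"
    using c transition_open[OF cM] unfolding cell_chart_def
    by (metis openin_Int_open)
  have "\<forall>\<^sub>F t in nhds 0. ?y + t *\<^sub>R u \<in> chart_image c f \<inter> chart_image c (fst c')"
    by (rule eventually_line_openin[OF op _ u]) (use x in auto)
  moreover have "?F y \<in> flat ?d" if "y \<in> chart_image c f \<inter> chart_image c (fst c')" for y
  proof -
    have "chart_inv c y \<in> f \<inter> fst c'"
      using that chart_image_iff[OF cM(1)] by auto
    then have "?F y \<in> chart_image c' f" by auto
    then show ?thesis
      using c' openin_imp_subset unfolding cell_chart_def by blast
  qed
  ultimately have ev: "\<forall>\<^sub>F t in nhds 0. ?F (?y + t *\<^sub>R u) \<in> flat ?d"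
    by (rule eventually_mono)
  have der: "((\<lambda>t. ?F (?y + t *\<^sub>R u)) has_derivative (\<lambda>t. dtr c c' x (t *\<^sub>R u))) (at 0)"
  proof -
    have "((\<lambda>t. ?y + t *\<^sub>R u) has_derivative (\<lambda>t. t *\<^sub>R u)) (at 0)"
      by (auto intro!: derivative_eq_intros)
    moreover have "(?F has_derivative dtr c c' x) (at (?y + 0 *\<^sub>R u))"
      using dtr_has_derivative[OF cM x(2,3)] by simp
    ultimately show ?thesis
      by (rule has_derivative_compose)
  qed
  have "dtr c c' x u $ of_nat i = 0" if i: "i \<in> {?d<..2}" for i
  proof -
    have "((\<lambda>t. ?F (?y + t *\<^sub>R u) $ of_nat i) has_derivative (\<lambda>t. dtr c c' x (t *\<^sub>R u) $ of_nat i)) (at 0)"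
      using bounded_linear.has_derivative[OF bounded_linear_vec_nth der] by simp
    moreover have "((\<lambda>t. ?F (?y + t *\<^sub>R u) $ of_nat i) has_derivative (\<lambda>t. 0)) (at 0)"
    proof (rule has_derivative_transform_eventually[where f="\<lambda>_. 0"])
      show "\<forall>\<^sub>F t in at 0. 0 = ?F (?y + t *\<^sub>R u) $ of_nat i"
        using ev i by (auto simp: eventually_at_filter flat_def elim!: eventually_mono)
      show "0 = ?F (?y + 0 *\<^sub>R u) $ of_nat i"
        using eventually_nhds_x_imp_x[OF ev] i by (auto simp: flat_def)
    qed auto
    ultimately have "(\<lambda>t. dtr c c' x (t *\<^sub>R u) $ of_nat i) = (\<lambda>t. 0)"
      by (rule has_derivative_unique)
    then show ?thesis
      by (metis scaleR_one)
  qed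
  then show ?thesis by (simp add: flat_def)
qed

text \<open>The definition takes vectors from all cell charts around the point; by
  \<open>dtr_flat\<close> any one of them already gives the whole tangent space.\<close>

lemma cell_tspace_eq:
  assumes c: "cell_chart M f c" and x: "x \<in> f" "x \<in> fst c"
  shows "cell_tspace M f x = tvec_of M c x ` flat (cdim M f)"
proof (intro equalityI subsetI)
  fix v assume "v \<in> cell_tspace M f x"
  then obtain c' u where c': "v = tvec_of M c' x u" "cell_chart M f c'" "x \<in> fst c'" "u \<in> flat (cdim M f)"
    unfolding cell_tspace_def by blast
  then have "v = tvec_of M c x (dtr c' c x u)" "dtr c' c x u \<in> flat (cdim M f)"
    using tvec_change dtr_flat c x cell_chart_in by blast+
  then show "v \<in> tvec_of M c x ` flat (cdim M f)" by blast
next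
  fix v assume "v \<in> tvec_of M c x ` flat (cdim M f)"
  then show "v \<in> cell_tspace M f x"
    unfolding cell_tspace_def using c x by blast
qed

lemma cell_tspace_subspace:
  assumes "cell_chart M f c" "x \<in> f" "x \<in> fst c"
  shows "subspace (cell_tspace M f x)" "cell_tspace M f x \<subseteq> tspace M x"
proof -
  have c: "c \<in> charts M" using assms(1) by (rule cell_chart_in)
  show "subspace (cell_tspace M f x)"
    unfolding cell_tspace_eq[OF assms]
    by (rule linear_subspace_image[OF tvec_linear[OF c assms(3)] subspace_flat])
  show "cell_tspace M f x \<subseteq> tspace M x"
    unfolding cell_tspace_eq[OF assms] using tvec_in_tspace[OF c assms(3)] by blast
qed

lemma tvec_in_cell_tspace:
  "cell_chart M f c \<Longrightarrow> x \<in> fst c \<Longrightarrow> u \<in> flat (cdim M f) \<Longrightarrow> tvec_of M c x u \<in> cell_tspace M f x"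
  unfolding cell_tspace_def by blast

end

section \<open>Inner product and Hodge star at a point of a cell\<close>

lemma form_inner_add_left:
  "form_inner M f x (s *\<^sub>R a + b) \<mu> = s * form_inner M f x a \<mu> + form_inner M f x b \<mu>"
  unfolding form_inner_def by (induction "subseqs (SOME es. orthonormal_frame M f x es)") (auto simp: sum_list_addf algebra_simps sum_list_const_mult)

lemma form_inner_sym: "form_inner M f x a b = form_inner M f x b a"
  by (simp add: form_inner_def mult.commute)

lemma form_inner_add_right:
  "form_inner M f x \<mu> (s *\<^sub>R a + b) = s * form_inner M f x \<mu> a + form_inner M f x \<mu> b"
  using form_inner_add_left by (metis form_inner_sym)

lemma form_inner_scale_left: "form_inner M f x (s *\<^sub>R a) \<mu> = s * form_inner M f x a \<mu>"
  by (simp add: form_inner_def sum_list_const_mult mult.assoc)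

lemma form_inner_scale_right: "form_inner M f x \<mu> (s *\<^sub>R a) = s * form_inner M f x \<mu> a"
  using form_inner_scale_left by (metis form_inner_sym)

lemma form_inner_nonneg: "form_inner M f x a a \<ge> 0"
  by (auto simp: form_inner_def intro!: sum_list_nonneg)

text \<open>Nonnegativity of the square of \<open>s *\<^sub>R a + b\<close> for \<open>s = 1\<close>
  and \<open>s = -1\<close>. It reduces bounds on mixed products to bounds on squared norms.\<close>

lemma form_inner_le: "\<bar>form_inner M f x a b\<bar> \<le> (form_inner M f x a a + form_inner M f x b b) / 2"
proof -
  have "0 \<le> form_inner M f x (s *\<^sub>R a + b) (s *\<^sub>R a + b)" for s
    by (rule form_inner_nonneg)
  then have "0 \<le> s * s * form_inner M f x a a + 2 * s * form_inner M f x a b + form_inner M f x b b" for s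
    by (simp only: form_inner_add_left form_inner_add_right) (simp add: form_inner_sym[of M f x b a] algebra_simps)
  from this[of 1] this[of "-1"] show ?thesis by auto
qed

lemma form_inner_add_bound:
  "form_inner M f x (s *\<^sub>R a + b) (s *\<^sub>R a + b) \<le> 2 * (s\<^sup>2 * form_inner M f x a a + form_inner M f x b b)"
proof -
  have "0 \<le> form_inner M f x (s *\<^sub>R a + (-1) *\<^sub>R b) (s *\<^sub>R a + (-1) *\<^sub>R b)"
    by (rule form_inner_nonneg)
  then show ?thesis
    by (simp only: form_inner_add_left form_inner_add_right form_inner_scale_left form_inner_scale_right)
      (simp add: form_inner_sym[of M f x b a] algebra_simps power2_eq_square)
qed

lemma mult_square_cancel: "q * v = (v * v) * X \<Longrightarrow> v \<noteq> 0 \<Longrightarrow> q = v * X" for v :: real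
  by (metis mult.assoc mult.commute mult_right_cancel)

text \<open>If the rows \<open>(p, q)\<close> and \<open>(r, s)\<close> of a matrix \<open>A\<close>
  are orthonormal for the Gram matrix \<open>G\<close>, then \<open>A G A^T = 1\<close>, hence
  \<open>A^T A\<close> is the inverse of \<open>G\<close>, and the squared determinant of
  \<open>A\<close> is the inverse of that of \<open>G\<close>. The conclusions are these identities
  entry by entry.\<close>

lemma inverse_gram:
  fixes p q r s :: real
  assumes "p * (p * G11 + q * G12) + q * (p * G12 + q * G22) = 1"
    and "r * (r * G11 + s * G12) + s * (r * G12 + s * G22) = 1"
    and "r * (p * G11 + q * G12) + s * (p * G12 + q * G22) = 0"
  defines "D \<equiv> p * s - q * r"
  shows "D\<^sup>2 * (G11 * G22 - G12\<^sup>2) = 1" "p\<^sup>2 + r\<^sup>2 = D\<^sup>2 * G22" "p * q + r * s = - (D\<^sup>2 * G12)" "q\<^sup>2 + s\<^sup>2 = D\<^sup>2 * G11"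
proof -
  define X Y Z W where "X = p * G11 + q * G12" and "Y = p * G12 + q * G22"
    and "Z = r * G11 + s * G12" and "W = r * G12 + s * G22"
  have 1: "p * X + q * Y = 1" "r * X + s * Y = 0" "r * Z + s * W = 1"
    using assms(1-3) by (auto simp: X_def Y_def Z_def W_def)
  have 2: "p * Z + q * W = 0"
    using 1(2) by (simp add: X_def Y_def Z_def W_def algebra_simps)
  \<comment> \<open>Cramer's rule for the two linear systems satisfied by \<open>(X, Y)\<close> and
    \<open>(Z, W)\<close>, the rows of \<open>A G\<close>.\<close>
  have XW: "D * X = s" "D * Y = - r" "D * Z = - q" "D * W = p"
    using 1 2 unfolding D_def by algebra+
  show "D\<^sup>2 * (G11 * G22 - G12\<^sup>2) = 1"
  proof -
    have "D\<^sup>2 * (G11 * G22 - G12\<^sup>2) = D * (X * W - Y * Z)"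
      by (simp add: D_def X_def Y_def Z_def W_def algebra_simps power2_eq_square)
    also have "\<dots> = s * W + r * Z"
      using XW by (simp add: right_diff_distrib flip: mult.assoc)
    finally show ?thesis using 1 by simp
  qed
  have "p\<^sup>2 + r\<^sup>2 = p * (D * W) - r * (D * Y)" "p * q + r * s = q * (D * W) - s * (D * Y)"
     "q\<^sup>2 + s\<^sup>2 = s * (D * X) - q * (D * Z)"
    unfolding XW by (simp_all add: power2_eq_square algebra_simps)
  then show "p\<^sup>2 + r\<^sup>2 = D\<^sup>2 * G22" "p * q + r * s = - (D\<^sup>2 * G12)" "q\<^sup>2 + s\<^sup>2 = D\<^sup>2 * G11"
    by (simp_all add: D_def X_def Y_def Z_def W_def algebra_simps power2_eq_square)
qed

locale riem_mesh = riem_surface M for M :: "('p::t2_space, 'z) ddr_surface_scheme" +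
  assumes compact: "compact (pts M)" and mesh: "mesh M"
begin

lemma cell_facts:
  assumes "f \<in> cells M"
  shows "f \<noteq> {}" "connected f" "cdim M f \<le> 2" "submanifold M (cdim M f) f" "oriented_cell M f"
  using mesh assms unfolding mesh_def by blast+

lemma cell_subset: "f \<in> cells M \<Longrightarrow> f \<subseteq> pts M"
  using cell_facts(4) by (auto simp: submanifold_def)

lemma cell_chart_exists:
  assumes "f \<in> cells M" "x \<in> f"
  obtains c where "cell_chart M f c" "x \<in> fst c"
proof -
  obtain c where c: "c \<in> charts M" "x \<in> fst c" "chart_image c f = chart_range c \<inter> flat (cdim M f)"
    using cell_facts(4)[OF assms(1)] assms(2) unfolding submanifold_def by metis
  then have "cell_chart M f c"
    using chart_open_range[of c] by (simp add: cell_chart_def Int_commute openin_open_Int)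
  then show thesis using that c by blast
qed

abbreviation G11 where "G11 c \<equiv> gm c (axis 1 1) (axis 1 1)"
abbreviation G12 where "G12 c \<equiv> gm c (axis 1 1) (axis 2 1)"
abbreviation G22 where "G22 c \<equiv> gm c (axis 2 1) (axis 2 1)"

definition gdet where "gdet c x = G11 c x * G22 c x - (G12 c x)\<^sup>2"

lemma gm_expand:
  assumes "c \<in> charts M" "x \<in> fst c"
  shows "gm c u w x = u $ 1 * w $ 1 * G11 c x + (u $ 1 * w $ 2 + u $ 2 * w $ 1) * G12 c x + u $ 2 * w $ 2 * G22 c x"
proof -
  have x: "x \<in> pts M" using chart_subset assms by blast
  note t = tvec_in_tspace[OF assms]
  have sym: "gm c u w x = gm c w u x" for u w
    unfolding gm_def using metric_sym[OF x t t] .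
  have left: "gm c (s *\<^sub>R u + v) w x = s * gm c u w x + gm c v w x" for s u v w
    unfolding gm_def tvec_add[OF assms] using metric_lin[OF x t t t] .
  have z: "gm c 0 w x = 0" for w
    using left[of 1 0 0 w] by simp
  have comb: "gm c u w x = u $ 1 * gm c (axis 1 1) w x + u $ 2 * gm c (axis 2 1) w x" for u w
  proof -
    have "gm c u w x = gm c ((u $ 1) *\<^sub>R axis 1 1 + ((u $ 2) *\<^sub>R axis 2 1 + 0)) w x"
      using vec2_decomp[of u] by simp
    also have "\<dots> = u $ 1 * gm c (axis 1 1) w x + u $ 2 * gm c (axis 2 1) w x"
      unfolding left z by simp
    finally show ?thesis .
  qed
  have "gm c v w x = w $ 1 * gm c v (axis 1 1) x + w $ 2 * gm c v (axis 2 1) x" for v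
    using comb[of w v] sym by simp
  then show ?thesis
    using comb[of u w] sym[of "axis 2 1" "axis 1 1"] by (simp add: algebra_simps)
qed

lemma gm_pos:
  assumes "c \<in> charts M" "x \<in> fst c" "u \<noteq> 0"
  shows "gm c u u x > 0"
proof -
  have "tvec_of M c x u \<noteq> 0"
    using tvec_comp_self[OF assms(1,2), of u] assms(3) by (metis zero_fun_apply)
  then show ?thesis
    unfolding gm_def using metric_pos tvec_in_tspace chart_subset assms by blast
qed

lemma gram_pos:
  assumes "c \<in> charts M" "x \<in> fst c"
  shows "G11 c x > 0" "gdet c x > 0"
proof -
  show 1: "G11 c x > 0"
    using gm_pos[OF assms, of "axis 1 1"] by (simp add: axis_eq_0_iff)
  \<comment> \<open>A vector orthogonal to the first coordinate vector; its squared length is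
    \<open>G11\<close> times the Gram determinant.\<close>
  define u :: "real^2" where "u = (G12 c x) *\<^sub>R axis 1 1 - (G11 c x) *\<^sub>R axis 2 1"
  have u: "u $ 1 = G12 c x" "u $ 2 = - G11 c x"
    by (simp_all add: u_def axis_def)
  then have "u \<noteq> 0" using 1 by (metis neg_equal_0_iff_equal order_less_irrefl zero_index)
  then have "gm c u u x > 0" by (rule gm_pos[OF assms])
  also have "gm c u u x = G11 c x * gdet c x"
    unfolding gm_expand[OF assms, of u u] u by (simp add: gdet_def algebra_simps power2_eq_square)
  finally show "gdet c x > 0" using 1 zero_less_mult_pos by blast
qed

lemma gdet_continuous: "c \<in> charts M \<Longrightarrow> continuous_on (fst c) (gdet c)"
  unfolding gdet_def[abs_def] by (intro continuous_intros gm_continuous)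

text \<open>The defining condition of \<open>star\<close> at a single point. Existence, uniqueness
  and bijectivity are linear algebra in one tangent space and are glued over the cell
  afterwards.\<close>

definition star_rel :: "'p set \<Rightarrow> 'p \<Rightarrow> nat \<Rightarrow> ('p tvec list \<Rightarrow> real) \<Rightarrow> ('p tvec list \<Rightarrow> real) \<Rightarrow> bool" where
  "star_rel f x k a \<beta> \<longleftrightarrow> \<beta> \<in> alt_forms (int (cdim M f) - int k) (cell_tspace M f x) \<and>
     (\<forall>\<mu>\<in>alt_forms (int (cdim M f) - int k) (cell_tspace M f x).
        form_inner M f x \<beta> \<mu> *\<^sub>R orient M f x = alt_wedge a \<mu>)"

context
  fixes f c x
  assumes f: "f \<in> cells M" and c: "cell_chart M f c" and x: "x \<in> f" "x \<in> fst c"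
begin

abbreviation (input) "T \<equiv> cell_tspace M f x"
abbreviation (input) "b1 \<equiv> tvec_of M c x (axis 1 1)"
abbreviation (input) "b2 \<equiv> tvec_of M c x (axis 2 1)"

lemma chart_of_cell: "c \<in> charts M"
  using c cell_chart_in by blast

lemmas T_eq = cell_tspace_eq[OF c x]
lemmas T_subspace = cell_tspace_subspace(1)[OF c x]

lemma tvec_decomp: "tvec_of M c x u = (u $ 1) *\<^sub>R b1 + (u $ 2) *\<^sub>R b2"
proof -
  have "tvec_of M c x u = tvec_of M c x ((u $ 1) *\<^sub>R axis 1 1 + (u $ 2) *\<^sub>R axis 2 1)"
    using vec2_decomp[of u] by simp
  also have "\<dots> = (u $ 1) *\<^sub>R b1 + (u $ 2) *\<^sub>R b2"
    using tvec_linear[OF chart_of_cell x(2)] by (simp only: linear_add linear_scale)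
  finally show ?thesis .
qed

lemma T_1: 
  assumes "cdim M f = 1"
  shows "b1 \<in> T" "v \<in> T \<Longrightarrow> \<exists>s. v = s *\<^sub>R b1"
proof -
  show "b1 \<in> T" unfolding T_eq assms by (simp add: axis_1_flat)
  assume "v \<in> T"
  then obtain u where u: "v = tvec_of M c x u" "u \<in> flat 1"
    unfolding T_eq assms by blast
  then have "v = (u $ 1) *\<^sub>R b1"
    using tvec_decomp[of u] flat_1 by simp
  then show "\<exists>s. v = s *\<^sub>R b1" by blast
qed

lemma T_2:
  assumes "cdim M f = 2"
  shows "tvec_of M c x u \<in> T" "v \<in> T \<Longrightarrow> \<exists>s t. v = s *\<^sub>R b1 + t *\<^sub>R b2"
proof -
  show "tvec_of M c x u \<in> T" unfolding T_eq assms by (simp add: flat_2)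
  show "v \<in> T \<Longrightarrow> \<exists>s t. v = s *\<^sub>R b1 + t *\<^sub>R b2"
    unfolding T_eq using tvec_decomp by blast
qed

lemma metric_tvec: "metric M x (tvec_of M c x u) (tvec_of M c x w) = gm c u w x"
  by (simp add: gm_def)

lemma frame_exists:
  assumes d: "cdim M f = 1 \<or> cdim M f = 2"
  shows "orthonormal_frame M f x (SOME es. orthonormal_frame M f x es)"
proof (rule someI_ex)
  note gp = gram_pos[OF chart_of_cell x(2)]
  define e1 :: "real^2" where "e1 = (1 / sqrt (G11 c x)) *\<^sub>R axis 1 1"
  have e1: "e1 $ 1 = 1 / sqrt (G11 c x)" "e1 $ 2 = 0"
    by (simp_all add: e1_def axis_def)
  have n1: "gm c e1 e1 x = 1"
    unfolding gm_expand[OF chart_of_cell x(2), of e1 e1] e1 using gp(1) by simp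
  show "\<exists>es. orthonormal_frame M f x es"
  proof (cases "cdim M f = 1")
    case True
    have "tvec_of M c x e1 \<in> T"
      unfolding T_eq True using e1 by (simp add: flat_1)
    then have "orthonormal_frame M f x [tvec_of M c x e1]"
      unfolding orthonormal_frame_def using True n1 by (simp add: metric_tvec)
    then show ?thesis by blast
  next
    case False
    then have d2: "cdim M f = 2" using d by simp
    \<comment> \<open>Gram-Schmidt: the first component of \<open>e2\<close> removes the part along
      the first coordinate vector, which leaves squared length \<open>gdet / G11\<close> before
      scaling by \<open>k\<close>.\<close>
    define k where "k = sqrt (G11 c x / gdet c x)"
    have k2: "k * k = G11 c x / gdet c x"
      using gp by (simp add: k_def)
    define e2 :: "real^2" where "e2 = (- k * G12 c x / G11 c x) *\<^sub>R axis 1 1 + k *\<^sub>R axis 2 1"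
    have e2: "e2 $ 1 = - k * G12 c x / G11 c x" "e2 $ 2 = k"
      by (simp_all add: e2_def axis_def)
    have o12: "gm c e1 e2 x = 0" "gm c e2 e1 x = 0"
      unfolding gm_expand[OF chart_of_cell x(2), of e1 e2] gm_expand[OF chart_of_cell x(2), of e2 e1] e1 e2
      using gp(1) by simp_all
    have "gm c e2 e2 x = k * k * (gdet c x / G11 c x)"
      unfolding gm_expand[OF chart_of_cell x(2), of e2 e2] e2 gdet_def
      using gp(1) by (simp add: field_simps power2_eq_square)
    then have n2: "gm c e2 e2 x = 1"
      unfolding k2 using gp by simp
    have "orthonormal_frame M f x [tvec_of M c x e1, tvec_of M c x e2]"
      unfolding orthonormal_frame_def using d2 n1 n2 o12 T_2(1)[OF d2]
      by (auto simp: metric_tvec less_2_cases_iff nth_Cons')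
    then show ?thesis by blast
  qed
qed

text \<open>\<open>form_inner\<close> uses a frame chosen by \<open>SOME\<close>, with no continuity
  in the point. The formula removes the choice and leaves metric coefficients, which are continuous.
  The degrees may be arbitrary, since components of the wrong degree are zero.\<close>

lemma form_inner_1:
  assumes d: "cdim M f = 1" and a: "a \<in> alt_forms l T" and b: "b \<in> alt_forms l' T"
  shows "form_inner M f x a b = a [] * b [] + a [b1] * b [b1] / G11 c x"
proof -
  define es where "es = (SOME es. orthonormal_frame M f x es)"
  have es: "orthonormal_frame M f x es"
    unfolding es_def using frame_exists d by blast
  then obtain e where e: "es = [e]" "e \<in> T" "metric M x e e = 1"
    using d list_length_1[of es] unfolding orthonormal_frame_def by fastforce
  then obtain u where u: "e = tvec_of M c x u" "u \<in> flat 1"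
    unfolding T_eq d by blast
  have u2: "u $ 2 = 0" using u(2) flat_1 by simp
  have 1: "(u $ 1)\<^sup>2 * G11 c x = 1"
    using e(3) gm_expand[OF chart_of_cell x(2), of u u] unfolding u(1) metric_tvec
    by (simp add: u2 power2_eq_square)
  have ev: "h [e] = u $ 1 * h [b1]" if "h \<in> alt_forms m T" for h m
    using alt_forms_1_comb[OF T_subspace that T_1(1)[OF d] T_1(1)[OF d], of "u $ 1" 0]
      tvec_decomp[of u] by (simp add: u(1) u2)
  have "form_inner M f x a b = a [e] * b [e] + a [] * b []"
    unfolding form_inner_def es_def[symmetric] e(1) by simp
  also have "a [e] * b [e] = (u $ 1)\<^sup>2 * (a [b1] * b [b1])"
    by (simp add: ev[OF a] ev[OF b] power2_eq_square)
  also have "(u $ 1)\<^sup>2 = 1 / G11 c x"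
    using 1 gram_pos(1)[OF chart_of_cell x(2)] by (simp add: field_simps)
  finally show ?thesis by simp
qed

text \<open>On 1-forms the product is given by the inverse Gram matrix, on 2-forms by the inverse of
  its determinant; both come from \<open>inverse_gram\<close> applied to the coordinates of the
  frame.\<close>

lemma form_inner_2:
  assumes d: "cdim M f = 2" and a: "a \<in> alt_forms l T" and b: "b \<in> alt_forms l' T"
  shows "form_inner M f x a b = a [] * b [] +
    (G22 c x * a [b1] * b [b1] - G12 c x * (a [b1] * b [b2] + a [b2] * b [b1]) + G11 c x * a [b2] * b [b2]) / gdet c x
    + a [b1, b2] * b [b1, b2] / gdet c x"
proof -
  define es where "es = (SOME es. orthonormal_frame M f x es)"
  have es: "orthonormal_frame M f x es"
    unfolding es_def using frame_exists d by blast
  then obtain e e' where e: "es = [e, e']"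
    using d list_length_2[of es] unfolding orthonormal_frame_def by auto
  have m: "e \<in> T" "e' \<in> T" "metric M x e e = 1" "metric M x e' e' = 1" "metric M x e' e = 0"
    using es d unfolding orthonormal_frame_def e by (auto simp: numeral_2_eq_2 All_less_Suc)
  then obtain u w where u: "e = tvec_of M c x u" "e' = tvec_of M c x w"
    unfolding T_eq d by blast
  define p q r s where "p = u $ 1" and "q = u $ 2" and "r = w $ 1" and "s = w $ 2"
  define D where "D = p * s - q * r"
  have g: "p * (p * G11 c x + q * G12 c x) + q * (p * G12 c x + q * G22 c x) = 1"
    "r * (r * G11 c x + s * G12 c x) + s * (r * G12 c x + s * G22 c x) = 1"
    "r * (p * G11 c x + q * G12 c x) + s * (p * G12 c x + q * G22 c x) = 0"
    using m(3-5) gm_expand[OF chart_of_cell x(2), of u u] gm_expand[OF chart_of_cell x(2), of w w]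
      gm_expand[OF chart_of_cell x(2), of w u] unfolding u metric_tvec
    by (simp_all add: p_def q_def r_def s_def algebra_simps)
  note ig = inverse_gram[OF g, folded D_def]
  have bT: "b1 \<in> T" "b2 \<in> T" using T_2(1)[OF d] by auto
  have e_eq: "e = p *\<^sub>R b1 + q *\<^sub>R b2" "e' = r *\<^sub>R b1 + s *\<^sub>R b2"
    using tvec_decomp[of u] tvec_decomp[of w] by (simp_all add: u p_def q_def r_def s_def)
  have D2: "D\<^sup>2 = 1 / gdet c x"
    using ig(1) gram_pos(2)[OF chart_of_cell x(2)] by (simp add: gdet_def field_simps)
  have "form_inner M f x a b = a [e, e'] * b [e, e'] + a [e] * b [e] + a [e'] * b [e'] + a [] * b []"
    unfolding form_inner_def es_def[symmetric] e by (simp add: Let_def)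
  also have "a [e, e'] * b [e, e'] = D\<^sup>2 * (a [b1, b2] * b [b1, b2])"
    unfolding e_eq alt_forms_2_comb[OF T_subspace a bT] alt_forms_2_comb[OF T_subspace b bT]
    by (simp add: D_def power2_eq_square algebra_simps)
  also have "a [e] * b [e] = (p * a [b1] + q * a [b2]) * (p * b [b1] + q * b [b2])"
    unfolding e_eq alt_forms_1_comb[OF T_subspace a bT] alt_forms_1_comb[OF T_subspace b bT] ..
  also have "a [e'] * b [e'] = (r * a [b1] + s * a [b2]) * (r * b [b1] + s * b [b2])"
    unfolding e_eq alt_forms_1_comb[OF T_subspace a bT] alt_forms_1_comb[OF T_subspace b bT] ..
  finally have "form_inner M f x a b = D\<^sup>2 * (a [b1, b2] * b [b1, b2]) + a [] * b []
      + (p\<^sup>2 + r\<^sup>2) * (a [b1] * b [b1]) + (p * q + r * s) * (a [b1] * b [b2] + a [b2] * b [b1])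
      + (q\<^sup>2 + s\<^sup>2) * (a [b2] * b [b2])"
    by (simp add: algebra_simps power2_eq_square)
  then show ?thesis
    unfolding ig(2-4) D2 by (simp add: field_simps diff_divide_distrib add_divide_distrib)
qed

text \<open>Completing the square: \<open>G11\<close> times the quadratic form is a square plus
  \<open>gdet\<close> times \<open>s\<close> squared, and both \<open>G11\<close> and
  \<open>gdet\<close> are positive.\<close>

lemma quadratic_zero:
  assumes "G22 c x * s * s - G12 c x * (s * t + t * s) + G11 c x * t * t = 0"
  shows "s = 0 \<and> t = 0"
proof -
  note gp = gram_pos[OF chart_of_cell x(2)]
  have "(G11 c x * t - G12 c x * s)\<^sup>2 + gdet c x * s\<^sup>2
      = G11 c x * (G22 c x * s * s - G12 c x * (s * t + t * s) + G11 c x * t * t)"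
    by (simp add: gdet_def power2_eq_square algebra_simps)
  then have 0: "(G11 c x * t - G12 c x * s)\<^sup>2 + gdet c x * s\<^sup>2 = 0" using assms by simp
  have "gdet c x * s\<^sup>2 \<ge> 0" using gp by simp
  then have "gdet c x * s\<^sup>2 = 0" "(G11 c x * t - G12 c x * s)\<^sup>2 = 0"
    using 0 zero_le_power2[of "G11 c x * t - G12 c x * s"] by linarith+
  then show ?thesis using gp by auto
qed

lemma quadratic_nonneg:
  "G22 c x * s * s - G12 c x * (s * t + t * s) + G11 c x * t * t \<ge> 0"
proof -
  note gp = gram_pos[OF chart_of_cell x(2)]
  have "(G11 c x * t - G12 c x * s)\<^sup>2 + gdet c x * s\<^sup>2
      = G11 c x * (G22 c x * s * s - G12 c x * (s * t + t * s) + G11 c x * t * t)"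
    by (simp add: gdet_def power2_eq_square algebra_simps)
  moreover have "(G11 c x * t - G12 c x * s)\<^sup>2 + gdet c x * s\<^sup>2 \<ge> 0"
    using gp by simp
  ultimately show ?thesis
    using mult_le_cancel_left_pos[OF gp(1), of 0] by simp
qed

lemma form_inner_definite:
  assumes d: "cdim M f = 1 \<or> cdim M f = 2" and l: "l \<le> int (cdim M f)"
    and a: "a \<in> alt_forms l T" and 0: "form_inner M f x a a = 0"
  shows "a = 0"
proof (cases "l < 0")
  case True
  then show ?thesis using alt_forms_negative a by blast
next
  case False
  note gp = gram_pos[OF chart_of_cell x(2)]
  have z: "0 \<in> alt_forms l T" using subspace_alt_forms subspace_0 by blast
  show ?thesis
  proof (cases "cdim M f = 1")
    case True
    have "a [b1] * a [b1] / G11 c x \<ge> 0" using gp by simp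
    then have "a [] = 0" "a [b1] = 0"
      using form_inner_1[OF True a a] 0 gp zero_le_square[of "a []"] by (auto simp: add_nonneg_eq_0_iff)
    moreover have "l = 0 \<or> l = 1" using False l True by auto
    moreover have "\<exists>s t. v = s *\<^sub>R b1 + t *\<^sub>R b1" if "v \<in> T" for v
      using T_1(2)[OF True that] by (metis add.right_neutral scaleR_zero_left)
    ultimately show ?thesis
      using alt_forms_0_eqI[of a T 0]
        alt_forms_1_eqI[OF T_subspace T_1(1)[OF True] T_1(1)[OF True], of a 0] a z
      by auto
  next
    case False2: False
    then have d2: "cdim M f = 2" using d by simp
    let ?q = "G22 c x * a [b1] * a [b1] - G12 c x * (a [b1] * a [b2] + a [b2] * a [b1]) + G11 c x * a [b2] * a [b2]"
    have q: "?q / gdet c x \<ge> 0" "a [b1, b2] * a [b1, b2] / gdet c x \<ge> 0" "a [] * a [] \<ge> 0"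
      using quadratic_nonneg gp by simp_all
    then have *: "?q / gdet c x = 0" "a [b1, b2] * a [b1, b2] / gdet c x = 0" "a [] * a [] = 0"
      using form_inner_2[OF d2 a a] 0 by linarith+
    have gd: "gdet c x \<noteq> 0" using gp by simp
    have "a [b1] = 0 \<and> a [b2] = 0"
      by (rule quadratic_zero) (use *(1) gd in simp)
    moreover have "a [] = 0" using *(3) by simp
    moreover have "a [b1, b2] = 0" using *(2) gd by simp
    moreover have "l = 0 \<or> l = 1 \<or> l = 2" using False l d2 by auto
    moreover note bT = T_2(1)[OF d2] T_2(2)[OF d2]
    ultimately show ?thesis
      using alt_forms_0_eqI[of a T 0] alt_forms_1_eqI[OF T_subspace bT(1) bT(1) bT(2), of a 0]
        alt_forms_2_eqI[OF T_subspace bT(1) bT(1) bT(2), of a 0] a z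
      by auto
  qed
qed

lemma orient_form: "orient M f x \<in> alt_forms (int (cdim M f)) T" "form_inner M f x (orient M f x) (orient M f x) = 1"
  using cell_facts(5)[OF f] x by (auto simp: oriented_cell_def cell_forms_def)

text \<open>The volume form has norm one, so by the coordinate formulas its squared component on the
  coordinate basis is the Gram determinant.\<close>

lemma orient_basis_sq:
  "cdim M f = 1 \<Longrightarrow> (orient M f x [b1])\<^sup>2 = G11 c x"
  "cdim M f = 2 \<Longrightarrow> (orient M f x [b1, b2])\<^sup>2 = gdet c x"
proof -
  note gp = gram_pos[OF chart_of_cell x(2)]
  show "(orient M f x [b1])\<^sup>2 = G11 c x" if d: "cdim M f = 1"
  proof -
    have "orient M f x [] = 0" using alt_forms_support(1)[OF orient_form(1), of "[]"] d by auto
    then show ?thesis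
      using form_inner_1[OF d orient_form(1) orient_form(1)] orient_form(2) gp by (simp add: power2_eq_square field_simps)
  qed
  show "(orient M f x [b1, b2])\<^sup>2 = gdet c x" if d: "cdim M f = 2"
  proof -
    have "orient M f x [] = 0" "orient M f x [v] = 0" for v
      using alt_forms_support(1)[OF orient_form(1), of "[]"] alt_forms_support(1)[OF orient_form(1), of "[v]"] d by auto
    then show ?thesis
      using form_inner_2[OF d orient_form(1) orient_form(1)] orient_form(2) gp by (simp add: power2_eq_square field_simps)
  qed
qed

lemma top_form_multiple:
  assumes d: "cdim M f = 1 \<or> cdim M f = 2" and \<mu>: "\<mu> \<in> alt_forms (int (cdim M f)) T"
  obtains t where "\<mu> = t *\<^sub>R orient M f x"
proof -
  note gp = gram_pos[OF chart_of_cell x(2)]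
  note o = orient_form(1)
  show thesis
  proof (cases "cdim M f = 1")
    case True
    let ?t = "\<mu> [b1] / orient M f x [b1]"
    have "orient M f x [b1] \<noteq> 0" using orient_basis_sq(1)[OF True] gp by auto
    then have "\<mu> = ?t *\<^sub>R orient M f x"
      using \<mu> o subspace_scale[OF subspace_alt_forms o, of ?t] T_1(2)[OF True] True
      by (intro alt_forms_1_eqI[OF T_subspace T_1(1)[OF True] T_1(1)[OF True]])
        (auto, metis add.right_neutral scaleR_zero_left)
    then show thesis by (rule that)
  next
    case False
    then have d2: "cdim M f = 2" using d by simp
    let ?t = "\<mu> [b1, b2] / orient M f x [b1, b2]"
    have "orient M f x [b1, b2] \<noteq> 0" using orient_basis_sq(2)[OF d2] gp by auto
    then have "\<mu> = ?t *\<^sub>R orient M f x"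
      using \<mu> o subspace_scale[OF subspace_alt_forms o, of ?t] T_2[OF d2] d2
      by (intro alt_forms_2_eqI[OF T_subspace T_2(1)[OF d2] T_2(1)[OF d2]]) auto
    then show thesis by (rule that)
  qed
qed

lemma form_inner_0:
  assumes d: "cdim M f = 1 \<or> cdim M f = 2" and a: "a \<in> alt_forms 0 T" and b: "b \<in> alt_forms 0 T"
  shows "form_inner M f x a b = a [] * b []"
  using d form_inner_1[OF _ a b] form_inner_2[OF _ a b] alt_forms_support(1)[OF a]
  by (auto simp: alt_forms_0_apply[OF a, of "[b1]"] alt_forms_0_apply[OF a, of "[b2]"] alt_forms_0_apply[OF a, of "[b1, b2]"])

lemma orient_neq_0: "orient M f x \<noteq> 0"
proof
  assume "orient M f x = 0"
  then have "form_inner M f x (0 *\<^sub>R 0) (orient M f x) = 1" using orient_form(2) by simp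
  then show False unfolding form_inner_scale_left by simp
qed

lemma star_rel_unique:
  assumes d: "cdim M f = 1 \<or> cdim M f = 2" and "star_rel f x k a \<beta>" "star_rel f x k a \<beta>'"
  shows "\<beta> = \<beta>'"
proof -
  let ?l = "int (cdim M f) - int k"
  have \<beta>: "\<beta> \<in> alt_forms ?l T" "\<beta>' \<in> alt_forms ?l T"
    using assms by (auto simp: star_rel_def)
  have D: "\<beta> - \<beta>' \<in> alt_forms ?l T"
    using \<beta> subspace_alt_forms subspace_diff by blast
  then have "form_inner M f x \<beta> (\<beta> - \<beta>') *\<^sub>R orient M f x = form_inner M f x \<beta>' (\<beta> - \<beta>') *\<^sub>R orient M f x"
    using assms by (simp add: star_rel_def)
  then have "form_inner M f x \<beta> (\<beta> - \<beta>') = form_inner M f x \<beta>' (\<beta> - \<beta>')"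
    using orient_neq_0 by simp
  then have "form_inner M f x (\<beta> - \<beta>') (\<beta> - \<beta>') = 0"
    using form_inner_add_left[of M f x "-1" \<beta>' \<beta> "\<beta> - \<beta>'"] by simp
  then show ?thesis
    using form_inner_definite[OF d _ D] by simp
qed

text \<open>The condition is linear in the test form, so the two coordinate forms decide it. The
  component \<open>v\<close> of the volume form satisfies \<open>v * v = gdet c x\<close>; this
  cancels the denominator of the inverse Gram matrix up to one factor \<open>v\<close>.\<close>

lemma star_rel_1_of_2:
  assumes d: "cdim M f = 2" and a: "a \<in> alt_forms 1 T" and \<beta>: "\<beta> \<in> alt_forms 1 T"
    and v: "v = orient M f x [b1, b2]"
  shows "star_rel f x 1 a \<beta> \<longleftrightarrow>
    v * a [b1] = G11 c x * \<beta> [b2] - G12 c x * \<beta> [b1] \<and> v * a [b2] = G12 c x * \<beta> [b2] - G22 c x * \<beta> [b1]"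
proof
  note gp = gram_pos[OF chart_of_cell x(2)]
  have v2: "v * v = gdet c x" "v \<noteq> 0"
    using orient_basis_sq(2)[OF d] gp by (auto simp: v power2_eq_square)
  have bT: "b1 \<in> T" "b2 \<in> T" using T_2(1)[OF d] by auto
  let ?q = "\<lambda>\<mu>. G22 c x * \<beta> [b1] * \<mu> [b1] - G12 c x * (\<beta> [b1] * \<mu> [b2] + \<beta> [b2] * \<mu> [b1]) + G11 c x * \<beta> [b2] * \<mu> [b2]"
  have fi: "form_inner M f x \<beta> \<mu> = ?q \<mu> / gdet c x" if "\<mu> \<in> alt_forms 1 T" for \<mu>
  proof -
    have "\<beta> [] = 0" "\<beta> [b1, b2] = 0"
      using alt_forms_support(1)[OF \<beta>, of "[]"] alt_forms_support(1)[OF \<beta>, of "[b1, b2]"] by auto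
    then show ?thesis using form_inner_2[OF d \<beta> that] by simp
  qed
  {
    assume R: "star_rel f x 1 a \<beta>"
    have eq: "?q \<mu> = v * (a [b1] * \<mu> [b2] - a [b2] * \<mu> [b1])" if \<mu>: "\<mu> \<in> alt_forms 1 T" for \<mu>
    proof -
      have "form_inner M f x \<beta> \<mu> *\<^sub>R orient M f x = alt_wedge a \<mu>"
        using R \<mu> d by (simp add: star_rel_def)
      then have "form_inner M f x \<beta> \<mu> * v = a [b1] * \<mu> [b2] - a [b2] * \<mu> [b1]"
        using alt_wedge_1_1[OF a \<mu>, of "[b1, b2]"] by (simp add: v fun_eq_iff)
      then have "?q \<mu> * v = (v * v) * (a [b1] * \<mu> [b2] - a [b2] * \<mu> [b1])"
        unfolding fi[OF \<mu>] v2(1) using gp by (simp add: field_simps)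
      then show ?thesis using v2(2) mult_square_cancel by blast
    qed
    \<comment> \<open>The coordinate forms dual to \<open>b1\<close> and \<open>b2\<close>: the
      entry of a tangent vector at the chart \<open>c\<close> is its list of components in
      \<open>c\<close>.\<close>
    define \<mu> where "\<mu> i = one_form T (\<lambda>w. w c $ i)" for i :: 2
    have \<mu>: "\<mu> i \<in> alt_forms 1 T" for i
      unfolding \<mu>_def by (rule one_form_in[OF T_subspace]) (simp add: lin_on_def)
    have "\<mu> i [b1] = axis 1 1 $ i" "\<mu> i [b2] = axis 2 1 $ i" for i
      using bT x chart_of_cell by (simp_all add: \<mu>_def one_form_apply)
    then show "v * a [b1] = G11 c x * \<beta> [b2] - G12 c x * \<beta> [b1] \<and> v * a [b2] = G12 c x * \<beta> [b2] - G22 c x * \<beta> [b1]"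
      using eq[OF \<mu>[of 1]] eq[OF \<mu>[of 2]] by (simp add: axis_def algebra_simps)
  }
  assume R: "v * a [b1] = G11 c x * \<beta> [b2] - G12 c x * \<beta> [b1] \<and> v * a [b2] = G12 c x * \<beta> [b2] - G22 c x * \<beta> [b1]"
  have "form_inner M f x \<beta> \<mu> *\<^sub>R orient M f x = alt_wedge a \<mu>" if \<mu>: "\<mu> \<in> alt_forms 1 T" for \<mu>
  proof
    fix vs
    have "?q \<mu> = (v * a [b1]) * \<mu> [b2] - (v * a [b2]) * \<mu> [b1]"
      unfolding R[THEN conjunct1] R[THEN conjunct2] by (simp add: algebra_simps)
    then have "?q \<mu> * v = ((v * a [b1]) * \<mu> [b2] - (v * a [b2]) * \<mu> [b1]) * v"
      by simp
    also have "\<dots> = gdet c x * (a [b1] * \<mu> [b2] - a [b2] * \<mu> [b1])"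
      unfolding v2(1)[symmetric] by (simp add: algebra_simps)
    finally have "?q \<mu> * v = gdet c x * (a [b1] * \<mu> [b2] - a [b2] * \<mu> [b1])" .
    then have K: "form_inner M f x \<beta> \<mu> * v = a [b1] * \<mu> [b2] - a [b2] * \<mu> [b1]"
      unfolding fi[OF \<mu>] using gp by (simp add: field_simps)
    have o: "orient M f x \<in> alt_forms 2 T" using orient_form(1) d by simp
    show "(form_inner M f x \<beta> \<mu> *\<^sub>R orient M f x) vs = alt_wedge a \<mu> vs"
    proof (cases "length vs = 2")
      case False
      then show ?thesis
        using alt_forms_support(1)[OF o, of vs] alt_wedge_1_1[OF a \<mu>, of vs] by (auto split: list.splits)
    next
      case True
      then obtain w z where vs: "vs = [w, z]" using list_length_2 by metis
      show ?thesis
      proof (cases "w \<in> T \<and> z \<in> T")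
        case True
        then obtain s t s' t' where st: "w = s *\<^sub>R b1 + t *\<^sub>R b2" "z = s' *\<^sub>R b1 + t' *\<^sub>R b2"
          using T_2(2)[OF d] by meson
        have "(form_inner M f x \<beta> \<mu> *\<^sub>R orient M f x) vs = (s * t' - t * s') * (form_inner M f x \<beta> \<mu> * v)"
          unfolding vs st scaleR_fun_apply alt_forms_2_comb[OF T_subspace o bT] v by simp
        also have "\<dots> = alt_wedge a \<mu> vs"
          unfolding K alt_wedge_1_1[OF a \<mu>] vs st
          by (simp add: alt_forms_1_comb[OF T_subspace a bT] alt_forms_1_comb[OF T_subspace \<mu> bT] algebra_simps)
        finally show ?thesis .
      next
        case False
        then have "orient M f x vs = 0" "a [w] * \<mu> [z] = 0" "a [z] * \<mu> [w] = 0"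
          using alt_forms_support(2)[OF o, of vs] alt_forms_support(2)[OF a, of "[w]"] alt_forms_support(2)[OF a, of "[z]"]
            alt_forms_support(2)[OF \<mu>, of "[w]"] alt_forms_support(2)[OF \<mu>, of "[z]"] vs by auto
        moreover have "alt_wedge a \<mu> vs = a [w] * \<mu> [z] - a [z] * \<mu> [w]"
          using alt_wedge_1_1[OF a \<mu>, of vs] vs by simp
        ultimately show ?thesis by (simp only: scaleR_fun_apply) simp
      qed
    qed
  qed
  then show "star_rel f x 1 a \<beta>" using \<beta> d by (simp add: star_rel_def)
qed

lemma star_rel_0:
  assumes d: "cdim M f = 1 \<or> cdim M f = 2" and a: "a \<in> alt_forms 0 T"
  shows "star_rel f x 0 a (a [] *\<^sub>R orient M f x)"
proof -
  have "form_inner M f x (a [] *\<^sub>R orient M f x) \<mu> *\<^sub>R orient M f x = alt_wedge a \<mu>"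
    if \<mu>: "\<mu> \<in> alt_forms (int (cdim M f)) T" for \<mu>
  proof -
    obtain t where t: "\<mu> = t *\<^sub>R orient M f x" by (rule top_form_multiple[OF d \<mu>])
    show ?thesis
      unfolding alt_wedge_0_left_form[OF a] t form_inner_scale_left form_inner_scale_right orient_form(2) by simp
  qed
  then show ?thesis
    using orient_form(1) subspace_scale[OF subspace_alt_forms] by (simp add: star_rel_def)
qed

lemma star_rel_top:
  assumes d: "cdim M f = 1 \<or> cdim M f = 2"
  shows "star_rel f x (cdim M f) (t *\<^sub>R orient M f x) (zero_form t)"
proof -
  have "form_inner M f x (zero_form t) \<mu> *\<^sub>R orient M f x = alt_wedge (t *\<^sub>R orient M f x) \<mu>"
    if "\<mu> \<in> alt_forms 0 T" for \<mu>
    unfolding alt_wedge_0_right_form[OF that] form_inner_0[OF d zero_form_in that] by simp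
  then show ?thesis by (simp add: star_rel_def zero_form_in)
qed

lemma coord_form:
  assumes d: "cdim M f = 2"
  obtains \<beta> where "\<beta> \<in> alt_forms 1 T" "\<beta> [b1] = s" "\<beta> [b2] = t"
proof -
  let ?\<beta> = "one_form T (\<lambda>w. s * w c $ 1 + t * w c $ 2)"
  have "?\<beta> \<in> alt_forms 1 T"
    by (rule one_form_in[OF T_subspace]) (simp add: lin_on_def algebra_simps)
  moreover have "?\<beta> [b1] = s" "?\<beta> [b2] = t"
    using T_2(1)[OF d] chart_of_cell x by (simp_all add: one_form_apply axis_def)
  ultimately show thesis by (rule that)
qed

lemma star_rel_exists:
  assumes d: "cdim M f = 1 \<or> cdim M f = 2" and k: "k \<le> cdim M f" and a: "a \<in> alt_forms (int k) T"
  shows "\<exists>\<beta>. star_rel f x k a \<beta>"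
proof -
  consider "k = 0" | "k = cdim M f" | "k = 1" "cdim M f = 2" using k d by force
  then show ?thesis
  proof cases
    case 1
    then show ?thesis using star_rel_0[OF d] a by auto
  next
    case 2
    then obtain t where "a = t *\<^sub>R orient M f x" using top_form_multiple[OF d] a by blast
    then show ?thesis using star_rel_top[OF d] 2 by blast
  next
    case 3
    define v where "v = orient M f x [b1, b2]"
    have v2: "v * v = gdet c x" "gdet c x > 0"
      using orient_basis_sq(2)[OF 3(2)] gram_pos[OF chart_of_cell x(2)] by (auto simp: v_def power2_eq_square)
    then have v0: "v \<noteq> 0" by auto
    \<comment> \<open>Cramer's rule for the equations of \<open>star_rel_1_of_2\<close>. The
      determinant is, up to sign, \<open>gdet c x = v * v\<close>, so one factor \<open>v\<close>
      remains in the denominators.\<close>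
    obtain \<beta> where \<beta>: "\<beta> \<in> alt_forms 1 T" "\<beta> [b1] = (a [b1] * G12 c x - a [b2] * G11 c x) / v"
        "\<beta> [b2] = (a [b1] * G22 c x - a [b2] * G12 c x) / v"
      by (rule coord_form[OF 3(2)])
    have "v * a [b1] = G11 c x * \<beta> [b2] - G12 c x * \<beta> [b1]" "v * a [b2] = G12 c x * \<beta> [b2] - G22 c x * \<beta> [b1]"
    proof -
      have v\<beta>: "v * \<beta> [b1] = a [b1] * G12 c x - a [b2] * G11 c x" "v * \<beta> [b2] = a [b1] * G22 c x - a [b2] * G12 c x"
        using v0 by (simp_all add: \<beta>)
      have "v * (G11 c x * \<beta> [b2] - G12 c x * \<beta> [b1]) = G11 c x * (v * \<beta> [b2]) - G12 c x * (v * \<beta> [b1])"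
        by (simp add: algebra_simps)
      also have "\<dots> = v * (v * a [b1])"
        unfolding v\<beta> mult.assoc[symmetric] v2(1) gdet_def by (simp add: algebra_simps power2_eq_square)
      finally have "v * (v * a [b1]) = v * (G11 c x * \<beta> [b2] - G12 c x * \<beta> [b1])" ..
      then show "v * a [b1] = G11 c x * \<beta> [b2] - G12 c x * \<beta> [b1]" using v0 by simp
      have "v * (G12 c x * \<beta> [b2] - G22 c x * \<beta> [b1]) = G12 c x * (v * \<beta> [b2]) - G22 c x * (v * \<beta> [b1])"
        by (simp add: algebra_simps)
      also have "\<dots> = v * (v * a [b2])"
        unfolding v\<beta> mult.assoc[symmetric] v2(1) gdet_def by (simp add: algebra_simps power2_eq_square)
      finally have "v * (v * a [b2]) = v * (G12 c x * \<beta> [b2] - G22 c x * \<beta> [b1])" ..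
      then show "v * a [b2] = G12 c x * \<beta> [b2] - G22 c x * \<beta> [b1]" using v0 by simp
    qed
    then have "star_rel f x 1 a \<beta>"
      using star_rel_1_of_2[OF 3(2) _ \<beta>(1) v_def] a 3 by simp
    then show ?thesis using 3 by blast
  qed
qed

lemma star_rel_surj:
  assumes d: "cdim M f = 1 \<or> cdim M f = 2" and k: "k \<le> cdim M f"
    and \<beta>: "\<beta> \<in> alt_forms (int (cdim M f) - int k) T"
  shows "\<exists>a\<in>alt_forms (int k) T. star_rel f x k a \<beta>"
proof -
  consider "k = 0" | "k = cdim M f" | "k = 1" "cdim M f = 2" using k d by force
  then show ?thesis
  proof cases
    case 1
    then obtain t where "\<beta> = t *\<^sub>R orient M f x" using top_form_multiple[OF d] \<beta> by auto
    then show ?thesis using star_rel_0[OF d zero_form_in, of t] 1 zero_form_in by auto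
  next
    case 2
    then have "\<beta> = zero_form (\<beta> [])"
      using alt_forms_0_eqI[of \<beta> T "zero_form (\<beta> [])"] \<beta> zero_form_in by auto
    then show ?thesis
      using star_rel_top[OF d, of "\<beta> []"] 2 orient_form(1) subspace_scale[OF subspace_alt_forms] by metis
  next
    case 3
    define v where "v = orient M f x [b1, b2]"
    have v0: "v \<noteq> 0"
      using orient_basis_sq(2)[OF 3(2)] gram_pos[OF chart_of_cell x(2)] by (auto simp: v_def)
    obtain a where a: "a \<in> alt_forms 1 T" "a [b1] = (G11 c x * \<beta> [b2] - G12 c x * \<beta> [b1]) / v"
        "a [b2] = (G12 c x * \<beta> [b2] - G22 c x * \<beta> [b1]) / v"
      by (rule coord_form[OF 3(2)])
    then have "star_rel f x 1 a \<beta>"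
      using star_rel_1_of_2[OF 3(2) a(1) _ v_def] \<beta> 3 v0 by simp
    then show ?thesis using a 3 by auto
  qed
qed

text \<open>\<open>\<beta>\<close> fixes all wedge products of \<open>a\<close> with forms of
  complementary degree, and the wedge pairing is nondegenerate: test with the volume form, with the
  constant 1, or with the two coordinate forms.\<close>

lemma star_rel_inj:
  assumes d: "cdim M f = 1 \<or> cdim M f = 2" and k: "k \<le> cdim M f"
    and a: "a \<in> alt_forms (int k) T" "a' \<in> alt_forms (int k) T"
    and R: "star_rel f x k a \<beta>" "star_rel f x k a' \<beta>"
  shows "a = a'"
proof -
  have w: "alt_wedge a \<mu> = alt_wedge a' \<mu>" if "\<mu> \<in> alt_forms (int (cdim M f) - int k) T" for \<mu>
    using R that by (simp add: star_rel_def)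
  consider "k = 0" | "k = cdim M f" | "k = 1" "cdim M f = 2" using k d by force
  then show ?thesis
  proof cases
    case 1
    then have a0: "a \<in> alt_forms 0 T" "a' \<in> alt_forms 0 T" using a by auto
    have "a [] *\<^sub>R orient M f x = a' [] *\<^sub>R orient M f x"
      using w[of "orient M f x"] orient_form(1) 1
      unfolding alt_wedge_0_left_form[OF a0(1)] alt_wedge_0_left_form[OF a0(2)] by simp
    then show ?thesis using alt_forms_0_eqI[OF a0] orient_neq_0 by simp
  next
    case 2
    have z: "zero_form 1 \<in> alt_forms 0 T" by (rule zero_form_in)
    show ?thesis
      using w[of "zero_form 1"] 2 z by (simp add: alt_wedge_0_right_form[OF z])
  next
    case 3
    then have a1: "a \<in> alt_forms 1 T" "a' \<in> alt_forms 1 T" using a by auto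
    have bT: "b1 \<in> T" "b2 \<in> T" using T_2(1)[OF 3(2)] by auto
    have e: "a [b1] * \<mu> [b2] - a [b2] * \<mu> [b1] = a' [b1] * \<mu> [b2] - a' [b2] * \<mu> [b1]"
      if "\<mu> \<in> alt_forms 1 T" for \<mu>
      using w[of \<mu>] alt_wedge_1_1[OF a1(1) that, of "[b1, b2]"] alt_wedge_1_1[OF a1(2) that, of "[b1, b2]"] 3 that
      by simp
    obtain \<mu> where \<mu>: "\<mu> \<in> alt_forms 1 T" "\<mu> [b1] = 1" "\<mu> [b2] = 0" by (rule coord_form[OF 3(2)])
    obtain \<nu> where \<nu>: "\<nu> \<in> alt_forms 1 T" "\<nu> [b1] = 0" "\<nu> [b2] = 1" by (rule coord_form[OF 3(2)])
    show ?thesis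
      using e[OF \<mu>(1)] e[OF \<nu>(1)] \<mu> \<nu> by (intro alt_forms_1_eqI[OF T_subspace bT T_2(2)[OF 3(2)] a1]) auto
  qed
qed

end

end

lemma subspace_comb: "subspace S \<Longrightarrow> p \<in> S \<Longrightarrow> q \<in> S \<Longrightarrow> s *\<^sub>R p + q \<in> S"
  by (simp add: subspace_add subspace_scale)

context riem_mesh
begin

section \<open>The Hodge star on cells\<close>

lemma subspace_cell_forms: "subspace (cell_forms M f l)"
  using subspace_alt_forms unfolding cell_forms_def subspace_def by auto

lemma cell_formsD: "\<omega> \<in> cell_forms M f l \<Longrightarrow> x \<in> f \<Longrightarrow> \<omega> x \<in> alt_forms l (cell_tspace M f x)"
    "\<omega> \<in> cell_forms M f l \<Longrightarrow> x \<notin> f \<Longrightarrow> \<omega> x = 0"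
  by (auto simp: cell_forms_def)

lemma cell_forms_negative: "l < 0 \<Longrightarrow> \<omega> \<in> cell_forms M f l \<Longrightarrow> \<omega> = 0"
proof (rule ext)
  fix x assume "l < 0" "\<omega> \<in> cell_forms M f l"
  then show "\<omega> x = 0 x"
    using alt_forms_negative[of l "\<omega> x"] cell_formsD[of \<omega> f l x] by (cases "x \<in> f") auto
qed

context
  fixes f k assumes f: "f \<in> cells M" and d: "cdim M f = 1 \<or> cdim M f = 2" and k: "k \<le> cdim M f"
begin

lemma star_props:
  assumes \<omega>: "\<omega> \<in> cell_forms M f (int k)"
  shows "star M f k \<omega> \<in> cell_forms M f (int (cdim M f) - int k)"
    and "x \<in> f \<Longrightarrow> star_rel f x k (\<omega> x) (star M f k \<omega> x)"
proof -
  have ex: "\<exists>!\<beta>. star_rel f x k (\<omega> x) \<beta>" if "x \<in> f" for x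
  proof -
    obtain c where c: "cell_chart M f c" "x \<in> fst c" using cell_chart_exists[OF f \<open>x \<in> f\<close>] .
    show ?thesis
      using star_rel_exists[OF f c(1) that c(2) d k] star_rel_unique[OF f c(1) that c(2) d] cell_formsD(1)[OF \<omega> that]
      by blast
  qed
  define \<eta> where "\<eta> x = (if x \<in> f then THE \<beta>. star_rel f x k (\<omega> x) \<beta> else 0)" for x
  have R: "star_rel f x k (\<omega> x) (\<eta> x)" if "x \<in> f" for x
    using theI'[OF ex[OF that]] that by (simp add: \<eta>_def)
  let ?P = "\<lambda>\<eta>. \<eta> \<in> cell_forms M f (int (cdim M f) - int k) \<and>
     (\<forall>x\<in>f. \<forall>\<mu>\<in>alt_forms (int (cdim M f) - int k) (cell_tspace M f x).
        form_inner M f x (\<eta> x) \<mu> *\<^sub>R orient M f x = alt_wedge (\<omega> x) \<mu>)"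
  have P_iff: "?P \<eta>' \<longleftrightarrow> (\<forall>x\<in>f. star_rel f x k (\<omega> x) (\<eta>' x)) \<and> (\<forall>x. x \<notin> f \<longrightarrow> \<eta>' x = 0)" for \<eta>'
    unfolding star_rel_def cell_forms_def by blast
  have P: "?P \<eta>"
    unfolding P_iff using R by (simp add: \<eta>_def)
  have "\<eta>' = \<eta>" if "?P \<eta>'" for \<eta>'
  proof
    fix x show "\<eta>' x = \<eta> x"
      using that[unfolded P_iff] P[unfolded P_iff] ex[of x] by (cases "x \<in> f") auto
  qed
  then have eq: "star M f k \<omega> = \<eta>"
    unfolding star_def using P by (intro the_equality) blast+
  show "star M f k \<omega> \<in> cell_forms M f (int (cdim M f) - int k)"
    unfolding eq using P by blast
  show "x \<in> f \<Longrightarrow> star_rel f x k (\<omega> x) (star M f k \<omega> x)"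
    unfolding eq by (rule R)
qed

lemma star_eqI:
  assumes \<omega>: "\<omega> \<in> cell_forms M f (int k)" and "\<And>x. x \<in> f \<Longrightarrow> star_rel f x k (\<omega> x) (\<eta> x)" "\<And>x. x \<notin> f \<Longrightarrow> \<eta> x = 0"
  shows "star M f k \<omega> = \<eta>"
proof
  fix x show "star M f k \<omega> x = \<eta> x"
  proof (cases "x \<in> f")
    case True
    obtain c where c: "cell_chart M f c" "x \<in> fst c" using cell_chart_exists[OF f True] .
    show ?thesis
      using star_rel_unique[OF f c(1) True c(2) d star_props(2)[OF \<omega> True] assms(2)[OF True]] .
  next
    case False
    then show ?thesis using cell_formsD(2)[OF star_props(1)[OF \<omega>]] assms(3) by simp
  qed
qed

lemma star_lin: "lin_on (cell_forms M f (int k)) (star M f k)"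
  unfolding lin_on_def
proof (intro ballI allI)
  fix p q s assume p: "p \<in> cell_forms M f (int k)" and q: "q \<in> cell_forms M f (int k)"
  show "star M f k (s *\<^sub>R p + q) = s *\<^sub>R star M f k p + star M f k q"
  proof (rule star_eqI)
    show "s *\<^sub>R p + q \<in> cell_forms M f (int k)"
      using subspace_comb[OF subspace_cell_forms p q] .
    show "(s *\<^sub>R star M f k p + star M f k q) x = 0" if "x \<notin> f" for x
      using cell_formsD(2)[OF star_props(1)[OF p] that] cell_formsD(2)[OF star_props(1)[OF q] that] by simp
    show "star_rel f x k ((s *\<^sub>R p + q) x) ((s *\<^sub>R star M f k p + star M f k q) x)" if "x \<in> f" for x
    proof -
      note R = star_props(2)[OF p that] star_props(2)[OF q that]
      let ?l = "int (cdim M f) - int k"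
      have "s *\<^sub>R star M f k p x + star M f k q x \<in> alt_forms ?l (cell_tspace M f x)"
        using R unfolding star_rel_def by (intro subspace_comb[OF subspace_alt_forms]) blast+
      moreover have "form_inner M f x (s *\<^sub>R star M f k p x + star M f k q x) \<mu> *\<^sub>R orient M f x
          = alt_wedge (s *\<^sub>R p x + q x) \<mu>" if "\<mu> \<in> alt_forms ?l (cell_tspace M f x)" for \<mu>
      proof -
        have "form_inner M f x (star M f k p x) \<mu> *\<^sub>R orient M f x = alt_wedge (p x) \<mu>"
          "form_inner M f x (star M f k q x) \<mu> *\<^sub>R orient M f x = alt_wedge (q x) \<mu>"
          using R that unfolding star_rel_def by blast+
        then show ?thesis
          by (simp only: form_inner_add_left alt_wedge_add_left scaleR_add_left flip: scaleR_scaleR)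
      qed
      ultimately show ?thesis unfolding star_rel_def by simp
    qed
  qed
qed

lemma star_bij: "bij_betw (star M f k) (cell_forms M f (int k)) (cell_forms M f (int (cdim M f) - int k))"
proof (rule bij_betw_imageI)
  show "inj_on (star M f k) (cell_forms M f (int k))"
  proof (rule inj_onI)
    fix p q assume p: "p \<in> cell_forms M f (int k)" and q: "q \<in> cell_forms M f (int k)"
      and eq: "star M f k p = star M f k q"
    show "p = q"
    proof
      fix x show "p x = q x"
      proof (cases "x \<in> f")
        case True
        obtain c where c: "cell_chart M f c" "x \<in> fst c" using cell_chart_exists[OF f True] .
        show ?thesis
          using star_rel_inj[OF f c(1) True c(2) d k cell_formsD(1)[OF p True] cell_formsD(1)[OF q True]]
            star_props(2)[OF p True] star_props(2)[OF q True] eq by simp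
      next
        case False
        then show ?thesis using cell_formsD(2)[OF p] cell_formsD(2)[OF q] by simp
      qed
    qed
  qed
  have "\<beta> \<in> star M f k ` cell_forms M f (int k)" if \<beta>: "\<beta> \<in> cell_forms M f (int (cdim M f) - int k)" for \<beta>
  proof -
    have "\<exists>a. a \<in> alt_forms (int k) (cell_tspace M f x) \<and> star_rel f x k a (\<beta> x)" if "x \<in> f" for x
    proof -
      obtain c where c: "cell_chart M f c" "x \<in> fst c" using cell_chart_exists[OF f \<open>x \<in> f\<close>] .
      show ?thesis using star_rel_surj[OF f c(1) that c(2) d k cell_formsD(1)[OF \<beta> that]] by blast
    qed
    then obtain a where a: "\<And>x. x \<in> f \<Longrightarrow> a x \<in> alt_forms (int k) (cell_tspace M f x) \<and> star_rel f x k (a x) (\<beta> x)"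
      by metis
    let ?a = "\<lambda>x. if x \<in> f then a x else 0"
    have "?a \<in> cell_forms M f (int k)" using a by (simp add: cell_forms_def)
    moreover have "star M f k ?a = \<beta>"
      by (rule star_eqI) (use a cell_formsD(2)[OF \<beta>] calculation in auto)
    ultimately show ?thesis by blast
  qed
  then show "star M f k ` cell_forms M f (int k) = cell_forms M f (int (cdim M f) - int k)"
    using star_props(1) by blast
qed

lemma star_inv_in:
  "p \<in> cell_forms M f (int (cdim M f) - int k) \<Longrightarrow> star_inv M f k p \<in> cell_forms M f (int k)"
  unfolding star_inv_def using bij_betw_imp_surj_on[OF star_bij] inv_into_into by metis

lemma star_star_inv [simp]:
  "p \<in> cell_forms M f (int (cdim M f) - int k) \<Longrightarrow> star M f k (star_inv M f k p) = p"
  unfolding star_inv_def using bij_betw_inv_into_right[OF star_bij] .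

lemma star_inv_star [simp]:
  "\<omega> \<in> cell_forms M f (int k) \<Longrightarrow> star_inv M f k (star M f k \<omega>) = \<omega>"
  unfolding star_inv_def using bij_betw_inv_into_left[OF star_bij] .

lemma star_inv_lin: "lin_on (cell_forms M f (int (cdim M f) - int k)) (star_inv M f k)"
  unfolding lin_on_def
proof (intro ballI allI)
  fix p q s assume p: "p \<in> cell_forms M f (int (cdim M f) - int k)" and q: "q \<in> cell_forms M f (int (cdim M f) - int k)"
  let ?a = "s *\<^sub>R star_inv M f k p + star_inv M f k q"
  have a: "?a \<in> cell_forms M f (int k)"
    using subspace_comb[OF subspace_cell_forms star_inv_in[OF p] star_inv_in[OF q]] .
  have "star M f k ?a = s *\<^sub>R p + q"
    using lin_onD[OF star_lin star_inv_in[OF p] star_inv_in[OF q]] p q by simp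
  then show "star_inv M f k (s *\<^sub>R p + q) = ?a"
    using star_inv_star[OF a] by simp
qed

text \<open>The bridge from wedge products to Riesz: the relation defining \<open>star\<close> turns
  the integrand into a scalar product times the volume form.\<close>

lemma integral_wedge:
  assumes \<omega>: "\<omega> \<in> cell_forms M f (int k)" and \<mu>: "\<mu> \<in> cell_forms M f (int (cdim M f) - int k)"
  shows "cell_integral M f (wedge \<omega> \<mu>) = L2_inner M f (star M f k \<omega>) \<mu>"
proof -
  have "wedge \<omega> \<mu> = (\<lambda>x. form_inner M f x (star M f k \<omega> x) (\<mu> x) *\<^sub>R orient M f x)"
  proof
    fix x show "wedge \<omega> \<mu> x = form_inner M f x (star M f k \<omega> x) (\<mu> x) *\<^sub>R orient M f x"
    proof (cases "x \<in> f")
      case True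
      then show ?thesis
        using star_props(2)[OF \<omega> True] cell_formsD(1)[OF \<mu> True] by (simp add: star_rel_def wedge_def)
    next
      case False
      then have "orient M f x = 0"
        using cell_facts(5)[OF f] by (auto simp: oriented_cell_def cell_forms_def)
      then show ?thesis using cell_formsD(2)[OF \<mu> False] by (simp add: wedge_def)
    qed
  qed
  then show ?thesis by (simp add: L2_inner_def)
qed

end

section \<open>Charts along the closure of a cell\<close>

lemma closed_pts: "closed (pts M)"
  using compact compact_imp_closed by blast

lemma closure_cell: "f \<in> cells M \<Longrightarrow> closure f \<subseteq> pts M" "f \<in> cells M \<Longrightarrow> compact (closure f)"
proof -
  assume f: "f \<in> cells M"
  show "closure f \<subseteq> pts M"
    using closure_minimal[OF cell_subset[OF f] closed_pts] .
  then show "compact (closure f)"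
    using compact_Int_closed[OF compact closed_closure[of f]] by (simp add: Int_absorb1)
qed

lemma bdry_chart_cell_charts:
  assumes c: "bdry_chart M f f' c" and d: "cdim M f = Suc (cdim M f')"
  shows "cell_chart M f c" "cell_chart M f' c"
proof -
  have cM: "c \<in> charts M" and i: "chart_image c f = chart_range c \<inter> {y \<in> flat (cdim M f). 0 < y $ of_nat (cdim M f)}"
    "chart_image c f' = chart_range c \<inter> flat (cdim M f')"
    using c d by (auto simp: bdry_chart_def)
  have "open {y :: real^2. 0 < y $ of_nat (cdim M f)}"
    by (intro open_Collect_less continuous_intros)
  then have "open (chart_range c \<inter> {y. 0 < y $ of_nat (cdim M f)})"
    using chart_open_range[OF cM] by blast
  then have "openin (top_of_set (flat (cdim M f))) (flat (cdim M f) \<inter> (chart_range c \<inter> {y. 0 < y $ of_nat (cdim M f)}))"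
    by (rule openin_open_Int)
  moreover have "flat (cdim M f) \<inter> (chart_range c \<inter> {y. 0 < y $ of_nat (cdim M f)}) = chart_image c f"
    unfolding i by blast
  ultimately show "cell_chart M f c"
    using cM by (simp add: cell_chart_def)
  show "cell_chart M f' c"
    using cM openin_open_Int[OF chart_open_range[OF cM], of "flat (cdim M f')"] i by (simp add: cell_chart_def Int_commute)
qed

lemmas mesh_conj = mesh[unfolded mesh_def, THEN conjunct1]
  mesh[unfolded mesh_def, THEN conjunct2, THEN conjunct1]
  mesh[unfolded mesh_def, THEN conjunct2, THEN conjunct2, THEN conjunct1]
  mesh[unfolded mesh_def, THEN conjunct2, THEN conjunct2, THEN conjunct2, THEN conjunct1]
  mesh[unfolded mesh_def, THEN conjunct2, THEN conjunct2, THEN conjunct2, THEN conjunct2, THEN conjunct1]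
  mesh[unfolded mesh_def, THEN conjunct2, THEN conjunct2, THEN conjunct2, THEN conjunct2, THEN conjunct2, THEN conjunct1]
  mesh[unfolded mesh_def, THEN conjunct2, THEN conjunct2, THEN conjunct2, THEN conjunct2, THEN conjunct2, THEN conjunct2]

lemma facet_facts:
  assumes "f \<in> cells M" "f' \<in> cells M" "f' \<subseteq> bdry f" "cdim M f = Suc (cdim M f')" "x \<in> f'"
  obtains c where "bdry_chart M f f' c" "x \<in> fst c"
proof -
  have "\<forall>x\<in>f'. \<exists>c. bdry_chart M f f' c \<and> x \<in> fst c"
    using mesh_conj(7) assms(1-4) by simp
  then show thesis using assms(5) that by blast
qed

lemma cell_touching:
  assumes "f \<in> cells M" "f' \<in> cells M" "cdim M f' < cdim M f" "f' \<inter> closure f \<noteq> {}"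
  shows "f' \<subseteq> bdry f"
  using mesh_conj(5) assms by simp

lemma bdry_cover: "f \<in> cells M \<Longrightarrow> x \<in> bdry f \<Longrightarrow> \<exists>f'\<in>cells M. cdim M f' < cdim M f \<and> x \<in> f'"
  using mesh_conj(6) by blast

lemma open_2_cell:
  assumes f: "f \<in> cells M" and d: "cdim M f = 2"
  shows "openin (top_of_set (pts M)) f"
proof (subst openin_subopen, intro ballI)
  fix x assume "x \<in> f"
  then obtain c where c: "c \<in> charts M" "x \<in> fst c" "chart_image c f = chart_range c \<inter> flat 2"
    using cell_facts(4)[OF f] unfolding submanifold_def d by metis
  have "fst c \<subseteq> f"
  proof
    fix z assume z: "z \<in> fst c"
    then have "snd c z \<in> chart_image c f" unfolding c(3) flat_2 by blast
    then show "z \<in> f" using z chart_inj[OF c(1)] by auto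
  qed
  then show "\<exists>U. openin (top_of_set (pts M)) U \<and> x \<in> U \<and> U \<subseteq> f"
    using chart_openin[OF c(1)] c(2) by blast
qed

lemma cell_chart_2:
  assumes "f \<in> cells M" "cdim M f = 2" "c \<in> charts M"
  shows "cell_chart M f c"
  using chart_openin_image[OF assms(3) open_2_cell[OF assms(1,2)]] assms by (simp add: cell_chart_def flat_2)

text \<open>A 2-cell is open in the surface, so any chart serves, also around its vertices. At the
  ends of an edge the chart comes from the mesh condition on facets.\<close>

lemma closure_cell_chart:
  assumes f: "f \<in> cells M" and d: "cdim M f = 1 \<or> cdim M f = 2" and x: "x \<in> closure f"
  obtains c where "cell_chart M f c" "x \<in> fst c"
proof (cases "cdim M f = 2")
  case True
  have "x \<in> pts M" using x closure_cell(1)[OF f] by blast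
  then obtain c where "c \<in> charts M" "x \<in> fst c" using chart_exists by blast
  then show thesis using that cell_chart_2[OF f True] by blast
next
  case False
  then have d1: "cdim M f = Suc 0" using d by simp
  show thesis
  proof (cases "x \<in> f")
    case True
    then show thesis using cell_chart_exists[OF f True] that by blast
  next
    case False
    then have xb: "x \<in> bdry f" using x by (simp add: bdry_def)
    then obtain f' where f': "f' \<in> cells M" "cdim M f' < cdim M f" "x \<in> f'"
      using bdry_cover[OF f] by blast
    then have "f' \<subseteq> bdry f" using cell_touching[OF f] x by blast
    then obtain c where c: "bdry_chart M f f' c" "x \<in> fst c"
      using facet_facts[OF f f'(1) _ _ f'(3)] f'(2) d1 by auto
    then show thesis using that bdry_chart_cell_charts(1)[OF c(1)] f'(2) d1 by simp
  qed
qed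

section \<open>Regular forms\<close>

lemma at_within_chart:
  assumes "openin (top_of_set (pts M)) W" "x \<in> W" "A \<subseteq> pts M"
  shows "at x within (W \<inter> A) = at x within A"
proof -
  obtain U where U: "open U" "W = pts M \<inter> U" using assms(1) by (auto simp: openin_open)
  show ?thesis
    by (rule at_within_nhd[where S=U]) (use U assms in auto)
qed

lemma continuous_on_localI:
  assumes "A \<subseteq> pts M" and "\<And>x. x \<in> A \<Longrightarrow> \<exists>W. openin (top_of_set (pts M)) W \<and> x \<in> W \<and> continuous_on (W \<inter> A) h"
  shows "continuous_on A h"
  unfolding continuous_on_def
proof
  fix x assume x: "x \<in> A"
  obtain W where W: "openin (top_of_set (pts M)) W" "x \<in> W" "continuous_on (W \<inter> A) h"
    using assms(2)[OF x] by blast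
  then have "(h \<longlongrightarrow> h x) (at x within (W \<inter> A))"
    using x by (simp add: continuous_on_def)
  then show "(h \<longlongrightarrow> h x) (at x within A)"
    using at_within_chart[OF W(1,2) assms(1)] by simp
qed

text \<open>Continuity inside the cell and a global bound on the pointwise norm, nothing at the
  boundary. This is enough for integrability and definiteness of the L2 product, and weak enough to
  be verified for the stars of the traces of potentials on edges.\<close>

definition regular_forms :: "'p set \<Rightarrow> int \<Rightarrow> 'p form set" where
  "regular_forms f l = {p \<in> cell_forms M f l.
     (\<forall>c. cell_chart M f c \<longrightarrow> (\<forall>us. set us \<subseteq> flat (cdim M f) \<longrightarrow>
        continuous_on (fst c \<inter> f) (\<lambda>x. p x (map (tvec_of M c x) us)))) \<and>
     (\<exists>C. \<forall>x\<in>f. form_inner M f x (p x) (p x) \<le> C)}"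

lemma regular_cell_forms: "regular_forms f l \<subseteq> cell_forms M f l"
  by (auto simp: regular_forms_def)

lemma regular_continuous:
  "p \<in> regular_forms f l \<Longrightarrow> cell_chart M f c \<Longrightarrow> set us \<subseteq> flat (cdim M f) \<Longrightarrow>
    continuous_on (fst c \<inter> f) (\<lambda>x. p x (map (tvec_of M c x) us))"
  unfolding regular_forms_def by blast

lemma regular_bounded: "p \<in> regular_forms f l \<Longrightarrow> \<exists>C. \<forall>x\<in>f. form_inner M f x (p x) (p x) \<le> C"
  unfolding regular_forms_def by blast

lemma subspace_regular_forms: "subspace (regular_forms f l)"
proof -
  have 0: "0 \<in> regular_forms f l"
  proof -
    have "form_inner M f x 0 0 = 0" for x
      using form_inner_scale_left[of M f x 0 0 0] by simp
    then show ?thesis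
      using subspace_0[OF subspace_cell_forms] by (auto simp: regular_forms_def)
  qed
  have comb: "s *\<^sub>R p + q \<in> regular_forms f l" if p: "p \<in> regular_forms f l" and q: "q \<in> regular_forms f l" for s p q
  proof -
    have "s *\<^sub>R p + q \<in> cell_forms M f l"
      using subspace_comb[OF subspace_cell_forms] regular_cell_forms p q by blast
    moreover have "continuous_on (fst c \<inter> f) (\<lambda>x. (s *\<^sub>R p + q) x (map (tvec_of M c x) us))"
      if "cell_chart M f c" "set us \<subseteq> flat (cdim M f)" for c us
      using continuous_on_add[OF continuous_on_mult_left[OF regular_continuous[OF p that], of s] regular_continuous[OF q that]]
      by simp
    moreover obtain C C' where C: "\<And>x. x \<in> f \<Longrightarrow> form_inner M f x (p x) (p x) \<le> C" "\<And>x. x \<in> f \<Longrightarrow> form_inner M f x (q x) (q x) \<le> C'"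
      using regular_bounded[OF p] regular_bounded[OF q] by blast
    have "form_inner M f x ((s *\<^sub>R p + q) x) ((s *\<^sub>R p + q) x) \<le> 2 * (s\<^sup>2 * C + C')" if "x \<in> f" for x
    proof -
      have "s\<^sup>2 * form_inner M f x (p x) (p x) + form_inner M f x (q x) (q x) \<le> s\<^sup>2 * C + C'"
        by (intro add_mono mult_left_mono C that) auto
      then show ?thesis
        using form_inner_add_bound[of M f x s "p x" "q x"] by simp
    qed
    ultimately show ?thesis unfolding regular_forms_def by blast
  qed
  show ?thesis
    unfolding subspace_def using 0 comb[of _ 0] comb[of _ _ 1] by auto
qed

text \<open>\<open>F\<close> is the coordinate formula written with \<open>p\<close> and
  \<open>q\<close> on all of \<open>W\<close>, also at points of \<open>W\<close> outside
  \<open>f\<close>. Inside the cell \<open>p\<close> and \<open>q\<close> are the forms themselves;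
  near a boundary point they are local extensions, and continuity of \<open>F\<close> at that point
  bounds the scalar product on \<open>f\<close> nearby.\<close>

lemma inner_formula:
  assumes f: "f \<in> cells M" and c: "cell_chart M f c" and W: "W \<subseteq> fst c"
    and d: "cdim M f = 1 \<or> cdim M f = 2"
    and p: "\<And>us. set us \<subseteq> flat (cdim M f) \<Longrightarrow> continuous_on W (\<lambda>x. p x (map (tvec_of M c x) us))"
    and q: "\<And>us. set us \<subseteq> flat (cdim M f) \<Longrightarrow> continuous_on W (\<lambda>x. q x (map (tvec_of M c x) us))"
  obtains F where "continuous_on W F"
    and "\<And>x a b l l'. x \<in> W \<inter> f \<Longrightarrow> a \<in> alt_forms l (cell_tspace M f x) \<Longrightarrow> b \<in> alt_forms l' (cell_tspace M f x) \<Longrightarrow>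
      (\<And>us. set us \<subseteq> flat (cdim M f) \<Longrightarrow> a (map (tvec_of M c x) us) = p x (map (tvec_of M c x) us)) \<Longrightarrow>
      (\<And>us. set us \<subseteq> flat (cdim M f) \<Longrightarrow> b (map (tvec_of M c x) us) = q x (map (tvec_of M c x) us)) \<Longrightarrow>
      form_inner M f x a b = F x"
proof -
  have cM: "c \<in> charts M" using c cell_chart_in by blast
  let ?b1 = "\<lambda>x. tvec_of M c x (axis 1 1)" and ?b2 = "\<lambda>x. tvec_of M c x (axis 2 1)"
  note g = continuous_on_subset[OF gm_continuous[OF cM] W] continuous_on_subset[OF gdet_continuous[OF cM] W]
  have nz: "G11 c x \<noteq> 0" "gdet c x \<noteq> 0" if "x \<in> W" for x
    using gram_pos[OF cM, of x] that W by auto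
  show thesis
  proof (cases "cdim M f = 1")
    case True
    have u: "set [] \<subseteq> flat (cdim M f)" "set [axis 1 1] \<subseteq> flat (cdim M f)"
      using True axis_1_flat by auto
    note cont = p[OF u(1)] p[OF u(2)] q[OF u(1)] q[OF u(2)]
    let ?F = "\<lambda>x. p x [] * q x [] + p x [?b1 x] * q x [?b1 x] / G11 c x"
    show thesis
    proof (rule that[of ?F])
      show "continuous_on W ?F"
        using cont by (intro continuous_intros g) (auto simp: nz)
      fix x a b l l' assume x: "x \<in> W \<inter> f"
        and "a \<in> alt_forms l (cell_tspace M f x)" "b \<in> alt_forms l' (cell_tspace M f x)"
        and eq: "\<And>us. set us \<subseteq> flat (cdim M f) \<Longrightarrow> a (map (tvec_of M c x) us) = p x (map (tvec_of M c x) us)"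
         "\<And>us. set us \<subseteq> flat (cdim M f) \<Longrightarrow> b (map (tvec_of M c x) us) = q x (map (tvec_of M c x) us)"
      then show "form_inner M f x a b = ?F x"
        using form_inner_1[OF f c _ _ True] W eq(1)[OF u(1)] eq(1)[OF u(2)] eq(2)[OF u(1)] eq(2)[OF u(2)] by auto
    qed
  next
    case False
    then have d2: "cdim M f = 2" using d by simp
    have u: "set us \<subseteq> flat (cdim M f)" for us using d2 flat_2 by simp
    note cont = p[OF u, of "[]"] p[OF u, of "[axis 1 1]"] p[OF u, of "[axis 2 1]"] p[OF u, of "[axis 1 1, axis 2 1]"]
       q[OF u, of "[]"] q[OF u, of "[axis 1 1]"] q[OF u, of "[axis 2 1]"] q[OF u, of "[axis 1 1, axis 2 1]"]
    let ?F = "\<lambda>x. p x [] * q x [] +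
      (G22 c x * p x [?b1 x] * q x [?b1 x] - G12 c x * (p x [?b1 x] * q x [?b2 x] + p x [?b2 x] * q x [?b1 x])
        + G11 c x * p x [?b2 x] * q x [?b2 x]) / gdet c x
      + p x [?b1 x, ?b2 x] * q x [?b1 x, ?b2 x] / gdet c x"
    show thesis
    proof (rule that[of ?F])
      show "continuous_on W ?F"
        using cont by (intro continuous_intros g) (auto simp: nz)
      fix x a b l l' assume x: "x \<in> W \<inter> f"
        and ab: "a \<in> alt_forms l (cell_tspace M f x)" "b \<in> alt_forms l' (cell_tspace M f x)"
        and eq: "\<And>us. set us \<subseteq> flat (cdim M f) \<Longrightarrow> a (map (tvec_of M c x) us) = p x (map (tvec_of M c x) us)"
         "\<And>us. set us \<subseteq> flat (cdim M f) \<Longrightarrow> b (map (tvec_of M c x) us) = q x (map (tvec_of M c x) us)"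
      note e = eq(1)[OF u, of "[]"] eq(1)[OF u, of "[axis 1 1]"] eq(1)[OF u, of "[axis 2 1]"] eq(1)[OF u, of "[axis 1 1, axis 2 1]"]
         eq(2)[OF u, of "[]"] eq(2)[OF u, of "[axis 1 1]"] eq(2)[OF u, of "[axis 2 1]"] eq(2)[OF u, of "[axis 1 1, axis 2 1]"]
      have xx: "x \<in> f" "x \<in> fst c" using x W by auto
      show "form_inner M f x a b = ?F x"
        unfolding form_inner_2[OF f c xx d2 ab] using e by simp
    qed
  qed
qed

lemma regular_inner:
  assumes f: "f \<in> cells M" and d: "cdim M f = 1 \<or> cdim M f = 2"
    and p: "p \<in> regular_forms f l" and q: "q \<in> regular_forms f l'"
  shows "continuous_on f (\<lambda>x. form_inner M f x (p x) (q x))"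
    and "\<exists>C. \<forall>x\<in>f. \<bar>form_inner M f x (p x) (q x)\<bar> \<le> C"
proof -
  show "continuous_on f (\<lambda>x. form_inner M f x (p x) (q x))"
  proof (rule continuous_on_localI[OF cell_subset[OF f]])
    fix x assume x: "x \<in> f"
    obtain c where c: "cell_chart M f c" "x \<in> fst c" using cell_chart_exists[OF f x] .
    obtain F where F: "continuous_on (fst c \<inter> f) F"
      and eq: "\<And>x a b l l'. x \<in> (fst c \<inter> f) \<inter> f \<Longrightarrow> a \<in> alt_forms l (cell_tspace M f x) \<Longrightarrow> b \<in> alt_forms l' (cell_tspace M f x) \<Longrightarrow>
      (\<And>us. set us \<subseteq> flat (cdim M f) \<Longrightarrow> a (map (tvec_of M c x) us) = p x (map (tvec_of M c x) us)) \<Longrightarrow>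
      (\<And>us. set us \<subseteq> flat (cdim M f) \<Longrightarrow> b (map (tvec_of M c x) us) = q x (map (tvec_of M c x) us)) \<Longrightarrow>
      form_inner M f x a b = F x"
      by (rule inner_formula[OF f c(1) _ d, of "fst c \<inter> f" p q])
        (use regular_continuous[OF p c(1)] regular_continuous[OF q c(1)] in auto)
    have "continuous_on (fst c \<inter> f) (\<lambda>x. form_inner M f x (p x) (q x))"
    proof (rule continuous_on_eq[OF F])
      show "F z = form_inner M f z (p z) (q z)" if "z \<in> fst c \<inter> f" for z
      proof -
        have "p z \<in> alt_forms l (cell_tspace M f z)" "q z \<in> alt_forms l' (cell_tspace M f z)"
          using that cell_formsD(1) p q regular_cell_forms by blast+
        then show ?thesis
          using eq[of z "p z" l "q z" l'] that by simp
      qed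
    qed
    then show "\<exists>W. openin (top_of_set (pts M)) W \<and> x \<in> W \<and> continuous_on (W \<inter> f) (\<lambda>x. form_inner M f x (p x) (q x))"
      using c chart_openin cell_chart_in by blast
  qed
  obtain C C' where C: "\<And>x. x \<in> f \<Longrightarrow> form_inner M f x (p x) (p x) \<le> C" "\<And>x. x \<in> f \<Longrightarrow> form_inner M f x (q x) (q x) \<le> C'"
    using regular_bounded[OF p] regular_bounded[OF q] by blast
  have "\<bar>form_inner M f x (p x) (q x)\<bar> \<le> (C + C') / 2" if "x \<in> f" for x
    using form_inner_le[of M f x "p x" "q x"] C[OF that] by simp
  then show "\<exists>C. \<forall>x\<in>f. \<bar>form_inner M f x (p x) (q x)\<bar> \<le> C" by blast
qed

text \<open>The local condition inside \<open>Ck_cell_forms\<close> and \<open>trace\<close>, with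
  the extension and its domain as explicit arguments, so that one extension can be handed from a
  cell to its facets.\<close>

definition extends :: "nat \<Rightarrow> int \<Rightarrow> 'p set \<Rightarrow> 'p form \<Rightarrow> 'p \<Rightarrow> 'p set \<Rightarrow> 'p form \<Rightarrow> bool" where
  "extends m l f \<omega> x W \<eta> \<longleftrightarrow> openin (top_of_set (pts M)) W \<and> x \<in> W \<and> \<eta> \<in> Ck_forms M m W l \<and>
     (\<forall>z\<in>f \<inter> W. \<omega> z = pullback M f \<eta> z)"

lemma Ck_cell_forms_iff:
  "\<omega> \<in> Ck_cell_forms M m f l \<longleftrightarrow> \<omega> \<in> cell_forms M f l \<and> (\<forall>x\<in>closure f. \<exists>W \<eta>. extends m l f \<omega> x W \<eta>)"
  by (auto simp: Ck_cell_forms_def extends_def)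

lemma Ck_forms_continuous:
  assumes "\<eta> \<in> Ck_forms M 0 W l" "c \<in> charts M"
  shows "continuous_on (fst c \<inter> W) (\<lambda>x. \<eta> x (map (tvec_of M c x) us))"
proof -
  have "continuous_on (chart_image c W) (\<lambda>y. \<eta> (chart_inv c y) (map (tvec_of M c (chart_inv c y)) us))"
    using assms by (simp add: Ck_forms_def Let_def)
  then show ?thesis
    using chart_cont_iff[OF assms(2), of W "\<lambda>x. \<eta> x (map (tvec_of M c x) us)"] by simp
qed

lemma Ck_forms_1_0: "\<eta> \<in> Ck_forms M 1 W l \<Longrightarrow> \<eta> \<in> Ck_forms M 0 W l"
proof -
  have "Ck_on 1 F S \<Longrightarrow> Ck_on 0 F S" for F :: "real^2 \<Rightarrow> real" and S
    using differentiable_imp_continuous_on[of F S] by simp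
  then show "\<eta> \<in> Ck_forms M 1 W l \<Longrightarrow> \<eta> \<in> Ck_forms M 0 W l"
    unfolding Ck_forms_def by blast
qed

lemma extends_1_0: "extends 1 l f \<omega> x W \<eta> \<Longrightarrow> extends 0 l f \<omega> x W \<eta>"
  using Ck_forms_1_0 by (auto simp: extends_def)

lemma Ck_cell_forms_1_0: "Ck_cell_forms M 1 f l \<subseteq> Ck_cell_forms M 0 f l"
  using extends_1_0 unfolding Ck_cell_forms_iff[abs_def] by (auto simp: Ck_cell_forms_iff) blast

lemma pullback_tvec:
  assumes "cell_chart M f c" "z \<in> f" "z \<in> fst c" "set us \<subseteq> flat (cdim M f)"
  shows "pullback M f \<eta> z (map (tvec_of M c z) us) = \<eta> z (map (tvec_of M c z) us)"
proof -
  have "set (map (tvec_of M c z) us) \<subseteq> cell_tspace M f z"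
    unfolding cell_tspace_eq[OF assms(1-3)] using assms(4) by auto
  then show ?thesis using assms(2) by (simp add: pullback_def restr_alt_def)
qed

text \<open>Near each point of the closure the squared norm agrees on \<open>f\<close> with a
  continuous function of the extension, hence is bounded there. The closure is compact, so finitely
  many such neighbourhoods give a global bound.\<close>

lemma Ck_cell_forms_regular:
  assumes f: "f \<in> cells M" and d: "cdim M f = 1 \<or> cdim M f = 2"
  shows "Ck_cell_forms M 0 f l \<subseteq> regular_forms f l"
proof
  fix p assume p: "p \<in> Ck_cell_forms M 0 f l"
  then have pc: "p \<in> cell_forms M f l" by (simp add: Ck_cell_forms_iff)
  have cont: "continuous_on (fst c \<inter> f) (\<lambda>x. p x (map (tvec_of M c x) us))"
    if c: "cell_chart M f c" "set us \<subseteq> flat (cdim M f)" for c us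
  proof (rule continuous_on_localI)
    show "fst c \<inter> f \<subseteq> pts M" using cell_subset[OF f] by blast
    fix x assume x: "x \<in> fst c \<inter> f"
    then have "x \<in> closure f" using closure_subset by blast
    then obtain W \<eta> where E: "extends 0 l f p x W \<eta>"
      using p unfolding Ck_cell_forms_iff by blast
    have "continuous_on (fst c \<inter> W) (\<lambda>x. \<eta> x (map (tvec_of M c x) us))"
      using Ck_forms_continuous[OF _ cell_chart_in[OF c(1)], of \<eta> W l us] E unfolding extends_def by blast
    then have "continuous_on (W \<inter> (fst c \<inter> f)) (\<lambda>x. \<eta> x (map (tvec_of M c x) us))"
      by (rule continuous_on_subset) blast
    then have "continuous_on (W \<inter> (fst c \<inter> f)) (\<lambda>x. p x (map (tvec_of M c x) us))"
    proof (rule continuous_on_eq)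
      show "\<eta> z (map (tvec_of M c z) us) = p z (map (tvec_of M c z) us)" if "z \<in> W \<inter> (fst c \<inter> f)" for z
        using that E pullback_tvec[OF c(1) _ _ c(2), of z \<eta>] by (auto simp: extends_def)
    qed
    then show "\<exists>W. openin (top_of_set (pts M)) W \<and> x \<in> W \<and>
        continuous_on (W \<inter> (fst c \<inter> f)) (\<lambda>x. p x (map (tvec_of M c x) us))"
      using E by (auto simp: extends_def)
  qed
  have "\<exists>U C. open U \<and> x \<in> U \<and> (\<forall>z\<in>f \<inter> U. form_inner M f z (p z) (p z) \<le> C)" if x: "x \<in> closure f" for x
  proof -
    obtain W \<eta> where E: "extends 0 l f p x W \<eta>" using p x unfolding Ck_cell_forms_iff by blast
    obtain c where c: "cell_chart M f c" "x \<in> fst c" using closure_cell_chart[OF f d x] .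
    have cM: "c \<in> charts M" using c cell_chart_in by blast
    have oW: "openin (top_of_set (pts M)) (fst c \<inter> W)" "x \<in> fst c \<inter> W"
      using E chart_openin[OF cM] c by (auto simp: extends_def)
    have \<eta>c: "continuous_on (fst c \<inter> W) (\<lambda>x. \<eta> x (map (tvec_of M c x) us))" for us
      using Ck_forms_continuous[OF _ cM, of \<eta> W l us] E unfolding extends_def by blast
    obtain F where F: "continuous_on (fst c \<inter> W) F"
      and eq: "\<And>x a b l l'. x \<in> (fst c \<inter> W) \<inter> f \<Longrightarrow> a \<in> alt_forms l (cell_tspace M f x) \<Longrightarrow> b \<in> alt_forms l' (cell_tspace M f x) \<Longrightarrow>
      (\<And>us. set us \<subseteq> flat (cdim M f) \<Longrightarrow> a (map (tvec_of M c x) us) = \<eta> x (map (tvec_of M c x) us)) \<Longrightarrow>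
      (\<And>us. set us \<subseteq> flat (cdim M f) \<Longrightarrow> b (map (tvec_of M c x) us) = \<eta> x (map (tvec_of M c x) us)) \<Longrightarrow>
      form_inner M f x a b = F x"
      by (rule inner_formula[OF f c(1) _ d, of "fst c \<inter> W" \<eta> \<eta>]) (use \<eta>c in auto)
    have "form_inner M f z (p z) (p z) = F z" if "z \<in> (fst c \<inter> W) \<inter> f" for z
    proof (rule eq[OF that])
      show "p z \<in> alt_forms l (cell_tspace M f z)" "p z \<in> alt_forms l (cell_tspace M f z)"
        using cell_formsD(1)[OF pc] that by auto
      show "p z (map (tvec_of M c z) us) = \<eta> z (map (tvec_of M c z) us)"
        "p z (map (tvec_of M c z) us) = \<eta> z (map (tvec_of M c z) us)"
        if "set us \<subseteq> flat (cdim M f)" for us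
        using E \<open>z \<in> _\<close> pullback_tvec[OF c(1) _ _ that, of z \<eta>] by (auto simp: extends_def)
    qed
    \<comment> \<open>The neighbourhood on which the norm exceeds its limiting value at
      \<open>x\<close> by less than one.\<close>
    moreover have "openin (top_of_set (fst c \<inter> W)) ((fst c \<inter> W) \<inter> F -` {..<F x + 1})"
      by (rule continuous_openin_preimage_gen[OF F]) simp
    then have "openin (top_of_set (pts M)) ((fst c \<inter> W) \<inter> F -` {..<F x + 1})"
      using oW(1) by (rule openin_trans)
    then obtain U where U: "open U" "(fst c \<inter> W) \<inter> F -` {..<F x + 1} = pts M \<inter> U"
      by (auto simp: openin_open)
    moreover have "x \<in> (fst c \<inter> W) \<inter> F -` {..<F x + 1}" using oW(2) by simp
    moreover have "z \<in> (fst c \<inter> W) \<inter> F -` {..<F x + 1}" if "z \<in> f \<inter> U" for z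
      unfolding U(2) using that cell_subset[OF f] by blast
    ultimately have "open U \<and> x \<in> U \<and> (\<forall>z\<in>f \<inter> U. form_inner M f z (p z) (p z) \<le> F x + 1)"
      by fastforce
    then show ?thesis by blast
  qed
  then obtain U C where U: "\<And>x. x \<in> closure f \<Longrightarrow> open (U x) \<and> x \<in> U x \<and> (\<forall>z\<in>f \<inter> U x. form_inner M f z (p z) (p z) \<le> C x)"
    by metis
  have "closure f \<subseteq> (\<Union>x\<in>closure f. U x)" "\<And>x. x \<in> closure f \<Longrightarrow> open (U x)" using U by blast+
  then obtain X where X: "X \<subseteq> closure f" "finite X" "closure f \<subseteq> (\<Union>x\<in>X. U x)"
    using compactE_image[OF closure_cell(2)[OF f]] by metis
  have "form_inner M f z (p z) (p z) \<le> (\<Sum>x\<in>X. \<bar>C x\<bar>)" if z: "z \<in> f" for z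
  proof -
    obtain x where x: "x \<in> X" "z \<in> U x" using X(3) closure_subset z by blast
    then have "form_inner M f z (p z) (p z) \<le> C x" using U X(1) z by blast
    also have "C x \<le> \<bar>C x\<bar>" by simp
    also have "\<dots> \<le> (\<Sum>x\<in>X. \<bar>C x\<bar>)" using x X(2) by (intro member_le_sum) auto
    finally show ?thesis .
  qed
  then show "p \<in> regular_forms f l"
    using pc cont unfolding regular_forms_def by blast
qed

end

section \<open>Integration on cells\<close>

context riem_mesh
begin

lemma compact_chart_neighbourhood:
  assumes c: "c \<in> charts M" and x: "x \<in> fst c"
  obtains U K where "open U" "x \<in> U" "compact K" "U \<inter> pts M \<subseteq> K" "K \<subseteq> fst c"
proof -
  obtain e where e: "e > 0" "cball (snd c x) e \<subseteq> chart_range c"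
    using chart_open_range[OF c] x open_contains_cball by (metis imageI)
  let ?K = "chart_inv c ` cball (snd c x) e"
  have "compact ?K"
    by (rule compact_continuous_image[OF continuous_on_subset[OF chart_inv_cont[OF c] e(2)] compact_cball])
  moreover have "?K \<subseteq> fst c" using chart_inv_in[OF c] e(2) by blast
  moreover obtain U where U: "open U" "{z \<in> fst c. snd c z \<in> ball (snd c x) e} = pts M \<inter> U"
    using chart_openin_preimage[OF c open_ball, of "snd c x" e] unfolding openin_open by blast
  moreover have "U \<inter> pts M \<subseteq> ?K"
  proof
    fix z assume "z \<in> U \<inter> pts M"
    then have "z \<in> fst c" "snd c z \<in> ball (snd c x) e" using U(2) by blast+
    then show "z \<in> ?K" using chart_inv_left[OF c, of z] ball_subset_cball by (metis image_eqI subsetD)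
  qed
  moreover have "x \<in> {z \<in> fst c. snd c z \<in> ball (snd c x) e}" using x e(1) by simp
  then have "x \<in> U" unfolding U(2) by blast
  ultimately show thesis using that by blast
qed

lemma borel_chart_image_cell: "cell_chart M f c \<Longrightarrow> chart_image c f \<in> sets borel"
proof -
  assume "cell_chart M f c"
  then obtain U where "open U" "chart_image c f = flat (cdim M f) \<inter> U"
    by (auto simp: cell_chart_def openin_open)
  then show ?thesis using closed_flat by (simp add: sets.Int)
qed

lemma borel_chart_image_compact:
  assumes c: "c \<in> charts M" and K: "compact K"
  shows "chart_image c K \<in> sets borel"
proof -
  have "closedin (top_of_set (chart_range c)) (chart_range c \<inter> chart_inv c -` K)"
    by (rule continuous_closedin_preimage[OF chart_inv_cont[OF c] compact_imp_closed[OF K]])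
  moreover have "chart_range c \<inter> chart_inv c -` K = chart_image c K"
    using chart_image_iff[OF c, of _ K] by blast
  ultimately obtain T where "closed T" "chart_image c K = chart_range c \<inter> T"
    by (auto simp: closedin_closed)
  then show ?thesis using chart_open_range[OF c] by (simp add: sets.Int)
qed

text \<open>Compactness is applied to the closure of \<open>f\<close>, so the pieces stay relatively
  compact in chart domains also towards the boundary. The charts at boundary points come from
  \<open>closure_cell_chart\<close>.\<close>

lemma cell_decomposition_exists:
  assumes f: "f \<in> cells M" and d: "cdim M f = 1 \<or> cdim M f = 2"
  shows "\<exists>D. cell_decomposition M f D"
proof -
  have "\<exists>U K c. open U \<and> x \<in> U \<and> compact K \<and> U \<inter> pts M \<subseteq> K \<and> K \<subseteq> fst c \<and> cell_chart M f c"
    if x: "x \<in> closure f" for x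
  proof -
    obtain c where c: "cell_chart M f c" "x \<in> fst c" using closure_cell_chart[OF f d x] .
    show ?thesis using compact_chart_neighbourhood[OF cell_chart_in[OF c(1)] c(2)] c(1) by metis
  qed
  then obtain U K c where U: "\<And>x. x \<in> closure f \<Longrightarrow> open (U x) \<and> x \<in> U x \<and> compact (K x) \<and>
      U x \<inter> pts M \<subseteq> K x \<and> K x \<subseteq> fst (c x) \<and> cell_chart M f (c x)"
    by metis
  have "closure f \<subseteq> (\<Union>x\<in>closure f. U x)" "\<And>x. x \<in> closure f \<Longrightarrow> open (U x)" using U by blast+
  then obtain X where X: "X \<subseteq> closure f" "finite X" "closure f \<subseteq> (\<Union>x\<in>X. U x)"
    using compactE_image[OF closure_cell(2)[OF f]] by metis
  obtain xs where xs: "set xs = X" using finite_list[OF X(2)] by blast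
  have cov: "f \<subseteq> (\<Union>x\<in>X. K x)"
  proof
    fix z assume z: "z \<in> f"
    then obtain x where "x \<in> X" "z \<in> U x" using X(3) closure_subset by blast
    then show "z \<in> (\<Union>x\<in>X. K x)" using U X(1) cell_subset[OF f] z by blast
  qed
  \<comment> \<open>Each compact set is cut down by those before it, which makes the pieces disjoint
    and keeps them Borel in coordinates.\<close>
  define A where "A i = f \<inter> K (xs ! i) - (\<Union>j<i. K (xs ! j))" for i
  define D where "D = (\<lambda>i. (A i, c (xs ! i))) ` {..<length xs}"
  have in_cl: "xs ! i \<in> closure f" if "i < length xs" for i
    using that xs X(1) nth_mem by blast
  have disj: "A i \<inter> A j = {}" if "i < j" for i j
    using that by (auto simp: A_def)
  have "finite D" by (simp add: D_def)
  moreover have "(\<Union>(A, c)\<in>D. A) = f"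
    proof (intro equalityI subsetI)
      fix z assume z: "z \<in> f"
      then obtain x where "x \<in> X" "z \<in> K x" using cov by blast
      then have "\<exists>i<length xs. z \<in> K (xs ! i)" using xs by (metis in_set_conv_nth)
      then obtain i where i: "i < length xs \<and> z \<in> K (xs ! i)" "\<And>j. j < i \<Longrightarrow> \<not> (j < length xs \<and> z \<in> K (xs ! j))"
        using exists_least_iff[of "\<lambda>i. i < length xs \<and> z \<in> K (xs ! i)"] by blast
      then have "z \<in> A i" using z by (auto simp: A_def)
      then show "z \<in> (\<Union>(A, c)\<in>D. A)" using i by (auto simp: D_def)
    qed (auto simp: D_def A_def)
  moreover have "fst p \<inter> fst q = {}" if pq: "p \<in> D" "q \<in> D" "p \<noteq> q" for p q
    proof -
      obtain i j where ij: "p = (A i, c (xs ! i))" "q = (A j, c (xs ! j))" using pq by (auto simp: D_def)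
      then have "i \<noteq> j" using pq by auto
      then consider "i < j" | "j < i" by linarith
      then show ?thesis using disj ij by cases auto
    qed
  moreover have "case p of (A, c) \<Rightarrow> cell_chart M f c \<and> (\<exists>K. compact K \<and> A \<subseteq> K \<and> K \<subseteq> fst c) \<and> snd c ` A \<in> sets borel"
    if "p \<in> D" for p
  proof -
    obtain i where i: "i < length xs" "p = (A i, c (xs ! i))" using \<open>p \<in> D\<close> by (auto simp: D_def)
    note Ui = U[OF in_cl[OF i(1)]]
    have cM: "c (xs ! i) \<in> charts M" using Ui cell_chart_in by blast
    have eq: "snd (c (xs ! i)) ` A i = chart_image (c (xs ! i)) f \<inter> chart_image (c (xs ! i)) (K (xs ! i))
        - (\<Union>j<i. chart_image (c (xs ! i)) (K (xs ! j)))" (is "?L = ?R")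
    proof (intro equalityI subsetI)
      fix y assume "y \<in> ?L"
      then obtain z where z: "z \<in> A i" "y = snd (c (xs ! i)) z" by blast
      then have "z \<in> fst (c (xs ! i))" using Ui by (auto simp: A_def)
      then show "y \<in> ?R" using z chart_image_iff[OF cM] by (auto simp: A_def chart_inv_left[OF cM])
    next
      fix y assume "y \<in> ?R"
      then have "y \<in> chart_range (c (xs ! i))" "chart_inv (c (xs ! i)) y \<in> A i"
        using chart_image_iff[OF cM] by (auto simp: A_def)
      then show "y \<in> ?L" using chart_inv_right[OF cM] by (metis imageI)
    qed
    have Kb: "chart_image (c (xs ! i)) (K (xs ! j)) \<in> sets borel" if "j < length xs" for j
      using borel_chart_image_compact[OF cM] U[OF in_cl[OF that]] by blast
    have "(\<Union>j<i. chart_image (c (xs ! i)) (K (xs ! j))) \<in> sets borel"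
      by (rule sets.finite_UN) (use Kb i in auto)
    then have "?R \<in> sets borel"
      using borel_chart_image_cell Ui Kb[OF i(1)] by (intro sets.Diff sets.Int) blast+
    then have "snd (c (xs ! i)) ` A i \<in> sets borel" unfolding eq by blast
    moreover have "A i \<subseteq> K (xs ! i)" by (auto simp: A_def)
    ultimately show ?thesis
      using Ui i(2) by auto
  qed
  ultimately have "cell_decomposition M f D"
    unfolding cell_decomposition_def by blast
  then show ?thesis by blast
qed

lemma cell_decompositionD:
  assumes "cell_decomposition M f D"
  shows "finite D" "z \<in> f \<Longrightarrow> \<exists>A c. (A, c) \<in> D \<and> z \<in> A"
    and "(A, c) \<in> D \<Longrightarrow> A \<subseteq> f" "(A, c) \<in> D \<Longrightarrow> cell_chart M f c"
      "(A, c) \<in> D \<Longrightarrow> \<exists>K. compact K \<and> A \<subseteq> K \<and> K \<subseteq> fst c" "(A, c) \<in> D \<Longrightarrow> snd c ` A \<in> sets borel"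
proof -
  note D = assms[unfolded cell_decomposition_def]
  show "finite D" by (rule D[THEN conjunct1])
  have U: "(\<Union>(A, c)\<in>D. A) = f" by (rule D[THEN conjunct2, THEN conjunct1])
  then show "z \<in> f \<Longrightarrow> \<exists>A c. (A, c) \<in> D \<and> z \<in> A" by blast
  show "(A, c) \<in> D \<Longrightarrow> A \<subseteq> f" using U by blast
  assume "(A, c) \<in> D"
  from D[THEN conjunct2, THEN conjunct2, THEN conjunct2, THEN bspec, OF this, unfolded prod.case]
  show "cell_chart M f c" "\<exists>K. compact K \<and> A \<subseteq> K \<and> K \<subseteq> fst c" "snd c ` A \<in> sets borel" by blast+
qed

text \<open>The Riemannian volume density in coordinates. The absolute value appears because
  \<open>cell_integral\<close> multiplies the component of the volume form by its own sign.\<close>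

definition density :: "'p set \<Rightarrow> 'p chart \<Rightarrow> 'p \<Rightarrow> real" where
  "density f c x = \<bar>orient M f x (map (tvec_of M c x) (ebasis (cdim M f)))\<bar>"

definition cellint :: "'p set \<Rightarrow> ('p \<Rightarrow> real) \<Rightarrow> real" where
  "cellint f h = cell_integral M f (\<lambda>x. h x *\<^sub>R orient M f x)"

lemma cellint_eq:
  "cellint f h = (\<Sum>(A, c)\<in>(SOME D. cell_decomposition M f D).
     flat_integral (cdim M f) (snd c ` A) (\<lambda>y. h (chart_inv c y) * density f c (chart_inv c y)))"
  unfolding cellint_def cell_integral_def density_def Let_def
  by (simp add: abs_sgn mult.assoc)

lemma density_sq:
  assumes "f \<in> cells M" "cell_chart M f c" "x \<in> f" "x \<in> fst c"
  shows "cdim M f = 1 \<Longrightarrow> (density f c x)\<^sup>2 = G11 c x" "cdim M f = 2 \<Longrightarrow> (density f c x)\<^sup>2 = gdet c x"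
  using orient_basis_sq[OF assms] by (simp_all add: density_def ebasis_simps)

lemma density_pos:
  assumes "f \<in> cells M" "cell_chart M f c" "x \<in> f" "x \<in> fst c" "cdim M f = 1 \<or> cdim M f = 2"
  shows "density f c x > 0"
proof -
  have "(density f c x)\<^sup>2 > 0"
    using density_sq[OF assms(1-4)] gram_pos[OF cell_chart_in[OF assms(2)] assms(4)] assms(5) by auto
  then have "density f c x \<noteq> 0" by auto
  then show ?thesis by (auto simp: density_def)
qed

lemma density_continuous:
  assumes "f \<in> cells M" "cell_chart M f c"
  shows "continuous_on (chart_image c f) (\<lambda>y. density f c (chart_inv c y))"
proof -
  have "continuous_on (chart_image c f) (\<lambda>y. let x = chart_inv c y in
      orient M f x (map (tvec_of M c x) (ebasis (cdim M f))))"
    using cell_facts(5)[OF assms(1)] assms(2) unfolding oriented_cell_def by blast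
  then show ?thesis
    unfolding density_def Let_def by (rule continuous_on_rabs)
qed

text \<open>The volume form is continuous only on \<open>f\<close>, which need not be closed in
  \<open>K\<close>. The square of the density, however, is a metric coefficient or the Gram
  determinant, continuous on the whole compact set.\<close>

lemma density_bounded:
  assumes f: "f \<in> cells M" and c: "cell_chart M f c" and K: "compact K" "K \<subseteq> fst c"
    and d: "cdim M f = 1 \<or> cdim M f = 2"
  shows "\<exists>C. \<forall>x\<in>K \<inter> f. density f c x \<le> C"
proof -
  have cM: "c \<in> charts M" using c cell_chart_in by blast
  define g where "g = (if cdim M f = 1 then G11 c else gdet c)"
  have "continuous_on K g"
    unfolding g_def using continuous_on_subset[OF gm_continuous[OF cM] K(2)]
      continuous_on_subset[OF gdet_continuous[OF cM] K(2)] by auto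
  then have "bounded (g ` K)" using compact_continuous_image compact_imp_bounded K(1) by blast
  then obtain C where C: "\<And>x. x \<in> K \<Longrightarrow> \<bar>g x\<bar> \<le> C" by (auto simp: bounded_iff)
  have "density f c x \<le> sqrt C" if "x \<in> K \<inter> f" for x
  proof (rule real_le_rsqrt)
    have "(density f c x)\<^sup>2 = g x"
      using density_sq[OF f c, of x] that K(2) d unfolding g_def by auto
    then show "(density f c x)\<^sup>2 \<le> C" using C[of x] that by auto
  qed
  then show ?thesis by blast
qed

definition bounded_continuous :: "'p set \<Rightarrow> ('p \<Rightarrow> real) \<Rightarrow> bool" where
  "bounded_continuous f h \<longleftrightarrow> continuous_on f h \<and> (\<exists>C. \<forall>x\<in>f. \<bar>h x\<bar> \<le> C)"

end

text \<open>Both \<open>flat_integral 1\<close> and \<open>flat_integral 2\<close> are Lebesgue integrals over a Euclidean space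
  \<open>'a\<close> that parametrizes \<open>flat d\<close> linearly by \<open>j\<close>.\<close>

locale flat_param = riem_mesh M for M :: "('p::t2_space, 'z) ddr_surface_scheme" +
  fixes f :: "'p set" and j :: "'a::euclidean_space \<Rightarrow> real^2" and \<pi> :: "real^2 \<Rightarrow> 'a"
  assumes f: "f \<in> cells M" and d: "cdim M f = 1 \<or> cdim M f = 2"
    and j: "bounded_linear j" and \<pi>: "bounded_linear \<pi>" and \<pi>j: "\<And>s. \<pi> (j s) = s"
    and range_j: "range j = flat (cdim M f)"
    and flat_int: "\<And>A h. flat_integral (cdim M f) A h = (LINT s:{s. j s \<in> A}|lborel. h (j s))"
begin

lemma j\<pi>: "y \<in> flat (cdim M f) \<Longrightarrow> j (\<pi> y) = y"
  using range_j \<pi>j by (metis imageE)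

lemma cell_chart_flat: "cell_chart M f c \<Longrightarrow> chart_image c f \<subseteq> flat (cdim M f)"
  unfolding cell_chart_def using openin_imp_subset by blast

lemma open_param:
  assumes "cell_chart M f c"
  shows "open {s. j s \<in> chart_image c f}"
proof -
  obtain U where U: "open U" "chart_image c f = flat (cdim M f) \<inter> U"
    using assms by (auto simp: cell_chart_def openin_open)
  have "{s. j s \<in> chart_image c f} = j -` U" using range_j U(2) by auto
  then show ?thesis
    using continuous_open_vimage[of U j] U(1) linear_continuous_at[OF j] by simp
qed

lemma param_continuous:
  assumes "cell_chart M f c" "continuous_on f h"
  shows "continuous_on {s. j s \<in> chart_image c f} (\<lambda>s. h (chart_inv c (j s)))"
proof -
  have cM: "c \<in> charts M" using assms(1) cell_chart_in by blast
  have 1: "continuous_on (chart_image c f) (\<lambda>y. h (chart_inv c y))"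
    using chart_cont_iff[OF cM, of f h] continuous_on_subset[OF assms(2)] by auto
  show ?thesis
    by (rule continuous_on_compose2[OF 1 linear_continuous_on[OF j]]) auto
qed

lemma piece_facts:
  assumes D: "cell_decomposition M f D" and p: "(A, c) \<in> D"
  shows "cell_chart M f c" "A \<subseteq> f" "A \<subseteq> fst c" "{s. j s \<in> snd c ` A} \<in> sets borel"
    "bounded {s. j s \<in> snd c ` A}" "\<exists>C. \<forall>x\<in>A. density f c x \<le> C"
    "{s. j s \<in> snd c ` A} \<subseteq> {s. j s \<in> chart_image c f}"
    "\<And>s. j s \<in> snd c ` A \<Longrightarrow> chart_inv c (j s) \<in> A"
proof -
  obtain K where K: "compact K" "A \<subseteq> K" "K \<subseteq> fst c" and c: "cell_chart M f c" and B: "snd c ` A \<in> sets borel"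
    using cell_decompositionD[OF D] p by metis
  show "cell_chart M f c" by (rule c)
  have cM: "c \<in> charts M" using c cell_chart_in by blast
  show Af: "A \<subseteq> f" using cell_decompositionD(3)[OF D p] .
  show Ac: "A \<subseteq> fst c" using K by blast
  have "j \<in> borel_measurable borel"
    using linear_continuous_on[OF j] borel_measurable_continuous_onI by blast
  then have "j -` (snd c ` A) \<inter> space borel \<in> sets borel" using B by (rule measurable_sets)
  then show "{s. j s \<in> snd c ` A} \<in> sets borel" by (simp add: vimage_def)
  have "compact (snd c ` K)"
    using compact_continuous_image continuous_on_subset[OF chart_cont[OF cM] K(3)] K(1) by blast
  then have "bounded (\<pi> ` snd c ` K)"
    using bounded_linear_image[OF _ \<pi>] compact_imp_bounded by blast
  moreover have "{s. j s \<in> snd c ` A} \<subseteq> \<pi> ` snd c ` K"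
  proof
    fix s assume "s \<in> {s. j s \<in> snd c ` A}"
    then have "\<pi> (j s) \<in> \<pi> ` snd c ` K" using K(2) by blast
    then show "s \<in> \<pi> ` snd c ` K" by (simp add: \<pi>j)
  qed
  ultimately show "bounded {s. j s \<in> snd c ` A}" using bounded_subset by blast
  show "\<exists>C. \<forall>x\<in>A. density f c x \<le> C"
    using density_bounded[OF f c K(1,3) d] K(2) Af by blast
  show "{s. j s \<in> snd c ` A} \<subseteq> {s. j s \<in> chart_image c f}" using Af Ac by blast
  show "chart_inv c (j s) \<in> A" if "j s \<in> snd c ` A" for s
    using that chart_inv_left[OF cM] Ac by auto
qed

lemma piece_integrable:
  assumes D: "cell_decomposition M f D" and p: "(A, c) \<in> D" and h: "bounded_continuous f h"
  shows "set_integrable lborel {s. j s \<in> snd c ` A} (\<lambda>s. h (chart_inv c (j s)) * density f c (chart_inv c (j s)))"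
proof -
  let ?S = "{s. j s \<in> snd c ` A}" and ?g = "\<lambda>s. h (chart_inv c (j s)) * density f c (chart_inv c (j s))"
  note pf = piece_facts[OF D p]
  obtain C where C: "\<And>x. x \<in> f \<Longrightarrow> \<bar>h x\<bar> \<le> C" and hc: "continuous_on f h" using h by (auto simp: bounded_continuous_def)
  obtain C' where C': "\<And>x. x \<in> A \<Longrightarrow> density f c x \<le> C'" using pf(6) by blast
  have "continuous_on {s. j s \<in> chart_image c f} (\<lambda>s. density f c (chart_inv c (j s)))"
    by (rule continuous_on_compose2[OF density_continuous[OF f pf(1)] linear_continuous_on[OF j]]) auto
  then have "continuous_on {s. j s \<in> chart_image c f} ?g"
    using param_continuous[OF pf(1) hc] by (intro continuous_intros)
  then have cont: "continuous_on ?S ?g" using continuous_on_subset pf(7) by blast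
  have "integrable lborel (\<lambda>s. indicator ?S s *\<^sub>R ?g s)"
  proof (rule integrableI_bounded_set[where A="?S" and B="C * C'"])
    show "?S \<in> sets lborel" using pf(4) by simp
    show "(\<lambda>s. indicator ?S s *\<^sub>R ?g s) \<in> borel_measurable lborel"
      using borel_measurable_continuous_on_indicator[OF pf(4) cont] by simp
    show "emeasure lborel ?S < \<infinity>" using emeasure_bounded_finite[OF pf(5)] .
    show "AE s in lborel. s \<in> ?S \<longrightarrow> norm (indicator ?S s *\<^sub>R ?g s) \<le> C * C'"
    proof (rule AE_I2, rule impI)
      fix s assume "s \<in> ?S"
      then have x: "chart_inv c (j s) \<in> A" using pf(8) by blast
      then have "\<bar>h (chart_inv c (j s))\<bar> \<le> C" "density f c (chart_inv c (j s)) \<le> C'"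
        "density f c (chart_inv c (j s)) \<ge> 0" using C C' pf(2) by (auto simp: density_def)
      then have "\<bar>h (chart_inv c (j s))\<bar> * density f c (chart_inv c (j s)) \<le> C * C'"
        by (intro mult_mono) auto
      then show "norm (indicator ?S s *\<^sub>R ?g s) \<le> C * C'"
        using \<open>s \<in> ?S\<close> by (simp add: abs_mult density_def)
    qed
  qed auto
  then show ?thesis by (simp add: set_integrable_def)
qed

definition "DD = (SOME D. cell_decomposition M f D)"

lemma DD: "cell_decomposition M f DD"
  unfolding DD_def using cell_decomposition_exists[OF f d] by (rule someI_ex)

lemma cellint_param: "cellint f h = (\<Sum>(A, c)\<in>DD. LINT s:{s. j s \<in> snd c ` A}|lborel.
    h (chart_inv c (j s)) * density f c (chart_inv c (j s)))"
  unfolding cellint_eq flat_int DD_def ..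

text \<open>The decomposition chosen by \<open>SOME\<close> depends on the cell alone, not on the
  integrand, so linearity holds piece by piece without comparing decompositions.\<close>

lemma param_lin:
  assumes "bounded_continuous f h" "bounded_continuous f g"
  shows "cellint f (\<lambda>x. s * h x + g x) = s * cellint f h + cellint f g"
proof -
  let ?L = "\<lambda>h A c. LINT s:{s. j s \<in> snd c ` A}|lborel. h (chart_inv c (j s)) * density f c (chart_inv c (j s))"
  have "?L (\<lambda>x. s * h x + g x) A c = s * ?L h A c + ?L g A c" if "(A, c) \<in> DD" for A c
  proof -
    note I = piece_integrable[OF DD that assms(1)] piece_integrable[OF DD that assms(2)]
    have "?L (\<lambda>x. s * h x + g x) A c = (LINT t:{t. j t \<in> snd c ` A}|lborel.
        s * (h (chart_inv c (j t)) * density f c (chart_inv c (j t))) + g (chart_inv c (j t)) * density f c (chart_inv c (j t)))"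
      by (simp add: algebra_simps)
    also have "\<dots> = s * ?L h A c + ?L g A c"
      using set_integral_add(2)[OF set_integrable_mult_right[of s, OF I(1)] I(2)]
      by (simp add: set_integral_mult_right)
    finally show ?thesis .
  qed
  then have "cellint f (\<lambda>x. s * h x + g x) = (\<Sum>(A, c)\<in>DD. s * ?L h A c + ?L g A c)"
    unfolding cellint_param by (intro sum.cong refl) auto
  also have "\<dots> = s * cellint f h + cellint f g"
    unfolding cellint_param by (simp add: sum.distrib sum_distrib_left case_prod_beta)
  finally show ?thesis .
qed

lemma piece_nonneg:
  assumes "(A, c) \<in> DD" and "\<And>x. x \<in> f \<Longrightarrow> h x \<ge> 0"
  shows "0 \<le> (LINT s:{s. j s \<in> snd c ` A}|lborel. h (chart_inv c (j s)) * density f c (chart_inv c (j s)))"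
  unfolding set_lebesgue_integral_def
  using piece_facts(2,8)[OF DD assms(1)] assms(2)
  by (intro Bochner_Integration.integral_nonneg) (auto simp: indicator_def density_def intro!: mult_nonneg_nonneg)

lemma param_nonneg: "(\<And>x. x \<in> f \<Longrightarrow> h x \<ge> 0) \<Longrightarrow> cellint f h \<ge> 0"
  unfolding cellint_param by (intro sum_nonneg) (use piece_nonneg in auto)

text \<open>A piece need not contain a neighbourhood of \<open>x\<close>, so one piece cannot give
  the contradiction. Vanishing of the nonnegative terms makes the set \<open>h > 0\<close>
  negligible in the coordinates of every piece. Carried over by coordinate changes to one chart
  around \<open>x\<close>, these finitely many null sets would cover a nonempty open set.\<close>

lemma param_zero:
  assumes h: "bounded_continuous f h" and nn: "\<And>x. x \<in> f \<Longrightarrow> h x \<ge> 0" and z: "cellint f h = 0" and x: "x \<in> f"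
  shows "h x = 0"
proof (rule ccontr)
  assume "h x \<noteq> 0"
  then have hx: "h x > 0" using nn[OF x] by simp
  have hc: "continuous_on f h" using h by (simp add: bounded_continuous_def)
  let ?N = "\<lambda>c A. {s. j s \<in> snd c ` A \<and> h (chart_inv c (j s)) > 0}"
  have fin: "finite DD" using cell_decompositionD(1)[OF DD] .
  have negl: "negligible (?N c A)" if p: "(A, c) \<in> DD" for A c
  proof -
    let ?S = "{s. j s \<in> snd c ` A}" and ?g = "\<lambda>s. h (chart_inv c (j s)) * density f c (chart_inv c (j s))"
    note pf = piece_facts[OF DD p]
    have "(LINT s:?S|lborel. ?g s) = 0"
    proof -
      have "(\<Sum>p\<in>DD. (case p of (A, c) \<Rightarrow> LINT s:{s. j s \<in> snd c ` A}|lborel. h (chart_inv c (j s)) * density f c (chart_inv c (j s)))) = 0"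
        using z unfolding cellint_param .
      moreover have "\<And>p. p \<in> DD \<Longrightarrow> 0 \<le> (case p of (A, c) \<Rightarrow> LINT s:{s. j s \<in> snd c ` A}|lborel. h (chart_inv c (j s)) * density f c (chart_inv c (j s)))"
        using piece_nonneg nn by auto
      ultimately have "\<forall>p\<in>DD. (case p of (A, c) \<Rightarrow> LINT s:{s. j s \<in> snd c ` A}|lborel. h (chart_inv c (j s)) * density f c (chart_inv c (j s))) = 0"
        by (subst (asm) sum_nonneg_eq_0_iff[OF fin]) auto
      then show ?thesis using p by auto
    qed
    then have "integral\<^sup>L lborel (\<lambda>s. indicator ?S s *\<^sub>R ?g s) = 0"
      by (simp only: set_lebesgue_integral_def)
    moreover have "integrable lborel (\<lambda>s. indicator ?S s *\<^sub>R ?g s)"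
      using piece_integrable[OF DD p h] by (simp only: set_integrable_def)
    moreover have "AE s in lborel. 0 \<le> indicator ?S s *\<^sub>R ?g s"
      using pf(2,8) nn by (intro AE_I2) (auto simp: indicator_def density_def intro!: mult_nonneg_nonneg)
    ultimately have "AE s in lborel. indicator ?S s *\<^sub>R ?g s = 0"
      using integral_nonneg_eq_0_iff_AE by blast
    then obtain N where N: "{s. indicator ?S s *\<^sub>R ?g s \<noteq> 0} \<subseteq> N" "N \<in> null_sets lborel"
      by (auto simp: eventually_ae_filter)
    have "negligible N" using N(2) null_sets_completionI negligible_iff_null_sets by blast
    moreover have "?N c A \<subseteq> N"
    proof
      fix s assume s: "s \<in> ?N c A"
      then have "chart_inv c (j s) \<in> A" using pf(8) by blast
      then have "density f c (chart_inv c (j s)) > 0"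
        using density_pos[OF f pf(1) _ _ d] pf(2,3) by blast
      then have "indicator ?S s *\<^sub>R ?g s \<noteq> 0" using s by simp
      then show "s \<in> N" using N(1) by blast
    qed
    ultimately show ?thesis using negligible_subset by blast
  qed
  obtain c0 where c0: "cell_chart M f c0" "x \<in> fst c0" using cell_chart_exists[OF f x] .
  have c0M: "c0 \<in> charts M" using c0 cell_chart_in by blast
  let ?V = "{s. j s \<in> chart_image c0 f} \<inter> (\<lambda>s. h (chart_inv c0 (j s))) -` {0<..}"
  have "open ?V"
    using continuous_open_preimage[OF param_continuous[OF c0(1) hc] open_param[OF c0(1)]] by simp
  moreover have "\<pi> (snd c0 x) \<in> ?V"
  proof -
    have "snd c0 x \<in> chart_image c0 f" using c0 x by blast
    moreover then have "j (\<pi> (snd c0 x)) = snd c0 x" using j\<pi> cell_chart_flat[OF c0(1)] by blast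
    ultimately show ?thesis using hx chart_inv_left[OF c0M c0(2)] by simp
  qed
  ultimately have not_negl: "\<not> negligible ?V" using open_not_negligible by blast
  \<comment> \<open>The change from the chart of a piece to the chart around \<open>x\<close>, read
    in the parameters. It is differentiable between spaces of equal dimension and so maps negligible
    sets to negligible sets.\<close>
  define \<phi> where "\<phi> c s = \<pi> ((snd c0 \<circ> chart_inv c) (j s))" for c :: "'p chart" and s
  have "negligible (\<phi> c ` (?N c A \<inter> {s. j s \<in> chart_image c (fst c0)}))" if p: "(A, c) \<in> DD" for A c
  proof (rule negligible_differentiable_image_negligible)
    have cM: "c \<in> charts M" using piece_facts(1)[OF DD p] cell_chart_in by blast
    show "negligible (?N c A \<inter> {s. j s \<in> chart_image c (fst c0)})"
      by (rule negligible_subset[OF negl[OF p]]) blast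
    show "\<phi> c differentiable_on ?N c A \<inter> {s. j s \<in> chart_image c (fst c0)}"
      unfolding differentiable_on_def
    proof
      fix s assume "s \<in> ?N c A \<inter> {s. j s \<in> chart_image c (fst c0)}"
      then have js: "j s \<in> chart_image c (fst c0)" by blast
      have "(j has_derivative j) (at s)" using j by (rule bounded_linear_imp_has_derivative)
      from has_derivative_compose[OF this dtr_has_derivative_at[OF cM c0M js]]
      have "((\<lambda>s. (snd c0 \<circ> chart_inv c) (j s)) has_derivative (\<lambda>s'. frechet_derivative (snd c0 \<circ> chart_inv c) (at (j s)) (j s'))) (at s)" .
      from bounded_linear.has_derivative[OF \<pi> this]
      show "\<phi> c differentiable at s within ?N c A \<inter> {s. j s \<in> chart_image c (fst c0)}"
        unfolding \<phi>_def differentiable_def using has_derivative_at_withinI by blast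
    qed
  qed simp
  then have "negligible (\<Union>(A, c)\<in>DD. \<phi> c ` (?N c A \<inter> {s. j s \<in> chart_image c (fst c0)}))"
    using fin by (intro negligible_Union) auto
  moreover have "?V \<subseteq> (\<Union>(A, c)\<in>DD. \<phi> c ` (?N c A \<inter> {s. j s \<in> chart_image c (fst c0)}))"
  proof
    fix s assume s: "s \<in> ?V"
    define z where "z = chart_inv c0 (j s)"
    have z: "z \<in> f" "z \<in> fst c0" "snd c0 z = j s" "h z > 0"
      using s chart_image_iff[OF c0M, of "j s" f] chart_inv_in[OF c0M] chart_inv_right[OF c0M] by (auto simp: z_def)
    then obtain A c where p: "(A, c) \<in> DD" "z \<in> A" using cell_decompositionD(2)[OF DD] by blast
    note pf = piece_facts[OF DD p(1)]
    have cM: "c \<in> charts M" using pf(1) cell_chart_in by blast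
    have zc: "z \<in> fst c" using p(2) pf(3) by blast
    have e: "j (\<pi> (snd c z)) = snd c z"
      using j\<pi> cell_chart_flat[OF pf(1)] zc z(1) by blast
    have "\<pi> (snd c z) \<in> ?N c A \<inter> {s. j s \<in> chart_image c (fst c0)}"
      using e p(2) z zc chart_inv_left[OF cM zc] by auto
    moreover have "\<phi> c (\<pi> (snd c z)) = s"
      unfolding \<phi>_def e using chart_inv_left[OF cM zc] z(3) \<pi>j by simp
    ultimately have "s \<in> \<phi> c ` (?N c A \<inter> {s. j s \<in> chart_image c (fst c0)})" by blast
    then show "s \<in> (\<Union>(A, c)\<in>DD. \<phi> c ` (?N c A \<inter> {s. j s \<in> chart_image c (fst c0)}))" using p(1) by blast
  qed
  ultimately show False using not_negl negligible_subset by blast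
qed

end

section \<open>The L2 product of regular forms on edges and 2-cells\<close>

context riem_mesh
begin

context
  fixes f assumes f: "f \<in> cells M" and d: "cdim M f = 1 \<or> cdim M f = 2"
begin

lemma flat_param_cases:
  obtains "flat_param M f (axis 1 :: real \<Rightarrow> real^2) (\<lambda>y. y $ 1)" | "flat_param M f (\<lambda>y. y) (\<lambda>y. y)"
proof (cases "cdim M f = 1")
  case True
  have bl: "bounded_linear (axis 1 :: real \<Rightarrow> real^2)"
    unfolding linear_conv_bounded_linear[symmetric]
    by (rule linearI) (simp_all add: vec_eq_iff axis_def)
  have ax: "range (axis 1) = flat (Suc 0)"
  proof (intro equalityI subsetI)
    fix y assume "y \<in> flat (Suc 0)"
    then have "y = axis 1 (y $ 1)" by (simp add: flat_1 vec_eq_iff forall_2 axis_def)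
    then show "y \<in> range (axis 1)" by blast
  qed (use axis_1_flat in auto)
  have "flat_param M f (axis 1 :: real \<Rightarrow> real^2) (\<lambda>y. y $ 1)"
    by (rule flat_param.intro[OF riem_mesh_axioms], rule flat_param_axioms.intro) (rule f, rule d, rule bl, rule bounded_linear_vec_nth, simp add: axis_def,
      simp only: True ax One_nat_def, simp add: flat_integral_def True)
  then show thesis by (rule that(1))
next
  case False
  then have d2: "cdim M f = 2" using d by simp
  have "flat_param M f (\<lambda>y. y) (\<lambda>y. y)"
    by (rule flat_param.intro[OF riem_mesh_axioms], rule flat_param_axioms.intro) (rule f, rule d, rule bounded_linear_ident, rule bounded_linear_ident, rule refl,
      simp only: d2 flat_2 image_ident, simp add: flat_integral_def d2)
  then show thesis by (rule that(2))
qed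

lemma cellint_lin:
  "bounded_continuous f h \<Longrightarrow> bounded_continuous f g \<Longrightarrow> cellint f (\<lambda>x. s * h x + g x) = s * cellint f h + cellint f g"
  by (rule flat_param_cases) (erule flat_param.param_lin; assumption)+

lemma cellint_nonneg: "(\<And>x. x \<in> f \<Longrightarrow> h x \<ge> 0) \<Longrightarrow> cellint f h \<ge> 0"
  by (rule flat_param_cases) (erule flat_param.param_nonneg; blast)+

lemma cellint_zero:
  "bounded_continuous f h \<Longrightarrow> (\<And>x. x \<in> f \<Longrightarrow> h x \<ge> 0) \<Longrightarrow> cellint f h = 0 \<Longrightarrow> x \<in> f \<Longrightarrow> h x = 0"
  by (rule flat_param_cases) (erule flat_param.param_zero; blast)+

lemma L2_inner_cellint: "L2_inner M f p q = cellint f (\<lambda>x. form_inner M f x (p x) (q x))"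
  by (simp add: L2_inner_def cellint_def)

lemma L2_lin_left: "q \<in> regular_forms f l' \<Longrightarrow> lin_on (regular_forms f l) (\<lambda>p. L2_inner M f p q)"
proof -
  assume q: "q \<in> regular_forms f l'"
  have bc: "bounded_continuous f (\<lambda>x. form_inner M f x (p x) (q x))" if "p \<in> regular_forms f l" for p
    using regular_inner[OF f d that q] by (simp add: bounded_continuous_def)
  show ?thesis
    unfolding lin_on_def L2_inner_cellint
    using cellint_lin[OF bc bc] by (simp add: form_inner_add_left)
qed

lemma L2_sym: "L2_inner M f p q = L2_inner M f q p"
  by (simp add: L2_inner_def form_inner_sym)

lemma L2_lin_right: "p \<in> regular_forms f l' \<Longrightarrow> lin_on (regular_forms f l) (L2_inner M f p)"
  using L2_lin_left unfolding lin_on_def by (subst L2_sym, subst (2) L2_sym, subst (3) L2_sym) blast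

lemma L2_pos:
  assumes p: "p \<in> regular_forms f l" and l: "l \<le> int (cdim M f)" and "p \<noteq> 0"
  shows "L2_inner M f p p > 0"
proof (rule ccontr)
  assume "\<not> ?thesis"
  moreover have "L2_inner M f p p \<ge> 0"
    unfolding L2_inner_cellint by (rule cellint_nonneg) (rule form_inner_nonneg)
  ultimately have 0: "cellint f (\<lambda>x. form_inner M f x (p x) (p x)) = 0" unfolding L2_inner_cellint by simp
  have bc: "bounded_continuous f (\<lambda>x. form_inner M f x (p x) (p x))"
    using regular_inner[OF f d p p] by (simp add: bounded_continuous_def)
  have pc: "p \<in> cell_forms M f l" using p regular_cell_forms by blast
  have "p x = 0" for x
  proof (cases "x \<in> f")
    case True
    obtain c where c: "cell_chart M f c" "x \<in> fst c" using cell_chart_exists[OF f True] .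
    have "form_inner M f x (p x) (p x) = 0"
      by (rule cellint_zero[OF bc _ 0 True]) (rule form_inner_nonneg)
    then show ?thesis
      by (rule form_inner_definite[OF f c(1) True c(2) d l cell_formsD(1)[OF pc True]])
  qed (use cell_formsD(2)[OF pc] in auto)
  then have "p = 0" by (simp add: fun_eq_iff)
  then show False using assms(3) by simp
qed

end

end

section \<open>Symmetry of mixed partial derivatives\<close>

text \<open>The mean value theorem twice: first along \<open>u\<close> for the difference of two
  parallel sides of the parallelogram, then along \<open>w\<close> for the resulting directional
  derivative.\<close>

lemma second_difference:
  fixes H :: "'v::real_normed_vector \<Rightarrow> real"
  assumes h: "h > 0" and B: "\<And>s t. s \<in> {0..h} \<Longrightarrow> t \<in> {0..h} \<Longrightarrow> y + s *\<^sub>R u + t *\<^sub>R w \<in> S"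
    and H: "\<And>y. y \<in> S \<Longrightarrow> (H has_derivative (\<lambda>u. A u y)) (at y)"
    and A: "\<And>u y. y \<in> S \<Longrightarrow> (A u has_derivative A' u y) (at y)"
  obtains s t where "s \<in> {0..h}" "t \<in> {0..h}"
    "H (y + h *\<^sub>R u + h *\<^sub>R w) - H (y + h *\<^sub>R u) - (H (y + h *\<^sub>R w) - H y) = h * (h * A' u (y + s *\<^sub>R u + t *\<^sub>R w) w)"
proof -
  define \<phi> where "\<phi> s = H (y + s *\<^sub>R u + h *\<^sub>R w) - H (y + s *\<^sub>R u)" for s
  have line: "((\<lambda>s. F (a + s *\<^sub>R v)) has_real_derivative F' v) (at s)"
    if "(F has_derivative F') (at (a + s *\<^sub>R v))" for F :: "'v \<Rightarrow> real" and F' a v s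
  proof -
    have "((\<lambda>s. a + s *\<^sub>R v) has_derivative (\<lambda>s. s *\<^sub>R v)) (at s)"
      by (auto intro!: derivative_eq_intros)
    from has_derivative_compose[OF this that] has_derivative_linear[OF that] show ?thesis
      by (simp add: has_field_derivative_def linear_scale mult.commute[of _ "F' v"])
  qed
  have d\<phi>: "(\<phi> has_real_derivative A u (y + s *\<^sub>R u + h *\<^sub>R w) - A u (y + s *\<^sub>R u)) (at s)" if "0 \<le> s" "s \<le> h" for s
  proof -
    have "y + s *\<^sub>R u + h *\<^sub>R w \<in> S" "y + s *\<^sub>R u \<in> S"
      using B[of s h] B[of s 0] that h by auto
    then have "((\<lambda>s. H ((y + h *\<^sub>R w) + s *\<^sub>R u) - H (y + s *\<^sub>R u)) has_real_derivative
        A u ((y + h *\<^sub>R w) + s *\<^sub>R u) - A u (y + s *\<^sub>R u)) (at s)"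
      by (intro DERIV_diff line H) (simp_all add: add_ac)
    then show ?thesis unfolding \<phi>_def[abs_def] by (simp add: add_ac)
  qed
  obtain s where s: "0 < s" "s < h" "\<phi> h - \<phi> 0 = (h - 0) * (A u (y + s *\<^sub>R u + h *\<^sub>R w) - A u (y + s *\<^sub>R u))"
    using MVT2[OF h d\<phi>] by auto
  have "((\<lambda>t. A u (y + s *\<^sub>R u + t *\<^sub>R w)) has_real_derivative A' u (y + s *\<^sub>R u + t *\<^sub>R w) w) (at t)"
    if "0 \<le> t" "t \<le> h" for t
    by (rule line, rule A, rule B) (use that s in auto)
  from MVT2[OF h this] obtain t where t: "0 < t" "t < h"
    "A u (y + s *\<^sub>R u + h *\<^sub>R w) - A u (y + s *\<^sub>R u + 0 *\<^sub>R w) = (h - 0) * A' u (y + s *\<^sub>R u + t *\<^sub>R w) w"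
    by blast
  show thesis
    by (rule that[of s t]) (use s t in \<open>auto simp: \<phi>_def\<close>)
qed

text \<open>The second difference over a parallelogram is symmetric in \<open>u\<close> and
  \<open>w\<close>. By \<open>second_difference\<close> it is a multiple of either mixed derivative
  at some nearby point, and continuity brings both to \<open>y\<close>.\<close>

lemma mixed_derivatives_symmetric:
  fixes H :: "'v::real_normed_vector \<Rightarrow> real"
  assumes S: "open S" "y \<in> S"
    and H: "\<And>y. y \<in> S \<Longrightarrow> (H has_derivative (\<lambda>u. A u y)) (at y)"
    and A: "\<And>u y. y \<in> S \<Longrightarrow> (A u has_derivative A' u y) (at y)"
    and c: "\<And>u w. continuous_on S (\<lambda>y. A' u y w)"
  shows "A' u y w = A' w y u"
proof (rule ccontr)
  assume neq: "A' u y w \<noteq> A' w y u"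
  define e where "e = \<bar>A' u y w - A' w y u\<bar> / 2"
  have e: "e > 0" using neq by (simp add: e_def)
  have near: "\<exists>d>0. \<forall>z. dist z y < d \<longrightarrow> z \<in> S \<and> \<bar>A' u z w - A' u y w\<bar> < e" for u w
  proof -
    have "isCont (\<lambda>y. A' u y w) y" using c S continuous_on_eq_continuous_at by blast
    then obtain d where d: "d > 0" "\<And>z. dist z y < d \<Longrightarrow> dist (A' u z w) (A' u y w) < e"
      using e by (auto simp: continuous_at_eps_delta)
    obtain r where r: "r > 0" "ball y r \<subseteq> S" using S open_contains_ball by blast
    then have "\<forall>z. dist z y < min d r \<longrightarrow> z \<in> S \<and> \<bar>A' u z w - A' u y w\<bar> < e"
      using d by (auto simp: dist_real_def dist_commute subset_eq)
    then show ?thesis using d r by (metis min_less_iff_conj)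
  qed
  obtain d1 where d1: "d1 > 0" "\<And>z. dist z y < d1 \<Longrightarrow> z \<in> S \<and> \<bar>A' u z w - A' u y w\<bar> < e" using near by blast
  obtain d2 where d2: "d2 > 0" "\<And>z. dist z y < d2 \<Longrightarrow> z \<in> S \<and> \<bar>A' w z u - A' w y u\<bar> < e" using near by blast
  define K where "K = norm u + norm w + 1"
  \<comment> \<open>With this side length the whole parallelogram stays within half of
    \<open>min d1 d2\<close> of \<open>y\<close>; the summand 1 in \<open>K\<close> avoids division
    by zero.\<close>
  define h where "h = min d1 d2 / (2 * K)"
  have pos: "0 < K" by (simp add: K_def add_nonneg_pos)
  then have h: "h > 0" using d1 d2 by (simp add: h_def)
  have cl: "dist (y + s *\<^sub>R u + t *\<^sub>R w) y < min d1 d2" if "s \<in> {0..h}" "t \<in> {0..h}" for s t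
  proof -
    have "dist (y + s *\<^sub>R u + t *\<^sub>R w) y = norm (s *\<^sub>R u + t *\<^sub>R w)" by (simp add: dist_norm add.assoc)
    also have "\<dots> \<le> s * norm u + t * norm w" using norm_triangle_ineq[of "s *\<^sub>R u" "t *\<^sub>R w"] that by simp
    also have "\<dots> \<le> h * norm u + h * norm w" using that by (intro add_mono mult_right_mono) auto
    also have "\<dots> \<le> h * K" using h by (simp add: K_def algebra_simps)
    also have "\<dots> = min d1 d2 / 2" using pos by (simp add: h_def)
    also have "\<dots> < min d1 d2" using d1(1) d2(1) by (simp add: min_def)
    finally show ?thesis .
  qed
  obtain s t where st: "s \<in> {0..h}" "t \<in> {0..h}"
    "H (y + h *\<^sub>R u + h *\<^sub>R w) - H (y + h *\<^sub>R u) - (H (y + h *\<^sub>R w) - H y) = h * (h * A' u (y + s *\<^sub>R u + t *\<^sub>R w) w)"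
    by (rule second_difference[OF h _ H A, where S=S and y=y and u=u and w=w]) (use cl d1 in auto)
  have cl': "dist (y + t *\<^sub>R w + s *\<^sub>R u) y < min d1 d2" if "s \<in> {0..h}" "t \<in> {0..h}" for s t
    using cl[OF that] by (simp add: add_ac)
  obtain s' t' where st': "t' \<in> {0..h}" "s' \<in> {0..h}"
    "H (y + h *\<^sub>R w + h *\<^sub>R u) - H (y + h *\<^sub>R w) - (H (y + h *\<^sub>R u) - H y) = h * (h * A' w (y + t' *\<^sub>R w + s' *\<^sub>R u) u)"
    by (rule second_difference[OF h _ H A, where S=S and y=y and u=w and w=u]) (use cl' d1 in auto)
  have swap: "y + h *\<^sub>R w + h *\<^sub>R u = y + h *\<^sub>R u + h *\<^sub>R w" by (simp add: add_ac)
  have "h * (h * A' u (y + s *\<^sub>R u + t *\<^sub>R w) w) = h * (h * A' w (y + t' *\<^sub>R w + s' *\<^sub>R u) u)"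
    using st(3) st'(3)[unfolded swap] by linarith
  then have "A' u (y + s *\<^sub>R u + t *\<^sub>R w) w = A' w (y + t' *\<^sub>R w + s' *\<^sub>R u) u" using h by simp
  moreover have "\<bar>A' u (y + s *\<^sub>R u + t *\<^sub>R w) w - A' u y w\<bar> < e" using d1(2) cl[OF st(1,2)] by simp
  moreover have "\<bar>A' w (y + t' *\<^sub>R w + s' *\<^sub>R u) u - A' w y u\<bar> < e" using d2(2) cl'[OF st'(2,1)] by simp
  ultimately have "\<bar>A' u y w - A' w y u\<bar> < 2 * e" by linarith
  then show False by (simp add: e_def)
qed

context riem_mesh
begin

section \<open>Traces on facets\<close>

definition facet :: "'p set \<Rightarrow> 'p set \<Rightarrow> bool" where
  "facet f f' \<longleftrightarrow> f \<in> cells M \<and> f' \<in> cells M \<and> f' \<subseteq> bdry f \<and> cdim M f = Suc (cdim M f')"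

lemma facetD: "facet f f' \<Longrightarrow> f \<in> cells M" "facet f f' \<Longrightarrow> f' \<in> cells M" "facet f f' \<Longrightarrow> f' \<subseteq> bdry f"
    "facet f f' \<Longrightarrow> cdim M f = Suc (cdim M f')"
  by (auto simp: facet_def)

lemma facet_chart:
  assumes "facet f f'" "x \<in> f'"
  obtains c where "bdry_chart M f f' c" "x \<in> fst c" "cell_chart M f c" "cell_chart M f' c"
  using facet_facts[OF facetD[OF assms(1)] assms(2)] bdry_chart_cell_charts facetD(4)[OF assms(1)] by metis

lemma faces_eq_facets: "f \<in> cells M \<Longrightarrow> cdim M f > 0 \<Longrightarrow> faces M (cdim M f - 1) f = {f'. facet f f'}"
  by (auto simp: faces_def facet_def cells_of_dim_def)

lemma facet_closure: "facet f f' \<Longrightarrow> f' \<subseteq> closure f" "facet f f' \<Longrightarrow> f' \<inter> f = {}" "facet f f' \<Longrightarrow> closure f' \<subseteq> closure f"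
proof -
  assume F: "facet f f'"
  show "f' \<subseteq> closure f" "f' \<inter> f = {}" using facetD(3)[OF F] by (auto simp: bdry_def)
  then show "closure f' \<subseteq> closure f" by (simp add: closure_minimal)
qed

lemma at_facet_nontrivial: "facet f f' \<Longrightarrow> x \<in> f' \<Longrightarrow> at x within f \<noteq> bot"
proof -
  assume "facet f f'" "x \<in> f'"
  then have "x \<in> closure f" "x \<notin> f" using facet_closure by blast+
  then show ?thesis using trivial_limit_within by (auto simp: closure_def)
qed

lemma tendsto_within_cell:
  assumes "openin (top_of_set (pts M)) N" "x \<in> N" "continuous_on N g" "f \<subseteq> pts M"
  shows "(g \<longlongrightarrow> g x) (at x within f)"
proof -
  have "(g \<longlongrightarrow> g x) (at x within N)" using assms(2,3) by (simp add: continuous_on_def)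
  then have "(g \<longlongrightarrow> g x) (at x within (N \<inter> f))" by (rule tendsto_within_subset) blast
  then show ?thesis using at_within_chart[OF assms(1,2,4)] by simp
qed

lemma eventually_within_cell:
  assumes "openin (top_of_set (pts M)) N" "x \<in> N" "f \<subseteq> pts M"
  shows "\<forall>\<^sub>F z in at x within f. z \<in> N \<and> z \<in> f"
proof -
  have "\<forall>\<^sub>F z in at x within (N \<inter> f). z \<in> N \<inter> f" by (simp add: eventually_at_filter)
  then show ?thesis using at_within_chart[OF assms] by simp
qed

lemma cell_tspace_list:
  assumes "cell_chart M f c" "x \<in> f" "x \<in> fst c" "set vs \<subseteq> cell_tspace M f x"
  obtains us where "vs = map (tvec_of M c x) us" "set us \<subseteq> flat (cdim M f)"
proof (rule that)
  have e: "v c \<in> flat (cdim M f)" "tvec_of M c x (v c) = v" if "v \<in> set vs" for v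
    using that assms(4) tvec_comp_self[OF cell_chart_in[OF assms(1)] assms(3)]
    unfolding cell_tspace_eq[OF assms(1-3)] by auto
  then show "vs = map (tvec_of M c x) (map (\<lambda>v. v c) vs)" by (simp add: map_idI)
  show "set (map (\<lambda>v. v c) vs) \<subseteq> flat (cdim M f)" using e by auto
qed

lemma extends_continuous:
  assumes "extends 0 l f \<omega> x W \<eta>" "c \<in> charts M"
  shows "continuous_on (fst c \<inter> W) (\<lambda>x. \<eta> x (map (tvec_of M c x) us))"
  using assms Ck_forms_continuous[of \<eta> W l c us] unfolding extends_def by blast

lemma extends_openin: "extends m l f \<omega> x W \<eta> \<Longrightarrow> c \<in> charts M \<Longrightarrow> openin (top_of_set (pts M)) (fst c \<inter> W)"
  using chart_openin[of c] by (auto simp: extends_def)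

lemma extends_apply:
  assumes "extends m l f \<omega> x W \<eta>" "cell_chart M f c" "z \<in> f" "z \<in> fst c" "z \<in> W" "set us \<subseteq> flat (cdim M f)"
  shows "\<omega> z (map (tvec_of M c z) us) = \<eta> z (map (tvec_of M c z) us)"
  using assms pullback_tvec[OF assms(2,3,4,6), of \<eta>] by (simp add: extends_def)

lemma extends_move: "extends m l f \<omega> x W \<eta> \<Longrightarrow> z \<in> W \<Longrightarrow> extends m l f \<omega> z W \<eta>"
  by (simp add: extends_def)

text \<open>Two extensions agree on tangent vectors of \<open>f\<close>, and \<open>x\<close> is a
  limit point of \<open>f\<close>. In a boundary chart the directions of \<open>f'\<close> are also
  directions of \<open>f\<close>, so continuity gives agreement of the tangential components at
  \<open>x\<close>. This makes the description in \<open>trace\<close> unique.\<close>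

lemma pullback_unique:
  assumes F: "facet f f'" and x: "x \<in> f'" and E: "extends 0 l f \<omega> x W \<eta>" and E': "extends 0 l f \<omega> x W' \<eta>'"
  shows "pullback M f' \<eta> x = pullback M f' \<eta>' x"
proof
  fix vs
  obtain c where c: "x \<in> fst c" "cell_chart M f c" "cell_chart M f' c" by (rule facet_chart[OF F x])
  have cM: "c \<in> charts M" using c cell_chart_in by blast
  note fp = cell_subset[OF facetD(1)[OF F]]
  show "pullback M f' \<eta> x vs = pullback M f' \<eta>' x vs"
  proof (cases "set vs \<subseteq> cell_tspace M f' x")
    case True
    then obtain us where us: "vs = map (tvec_of M c x) us" "set us \<subseteq> flat (cdim M f')"
      using cell_tspace_list[OF c(3) x c(1)] by blast
    have us': "set us \<subseteq> flat (cdim M f)" using us(2) flat_mono[of "cdim M f'" "cdim M f"] facetD(4)[OF F] by auto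
    have xW: "x \<in> fst c \<inter> W" "x \<in> fst c \<inter> W'" using c E E' by (auto simp: extends_def)
    have "((\<lambda>z. \<eta> z (map (tvec_of M c z) us)) \<longlongrightarrow> \<eta> x vs) (at x within f)"
      unfolding us by (rule tendsto_within_cell[OF extends_openin[OF E cM] xW(1) extends_continuous[OF E cM] fp])
    moreover have "\<forall>\<^sub>F z in at x within f. \<eta> z (map (tvec_of M c z) us) = \<eta>' z (map (tvec_of M c z) us)"
      using eventually_within_cell[OF extends_openin[OF E cM] xW(1) fp]
        eventually_within_cell[OF extends_openin[OF E' cM] xW(2) fp]
    proof eventually_elim
      case (elim z)
      then show ?case
        using extends_apply[OF E c(2) _ _ _ us', of z] extends_apply[OF E' c(2) _ _ _ us', of z] by auto
    qed
    ultimately have "((\<lambda>z. \<eta>' z (map (tvec_of M c z) us)) \<longlongrightarrow> \<eta> x vs) (at x within f)"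
      by (rule Lim_transform_eventually)
    moreover have "((\<lambda>z. \<eta>' z (map (tvec_of M c z) us)) \<longlongrightarrow> \<eta>' x vs) (at x within f)"
      unfolding us by (rule tendsto_within_cell[OF extends_openin[OF E' cM] xW(2) extends_continuous[OF E' cM] fp])
    ultimately have "\<eta> x vs = \<eta>' x vs"
      using tendsto_unique[OF at_facet_nontrivial[OF F x]] by blast
    then show ?thesis by (simp add: pullback_def restr_alt_def)
  next
    case False
    then show ?thesis by (simp only: pullback_def restr_alt_def if_False split: if_split) simp
  qed
qed

text \<open>Extendability at the points of the facet only, not on the closure of the cell: inverse
  stars of polynomial forms are shown to extend to open edges, and the vertices are left
  out.\<close>

definition traceable :: "int \<Rightarrow> 'p set \<Rightarrow> 'p set \<Rightarrow> 'p form \<Rightarrow> bool" where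
  "traceable l f f' \<omega> \<longleftrightarrow> (\<forall>x\<in>f'. \<exists>W \<eta>. extends 0 l f \<omega> x W \<eta>)"

text \<open>From here on a trace can be computed with whichever local extension is at hand.\<close>

lemma trace_props:
  assumes F: "facet f f'" and T: "traceable l f f' \<omega>"
  shows "x \<notin> f' \<Longrightarrow> trace M l f f' \<omega> x = 0"
    and "x \<in> f' \<Longrightarrow> extends 0 l f \<omega> x W \<eta> \<Longrightarrow> trace M l f f' \<omega> x = pullback M f' \<eta> x"
proof -
  obtain W0 \<eta>0 where E0: "\<And>x. x \<in> f' \<Longrightarrow> extends 0 l f \<omega> x (W0 x) (\<eta>0 x)"
    using T unfolding traceable_def by metis
  define q where "q x = (if x \<in> f' then pullback M f' (\<eta>0 x) x else 0)" for x
  have eq: "trace M l f f' \<omega> = q"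
    unfolding trace_def
  proof (rule the_equality)
    show "(\<forall>x. x \<notin> f' \<longrightarrow> q x = 0) \<and>
     (\<forall>x\<in>f'. \<exists>W \<eta>. openin (top_of_set (pts M)) W \<and> x \<in> W \<and> \<eta> \<in> Ck_forms M 0 W l \<and>
        (\<forall>z\<in>f \<inter> W. \<omega> z = pullback M f \<eta> z) \<and> q x = pullback M f' \<eta> x)"
      using E0 unfolding extends_def q_def by (metis (no_types, lifting))
    fix q' assume q': "(\<forall>x. x \<notin> f' \<longrightarrow> q' x = 0) \<and>
     (\<forall>x\<in>f'. \<exists>W \<eta>. openin (top_of_set (pts M)) W \<and> x \<in> W \<and> \<eta> \<in> Ck_forms M 0 W l \<and>
        (\<forall>z\<in>f \<inter> W. \<omega> z = pullback M f \<eta> z) \<and> q' x = pullback M f' \<eta> x)"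
    show "q' = q"
    proof
      fix x show "q' x = q x"
      proof (cases "x \<in> f'")
        case True
        then obtain W \<eta> where E: "extends 0 l f \<omega> x W \<eta>" "q' x = pullback M f' \<eta> x"
          using q' unfolding extends_def by blast
        then show ?thesis using pullback_unique[OF F True E(1) E0[OF True]] True by (simp add: q_def)
      qed (use q' in \<open>simp add: q_def\<close>)
    qed
  qed
  show "x \<notin> f' \<Longrightarrow> trace M l f f' \<omega> x = 0" by (simp add: eq q_def)
  show "trace M l f f' \<omega> x = pullback M f' \<eta> x" if "x \<in> f'" "extends 0 l f \<omega> x W \<eta>"
    using pullback_unique[OF F that(1) that(2) E0[OF that(1)]] that(1) by (simp add: eq q_def)
qed

lemma pullback_alt_forms:
  assumes f: "f \<in> cells M" and x: "x \<in> f" "x \<in> W" and \<eta>: "\<eta> \<in> Ck_forms M m W l"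
  shows "pullback M f \<eta> x \<in> alt_forms l (cell_tspace M f x)"
proof -
  obtain c where c: "cell_chart M f c" "x \<in> fst c" using cell_chart_exists[OF f x(1)] .
  have "\<eta> x \<in> alt_forms l (tspace M x)" using \<eta> x(2) by (simp add: Ck_forms_def)
  then show ?thesis
    using alt_forms_restr[OF _ cell_tspace_subspace[OF c(1) x(1) c(2)]] x(1) by (simp add: pullback_def)
qed

lemma trace_cell_forms:
  assumes F: "facet f f'" and T: "traceable l f f' \<omega>"
  shows "trace M l f f' \<omega> \<in> cell_forms M f' l"
proof -
  have "trace M l f f' \<omega> x \<in> alt_forms l (cell_tspace M f' x)" if x: "x \<in> f'" for x
  proof -
    obtain W \<eta> where E: "extends 0 l f \<omega> x W \<eta>" using T x unfolding traceable_def by metis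
    then have "x \<in> W" "\<eta> \<in> Ck_forms M 0 W l" by (auto simp: extends_def)
    then show ?thesis
      unfolding trace_props(2)[OF F T x E] by (rule pullback_alt_forms[OF facetD(2)[OF F] x])
  qed
  then show ?thesis using trace_props(1)[OF F T] by (simp add: cell_forms_def)
qed

lemma Ck_forms_0_iff:
  "\<eta> \<in> Ck_forms M 0 W l \<longleftrightarrow> (\<forall>x\<in>W. \<eta> x \<in> alt_forms l (tspace M x)) \<and> (\<forall>x. x \<notin> W \<longrightarrow> \<eta> x = 0) \<and>
     (\<forall>c\<in>charts M. \<forall>us. continuous_on (fst c \<inter> W) (\<lambda>x. \<eta> x (map (tvec_of M c x) us)))"
proof -
  have "continuous_on (chart_image c W) (\<lambda>y. \<eta> (chart_inv c y) (map (tvec_of M c (chart_inv c y)) us))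
    \<longleftrightarrow> continuous_on (fst c \<inter> W) (\<lambda>x. \<eta> x (map (tvec_of M c x) us))" if "c \<in> charts M" for c us
    using chart_cont_iff[OF that, of W "\<lambda>x. \<eta> x (map (tvec_of M c x) us)"] by simp
  then show ?thesis unfolding Ck_forms_def Let_def Ck_on.simps by auto
qed

lemma extends_comb:
  assumes E: "extends 0 l f \<omega> x W \<eta>" and E': "extends 0 l f \<omega>' x W' \<eta>'"
  shows "extends 0 l f (s *\<^sub>R \<omega> + \<omega>') x (W \<inter> W') (\<lambda>z. if z \<in> W \<inter> W' then s *\<^sub>R \<eta> z + \<eta>' z else 0)" (is "extends 0 l f _ x _ ?\<eta>")
proof -
  have C: "\<eta> \<in> Ck_forms M 0 W l" "\<eta>' \<in> Ck_forms M 0 W' l" using E E' by (auto simp: extends_def)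
  have "continuous_on (fst c \<inter> (W \<inter> W')) (\<lambda>x. ?\<eta> x (map (tvec_of M c x) us))" if "c \<in> charts M" for c us
  proof -
    have "continuous_on (fst c \<inter> (W \<inter> W')) (\<lambda>x. s * \<eta> x (map (tvec_of M c x) us) + \<eta>' x (map (tvec_of M c x) us))"
      by (intro continuous_intros continuous_on_subset[OF extends_continuous[OF E that]]
          continuous_on_subset[OF extends_continuous[OF E' that]]) auto
    then show ?thesis by (rule continuous_on_eq) auto
  qed
  moreover have "s *\<^sub>R \<eta> z + \<eta>' z \<in> alt_forms l (tspace M z)" if "z \<in> W \<inter> W'" for z
    using C[unfolded Ck_forms_0_iff] that by (intro subspace_comb[OF subspace_alt_forms]) blast+
  ultimately have "?\<eta> \<in> Ck_forms M 0 (W \<inter> W') l" unfolding Ck_forms_0_iff by simp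
  moreover have "(s *\<^sub>R \<omega> + \<omega>') z = pullback M f ?\<eta> z" if "z \<in> f \<inter> (W \<inter> W')" for z
    using E E' that by (auto simp: extends_def pullback_def restr_alt_def fun_eq_iff)
  ultimately show ?thesis
    using E E' unfolding extends_def by (simp add: openin_Int)
qed

lemma trace_lin:
  assumes F: "facet f f'"
  shows "lin_on {\<omega>. traceable l f f' \<omega>} (trace M l f f')"
  unfolding lin_on_def
proof (intro ballI allI)
  fix \<omega> \<omega>' s assume "\<omega> \<in> {\<omega>. traceable l f f' \<omega>}" "\<omega>' \<in> {\<omega>. traceable l f f' \<omega>}"
  then have T: "traceable l f f' \<omega>" "traceable l f f' \<omega>'" by auto
  have T': "traceable l f f' (s *\<^sub>R \<omega> + \<omega>')"
    unfolding traceable_def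
  proof
    fix x assume "x \<in> f'"
    then obtain W \<eta> W' \<eta>' where E: "extends 0 l f \<omega> x W \<eta>" "extends 0 l f \<omega>' x W' \<eta>'"
      using T unfolding traceable_def by metis
    show "\<exists>W \<eta>. extends 0 l f (s *\<^sub>R \<omega> + \<omega>') x W \<eta>"
      using extends_comb[OF E] by blast
  qed
  show "trace M l f f' (s *\<^sub>R \<omega> + \<omega>') = s *\<^sub>R trace M l f f' \<omega> + trace M l f f' \<omega>'"
  proof
    fix x show "trace M l f f' (s *\<^sub>R \<omega> + \<omega>') x = (s *\<^sub>R trace M l f f' \<omega> + trace M l f f' \<omega>') x"
    proof (cases "x \<in> f'")
      case True
      then obtain W \<eta> W' \<eta>' where E: "extends 0 l f \<omega> x W \<eta>" "extends 0 l f \<omega>' x W' \<eta>'"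
        using T unfolding traceable_def by metis
      have "x \<in> W \<inter> W'" using E by (auto simp: extends_def)
      then show ?thesis
        unfolding plus_fun_apply scaleR_fun_apply trace_props(2)[OF F T' True extends_comb[OF E]]
          trace_props(2)[OF F T(1) True E(1)] trace_props(2)[OF F T(2) True E(2)]
        by (auto simp: pullback_def restr_alt_def fun_eq_iff)
    next
      case False
      then show ?thesis using trace_props(1)[OF F] T T' by simp
    qed
  qed
qed

lemma Ck_cell_forms_traceable: "facet f f' \<Longrightarrow> \<omega> \<in> Ck_cell_forms M 0 f l \<Longrightarrow> traceable l f f' \<omega>"
  using facet_closure(1) unfolding Ck_cell_forms_iff traceable_def by blast

text \<open>A local extension of a form also extends its trace, because both are pullbacks of it.
  Hence traces keep their class, can be iterated, and can be differentiated through the same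
  extension.\<close>

lemma trace_extends:
  assumes F: "facet f f'" and \<omega>: "\<omega> \<in> Ck_cell_forms M 0 f l" and E: "extends m l f \<omega> x W \<eta>" and m: "m = 0 \<or> m = 1"
  shows "extends m l f' (trace M l f f' \<omega>) x W \<eta>"
proof -
  have "extends 0 l f \<omega> x W \<eta>" using E m extends_1_0 by blast
  then have "trace M l f f' \<omega> z = pullback M f' \<eta> z" if "z \<in> f' \<inter> W" for z
    using trace_props(2)[OF F Ck_cell_forms_traceable[OF F \<omega>], of z W \<eta>] extends_move that by blast
  then show ?thesis using E by (simp add: extends_def)
qed

lemma trace_Ck:
  assumes F: "facet f f'" and \<omega>: "\<omega> \<in> Ck_cell_forms M m f l" and m: "m = 0 \<or> m = 1"
  shows "trace M l f f' \<omega> \<in> Ck_cell_forms M m f' l"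
proof -
  have \<omega>0: "\<omega> \<in> Ck_cell_forms M 0 f l" using \<omega> m Ck_cell_forms_1_0 by blast
  then show ?thesis
    using trace_cell_forms[OF F Ck_cell_forms_traceable[OF F \<omega>0]] trace_extends[OF F \<omega>0 _ m]
      facet_closure(3)[OF F] \<omega> unfolding Ck_cell_forms_iff[of _ m] by blast
qed

text \<open>The result does not mention the intermediate edge \<open>e\<close>; this is what makes
  the contributions at a vertex from different edges comparable.\<close>

lemma trace_trace:
  assumes F: "facet f e" "facet e v" and \<omega>: "\<omega> \<in> Ck_cell_forms M 0 f l" and x: "x \<in> v" and E: "extends 0 l f \<omega> x W \<eta>"
  shows "trace M l e v (trace M l f e \<omega>) x = pullback M v \<eta> x"
proof (rule trace_props(2)[OF F(2) _ x])
  show "extends 0 l e (trace M l f e \<omega>) x W \<eta>" using trace_extends[OF F(1) \<omega> E] by simp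
  show "traceable l e v (trace M l f e \<omega>)"
    using Ck_cell_forms_traceable[OF F(2) trace_Ck[OF F(1) \<omega>]] by simp
qed

section \<open>The exterior derivative\<close>

lemma extends_differentiable:
  assumes E: "extends 1 l f \<omega> x W \<eta>" and c: "c \<in> charts M"
  defines "H us \<equiv> \<lambda>y. \<eta> (chart_inv c y) (map (tvec_of M c (chart_inv c y)) us)"
  shows "y \<in> chart_image c W \<Longrightarrow> (H us has_derivative frechet_derivative (H us) (at y)) (at y)"
    and "continuous_on (chart_image c W) (\<lambda>y. frechet_derivative (H us) (at y) u)"
    and "open (chart_image c W)"
proof -
  have "\<eta> \<in> Ck_forms M (Suc 0) W l" using E by (simp add: extends_def)
  then have C: "Ck_on (Suc 0) (H us) (chart_image c W)"
    using c unfolding Ck_forms_def Let_def H_def by blast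
  show op: "open (chart_image c W)" using E chart_openin_image[OF c] by (simp add: extends_def)
  show "continuous_on (chart_image c W) (\<lambda>y. frechet_derivative (H us) (at y) u)"
    using C unfolding Ck_on.simps by blast
  assume y: "y \<in> chart_image c W"
  have "H us differentiable_on chart_image c W" using C unfolding Ck_on.simps by (rule conjunct1)
  then have "H us differentiable (at y within chart_image c W)"
    using y unfolding differentiable_on_def by (rule bspec)
  then show "(H us has_derivative frechet_derivative (H us) (at y)) (at y)"
    unfolding at_within_open[OF y op] by (simp only: frechet_derivative_works[symmetric])
qed

text \<open>In a cell chart a short segment in a flat direction remains in \<open>f\<close>, where
  the form and its extension have the same components on flat vectors. The one-variable derivative
  used by \<open>ext_deriv\<close> is thus a directional derivative of the extension.\<close>

lemma line_derivative:
  assumes E: "extends 1 l f \<omega> x W \<eta>" and c: "cell_chart M f c" and x: "x \<in> f" "x \<in> fst c"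
    and u: "u \<in> flat (cdim M f)" and us: "set us \<subseteq> flat (cdim M f)"
  shows "((\<lambda>t. let z = chart_inv c (snd c x + t *\<^sub>R u) in \<omega> z (map (tvec_of M c z) us)) has_real_derivative
      frechet_derivative (\<lambda>y. \<eta> (chart_inv c y) (map (tvec_of M c (chart_inv c y)) us)) (at (snd c x)) u) (at 0)"
proof -
  have cM: "c \<in> charts M" using c cell_chart_in by blast
  define H where "H = (\<lambda>y. \<eta> (chart_inv c y) (map (tvec_of M c (chart_inv c y)) us))"
  have xW: "x \<in> W" using E by (simp add: extends_def)
  then have y: "snd c x \<in> chart_image c W" using x by blast
  note Hd = extends_differentiable(1)[OF E cM y, of us, folded H_def]
  have "((\<lambda>t. snd c x + t *\<^sub>R u) has_derivative (\<lambda>t. t *\<^sub>R u)) (at 0)"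
    by (auto intro!: derivative_eq_intros)
  moreover have "(H has_derivative frechet_derivative H (at (snd c x))) (at (snd c x + 0 *\<^sub>R u))"
    using Hd by simp
  ultimately have "((\<lambda>t. H (snd c x + t *\<^sub>R u)) has_derivative (\<lambda>t. frechet_derivative H (at (snd c x)) (t *\<^sub>R u))) (at 0)"
    by (rule has_derivative_compose)
  then have D: "((\<lambda>t. H (snd c x + t *\<^sub>R u)) has_real_derivative frechet_derivative H (at (snd c x)) u) (at 0)"
    using has_derivative_linear[OF Hd]
    by (simp add: has_field_derivative_def linear_scale mult.commute[of _ "frechet_derivative H (at (snd c x)) u"])
  have "openin (top_of_set (flat (cdim M f))) (chart_image c f \<inter> chart_image c W)"
    using c extends_differentiable(3)[OF E cM] unfolding cell_chart_def by (metis openin_Int_open)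
  then have "\<forall>\<^sub>F t in nhds 0. snd c x + t *\<^sub>R u \<in> chart_image c f \<inter> chart_image c W"
    by (rule eventually_line_openin[OF _ _ u]) (use x xW in auto)
  then have "\<forall>\<^sub>F t in nhds 0. H (snd c x + t *\<^sub>R u) =
      (let z = chart_inv c (snd c x + t *\<^sub>R u) in \<omega> z (map (tvec_of M c z) us))"
  proof eventually_elim
    case (elim t)
    then have "chart_inv c (snd c x + t *\<^sub>R u) \<in> f" "chart_inv c (snd c x + t *\<^sub>R u) \<in> W" "chart_inv c (snd c x + t *\<^sub>R u) \<in> fst c"
      using chart_image_iff[OF cM] chart_inv_in[OF cM] by blast+
    then show ?case using extends_apply[OF E c _ _ _ us] by (simp add: H_def Let_def)
  qed
  from DERIV_cong_ev[OF refl this refl] D show ?thesis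
    unfolding H_def by blast
qed

text \<open>The chart selected by \<open>SOME\<close> depends on \<open>f\<close> and
  \<open>x\<close> only. Exposing it once for all forms \<open>\<omega>\<close> is what permits
  linear combinations.\<close>

lemma ext_deriv_unfold:
  assumes f: "f \<in> cells M" and x: "x \<in> f" and vs: "set vs \<subseteq> cell_tspace M f x"
  obtains c us where "cell_chart M f c" "x \<in> fst c" "set us \<subseteq> flat (cdim M f)" "us = map (\<lambda>v. v c) vs"
    "\<And>\<omega>. ext_deriv M f \<omega> x vs = (\<Sum>i<length us. (-1) ^ i * deriv (\<lambda>t. let z = chart_inv c (snd c x + t *\<^sub>R us ! i) in
         \<omega> z (map (tvec_of M c z) (take i us @ drop (Suc i) us))) 0)"
proof -
  define c where "c = (SOME c. cell_chart M f c \<and> x \<in> fst c)"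
  have "\<exists>c. cell_chart M f c \<and> x \<in> fst c" using cell_chart_exists[OF f x] by blast
  then have c: "cell_chart M f c" "x \<in> fst c" unfolding c_def by (metis (mono_tags, lifting) someI_ex)+
  have "v c \<in> flat (cdim M f)" if "v \<in> set vs" for v
    using that vs tvec_comp_self[OF cell_chart_in[OF c(1)] c(2)] unfolding cell_tspace_eq[OF c(1) x c(2)] by auto
  then have "set (map (\<lambda>v. v c) vs) \<subseteq> flat (cdim M f)" by auto
  moreover have "ext_deriv M f \<omega> x vs = (\<Sum>i<length (map (\<lambda>v. v c) vs). (-1) ^ i * deriv (\<lambda>t. let z = chart_inv c (snd c x + t *\<^sub>R map (\<lambda>v. v c) vs ! i) in
         \<omega> z (map (tvec_of M c z) (take i (map (\<lambda>v. v c) vs) @ drop (Suc i) (map (\<lambda>v. v c) vs)))) 0)" for \<omega>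
    unfolding ext_deriv_def c_def Let_def using x vs by simp
  ultimately show thesis using that[OF c _ refl] by blast
qed

lemma ext_deriv_lin:
  assumes f: "f \<in> cells M"
  shows "lin_on (Ck_cell_forms M 1 f l) (ext_deriv M f)"
  unfolding lin_on_def
proof (intro ballI allI ext)
  fix p q s x vs assume p: "p \<in> Ck_cell_forms M 1 f l" and q: "q \<in> Ck_cell_forms M 1 f l"
  show "ext_deriv M f (s *\<^sub>R p + q) x vs = (s *\<^sub>R ext_deriv M f p + ext_deriv M f q) x vs"
  proof (cases "x \<in> f \<and> set vs \<subseteq> cell_tspace M f x")
    case True
    then have x: "x \<in> f" by simp
    obtain c us where c: "cell_chart M f c" "x \<in> fst c" and us: "set us \<subseteq> flat (cdim M f)"
      and eq: "\<And>\<omega>. ext_deriv M f \<omega> x vs = (\<Sum>i<length us. (-1) ^ i * deriv (\<lambda>t. let z = chart_inv c (snd c x + t *\<^sub>R us ! i) in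
         \<omega> z (map (tvec_of M c z) (take i us @ drop (Suc i) us))) 0)"
      by (rule ext_deriv_unfold[OF f x conjunct2[OF True]]) (rule that; assumption)
    obtain W \<eta> W' \<eta>' where E: "extends 1 l f p x W \<eta>" "extends 1 l f q x W' \<eta>'"
      using p q x closure_subset unfolding Ck_cell_forms_iff by (metis subsetD)
    let ?d = "\<lambda>\<omega> i t. let z = chart_inv c (snd c x + t *\<^sub>R us ! i) in \<omega> z (map (tvec_of M c z) (take i us @ drop (Suc i) us))"
    have "deriv (?d (s *\<^sub>R p + q) i) 0 = s * deriv (?d p i) 0 + deriv (?d q i) 0" if i: "i < length us" for i
    proof -
      have u: "us ! i \<in> flat (cdim M f)" "set (take i us @ drop (Suc i) us) \<subseteq> flat (cdim M f)"
        using us i set_take_subset[of i us] set_drop_subset[of "Suc i" us] nth_mem[OF i] by auto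
      note D = line_derivative[OF E(1) c(1) x c(2) u] line_derivative[OF E(2) c(1) x c(2) u]
      have "(\<lambda>t. ?d (s *\<^sub>R p + q) i t) = (\<lambda>t. s * ?d p i t + ?d q i t)"
        by (simp add: Let_def)
      then show ?thesis
        using DERIV_imp_deriv[OF DERIV_add[OF DERIV_cmult[OF D(1), of s] D(2)]]
          DERIV_imp_deriv[OF D(1)] DERIV_imp_deriv[OF D(2)] by simp
    qed
    then have "(\<Sum>i<length us. (-1) ^ i * deriv (?d (s *\<^sub>R p + q) i) 0)
        = (\<Sum>i<length us. s * ((-1) ^ i * deriv (?d p i) 0) + (-1) ^ i * deriv (?d q i) 0)"
      by (intro sum.cong refl) (simp add: distrib_left mult.left_commute)
    then show ?thesis
      unfolding plus_fun_apply scaleR_fun_apply eq by (simp add: sum.distrib sum_distrib_left)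
  next
    case False
    then show ?thesis unfolding ext_deriv_def plus_fun_apply scaleR_fun_apply by (simp only: if_False) simp
  qed
qed

text \<open>Frees the derivative of a 0-form from the selected chart: by the chain rule the
  derivative of the extension in the selected chart, applied to the transformed direction, equals
  the one in \<open>c\<close>.\<close>

lemma ext_deriv_0_form:
  assumes f: "f \<in> cells M" and E: "extends 1 0 f \<mu> x W \<eta>" and c: "cell_chart M f c" and x: "x \<in> f" "x \<in> fst c"
    and u: "u \<in> flat (cdim M f)"
  shows "ext_deriv M f \<mu> x [tvec_of M c x u] = frechet_derivative (\<lambda>y. \<eta> (chart_inv c y) []) (at (snd c x)) u"
proof -
  have cM: "c \<in> charts M" using c cell_chart_in by blast
  have v: "set [tvec_of M c x u] \<subseteq> cell_tspace M f x"
    using tvec_in_cell_tspace[OF c x(2) u] by simp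
  obtain c0 us where c0: "cell_chart M f c0" "x \<in> fst c0" and us: "set us \<subseteq> flat (cdim M f)" "us = map (\<lambda>v. v c0) [tvec_of M c x u]"
    and eq: "\<And>\<omega>. ext_deriv M f \<omega> x [tvec_of M c x u] = (\<Sum>i<length us. (-1) ^ i * deriv (\<lambda>t. let z = chart_inv c0 (snd c0 x + t *\<^sub>R us ! i) in
         \<omega> z (map (tvec_of M c0 z) (take i us @ drop (Suc i) us))) 0)"
    by (rule ext_deriv_unfold[OF f x(1) v]) (rule that; assumption)
  have c0M: "c0 \<in> charts M" using c0 cell_chart_in by blast
  have us': "us = [dtr c c0 x u]" using us(2) tvec_of_component[OF cM c0M c0(2)] by simp
  have w: "dtr c c0 x u \<in> flat (cdim M f)" using us(1) us' by simp
  define H where "H c = (\<lambda>y. \<eta> (chart_inv c y) [])" for c :: "'p chart"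
  have xW: "x \<in> W" using E by (simp add: extends_def)
  have "ext_deriv M f \<mu> x [tvec_of M c x u] = deriv (\<lambda>t. let z = chart_inv c0 (snd c0 x + t *\<^sub>R dtr c c0 x u) in
      \<mu> z (map (tvec_of M c0 z) [])) 0"
    unfolding eq us' by simp
  also have "\<dots> = frechet_derivative (H c0) (at (snd c0 x)) (dtr c c0 x u)"
    using DERIV_imp_deriv[OF line_derivative[OF E c0(1) x(1) c0(2) w, of "[]"]] by (simp add: H_def)
  also have "\<dots> = frechet_derivative (H c) (at (snd c x)) u"
  proof -
    have D: "(H c has_derivative frechet_derivative (H c) (at (snd c x))) (at ((snd c \<circ> chart_inv c0) (snd c0 x)))"
      using extends_differentiable(1)[OF E cM, of "snd c x" "[]"] x xW c0 c0M by (auto simp: H_def)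
    have "(H c \<circ> (snd c \<circ> chart_inv c0) has_derivative frechet_derivative (H c) (at (snd c x)) \<circ> dtr c0 c x) (at (snd c0 x))"
      by (rule diff_chain_at[OF dtr_has_derivative[OF c0M cM c0(2) x(2)] D])
    then have "(H c0 has_derivative frechet_derivative (H c) (at (snd c x)) \<circ> dtr c0 c x) (at (snd c0 x))"
    proof (rule has_derivative_transform_within_open[OF _ transition_open[OF c0M cM]])
      show "snd c0 x \<in> chart_image c0 (fst c)" using x c0 by blast
      show "(H c \<circ> (snd c \<circ> chart_inv c0)) y = H c0 y" if "y \<in> chart_image c0 (fst c)" for y
        using that chart_image_iff[OF c0M] chart_inv_left[OF cM] by (auto simp: H_def)
    qed
    then have "frechet_derivative (H c0) (at (snd c0 x)) = frechet_derivative (H c) (at (snd c x)) \<circ> dtr c0 c x"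
      by (rule frechet_derivative_at[symmetric])
    then show ?thesis
      using dtr_trans[OF cM c0M cM x(2) c0(2) x(2)] dtr_self[OF cM x(2)] by simp
  qed
  finally show ?thesis by (simp add: H_def)
qed

text \<open>The 0-form is only of class C1, so its second derivatives are taken from the C1
  extension of \<open>ext_deriv M f \<mu>\<close>. On the open cell that extension consists of the
  first derivatives of a function \<open>H\<close>, whose mixed derivatives are then continuous and
  symmetric.\<close>

lemma ext_deriv_ext_deriv:
  assumes f: "f \<in> cells M" and d: "cdim M f = 2" and \<mu>: "\<mu> \<in> Ck_cell_forms M 1 f 0"
    and d\<mu>: "ext_deriv M f \<mu> \<in> Ck_cell_forms M 1 f 1" and dd: "ext_deriv M f (ext_deriv M f \<mu>) \<in> cell_forms M f 2"
  shows "ext_deriv M f (ext_deriv M f \<mu>) = 0"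
proof (intro ext)
  fix x vs
  show "ext_deriv M f (ext_deriv M f \<mu>) x vs = 0 x vs"
  proof (rule ccontr)
    assume nz: "\<not> ?thesis"
    then have x: "x \<in> f" using cell_formsD(2)[OF dd, of x] by (cases "x \<in> f") auto
    then have "length vs = 2" and vs: "set vs \<subseteq> cell_tspace M f x"
      using alt_forms_support[OF cell_formsD(1)[OF dd x], of vs] nz by auto
    obtain c us where c: "cell_chart M f c" "x \<in> fst c" and us: "us = map (\<lambda>v. v c) vs"
      and eq: "\<And>\<omega>. ext_deriv M f \<omega> x vs = (\<Sum>i<length us. (-1) ^ i * deriv (\<lambda>t. let z = chart_inv c (snd c x + t *\<^sub>R us ! i) in
         \<omega> z (map (tvec_of M c z) (take i us @ drop (Suc i) us))) 0)"
      by (rule ext_deriv_unfold[OF f x vs]) (rule that; assumption)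
    have cM: "c \<in> charts M" using c cell_chart_in by blast
    obtain u w where uw: "us = [u, w]" using list_length_2[of us] us \<open>length vs = 2\<close> by auto
    have fl: "v \<in> flat (cdim M f)" "set ls \<subseteq> flat (cdim M f)" for v ls by (simp_all add: d flat_2)
    have xcl: "x \<in> closure f" using x closure_subset by blast
    obtain W \<eta> where E: "extends 1 0 f \<mu> x W \<eta>" using \<mu> xcl unfolding Ck_cell_forms_iff by blast
    obtain W' \<eta>' where E': "extends 1 1 f (ext_deriv M f \<mu>) x W' \<eta>'" using d\<mu> xcl unfolding Ck_cell_forms_iff by blast
    define S where "S = chart_image c f \<inter> (chart_image c W \<inter> chart_image c W')"
    have S: "open S" "snd c x \<in> S"
      using chart_openin_image[OF cM open_2_cell[OF f d]] extends_differentiable(3)[OF E cM] extends_differentiable(3)[OF E' cM]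
        E E' x c(2) by (auto simp: S_def extends_def)
    define H where "H y = \<eta> (chart_inv c y) []" for y
    define A where "A u y = \<eta>' (chart_inv c y) [tvec_of M c (chart_inv c y) u]" for u y
    define A' where "A' u y = frechet_derivative (A u) (at y)" for u y
    \<comment> \<open>Valid only over the cell itself, where both extensions represent their forms;
      \<open>S\<close> is open because 2-cells are open.\<close>
    have A_eq: "A u y = frechet_derivative H (at y) u" if "y \<in> S" for u y
    proof -
      let ?z = "chart_inv c y"
      have z: "?z \<in> f" "?z \<in> W" "?z \<in> W'" "?z \<in> fst c" "snd c ?z = y"
        using that[unfolded S_def Int_iff, unfolded chart_image_iff[OF cM]] chart_inv_in[OF cM, of y] chart_inv_right[OF cM, of y] by auto
      have "A u y = ext_deriv M f \<mu> ?z [tvec_of M c ?z u]"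
        using extends_apply[OF E' c(1) z(1,4,3) fl(2), of "[u]"] by (simp add: A_def)
      also have "\<dots> = frechet_derivative H (at y) u"
        using ext_deriv_0_form[OF f extends_move[OF E z(2)] c(1) z(1,4) fl(1)] z(5) by (simp add: H_def[abs_def])
      finally show ?thesis .
    qed
    have HD: "(H has_derivative (\<lambda>u. A u y)) (at y)" if "y \<in> S" for y
      using extends_differentiable(1)[OF E cM, of y "[]"] that A_eq[OF that] by (simp add: S_def H_def[abs_def])
    have AD: "(A u has_derivative A' u y) (at y)" if "y \<in> S" for u y
      using extends_differentiable(1)[OF E' cM, of y "[u]"] that by (simp add: S_def A_def[abs_def] A'_def)
    have Ac: "continuous_on S (\<lambda>y. A' u y w)" for u w
      using continuous_on_subset[OF extends_differentiable(2)[OF E' cM, of "[u]" w], of S]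
      by (auto simp: S_def A_def[abs_def] A'_def)
    have "A' w (snd c x) u = A' u (snd c x) w"
      by (rule mixed_derivatives_symmetric[OF S HD AD Ac])
    moreover have "ext_deriv M f (ext_deriv M f \<mu>) x vs = A' w (snd c x) u - A' u (snd c x) w"
    proof -
      have "deriv (\<lambda>t. let z = chart_inv c (snd c x + t *\<^sub>R u') in ext_deriv M f \<mu> z (map (tvec_of M c z) [w'])) 0 = A' w' (snd c x) u'" for u' w'
        using DERIV_imp_deriv[OF line_derivative[OF E' c(1) x c(2) fl, where us="[w']"]] by (simp add: A_def[abs_def] A'_def)
      then show ?thesis unfolding eq uw by (simp add: lessThan_Suc)
    qed
    ultimately show False using nz by simp
  qed
qed

text \<open>Let \<open>H\<close> be the extension of \<open>\<mu>\<close> in a boundary chart. The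
  right side is the derivative of \<open>H\<close> at \<open>x\<close>, since the same extension
  serves the trace. The left side is the limit, from inside \<open>f\<close>, of the components of
  \<open>ext_deriv M f \<mu>\<close>, which are derivatives of \<open>H\<close>; these are
  continuous.\<close>

lemma trace_ext_deriv:
  assumes F: "facet f e" and d: "cdim M e > 0" and \<mu>: "\<mu> \<in> Ck_cell_forms M 1 f 0" and d\<mu>: "ext_deriv M f \<mu> \<in> Ck_cell_forms M 0 f 1"
    and de: "ext_deriv M e (trace M 0 f e \<mu>) \<in> cell_forms M e 1"
  shows "trace M 1 f e (ext_deriv M f \<mu>) = ext_deriv M e (trace M 0 f e \<mu>)"
proof
  fix x
  note T = Ck_cell_forms_traceable[OF F d\<mu>]
  note fp = cell_subset[OF facetD(1)[OF F]]
  have \<mu>0: "\<mu> \<in> Ck_cell_forms M 0 f 0" using \<mu> Ck_cell_forms_1_0 by blast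
  show "trace M 1 f e (ext_deriv M f \<mu>) x = ext_deriv M e (trace M 0 f e \<mu>) x"
  proof (cases "x \<in> e")
    case x: True
    have xcl: "x \<in> closure f" using facet_closure(1)[OF F] x by blast
    obtain c where c: "x \<in> fst c" "cell_chart M f c" "cell_chart M e c" by (rule facet_chart[OF F x])
    have cM: "c \<in> charts M" using c cell_chart_in by blast
    obtain W \<eta> where E: "extends 1 0 f \<mu> x W \<eta>" using \<mu> xcl unfolding Ck_cell_forms_iff by blast
    obtain W' \<eta>' where E': "extends 0 1 f (ext_deriv M f \<mu>) x W' \<eta>'" using d\<mu> xcl unfolding Ck_cell_forms_iff by blast
    show ?thesis
    proof (rule alt_forms_eqI[OF cell_formsD(1)[OF trace_cell_forms[OF F T] x] cell_formsD(1)[OF de x]])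
      fix vs assume vs: "int (length vs) = 1" "set vs \<subseteq> cell_tspace M e x"
      then obtain us where us: "vs = map (tvec_of M c x) us" "set us \<subseteq> flat (cdim M e)"
        using cell_tspace_list[OF c(3) x c(1)] by blast
      then obtain u where u: "vs = [tvec_of M c x u]" "u \<in> flat (cdim M e)" "set [u] \<subseteq> flat (cdim M e)"
        using vs(1) list_length_1[of us] by auto
      have u': "u \<in> flat (cdim M f)" "set [u] \<subseteq> flat (cdim M f)"
        using u(2) flat_mono[of "cdim M e" "cdim M f"] facetD(4)[OF F] by auto
      define H where "H = (\<lambda>y. \<eta> (chart_inv c y) [])"
      have "trace M 1 f e (ext_deriv M f \<mu>) x vs = \<eta>' x [tvec_of M c x u]"
        unfolding u(1) trace_props(2)[OF F T x E'] using pullback_tvec[OF c(3) x c(1) u(3)] by simp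
      moreover have "ext_deriv M e (trace M 0 f e \<mu>) x vs = frechet_derivative H (at (snd c x)) u"
        unfolding u(1) H_def
        by (rule ext_deriv_0_form[OF facetD(2)[OF F] trace_extends[OF F \<mu>0 E] c(3) x c(1) u(2)]) simp
      moreover have "\<eta>' x [tvec_of M c x u] = frechet_derivative H (at (snd c x)) u"
      proof (rule tendsto_unique[OF at_facet_nontrivial[OF F x]])
        have xW: "x \<in> fst c \<inter> W" "x \<in> fst c \<inter> W'" using E E' c by (auto simp: extends_def)
        show "((\<lambda>z. \<eta>' z (map (tvec_of M c z) [u])) \<longlongrightarrow> \<eta>' x [tvec_of M c x u]) (at x within f)"
          using tendsto_within_cell[OF extends_openin[OF E' cM] xW(2) extends_continuous[OF E' cM, of "[u]"] fp] by simp
        have "continuous_on (fst c \<inter> W) (\<lambda>z. frechet_derivative H (at (snd c z)) u)"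
          by (rule continuous_on_compose2[OF extends_differentiable(2)[OF E cM, of "[]" u, unfolded list.map, folded H_def]
            continuous_on_subset[OF chart_cont[OF cM]]]) auto
        then have "((\<lambda>z. frechet_derivative H (at (snd c z)) u) \<longlongrightarrow> frechet_derivative H (at (snd c x)) u) (at x within f)"
          by (rule tendsto_within_cell[OF extends_openin[OF E cM] xW(1) _ fp])
        moreover have "\<forall>\<^sub>F z in at x within f. frechet_derivative H (at (snd c z)) u = \<eta>' z (map (tvec_of M c z) [u])"
          using eventually_within_cell[OF extends_openin[OF E cM] xW(1) fp]
            eventually_within_cell[OF extends_openin[OF E' cM] xW(2) fp]
        proof eventually_elim
          case (elim z)
          then have z: "z \<in> f" "z \<in> fst c" "z \<in> W" "z \<in> W'" by auto
          have "ext_deriv M f \<mu> z [tvec_of M c z u] = frechet_derivative H (at (snd c z)) u"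
            unfolding H_def by (rule ext_deriv_0_form[OF facetD(1)[OF F] extends_move[OF E z(3)] c(2) z(1,2) u'(1)])
          then show ?case using extends_apply[OF E' c(2) z(1,2,4) u'(2)] by simp
        qed
        ultimately show "((\<lambda>z. \<eta>' z (map (tvec_of M c z) [u])) \<longlongrightarrow> frechet_derivative H (at (snd c x)) u) (at x within f)"
          by (rule Lim_transform_eventually)
      qed
      ultimately show "trace M 1 f e (ext_deriv M f \<mu>) x vs = ext_deriv M e (trace M 0 f e \<mu>) x vs" by simp
    qed
  next
    case False
    then show ?thesis using trace_props(1)[OF F T] cell_formsD(2)[OF de] by simp
  qed
qed

end

section \<open>Orientations\<close>

lemma sgn_constant:
  fixes g :: "'a::topological_space \<Rightarrow> real"
  assumes "connected S" "continuous_on S g" "\<And>y. y \<in> S \<Longrightarrow> g y \<noteq> 0"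
  shows "\<exists>s. (s = 1 \<or> s = -1) \<and> (\<forall>y\<in>S. sgn (g y) = s)"
proof (cases "S = {}")
  case False
  then obtain y0 where y0: "y0 \<in> S" by blast
  have I: "connected (g ` S)" using connected_continuous_image assms(1,2) by blast
  have no: "\<not> (g y < 0 \<and> 0 < g z)" if "y \<in> S" "z \<in> S" for y z
  proof
    assume "g y < 0 \<and> 0 < g z"
    then have "0 \<in> g ` S" using I[unfolded connected_iff_interval] that by (meson image_eqI less_imp_le)
    then show False using assms(3) by auto
  qed
  have "sgn (g y) = sgn (g y0)" if "y \<in> S" for y
    using no[OF that y0] no[OF y0 that] assms(3)[OF that] assms(3)[OF y0] by (auto simp: sgn_if)
  moreover have "sgn (g y0) = 1 \<or> sgn (g y0) = -1" using assms(3)[OF y0] by (auto simp: sgn_if)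
  ultimately show ?thesis by blast
qed auto

lemma eventually_sgn_eq:
  fixes g :: "'a \<Rightarrow> real"
  assumes "(g \<longlongrightarrow> l) F" "l \<noteq> 0"
  shows "\<forall>\<^sub>F z in F. sgn (g z) = sgn l"
proof (cases "l > 0")
  case True
  have "\<forall>\<^sub>F z in F. g z > 0" using order_tendstoD(1)[OF assms(1) True] .
  then show ?thesis by eventually_elim (use True in simp)
next
  case False
  then have l: "l < 0" using assms(2) by simp
  have "\<forall>\<^sub>F z in F. g z < 0" using order_tendstoD(2)[OF assms(1) l] .
  then show ?thesis by eventually_elim (use l in simp)
qed

context riem_mesh
begin

text \<open>Tells whether the chart is positively oriented for \<open>f\<close> at \<open>z\<close>.
  For a vertex the basis is empty, and this is the sign attached to the point, whatever the
  chart.\<close>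

definition osgn :: "'p set \<Rightarrow> 'p chart \<Rightarrow> 'p \<Rightarrow> real" where
  "osgn f c z = sgn (orient M f z (map (tvec_of M c z) (ebasis (cdim M f))))"

lemma orient_cell_form: "f \<in> cells M \<Longrightarrow> x \<in> f \<Longrightarrow> orient M f x \<in> alt_forms (int (cdim M f)) (cell_tspace M f x)"
  using cell_facts(5)[of f] by (auto simp: oriented_cell_def cell_forms_def)

lemma orient_basis_nonzero:
  assumes "f \<in> cells M" "cell_chart M f c" "z \<in> f" "z \<in> fst c" "cdim M f = 1 \<or> cdim M f = 2"
  shows "orient M f z (map (tvec_of M c z) (ebasis (cdim M f))) \<noteq> 0"
  using density_pos[OF assms] by (auto simp: density_def)

lemma osgn_unit:
  assumes "f \<in> cells M" "cell_chart M f c" "z \<in> f" "z \<in> fst c" "cdim M f = 1 \<or> cdim M f = 2"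
  shows "osgn f c z = 1 \<or> osgn f c z = -1"
  using orient_basis_nonzero[OF assms] by (auto simp: osgn_def sgn_if)

lemma orient_continuous:
  assumes "f \<in> cells M" "cell_chart M f c"
  shows "continuous_on (chart_image c f) (\<lambda>y. orient M f (chart_inv c y) (map (tvec_of M c (chart_inv c y)) (ebasis (cdim M f))))"
    and "continuous_on (fst c \<inter> f) (\<lambda>z. orient M f z (map (tvec_of M c z) (ebasis (cdim M f))))"
proof -
  have "continuous_on (chart_image c f) (\<lambda>y. let x = chart_inv c y in
      orient M f x (map (tvec_of M c x) (ebasis (cdim M f))))"
    using cell_facts(5)[OF assms(1)] assms(2) unfolding oriented_cell_def by blast
  then show 1: "continuous_on (chart_image c f) (\<lambda>y. orient M f (chart_inv c y) (map (tvec_of M c (chart_inv c y)) (ebasis (cdim M f))))"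
    by (simp add: Let_def)
  then show "continuous_on (fst c \<inter> f) (\<lambda>z. orient M f z (map (tvec_of M c z) (ebasis (cdim M f))))"
    using chart_cont_iff[OF cell_chart_in[OF assms(2)], of f "\<lambda>z. orient M f z (map (tvec_of M c z) (ebasis (cdim M f)))"] by simp
qed

text \<open>Inside a small coordinate ball the cell is a convex set, hence connected, and the volume
  form has no zero there. The point \<open>x\<close> may lie outside \<open>f\<close>, which is how
  it is used at facets.\<close>

lemma osgn_near:
  assumes f: "f \<in> cells M" and d: "cdim M f = 1 \<or> cdim M f = 2" and c: "cell_chart M f c" and x: "x \<in> fst c"
    and C: "chart_image c f = chart_range c \<inter> C" "convex C"
  obtains N s where "openin (top_of_set (pts M)) N" "x \<in> N" "N \<subseteq> fst c" "s = 1 \<or> s = -1"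
    "\<And>z. z \<in> N \<inter> f \<Longrightarrow> osgn f c z = s"
proof -
  have cM: "c \<in> charts M" using c cell_chart_in by blast
  obtain r where r: "r > 0" "ball (snd c x) r \<subseteq> chart_range c"
    using chart_open_range[OF cM] x open_contains_ball by (metis imageI)
  let ?S = "ball (snd c x) r \<inter> C"
  let ?g = "\<lambda>y. orient M f (chart_inv c y) (map (tvec_of M c (chart_inv c y)) (ebasis (cdim M f)))"
  have S: "?S \<subseteq> chart_image c f" using r(2) C(1) by blast
  have "?g y \<noteq> 0" if "y \<in> ?S" for y
    using S that chart_image_iff[OF cM, of y f] chart_inv_in[OF cM, of y] orient_basis_nonzero[OF f c _ _ d] by blast
  then obtain s where s: "s = 1 \<or> s = -1" "\<And>y. y \<in> ?S \<Longrightarrow> sgn (?g y) = s"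
    using sgn_constant[OF convex_connected[OF convex_Int[OF convex_ball C(2)]] continuous_on_subset[OF orient_continuous(1)[OF f c] S]]
    by blast
  show thesis
  proof (rule that[of "{z \<in> fst c. snd c z \<in> ball (snd c x) r}" s])
    show "openin (top_of_set (pts M)) {z \<in> fst c. snd c z \<in> ball (snd c x) r}" by (rule chart_openin_preimage[OF cM open_ball])
    show "osgn f c z = s" if z: "z \<in> {z \<in> fst c. snd c z \<in> ball (snd c x) r} \<inter> f" for z
    proof -
      have "snd c z \<in> chart_image c f" using z by blast
      then have "snd c z \<in> ?S" using z C(1) by blast
      then show ?thesis using s(2)[of "snd c z"] z chart_inv_left[OF cM] by (simp add: osgn_def)
    qed
  qed (use r x s in auto)
qed

definition half_space :: "nat \<Rightarrow> (real^2) set" where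
  "half_space d = {y \<in> flat d. 0 < y $ of_nat d}"

lemma convex_half_space: "convex (half_space d)"
proof -
  have "half_space d = flat d \<inter> {y. 0 < y $ of_nat d}" by (auto simp: half_space_def)
  moreover have "convex {y :: real^2. 0 < y $ of_nat d}"
    using convex_halfspace_gt[of 0 "axis (of_nat d) 1 :: real^2"] by (simp add: inner_axis')
  ultimately show ?thesis using convex_Int[OF subspace_imp_convex[OF subspace_flat]] by simp
qed

lemma bdry_chart_images:
  assumes "bdry_chart M f f' c" "cdim M f = Suc (cdim M f')"
  shows "chart_image c f = chart_range c \<inter> half_space (cdim M f)" "chart_image c f' = chart_range c \<inter> flat (cdim M f')"
  using assms by (auto simp: bdry_chart_def half_space_def)

section \<open>The normal component of a 1-form on an edge\<close>

lemma regular_0_form: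
  assumes f: "f \<in> cells M" and d: "cdim M f = 1 \<or> cdim M f = 2" and \<beta>: "\<beta> \<in> cell_forms M f 0"
    and c: "continuous_on f (\<lambda>x. \<beta> x [])" and C: "\<And>x. x \<in> f \<Longrightarrow> (\<beta> x [])\<^sup>2 \<le> C"
  shows "\<beta> \<in> regular_forms f 0"
  unfolding regular_forms_def
proof (intro CollectI conjI allI impI \<beta>)
  fix c us assume c': "cell_chart M f c"
  have e: "\<beta> x (map (tvec_of M c x) us) = (if us = [] then \<beta> x [] else 0)" if "x \<in> f" for x
    using alt_forms_0_apply[OF cell_formsD(1)[OF \<beta> that], of "map (tvec_of M c x) us"] by (cases us) auto
  have "continuous_on (fst c \<inter> f) (\<lambda>x. if us = [] then \<beta> x [] else 0)"
    using continuous_on_subset[OF c, of "fst c \<inter> f"] by (cases "us = []") auto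
  then show "continuous_on (fst c \<inter> f) (\<lambda>x. \<beta> x (map (tvec_of M c x) us))"
    by (rule continuous_on_eq) (use e in auto)
next
  have "form_inner M f x (\<beta> x) (\<beta> x) \<le> C" if x: "x \<in> f" for x
  proof -
    obtain c where "cell_chart M f c" "x \<in> fst c" using cell_chart_exists[OF f x] .
    then show ?thesis
      using form_inner_0[OF f _ x _ d cell_formsD(1)[OF \<beta> x] cell_formsD(1)[OF \<beta> x]] C[OF x] by (simp add: power2_eq_square)
  qed
  then show "\<exists>C. \<forall>x\<in>f. form_inner M f x (\<beta> x) (\<beta> x) \<le> C" by blast
qed

text \<open>Solving the equations of \<open>star_rel_1_of_2\<close> for the components of the
  inverse star involves \<open>\<beta>\<close>, metric coefficients and
  \<open>v = s * sqrt gdet\<close>. Once the sign \<open>s\<close> is constant, this formula is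
  continuous beyond \<open>f\<close>. \<open>a1\<close> is the component along the edge and
  \<open>Q\<close> the squared norm of \<open>p\<close>; their inequality is Cauchy-Schwarz, the
  star being an isometry.\<close>

lemma star_inv_extends:
  assumes F: "facet f e" and d: "cdim M f = 2" and p: "p \<in> Ck_cell_forms M 0 f 1" and x: "x \<in> e"
    and b: "bdry_chart M f e b" "x \<in> fst b"
  obtains W \<eta> a1 Q where "extends 0 1 f (star_inv M f 1 p) x W \<eta>" "W \<subseteq> fst b"
    "continuous_on W a1" "continuous_on W Q" "\<And>z. z \<in> W \<Longrightarrow> \<eta> z [tvec_of M b z (axis 1 1)] = a1 z"
    "\<And>z. z \<in> W \<Longrightarrow> (a1 z)\<^sup>2 \<le> G11 b z * Q z"
    "\<And>z. z \<in> W \<inter> f \<Longrightarrow> Q z = form_inner M f z (p z) (p z)"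
proof -
  have f: "f \<in> cells M" and de: "cdim M f = Suc (cdim M e)" using facetD[OF F] by auto
  have d': "cdim M f = 1 \<or> cdim M f = 2" using d by simp
  have bc: "cell_chart M f b" using bdry_chart_cell_charts[OF b(1) de] by blast
  have bM: "b \<in> charts M" using bc cell_chart_in by blast
  have "x \<in> closure f" using facet_closure(1)[OF F] x by blast
  then obtain W0 \<eta>0 where E0: "extends 0 1 f p x W0 \<eta>0" using p unfolding Ck_cell_forms_iff by blast
  \<comment> \<open>A boundary chart shows \<open>f\<close> near \<open>x\<close> as part of one
    half space, so a single sign is valid for all nearby points of \<open>f\<close>.\<close>
  obtain N s where N: "openin (top_of_set (pts M)) N" "x \<in> N" "N \<subseteq> fst b" and s: "s = 1 \<or> s = -1"
    "\<And>z. z \<in> N \<inter> f \<Longrightarrow> osgn f b z = s"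
    using osgn_near[OF f d' bc b(2) bdry_chart_images(1)[OF b(1) de] convex_half_space] by metis
  define W where "W = W0 \<inter> N"
  have W: "openin (top_of_set (pts M)) W" "x \<in> W" "W \<subseteq> fst b"
    using E0 N by (auto simp: W_def extends_def openin_Int)
  define \<beta> where "\<beta> i z = \<eta>0 z [tvec_of M b z (axis i 1)]" for i :: 2 and z
  have \<beta>c: "continuous_on W (\<beta> i)" for i
    using continuous_on_subset[OF extends_continuous[OF E0 bM, of "[axis i 1]"], of W] W(3)
    by (auto simp: \<beta>_def[abs_def] W_def)
  note gc = continuous_on_subset[OF gm_continuous[OF bM] W(3)] continuous_on_subset[OF gdet_continuous[OF bM] W(3)]
  have gp: "G11 b z > 0" "gdet b z > 0" if "z \<in> W" for z using gram_pos[OF bM] that W(3) by blast+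
  \<comment> \<open>The two equations of \<open>star_rel_1_of_2\<close>, divided by the component of
    the volume form.\<close>
  define a1 where "a1 z = (G11 b z * \<beta> 2 z - G12 b z * \<beta> 1 z) / (s * sqrt (gdet b z))" for z
  define a2 where "a2 z = (G12 b z * \<beta> 2 z - G22 b z * \<beta> 1 z) / (s * sqrt (gdet b z))" for z
  define Q where "Q z = (G22 b z * \<beta> 1 z * \<beta> 1 z - G12 b z * (\<beta> 1 z * \<beta> 2 z + \<beta> 2 z * \<beta> 1 z) + G11 b z * \<beta> 2 z * \<beta> 2 z) / gdet b z" for z
  have s0: "s \<noteq> 0" using s(1) by auto
  have ac: "continuous_on W a1" "continuous_on W a2" "continuous_on W Q"
    unfolding a1_def[abs_def] a2_def[abs_def] Q_def[abs_def]
    by (intro continuous_intros gc \<beta>c; use gp s0 in force)+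
  define \<eta> where "\<eta> z = (if z \<in> W then one_form (tspace M z) (\<lambda>v. a1 z * v b $ 1 + a2 z * v b $ 2) else 0)" for z
  have \<eta>_alt: "\<eta> z \<in> alt_forms 1 (tspace M z)" if "z \<in> W" for z
  proof -
    have "z \<in> pts M" using that W(3) chart_subset[OF bM] by blast
    then have "one_form (tspace M z) (\<lambda>v. a1 z * v b $ 1 + a2 z * v b $ 2) \<in> alt_forms 1 (tspace M z)"
      by (intro one_form_in subspace_tspace) (auto simp: lin_on_def algebra_simps)
    then show ?thesis using that by (simp add: \<eta>_def)
  qed
  have \<eta>_tvec: "\<eta> z [tvec_of M c z u] = a1 z * dtr c b z u $ 1 + a2 z * dtr c b z u $ 2"
    if "z \<in> W" "c \<in> charts M" "z \<in> fst c" for z c u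
    using that W(3) tvec_in_tspace[OF that(2,3)] tvec_of_component[OF that(2) bM, of z u] by (auto simp: \<eta>_def one_form_apply)
  have "\<eta> \<in> Ck_forms M 0 W 1"
    unfolding Ck_forms_0_iff
  proof (intro conjI ballI allI impI \<eta>_alt)
    fix c us assume c: "c \<in> charts M"
    show "continuous_on (fst c \<inter> W) (\<lambda>x. \<eta> x (map (tvec_of M c x) us))"
    proof (cases "length us = 1")
      case True
      then obtain u where u: "us = [u]" using list_length_1 by metis
      have "continuous_on (fst c \<inter> W) (\<lambda>z. a1 z * dtr c b z u $ 1 + a2 z * dtr c b z u $ 2)"
        using W(3) by (intro continuous_intros continuous_on_subset[OF ac(1)] continuous_on_subset[OF ac(2)]
            continuous_on_subset[OF dtr_continuous[OF c bM]]) auto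
      then show ?thesis unfolding u by (rule continuous_on_eq) (use \<eta>_tvec c in auto)
    next
      case False
      then have "\<eta> x (map (tvec_of M c x) us) = 0" if "x \<in> W" for x
        using alt_forms_support(1)[OF \<eta>_alt[OF that], of "map (tvec_of M c x) us"] by auto
      then show ?thesis by (intro continuous_on_eq[OF continuous_on_const[of _ 0]]) auto
    qed
  qed (auto simp: \<eta>_def)
  have pcf: "p \<in> cell_forms M f (int (cdim M f) - int 1)" using p d by (simp add: Ck_cell_forms_iff)
  have ext: "star_inv M f 1 p z = pullback M f \<eta> z" "Q z = form_inner M f z (p z) (p z)" if z: "z \<in> f \<inter> W" for z
  proof -
    have zf: "z \<in> f" "z \<in> fst b" "z \<in> W0" "z \<in> N" "z \<in> W" using z W(3) by (auto simp: W_def)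
    note T2 = T_2[OF f bc zf(1,2) d]
    have pz: "p z \<in> alt_forms 1 (cell_tspace M f z)" using cell_formsD(1)[OF pcf zf(1)] d by simp
    have p\<beta>: "p z [tvec_of M b z (axis i 1)] = \<beta> i z" for i
      using extends_apply[OF E0 bc zf(1,2,3), of "[axis i 1]"] d by (simp add: \<beta>_def flat_2)
    have p0: "p z [] = 0" "p z [v, w] = 0" for v w
      using alt_forms_support(1)[OF pz, of "[]"] alt_forms_support(1)[OF pz, of "[v, w]"] by auto
    show "Q z = form_inner M f z (p z) (p z)"
      unfolding form_inner_2[OF f bc zf(1,2) d pz pz] p\<beta> p0 Q_def by simp
    let ?v = "orient M f z [tvec_of M b z (axis 1 1), tvec_of M b z (axis 2 1)]"
    have "sgn ?v = s" using s(2)[of z] zf d by (simp add: osgn_def ebasis_simps)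
    moreover have "?v\<^sup>2 = gdet b z" using orient_basis_sq(2)[OF f bc zf(1,2) d] .
    then have "\<bar>?v\<bar> = sqrt (gdet b z)" by (metis real_sqrt_abs)
    ultimately have v: "?v = s * sqrt (gdet b z)" by (metis sgn_mult_abs)
    define \<omega> where "\<omega> = star_inv M f 1 p z"
    have k1: "1 \<le> cdim M f" using d by simp
    have \<omega>: "\<omega> \<in> alt_forms 1 (cell_tspace M f z)"
      using cell_formsD(1)[OF star_inv_in[OF f d' k1 pcf] zf(1)] by (simp add: \<omega>_def)
    have "star_rel f z 1 \<omega> (p z)"
      using star_props(2)[OF f d' k1 star_inv_in[OF f d' k1 pcf] zf(1)] star_star_inv[OF f d' k1 pcf] by (simp add: \<omega>_def)
    then have R: "?v * \<omega> [tvec_of M b z (axis 1 1)] = G11 b z * \<beta> 2 z - G12 b z * \<beta> 1 z"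
      "?v * \<omega> [tvec_of M b z (axis 2 1)] = G12 b z * \<beta> 2 z - G22 b z * \<beta> 1 z"
      using star_rel_1_of_2[OF f bc zf(1,2) d \<omega> pz refl] unfolding p\<beta> by auto
    have v0: "s * sqrt (gdet b z) \<noteq> 0" using gp(2)[OF zf(5)] s0 by simp
    have \<omega>b: "\<omega> [tvec_of M b z (axis 1 1)] = a1 z" "\<omega> [tvec_of M b z (axis 2 1)] = a2 z"
      using R v0 unfolding v a1_def a2_def by (simp_all add: field_simps)
    have "pullback M f \<eta> z \<in> alt_forms 1 (cell_tspace M f z)"
      using pullback_alt_forms[OF f zf(1,5) \<open>\<eta> \<in> Ck_forms M 0 W 1\<close>] .
    moreover have "pullback M f \<eta> z [tvec_of M b z (axis i 1)] = (if i = 1 then a1 z else a2 z)" for i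
    proof -
      have "pullback M f \<eta> z [tvec_of M b z (axis i 1)] = \<eta> z [tvec_of M b z (axis i 1)]"
        using pullback_tvec[OF bc zf(1,2), of "[axis i 1]" \<eta>] d by (simp add: flat_2)
      also have "\<dots> = (if i = 1 then a1 z else a2 z)"
        unfolding \<eta>_tvec[OF zf(5) bM zf(2)] dtr_self[OF bM zf(2)] using exhaust_2[of i] by (auto simp: axis_def)
      finally show ?thesis .
    qed
    ultimately have "\<omega> = pullback M f \<eta> z"
      using \<omega>b alt_forms_1_eqI[OF T_subspace[OF f bc zf(1,2)] T2(1) T2(1) T2(2) \<omega>] by simp
    then show "star_inv M f 1 p z = pullback M f \<eta> z" by (simp add: \<omega>_def)
  qed
  show thesis
  proof (rule that[of W \<eta> a1 Q])
    show "extends 0 1 f (star_inv M f 1 p) x W \<eta>"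
      using W ext(1) \<open>\<eta> \<in> Ck_forms M 0 W 1\<close> by (simp add: extends_def)
    show "\<eta> z [tvec_of M b z (axis 1 1)] = a1 z" if "z \<in> W" for z
      using \<eta>_tvec[OF that bM, of "axis 1 1"] dtr_self[OF bM, of z] W(3) that by (auto simp: axis_def)
    show "(a1 z)\<^sup>2 \<le> G11 b z * Q z" if z: "z \<in> W" for z
    proof -
      have "s\<^sup>2 = 1" using s(1) by auto
      then have "(a1 z)\<^sup>2 = (G11 b z * \<beta> 2 z - G12 b z * \<beta> 1 z)\<^sup>2 / gdet b z"
        using gp[OF z] by (simp add: a1_def power_divide power_mult_distrib)
      also have "\<dots> \<le> ((G11 b z * \<beta> 2 z - G12 b z * \<beta> 1 z)\<^sup>2 + gdet b z * (\<beta> 1 z)\<^sup>2) / gdet b z"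
        using gp[OF z] by (intro divide_right_mono) auto
      also have "(G11 b z * \<beta> 2 z - G12 b z * \<beta> 1 z)\<^sup>2 + gdet b z * (\<beta> 1 z)\<^sup>2 =
         G11 b z * (G22 b z * \<beta> 1 z * \<beta> 1 z - G12 b z * (\<beta> 1 z * \<beta> 2 z + \<beta> 2 z * \<beta> 1 z) + G11 b z * \<beta> 2 z * \<beta> 2 z)"
        by (simp add: gdet_def power2_eq_square algebra_simps)
      finally show ?thesis by (simp add: Q_def)
    qed
    show "Q z = form_inner M f z (p z) (p z)" if "z \<in> W \<inter> f" for z using ext(2) that by blast
  qed (use ac W in auto)
qed

text \<open>The star of the trace on the edge is the scalar \<open>a1\<close> divided by the
  component of the edge's volume form, whose square is \<open>G11\<close>. Its square is at most
  \<open>Q\<close>, hence at most the bound for \<open>p\<close> on \<open>f\<close>. The bound is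
  uniform along the edge, although nothing is known at the end points.\<close>

lemma star_inv_trace:
  assumes F: "facet f e" and d: "cdim M f = 2" and p: "p \<in> Ck_cell_forms M 0 f 1"
  shows "traceable 1 f e (star_inv M f 1 p)"
    and "star M e 1 (trace M 1 f e (star_inv M f 1 p)) \<in> regular_forms e 0"
proof -
  note f = facetD(1)[OF F] and e = facetD(2)[OF F]
  have de: "cdim M e = 1" using facetD(4)[OF F] d by simp
  have de': "cdim M e = 1 \<or> cdim M e = 2" "1 \<le> cdim M e" and d': "cdim M f = 1 \<or> cdim M f = 2" using de d by auto
  have ex: "\<exists>b W \<eta> a1 Q. x \<in> fst b \<and> cell_chart M e b \<and> extends 0 1 f (star_inv M f 1 p) x W \<eta> \<and> W \<subseteq> fst b \<and>
    continuous_on W a1 \<and> continuous_on W Q \<and> (\<forall>z\<in>W. \<eta> z [tvec_of M b z (axis 1 1)] = a1 z) \<and>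
    (\<forall>z\<in>W. (a1 z)\<^sup>2 \<le> G11 b z * Q z) \<and> (\<forall>z\<in>W \<inter> f. Q z = form_inner M f z (p z) (p z))" if x: "x \<in> e" for x
  proof -
    obtain b where b: "bdry_chart M f e b" "x \<in> fst b" "cell_chart M e b" using facet_chart[OF F x] by metis
    obtain W \<eta> a1 Q where "extends 0 1 f (star_inv M f 1 p) x W \<eta>" "W \<subseteq> fst b"
    "continuous_on W a1" "continuous_on W Q" "\<And>z. z \<in> W \<Longrightarrow> \<eta> z [tvec_of M b z (axis 1 1)] = a1 z"
    "\<And>z. z \<in> W \<Longrightarrow> (a1 z)\<^sup>2 \<le> G11 b z * Q z"
    "\<And>z. z \<in> W \<inter> f \<Longrightarrow> Q z = form_inner M f z (p z) (p z)"
      using star_inv_extends[OF F d p x b(1,2)] by metis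
    then show ?thesis using b by (intro exI[of _ b] exI[of _ W] exI[of _ \<eta>] exI[of _ a1] exI[of _ Q]) auto
  qed
  show T: "traceable 1 f e (star_inv M f 1 p)"
    unfolding traceable_def using ex by metis
  define \<omega> where "\<omega> = trace M 1 f e (star_inv M f 1 p)"
  have \<omega>: "\<omega> \<in> cell_forms M e (int 1)" unfolding \<omega>_def using trace_cell_forms[OF F T] by simp
  define \<beta> where "\<beta> = star M e 1 \<omega>"
  have \<beta>: "\<beta> \<in> cell_forms M e 0" unfolding \<beta>_def using star_props(1)[OF e de' \<omega>] de by simp
  obtain C where C: "\<And>x. x \<in> f \<Longrightarrow> form_inner M f x (p x) (p x) \<le> C"
    using regular_bounded Ck_cell_forms_regular[OF f d'] p by blast
  have \<beta>_eq: "\<beta> x [] * orient M e x [tvec_of M b x (axis 1 1)] = \<omega> x [tvec_of M b x (axis 1 1)]"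
    if x: "x \<in> e" "x \<in> fst b" and b: "cell_chart M e b" for x b
  proof -
    obtain t where t: "\<omega> x = t *\<^sub>R orient M e x"
      using top_form_multiple[OF e b x de'(1)] cell_formsD(1)[OF \<omega> x(1)] de by auto
    have "star_rel e x 1 (\<omega> x) (zero_form t)" using star_rel_top[OF e b x de'(1), of t] t de by simp
    then have "\<beta> x = zero_form t"
      using star_rel_unique[OF e b x de'(1)] star_props(2)[OF e de' \<omega> x(1)] unfolding \<beta>_def by blast
    then show ?thesis by (simp add: t)
  qed
  have loc: "\<exists>W. openin (top_of_set (pts M)) W \<and> x \<in> W \<and> continuous_on (W \<inter> e) (\<lambda>x. \<beta> x []) \<and> (\<beta> x [])\<^sup>2 \<le> C"
    if x: "x \<in> e" for x
  proof -
    obtain b W \<eta> a1 Q where b: "x \<in> fst b" "cell_chart M e b" and E: "extends 0 1 f (star_inv M f 1 p) x W \<eta>" and Wb: "W \<subseteq> fst b"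
      and a1: "continuous_on W a1" "continuous_on W Q" "\<And>z. z \<in> W \<Longrightarrow> \<eta> z [tvec_of M b z (axis 1 1)] = a1 z"
       "\<And>z. z \<in> W \<Longrightarrow> (a1 z)\<^sup>2 \<le> G11 b z * Q z" "\<And>z. z \<in> W \<inter> f \<Longrightarrow> Q z = form_inner M f z (p z) (p z)"
      using ex[OF x] by blast
    have bM: "b \<in> charts M" using b cell_chart_in by blast
    have W: "openin (top_of_set (pts M)) W" "x \<in> W" using E by (auto simp: extends_def)
    let ?o = "\<lambda>z. orient M e z [tvec_of M b z (axis 1 1)]"
    have osq: "(?o z)\<^sup>2 = G11 b z" "?o z \<noteq> 0" if "z \<in> W \<inter> e" for z
      using orient_basis_sq(1)[OF e b(2), of z] gram_pos(1)[OF bM, of z] that Wb de by force+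
    have \<omega>_eq: "\<omega> z [tvec_of M b z (axis 1 1)] = a1 z" if z: "z \<in> W \<inter> e" for z
    proof -
      have "\<omega> z = pullback M e \<eta> z"
        unfolding \<omega>_def using trace_props(2)[OF F T, of z W \<eta>] extends_move[OF E, of z] z by blast
      then show ?thesis
        using pullback_tvec[OF b(2), of z "[axis 1 1]" \<eta>] z Wb a1(3)[of z] de axis_1_flat by auto
    qed
    have \<beta>z: "\<beta> z [] = a1 z / ?o z" if "z \<in> W \<inter> e" for z
      using \<beta>_eq[of z b] \<omega>_eq[OF that] osq[OF that] that Wb b(2) by (auto simp: field_simps)
    have "continuous_on (W \<inter> e) (\<lambda>z. a1 z / ?o z)"
    proof (intro continuous_on_divide continuous_on_subset[OF a1(1)])
      have "continuous_on (fst b \<inter> e) ?o" using orient_continuous(2)[OF e b(2)] de by (simp add: ebasis_simps)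
      then show "continuous_on (W \<inter> e) ?o" by (rule continuous_on_subset) (use Wb in blast)
    qed (use osq in auto)
    then have "continuous_on (W \<inter> e) (\<lambda>z. \<beta> z [])" by (rule continuous_on_eq) (use \<beta>z in auto)
    moreover have "(\<beta> x [])\<^sup>2 \<le> C"
    proof -
      \<comment> \<open>\<open>x\<close> lies on the edge, not in \<open>f\<close>; the bound is
        carried over as a limit from inside \<open>f\<close>.\<close>
      have "Q x \<le> C"
      proof (rule tendsto_upperbound[OF tendsto_within_cell[OF W a1(2) cell_subset[OF f]] _ at_facet_nontrivial[OF F x]])
        show "\<forall>\<^sub>F z in at x within f. Q z \<le> C"
          using eventually_within_cell[OF W cell_subset[OF f]] by eventually_elim (use a1(5) C in auto)
      qed
      have xx: "x \<in> W \<inter> e" using W x by blast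
      have "(\<beta> x [])\<^sup>2 = (a1 x)\<^sup>2 / G11 b x" using \<beta>z[OF xx] osq(1)[OF xx] by (simp add: power_divide)
      also have "\<dots> \<le> Q x" using a1(4)[of x] W(2) gram_pos(1)[OF bM b(1)] by (simp add: divide_le_eq mult.commute)
      finally show ?thesis using \<open>Q x \<le> C\<close> by simp
    qed
    ultimately show ?thesis using W by blast
  qed
  have "\<beta> \<in> regular_forms e 0"
    by (rule regular_0_form[OF e de'(1) \<beta> continuous_on_localI[OF cell_subset[OF e]]]) (use loc in blast)+
  then show "star M e 1 (trace M 1 f e (star_inv M f 1 p)) \<in> regular_forms e 0"
    by (simp add: \<beta>_def \<omega>_def)
qed

section \<open>The relative orientation\<close>

text \<open>A chart adapted to the cell meets it in one point only, so that point is open and closed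
  in the connected cell.\<close>

lemma cell_0_singleton:
  assumes f: "f \<in> cells M" and d: "cdim M f = 0" and x: "x \<in> f"
  shows "f = {x}"
proof -
  obtain c where c: "c \<in> charts M" "x \<in> fst c" "chart_image c f = chart_range c \<inter> flat 0"
    using cell_facts(4)[OF f] x unfolding submanifold_def d by metis
  have "fst c \<inter> f = {x}"
  proof -
    have 0: "snd c z = 0" if "z \<in> fst c \<inter> f" for z
    proof -
      have "snd c z \<in> chart_image c f" using that by blast
      then show ?thesis unfolding c(3) flat_0 by blast
    qed
    have "z = x" if "z \<in> fst c \<inter> f" for z
      using chart_inj[OF c(1), of z x] 0[OF that] 0[of x] that c(2) x by simp
    then show ?thesis using c(2) x by blast
  qed
  moreover obtain U where "open U" "fst c = pts M \<inter> U" using chart_openin[OF c(1)] by (auto simp: openin_open)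
  ultimately have "{x} = f \<inter> U" using cell_subset[OF f] by blast
  then have "openin (top_of_set f) {x}" using \<open>open U\<close> unfolding openin_open by blast
  moreover have "closedin (top_of_set f) {x}" using x by (simp add: closedin_closed_subset)
  ultimately show ?thesis using cell_facts(2)[OF f] unfolding connected_clopen by blast
qed

lemma osgn_vertex:
  assumes f: "f \<in> cells M" and d: "cdim M f = 0" and x: "x \<in> f"
  shows "osgn f c x = 1 \<or> osgn f c x = -1"
proof -
  have "form_inner M f x (orient M f x) (orient M f x) = 1"
    using cell_facts(5)[OF f] x by (simp add: oriented_cell_def)
  moreover have "orthonormal_frame M f x es \<longleftrightarrow> es = []" for es
    using d by (auto simp: orthonormal_frame_def)
  ultimately have "(orient M f x [])\<^sup>2 = 1" by (simp add: form_inner_def power2_eq_square)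
  then show ?thesis
    using d by (auto simp: osgn_def ebasis_simps power2_eq_1_iff)
qed

text \<open>The outward vector is minus the last basis vector. For an edge the list is the reversed
  basis vector, which costs a sign; for a 2-cell it is the positive basis turned by a quarter, of
  determinant one.\<close>

lemma rel_list_sign:
  assumes f: "f \<in> cells M" and c: "cell_chart M f c" and z: "z \<in> f" "z \<in> fst c"
    and d: "cdim M f = Suc d'" "d' = 0 \<or> d' = 1"
  shows "sgn (orient M f z (map (tvec_of M c z) (- axis (of_nat (cdim M f)) 1 # ebasis d'))) =
    (if d' = 0 then -1 else 1) * osgn f c z"
proof -
  have cM: "c \<in> charts M" using c cell_chart_in by blast
  note T = T_subspace[OF f c z] and o = orient_cell_form[OF f z(1)]
  have neg: "tvec_of M c z (- u) = (-1) *\<^sub>R tvec_of M c z u" for u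
    using linear_neg[OF tvec_linear[OF cM z(2)]] by simp
  show ?thesis
  proof (cases "d' = 0")
    case True
    then have d1: "cdim M f = 1" using d by simp
    have "orient M f z [(-1) *\<^sub>R tvec_of M c z (axis 1 1) + 0 *\<^sub>R tvec_of M c z (axis 1 1)] = - orient M f z [tvec_of M c z (axis 1 1)]"
      using alt_forms_1_comb[OF T o T_1(1)[OF f c z d1] T_1(1)[OF f c z d1], of "-1" 0] by simp
    then show ?thesis
      using True d1 by (simp add: osgn_def ebasis_simps neg sgn_minus)
  next
    case False
    then have d2: "cdim M f = 2" "d' = 1" using d by auto
    note bT = T_2(1)[OF f c z d2(1), of "axis 1 1"] T_2(1)[OF f c z d2(1), of "axis 2 1"]
    have "orient M f z [0 *\<^sub>R tvec_of M c z (axis 1 1) + (-1) *\<^sub>R tvec_of M c z (axis 2 1), 1 *\<^sub>R tvec_of M c z (axis 1 1) + 0 *\<^sub>R tvec_of M c z (axis 2 1)]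
        = orient M f z [tvec_of M c z (axis 1 1), tvec_of M c z (axis 2 1)]"
      using alt_forms_2_comb[OF T o bT, of 0 "-1" 1 0] by simp
    then show ?thesis
      using d2 by (simp add: osgn_def ebasis_simps neg)
  qed
qed

definition cross2 :: "real^2 \<Rightarrow> real^2 \<Rightarrow> real" where
  "cross2 u w = u $ 1 * w $ 2 - u $ 2 * w $ 1"

lemma osgn_change_2:
  assumes f: "f \<in> cells M" and d: "cdim M f = 2" and c: "c \<in> charts M" "c' \<in> charts M" and z: "z \<in> f" "z \<in> fst c" "z \<in> fst c'"
  shows "osgn f c' z = sgn (cross2 (dtr c' c z (axis 1 1)) (dtr c' c z (axis 2 1))) * osgn f c z"
proof -
  have cc: "cell_chart M f c" using cell_chart_2[OF f d c(1)] .
  note bT = T_2(1)[OF f cc z(1,2) d]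
  have e: "tvec_of M c' z u = (dtr c' c z u $ 1) *\<^sub>R tvec_of M c z (axis 1 1) + (dtr c' c z u $ 2) *\<^sub>R tvec_of M c z (axis 2 1)" for u
    using tvec_change[OF c(2,1) z(3,2)] tvec_decomp[OF f cc z(1,2)] by metis
  show ?thesis
    unfolding osgn_def d ebasis_simps list.map e alt_forms_2_comb[OF T_subspace[OF f cc z(1,2)] orient_cell_form[OF f z(1)] bT bT]
    by (simp add: sgn_mult cross2_def)
qed

lemma osgn_change_1:
  assumes f: "f \<in> cells M" and d: "cdim M f = 1" and c: "cell_chart M f c" "cell_chart M f c'" and z: "z \<in> f" "z \<in> fst c" "z \<in> fst c'"
  shows "osgn f c' z = sgn (dtr c' c z (axis 1 1) $ 1) * osgn f c z" "dtr c' c z (axis 1 1) $ 2 = 0" "dtr c' c z (axis 1 1) $ 1 \<noteq> 0"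
proof -
  have cM: "c \<in> charts M" "c' \<in> charts M" using c cell_chart_in by auto
  note bT = T_1(1)[OF f c(1) z(1,2) d]
  show z2: "dtr c' c z (axis 1 1) $ 2 = 0"
    using dtr_flat[OF c(2,1) z(1,3,2), of "axis 1 1"] d flat_1 axis_1_flat by auto
  have e: "tvec_of M c' z (axis 1 1) = (dtr c' c z (axis 1 1) $ 1) *\<^sub>R tvec_of M c z (axis 1 1) + 0 *\<^sub>R tvec_of M c z (axis 1 1)"
    using tvec_change[OF cM(2,1) z(3,2), of "axis 1 1"] tvec_decomp[OF f c(1) z(1,2), of "dtr c' c z (axis 1 1)"] z2 by simp
  have eq: "orient M f z [tvec_of M c' z (axis 1 1)] = dtr c' c z (axis 1 1) $ 1 * orient M f z [tvec_of M c z (axis 1 1)]"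
    unfolding e alt_forms_1_comb[OF T_subspace[OF f c(1) z(1,2)] orient_cell_form[OF f z(1)] bT bT] by simp
  then show "osgn f c' z = sgn (dtr c' c z (axis 1 1) $ 1) * osgn f c z"
    using d by (simp add: osgn_def ebasis_simps sgn_mult)
  show "dtr c' c z (axis 1 1) $ 1 \<noteq> 0"
    using eq orient_basis_nonzero[OF f c(2) z(1,3)] d by (auto simp: ebasis_simps)
qed

lemma dtr_inj:
  assumes "c \<in> charts M" "c' \<in> charts M" "x \<in> fst c" "x \<in> fst c'" "dtr c c' x u = 0"
  shows "u = 0"
  using dtr_trans[OF assms(1,2,1,3,4,3), of u] dtr_self[OF assms(1,3)] assms(5)
    linear_0[OF dtr_linear[OF assms(2,1,4,3)]] by simp

lemma cross2_dtr_nonzero: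
  assumes c: "c \<in> charts M" "c' \<in> charts M" and x: "x \<in> fst c" "x \<in> fst c'"
  shows "cross2 (dtr c c' x (axis 1 1)) (dtr c c' x (axis 2 1)) \<noteq> 0"
proof
  let ?P = "dtr c c' x (axis 1 1)" and ?Q = "dtr c c' x (axis 2 1)"
  assume 0: "cross2 ?P ?Q = 0"
  have lin: "dtr c c' x (a *\<^sub>R axis 1 1 + b *\<^sub>R axis 2 1) = a *\<^sub>R ?P + b *\<^sub>R ?Q" for a b
    using dtr_linear[OF c x] by (simp only: linear_add linear_scale)
  have z: "a = 0 \<and> b = 0" if "a *\<^sub>R ?P + b *\<^sub>R ?Q = 0" for a b
  proof -
    have "a *\<^sub>R axis 1 1 + b *\<^sub>R axis 2 1 = (0 :: real^2)"
      using dtr_inj[OF c x, of "a *\<^sub>R axis 1 1 + b *\<^sub>R axis 2 1"] lin that by simp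
    then show ?thesis by (simp add: vec_eq_iff forall_2 axis_def)
  qed
  have "?Q $ i *\<^sub>R ?P + (- (?P $ i)) *\<^sub>R ?Q = 0" for i
    using 0 exhaust_2[of i] by (auto simp: vec_eq_iff forall_2 cross2_def algebra_simps)
  then have "?Q $ i = 0 \<and> - (?P $ i) = 0" for i by (rule z)
  then have "1 *\<^sub>R ?P + 0 *\<^sub>R ?Q = 0" by (simp add: vec_eq_iff)
  then show False using z by fastforce
qed

text \<open>Both charts place \<open>f\<close> where the last coordinate is positive. With a
  negative derivative, a short step into \<open>f\<close> as seen by \<open>c'\<close> would be a
  step out of \<open>f\<close> as seen by \<open>c\<close>.\<close>

lemma transition_inward:
  assumes F: "facet f f'" and x: "x \<in> f'" "x \<in> fst c" "x \<in> fst c'"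
    and b: "bdry_chart M f f' c" "bdry_chart M f f' c'"
  shows "dtr c' c x (axis (of_nat (cdim M f)) 1) $ of_nat (cdim M f) \<ge> 0"
proof (rule ccontr)
  define i :: 2 where "i = of_nat (cdim M f)"
  assume "\<not> ?thesis"
  then have neg: "dtr c' c x (axis i 1) $ i < 0" by (simp add: i_def)
  have de: "cdim M f = Suc (cdim M f')" using facetD(4)[OF F] .
  have cM: "c \<in> charts M" "c' \<in> charts M" using b by (auto simp: bdry_chart_def)
  have d: "cdim M f = 1 \<or> cdim M f = 2" using de cell_facts(3)[OF facetD(1)[OF F]] by linarith
  have ax: "axis i 1 \<in> flat (cdim M f)"
    using d flat_2 axis_1_flat by (auto simp: i_def)
  have y: "snd c' x \<in> flat (cdim M f')" "snd c x \<in> flat (cdim M f')"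
    using bdry_chart_images(2)[OF b(2) de] bdry_chart_images(2)[OF b(1) de] x by blast+
  have z0: "y $ i = 0" if "y \<in> flat (cdim M f')" for y
    using that d de flat_0 flat_1 by (auto simp: i_def)
  define \<phi> where "\<phi> t = (snd c \<circ> chart_inv c') (snd c' x + t *\<^sub>R axis i 1) $ i" for t
  have "((\<lambda>t. snd c' x + t *\<^sub>R axis i 1) has_derivative (\<lambda>t. t *\<^sub>R axis i 1)) (at 0)"
    by (auto intro!: derivative_eq_intros)
  moreover have "((snd c \<circ> chart_inv c') has_derivative dtr c' c x) (at (snd c' x + 0 *\<^sub>R axis i 1))"
    using dtr_has_derivative[OF cM(2,1) x(3,2)] by simp
  ultimately have "((\<lambda>t. (snd c \<circ> chart_inv c') (snd c' x + t *\<^sub>R axis i 1)) has_derivative (\<lambda>t. dtr c' c x (t *\<^sub>R axis i 1))) (at 0)"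
    by (rule has_derivative_compose)
  from bounded_linear.has_derivative[OF bounded_linear_vec_nth this, of i]
  have "(\<phi> has_real_derivative dtr c' c x (axis i 1) $ i) (at 0)"
    unfolding \<phi>_def[abs_def] has_field_derivative_def
    by (simp add: linear_scale[OF dtr_linear[OF cM(2,1) x(3,2)]] mult.commute[of _ "dtr c' c x (axis i 1) $ i"])
  from has_real_derivative_neg_dec_right[OF this neg]
  obtain r where r: "r > 0" "\<And>h. 0 < h \<Longrightarrow> h < r \<Longrightarrow> \<phi> (0 + h) < \<phi> 0" by auto
  have "\<phi> 0 = 0"
    using y(2) z0 chart_inv_left[OF cM(2) x(3)] by (simp add: \<phi>_def)
  have "((\<lambda>t. snd c' x + t *\<^sub>R axis i 1) \<longlongrightarrow> snd c' x + 0 *\<^sub>R axis i 1) (at 0)"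
    by (intro tendsto_intros)
  moreover have "snd c' x \<in> chart_image c' (fst c)" using x by blast
  ultimately have "\<forall>\<^sub>F t in at 0. snd c' x + t *\<^sub>R axis i 1 \<in> chart_image c' (fst c)"
    using topological_tendstoD[OF _ transition_open[OF cM(2,1)]] by simp
  then obtain r' where r': "r' > 0" "\<And>t. t \<noteq> 0 \<Longrightarrow> dist t 0 < r' \<Longrightarrow> snd c' x + t *\<^sub>R axis i 1 \<in> chart_image c' (fst c)"
    unfolding eventually_at by blast
  define t where "t = min r r' / 2"
  have t: "0 < t" "t < r" "t < r'" using r r' by (auto simp: t_def min_def)
  let ?y = "snd c' x + t *\<^sub>R axis i 1"
  have yin: "?y \<in> chart_image c' (fst c)" using r'(2)[of t] t by simp
  have "?y \<in> flat (cdim M f)"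
    using y(1) ax flat_mono[of "cdim M f'" "cdim M f"] de subspace_flat by (auto intro!: subspace_add subspace_scale)
  moreover have "?y $ i > 0" using z0[OF y(1)] t(1) by simp
  ultimately have "?y \<in> chart_image c' f"
    unfolding bdry_chart_images(1)[OF b(2) de] half_space_def i_def[symmetric] using yin by blast
  then have "chart_inv c' ?y \<in> fst c \<inter> f"
    using yin chart_image_iff[OF cM(2)] by blast
  then have "snd c (chart_inv c' ?y) \<in> half_space (cdim M f)"
    using bdry_chart_images(1)[OF b(1) de] by blast
  then have "\<phi> t > 0" by (simp add: \<phi>_def half_space_def i_def)
  then show False using r(2)[of t] t \<open>\<phi> 0 = 0\<close> by simp
qed

text \<open>For a 2-cell the Jacobian at the edge is triangular, as it preserves the edge direction,
  and its normal entry is positive by \<open>transition_inward\<close>. The sign of its determinant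
  is therefore that of the tangential entry, and both factors of the product change by the same
  sign. For an edge the Jacobian is itself positive and the vertex sign is independent of the
  chart.\<close>

lemma osgn_product_chart_independent:
  assumes F: "facet f f'" and x: "x \<in> f'" "x \<in> fst c" "x \<in> fst c'"
    and b: "bdry_chart M f f' c" "bdry_chart M f f' c'"
  shows "\<forall>\<^sub>F z in at x within f. osgn f c' z * osgn f' c' x = osgn f c z * osgn f' c x"
proof -
  note f = facetD(1)[OF F] and f' = facetD(2)[OF F] and de = facetD(4)[OF F]
  have cM: "c \<in> charts M" "c' \<in> charts M" using b by (auto simp: bdry_chart_def)
  have d: "cdim M f = 1 \<or> cdim M f = 2" using de cell_facts(3)[OF f] by linarith
  note bc = bdry_chart_cell_charts[OF b(1) de] bdry_chart_cell_charts[OF b(2) de]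
  let ?P = "\<lambda>z. dtr c' c z (axis 1 1)" and ?Q = "\<lambda>z. dtr c' c z (axis 2 1)"
  have oN: "openin (top_of_set (pts M)) (fst c' \<inter> fst c)" "x \<in> fst c' \<inter> fst c"
    using chart_openin cM x by (auto simp: openin_Int)
  have lim: "((\<lambda>z. dtr c' c z u) \<longlongrightarrow> dtr c' c x u) (at x within f)" for u
    by (rule tendsto_within_cell[OF oN dtr_continuous[OF cM(2,1)] cell_subset[OF f]])
  note ev = eventually_within_cell[OF oN cell_subset[OF f]]
  show ?thesis
  proof (cases "cdim M f = 1")
    case True
    have f'0: "osgn f' c' x = osgn f' c x" using de True by (simp add: osgn_def ebasis_simps)
    have p2: "?P x $ 2 = 0"
    proof (rule tendsto_unique[OF at_facet_nontrivial[OF F x(1)] tendsto_vec_nth[OF lim]])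
      show "((\<lambda>z. ?P z $ 2) \<longlongrightarrow> 0) (at x within f)"
        by (rule tendsto_eventually, rule eventually_mono[OF ev]) (use osgn_change_1(2)[OF f True bc(1) bc(3)] in blast)
    qed
    have "?P x $ 1 \<ge> 0" using transition_inward[OF F x b] True by simp
    moreover have "?P x $ 1 \<noteq> 0"
    proof
      assume "?P x $ 1 = 0"
      then have "?P x = 0" using p2 by (simp add: vec_eq_iff forall_2)
      from dtr_inj[OF cM(2,1) x(3,2) this] show False by (simp add: axis_eq_0_iff)
    qed
    ultimately have pos: "?P x $ 1 > 0" by simp
    have "\<forall>\<^sub>F z in at x within f. sgn (?P z $ 1) = sgn (?P x $ 1)"
      by (rule eventually_sgn_eq[OF tendsto_vec_nth[OF lim]]) (use pos in simp)
    then show ?thesis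
      using ev
    proof eventually_elim
      case (elim z)
      then have "osgn f c' z = osgn f c z" using osgn_change_1(1)[OF f True bc(1) bc(3), of z] pos by simp
      then show ?case using f'0 by simp
    qed
  next
    case False
    then have d2: "cdim M f = 2" and d1: "cdim M f' = 1" using d de by auto
    note ch = osgn_change_1[OF f' d1 bc(2) bc(4) x]
    have "?Q x $ 2 \<ge> 0" using transition_inward[OF F x b] d2 by simp
    moreover have D: "cross2 (?P x) (?Q x) = ?P x $ 1 * ?Q x $ 2" using ch(2) by (simp add: cross2_def)
    moreover have D0: "cross2 (?P x) (?Q x) \<noteq> 0" by (rule cross2_dtr_nonzero[OF cM(2,1) x(3,2)])
    ultimately have "?Q x $ 2 > 0" by (cases "?Q x $ 2 = 0") auto
    then have sD: "sgn (cross2 (?P x) (?Q x)) = sgn (?P x $ 1)" unfolding D by (simp add: sgn_mult)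
    have "\<forall>\<^sub>F z in at x within f. sgn (cross2 (?P z) (?Q z)) = sgn (cross2 (?P x) (?Q x))"
      by (rule eventually_sgn_eq[OF _ D0]) (unfold cross2_def, intro tendsto_intros lim)
    then show ?thesis
      using ev
    proof eventually_elim
      case (elim z)
      then have "osgn f c' z = sgn (?P x $ 1) * osgn f c z" using osgn_change_2[OF f d2 cM, of z] sD by simp
      then show ?case using ch(1,3) by (auto simp: sgn_if)
    qed
  qed
qed

text \<open>The product of signs is independent of the boundary chart and locally constant along
  \<open>f'\<close> by \<open>osgn_near\<close>, hence constant on the connected facet. This is what
  makes the description in \<open>rel_orient\<close> proper.\<close>

lemma rel_orient_exists:
  assumes F: "facet f f'"
  shows "\<exists>s. (s = 1 \<or> s = -1) \<and> (\<forall>x\<in>f'. \<forall>c. bdry_chart M f f' c \<and> x \<in> fst c \<longrightarrow>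
     (\<forall>\<^sub>F z in at x within f. osgn f c z * osgn f' c x = s))"
proof -
  note f = facetD(1)[OF F] and f' = facetD(2)[OF F] and de = facetD(4)[OF F]
  have d: "cdim M f = 1 \<or> cdim M f = 2" using de cell_facts(3)[OF f] by linarith
  define R where "R x c s \<longleftrightarrow> (\<forall>\<^sub>F z in at x within f. osgn f c z * osgn f' c x = s)" for x c s
  have R_unique: "s = s'" if "R x c s" "R x c s'" "x \<in> f'" for x c s s'
  proof -
    have "\<forall>\<^sub>F z in at x within f. s = s'"
      using that(1,2) unfolding R_def by eventually_elim simp
    then show ?thesis using at_facet_nontrivial[OF F that(3)] eventually_const by blast
  qed
  have R_indep: "R x c' s" if "R x c s" "bdry_chart M f f' c" "bdry_chart M f f' c'" "x \<in> f'" "x \<in> fst c" "x \<in> fst c'" for x c c' s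
    using that(1) osgn_product_chart_independent[OF F that(4,5,6,2,3)] unfolding R_def
    by eventually_elim simp
  have local: "\<exists>N s. openin (top_of_set (pts M)) N \<and> x \<in> N \<and> N \<subseteq> fst c \<and> (s = 1 \<or> s = -1) \<and> (\<forall>x'\<in>N \<inter> f'. R x' c s)"
    if x: "x \<in> f'" "x \<in> fst c" and b: "bdry_chart M f f' c" for x c
  proof -
    note bc = bdry_chart_cell_charts[OF b de]
    obtain N s where N: "openin (top_of_set (pts M)) N" "x \<in> N" "N \<subseteq> fst c" "s = 1 \<or> s = -1" "\<And>z. z \<in> N \<inter> f \<Longrightarrow> osgn f c z = s"
      using osgn_near[OF f d bc(1) x(2) bdry_chart_images(1)[OF b de] convex_half_space] by metis
    obtain N' s' where N': "openin (top_of_set (pts M)) N'" "x \<in> N'" "s' = 1 \<or> s' = -1" "\<And>z. z \<in> N' \<inter> f' \<Longrightarrow> osgn f' c z = s'"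
    proof (cases "cdim M f' = 0")
      case True
      have "osgn f' c x = 1 \<or> osgn f' c x = -1" by (rule osgn_vertex[OF f' True x(1)])
      moreover have "osgn f' c z = osgn f' c x" if "z \<in> fst c \<inter> f'" for z
        using cell_0_singleton[OF f' True x(1)] that by simp
      ultimately show thesis using that[of "fst c"] chart_openin[OF cell_chart_in[OF bc(1)]] x(2) by blast
    next
      case False
      then have d': "cdim M f' = 1 \<or> cdim M f' = 2" using d de by auto
      show thesis
        using osgn_near[OF f' d' bc(2) x(2) bdry_chart_images(2)[OF b de] subspace_imp_convex[OF subspace_flat]] that by metis
    qed
    have NN: "openin (top_of_set (pts M)) (N \<inter> N')" using N N' by (simp add: openin_Int)
    have "R x' c (s * s')" if "x' \<in> (N \<inter> N') \<inter> f'" for x'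
    proof -
      have "\<forall>\<^sub>F z in at x' within f. z \<in> N \<inter> N' \<and> z \<in> f"
        using eventually_within_cell[OF NN _ cell_subset[OF f]] that by blast
      then show ?thesis unfolding R_def by eventually_elim (use N(5) N'(4) that in auto)
    qed
    then show ?thesis using N N' NN by (intro exI[of _ "N \<inter> N'"] exI[of _ "s * s'"]) auto
  qed
  have ex: "\<exists>s. (s = 1 \<or> s = -1) \<and> (\<forall>c. bdry_chart M f f' c \<and> x \<in> fst c \<longrightarrow> R x c s)" if x: "x \<in> f'" for x
  proof -
    obtain c where c: "bdry_chart M f f' c" "x \<in> fst c" using facet_chart[OF F x] by metis
    then obtain s where s: "s = 1 \<or> s = -1" "R x c s" using local[OF x c(2,1)] x by blast
    then show ?thesis using R_indep[OF s(2) c(1) _ x c(2)] by blast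
  qed
  then obtain \<sigma> where \<sigma>: "\<And>x. x \<in> f' \<Longrightarrow> (\<sigma> x = 1 \<or> \<sigma> x = -1) \<and> (\<forall>c. bdry_chart M f f' c \<and> x \<in> fst c \<longrightarrow> R x c (\<sigma> x))"
    by metis
  have loc_const: "\<forall>\<^sub>F y in at x within f'. \<sigma> x = \<sigma> y" if x: "x \<in> f'" for x
  proof -
    obtain c where c: "bdry_chart M f f' c" "x \<in> fst c" using facet_chart[OF F x] by metis
    obtain N s where N: "openin (top_of_set (pts M)) N" "x \<in> N" "N \<subseteq> fst c" "\<And>x'. x' \<in> N \<inter> f' \<Longrightarrow> R x' c s"
      using local[OF x c(2,1)] by blast
    have eq: "\<sigma> y = s" if "y \<in> N \<inter> f'" for y
      using R_unique[OF _ N(4)[OF that]] \<sigma>[of y] c(1) N(3) that by blast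
    show ?thesis
      using eventually_within_cell[OF N(1,2) cell_subset[OF f']]
      by eventually_elim (use eq N(2) x in auto)
  qed
  obtain x0 where x0: "x0 \<in> f'" using cell_facts(1)[OF f'] by blast
  have "\<sigma> x = \<sigma> x0" if "x \<in> f'" for x
    by (rule connected_local_const[OF cell_facts(2)[OF f'] that x0]) (use loc_const in blast)
  then have "(\<sigma> x0 = 1 \<or> \<sigma> x0 = -1) \<and> (\<forall>x\<in>f'. \<forall>c. bdry_chart M f f' c \<and> x \<in> fst c \<longrightarrow> R x c (\<sigma> x0))"
    using \<sigma> x0 by metis
  then show ?thesis unfolding R_def by blast
qed

text \<open>Restates \<open>rel_orient\<close> with chart signs in place of outward-first bases; by
  \<open>rel_list_sign\<close> the conversion factor \<open>k\<close> is \<open>-1\<close> exactly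
  at vertices.\<close>

lemma rel_orient_props:
  assumes F: "facet f f'"
  defines "k \<equiv> (if cdim M f' = 0 then -1 else 1 :: real)"
  shows "rel_orient M f f' = 1 \<or> rel_orient M f f' = -1"
    and "x \<in> f' \<Longrightarrow> bdry_chart M f f' c \<Longrightarrow> x \<in> fst c \<Longrightarrow>
      \<forall>\<^sub>F z in at x within f. osgn f c z * osgn f' c x = k * rel_orient M f f'"
proof -
  note f = facetD(1)[OF F] and f' = facetD(2)[OF F] and de = facetD(4)[OF F]
  have d: "cdim M f' = 0 \<or> cdim M f' = 1" using de cell_facts(3)[OF f] by linarith
  have k: "k * k = 1" by (simp add: k_def)
  obtain s where s: "s = 1 \<or> s = -1" and R: "\<And>x c. x \<in> f' \<Longrightarrow> bdry_chart M f f' c \<Longrightarrow> x \<in> fst c \<Longrightarrow>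
     \<forall>\<^sub>F z in at x within f. osgn f c z * osgn f' c x = s"
    using rel_orient_exists[OF F] by blast
  let ?L = "\<lambda>z c x. sgn (orient M f z (map (tvec_of M c z) (- axis (of_nat (cdim M f)) 1 # ebasis (cdim M f'))))
          * sgn (orient M f' x (map (tvec_of M c x) (ebasis (cdim M f'))))"
  have L: "?L z c x = k * (osgn f c z * osgn f' c x)" if "bdry_chart M f f' c" "z \<in> f" "z \<in> fst c" for z c x
    using rel_list_sign[OF f bdry_chart_cell_charts(1)[OF that(1) de] that(2,3) de d]
    by (simp add: k_def osgn_def)
  have ev: "\<forall>\<^sub>F z in at x within f. ?L z c x = k * (osgn f c z * osgn f' c x)"
    if "x \<in> f'" "bdry_chart M f f' c" "x \<in> fst c" for x c
  proof -
    have "c \<in> charts M" using that(2) by (simp add: bdry_chart_def)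
    from eventually_within_cell[OF chart_openin[OF this] that(3) cell_subset[OF f]]
    show ?thesis by eventually_elim (use L that(2) in blast)
  qed
  have "rel_orient M f f' = k * s"
    unfolding rel_orient_def
  proof (rule the_equality)
    show "\<forall>x\<in>f'. \<forall>c. bdry_chart M f f' c \<and> x \<in> fst c \<longrightarrow> (\<forall>\<^sub>F z in at x within f. k * s = ?L z c x)"
    proof (intro ballI allI impI)
      fix x c assume "x \<in> f'" and "bdry_chart M f f' c \<and> x \<in> fst c"
      then have xc: "x \<in> f'" "bdry_chart M f f' c" "x \<in> fst c" by auto
      from ev[OF xc] R[OF xc] show "\<forall>\<^sub>F z in at x within f. k * s = ?L z c x" by eventually_elim simp
    qed
    fix s' assume s': "\<forall>x\<in>f'. \<forall>c. bdry_chart M f f' c \<and> x \<in> fst c \<longrightarrow> (\<forall>\<^sub>F z in at x within f. s' = ?L z c x)"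
    obtain x where x: "x \<in> f'" using cell_facts(1)[OF f'] by blast
    obtain c where c: "bdry_chart M f f' c" "x \<in> fst c" using facet_chart[OF F x] by metis
    have "\<forall>\<^sub>F z in at x within f. s' = ?L z c x" using s' x c by blast
    from this ev[OF x c] R[OF x c] have "\<forall>\<^sub>F z in at x within f. s' = k * s" by eventually_elim simp
    then show "s' = k * s" using at_facet_nontrivial[OF F x] eventually_const by blast
  qed
  then have rs: "rel_orient M f f' = k * s" "k * rel_orient M f f' = s" using k by (simp_all flip: mult.assoc)
  show "rel_orient M f f' = 1 \<or> rel_orient M f f' = -1" using rs(1) s by (auto simp: k_def)
  show "\<forall>\<^sub>F z in at x within f. osgn f c z * osgn f' c x = k * rel_orient M f f'"
    if "x \<in> f'" "bdry_chart M f f' c" "x \<in> fst c"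
    unfolding rs(2) using R[OF that] .
qed

end

section \<open>The boundary of a boundary\<close>

text \<open>Subtract from \<open>G\<close> the step function \<open>K\<close> that collects the
  jumps passed so far. The difference, given its left limit at the jump points, is locally constant
  on the interval and so constant. \<open>K\<close> counts only jumps strictly before
  \<open>t\<close>, which matches the use of left limits.\<close>

lemma sum_of_jumps:
  fixes G J l :: "real \<Rightarrow> real"
  assumes S: "finite S" "S \<subseteq> {a<..<b}" and ab: "a < b"
    and G: "\<And>t. t \<in> {a..b} \<Longrightarrow> t \<notin> S \<Longrightarrow> \<forall>\<^sub>F u in at t. G u = G t"
    and left: "\<And>t. t \<in> S \<Longrightarrow> \<forall>\<^sub>F u in at_left t. G u = l t"
    and right: "\<And>t. t \<in> S \<Longrightarrow> \<forall>\<^sub>F u in at_right t. G u = l t + J t"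
  shows "G b - G a = (\<Sum>t\<in>S. J t)"
proof -
  define K where "K t = (\<Sum>s\<in>{s \<in> S. s < t}. J s)" for t
  define H where "H t = (if t \<in> S then l t else G t) - K t" for t
  have no_S: "\<forall>\<^sub>F u in at t. u \<notin> S" for t
    using islimpt_finite[OF S(1), of t] by (simp add: islimpt_iff_eventually)
  have Kl: "\<forall>\<^sub>F u in at_left t. K u = K t" for t
  proof -
    have "\<forall>\<^sub>F u in at_left t. s < u \<longleftrightarrow> s < t" for s
    proof (cases "s < t")
      case True
      have "\<forall>\<^sub>F u in at_left t. s < u" using order_tendstoD(1)[OF tendsto_ident_at True] .
      then show ?thesis by eventually_elim (use True in simp)
    next
      case False
      have "\<forall>\<^sub>F u in at_left t. u < t" by (simp add: eventually_at_filter)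
      then show ?thesis by eventually_elim (use False in simp)
    qed
    then have "\<forall>\<^sub>F u in at_left t. \<forall>s\<in>S. s < u \<longleftrightarrow> s < t" by (intro eventually_ball_finite[OF S(1)]) blast
    then show ?thesis
    proof eventually_elim
      case (elim u)
      then have "{s \<in> S. s < u} = {s \<in> S. s < t}" by blast
      then show ?case by (simp add: K_def)
    qed
  qed
  have Kr: "\<forall>\<^sub>F u in at_right t. K u = K t + (if t \<in> S then J t else 0)" for t
  proof -
    have "\<forall>\<^sub>F u in at_right t. s < u \<longleftrightarrow> s \<le> t" for s
    proof (cases "s \<le> t")
      case True
      have "\<forall>\<^sub>F u in at_right t. t < u" by (simp add: eventually_at_filter)
      then show ?thesis by eventually_elim (use True in simp)
    next
      case False
      then have "t < s" by simp
      have "\<forall>\<^sub>F u in at_right t. u < s" using order_tendstoD(2)[OF tendsto_ident_at \<open>t < s\<close>] .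
      then show ?thesis by eventually_elim (use False in simp)
    qed
    then have "\<forall>\<^sub>F u in at_right t. \<forall>s\<in>S. s < u \<longleftrightarrow> s \<le> t" by (intro eventually_ball_finite[OF S(1)]) blast
    then show ?thesis
    proof eventually_elim
      case (elim u)
      then have "{s \<in> S. s < u} = (if t \<in> S then insert t {s \<in> S. s < t} else {s \<in> S. s < t})"
        by (auto simp: le_less)
      then show ?case using S(1) by (simp add: K_def)
    qed
  qed
  have loc: "\<forall>\<^sub>F u in at t. H t = H u" if t: "t \<in> {a..b}" for t
  proof (cases "t \<in> S")
    case True
    have "\<forall>\<^sub>F u in at_left t. u \<notin> S" "\<forall>\<^sub>F u in at_right t. u \<notin> S"
      using no_S[of t] eventually_at_split by blast+
    from this(1) left[OF True] Kl[of t] have "\<forall>\<^sub>F u in at_left t. H t = H u"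
      by eventually_elim (use True in \<open>simp add: H_def\<close>)
    moreover from \<open>\<forall>\<^sub>F u in at_right t. u \<notin> S\<close> right[OF True] Kr[of t] have "\<forall>\<^sub>F u in at_right t. H t = H u"
      by eventually_elim (use True in \<open>simp add: H_def\<close>)
    ultimately show ?thesis using eventually_at_split by blast
  next
    case False
    have "\<forall>\<^sub>F u in at t. K u = K t"
      using Kl[of t] Kr[of t] False by (simp add: eventually_at_split)
    from this no_S[of t] G[OF t False] show ?thesis
      by eventually_elim (use False in \<open>simp add: H_def\<close>)
  qed
  have "H b = H a"
  proof (rule connected_local_const[of "{a..b}" b a H])
    show "\<forall>t\<in>{a..b}. \<forall>\<^sub>F u in at t within {a..b}. H t = H u"
    proof
      fix t assume "t \<in> {a..b}"
      from loc[OF this] show "\<forall>\<^sub>F u in at t within {a..b}. H t = H u"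
        using filter_leD[OF at_le[of "{a..b}" UNIV t]] by simp
    qed
  qed (use ab in auto)
  moreover have "a \<notin> S" "b \<notin> S" "{s \<in> S. s < a} = {}" "{s \<in> S. s < b} = S" using S(2) by force+
  ultimately show ?thesis by (simp add: H_def K_def)
qed

section \<open>Circles in the plane and curves leaving a point\<close>

lemma norm_sq_2: "(norm (v :: real^2))\<^sup>2 = (v $ 1)\<^sup>2 + (v $ 2)\<^sup>2"
  unfolding power2_norm_eq_inner by (simp add: inner_vec_def sum_2 power2_eq_square)

lemma norm_axis_2: "norm (axis 1 s :: real^2) = \<bar>s\<bar>"
proof -
  have "(norm (axis 1 s :: real^2))\<^sup>2 = s\<^sup>2" unfolding norm_sq_2 by (simp add: axis_def)
  then show ?thesis by (metis abs_norm_cancel power2_eq_iff abs_eq_iff)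
qed

lemma bounded_linear_axis_1: "bounded_linear (axis 1 :: real \<Rightarrow> real^2)"
  unfolding linear_conv_bounded_linear[symmetric]
  by (rule linearI) (simp_all add: vec_eq_iff axis_def)

definition circ :: "real^2 \<Rightarrow> real \<Rightarrow> real \<Rightarrow> real^2" where
  "circ y \<rho> \<theta> = y + ((\<rho> * cos \<theta>) *\<^sub>R axis 1 1 + (\<rho> * sin \<theta>) *\<^sub>R axis 2 1)"

lemma circ_components: "circ y \<rho> \<theta> $ 1 = y $ 1 + \<rho> * cos \<theta>" "circ y \<rho> \<theta> $ 2 = y $ 2 + \<rho> * sin \<theta>"
  by (simp_all add: circ_def axis_def)

lemma circ_norm: "\<rho> > 0 \<Longrightarrow> norm (circ y \<rho> \<theta> - y) = \<rho>"
proof -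
  assume \<rho>: "\<rho> > 0"
  have "(norm (circ y \<rho> \<theta> - y))\<^sup>2 = \<rho>\<^sup>2 * ((sin \<theta>)\<^sup>2 + (cos \<theta>)\<^sup>2)"
    unfolding norm_sq_2 vector_minus_component circ_components distrib_left
    by (simp add: power_mult_distrib)
  then have "(norm (circ y \<rho> \<theta> - y))\<^sup>2 = \<rho>\<^sup>2" by simp
  then show ?thesis using \<rho> by (simp add: power2_eq_iff_nonneg)
qed

lemma circ_derivative:
  "(circ y \<rho> has_derivative (\<lambda>t. t *\<^sub>R ((- \<rho> * sin \<theta>) *\<^sub>R axis 1 1 + (\<rho> * cos \<theta>) *\<^sub>R axis 2 1))) (at \<theta>)"
  unfolding circ_def[abs_def]
  by (rule has_derivative_eq_rhs, (rule derivative_intros)+) (auto simp: fun_eq_iff scaleR_add_right algebra_simps)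

lemma circ_continuous: "continuous_on A (circ y \<rho>)"
  unfolding circ_def[abs_def] by (intro continuous_intros)

lemma circ_periodic: "circ y \<rho> (\<theta> + 2 * pi) = circ y \<rho> \<theta>"
  by (simp add: circ_def)

lemma circ_surj:
  assumes "\<rho> > 0" "norm (w - y) = \<rho>"
  obtains t where "0 \<le> t" "t < 2 * pi" "w = circ y \<rho> t"
proof -
  let ?u = "w - y"
  have "(?u $ 1)\<^sup>2 + (?u $ 2)\<^sup>2 = \<rho>\<^sup>2" using norm_sq_2[of ?u] assms by simp
  then have "(?u $ 1 / \<rho>)\<^sup>2 + (?u $ 2 / \<rho>)\<^sup>2 = 1"
    using assms(1) by (simp add: power_divide add_divide_distrib[symmetric])
  then obtain t where t: "0 \<le> t" "t < 2 * pi" "?u $ 1 / \<rho> = cos t" "?u $ 2 / \<rho> = sin t"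
    by (rule sincos_total_2pi)
  have "w = circ y \<rho> t"
    using t(3,4) assms(1) by (simp add: vec_eq_iff forall_2 circ_components field_simps)
  then show thesis using that t by blast
qed

lemma circ_inj:
  assumes "\<rho> > 0" "circ y \<rho> s = circ y \<rho> t" "\<bar>s - t\<bar> < 2 * pi"
  shows "s = t"
proof -
  have "cos s = cos t" "sin s = sin t"
    using arg_cong[OF assms(2), of "\<lambda>v. v $ 1"] arg_cong[OF assms(2), of "\<lambda>v. v $ 2"] assms(1)
    by (simp_all add: circ_components)
  then obtain n :: int where n: "s = t + 2 * pi * n" using sin_cos_eq_iff by blast
  then have "\<bar>2 * pi * n\<bar> < 2 * pi" using assms(3) by simp
  then have "\<bar>real_of_int n\<bar> < 1" by (simp add: abs_mult)
  then have "n = 0" by linarith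
  then show ?thesis using n by simp
qed

lemma sgn_near_zero:
  assumes D: "(k has_real_derivative K) (at \<theta>)" and 0: "k \<theta> = 0" and K: "K \<noteq> 0"
  shows "\<forall>\<^sub>F t in at_right \<theta>. sgn (k t) = sgn K" "\<forall>\<^sub>F t in at_left \<theta>. sgn (k t) = - sgn K"
proof -
  have "((\<lambda>t. (k t - k \<theta>) / (t - \<theta>)) \<longlongrightarrow> K) (at \<theta>)"
    using D by (simp add: has_field_derivative_iff)
  then have "\<forall>\<^sub>F t in at \<theta>. sgn ((k t - k \<theta>) / (t - \<theta>)) = sgn K"
    using K by (rule eventually_sgn_eq)
  then have ev: "\<forall>\<^sub>F t in at_right \<theta>. sgn (k t / (t - \<theta>)) = sgn K" "\<forall>\<^sub>F t in at_left \<theta>. sgn (k t / (t - \<theta>)) = sgn K"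
    by (simp_all add: 0 eventually_at_split)
  have "\<forall>\<^sub>F t in at_right \<theta>. t > \<theta>" "\<forall>\<^sub>F t in at_left \<theta>. t < \<theta>" by (simp_all add: eventually_at_filter)
  from ev(1) this(1) show "\<forall>\<^sub>F t in at_right \<theta>. sgn (k t) = sgn K"
    by eventually_elim (simp add: sgn_divide)
  from ev(2) \<open>\<forall>\<^sub>F t in at_left \<theta>. t < \<theta>\<close> show "\<forall>\<^sub>F t in at_left \<theta>. sgn (k t) = - sgn K"
  proof eventually_elim
    case (elim t)
    then have "sgn (t - \<theta>) = -1" by simp
    with elim(1) have "sgn (k t) / -1 = sgn K" by (simp only: sgn_divide)
    then show ?case by simp
  qed
qed

text \<open>A C1 curve with nonzero initial velocity moves away from its starting point: the product
  of its velocity with the difference quotient tends to the squared initial speed. Thus the distance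
  increases strictly up to \<open>\<delta>\<close>, and every small circle is met exactly
  once.\<close>

lemma radial_growth:
  fixes \<gamma> :: "real \<Rightarrow> 'a::real_inner"
  assumes r: "r > 0" and D: "\<And>s. \<bar>s\<bar> < r \<Longrightarrow> (\<gamma> has_vector_derivative \<gamma>' s) (at s)"
    and c: "(\<gamma>' \<longlongrightarrow> \<gamma>' 0) (at 0)" and nz: "\<gamma>' 0 \<noteq> 0"
  obtains \<delta> where "0 < \<delta>" "\<delta> < r" "\<And>s. 0 < s \<Longrightarrow> s \<le> \<delta> \<Longrightarrow> \<gamma>' s \<bullet> (\<gamma> s - \<gamma> 0) > 0"
    "\<And>\<rho>. 0 < \<rho> \<Longrightarrow> \<rho> < norm (\<gamma> \<delta> - \<gamma> 0) \<Longrightarrow> \<exists>s. 0 < s \<and> s < \<delta> \<and> norm (\<gamma> s - \<gamma> 0) = \<rho>"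
    "\<And>s s'. 0 < s \<Longrightarrow> s \<le> \<delta> \<Longrightarrow> 0 < s' \<Longrightarrow> s' \<le> \<delta> \<Longrightarrow> norm (\<gamma> s - \<gamma> 0) = norm (\<gamma> s' - \<gamma> 0) \<Longrightarrow> s = s'"
proof -
  have "((\<lambda>h. norm (\<gamma> (0 + h) - \<gamma> 0 - h *\<^sub>R \<gamma>' 0) / norm h) \<longlongrightarrow> 0) (at 0)"
    using D[of 0] r unfolding has_vector_derivative_def has_derivative_at by simp
  moreover have "\<forall>\<^sub>F h in at 0. norm (\<gamma> (0 + h) - \<gamma> 0 - h *\<^sub>R \<gamma>' 0) / norm h = norm ((\<gamma> h - \<gamma> 0) /\<^sub>R h - \<gamma>' 0)"
  proof (rule eventually_at_filter[THEN iffD2], rule always_eventually, intro allI impI)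
    fix h :: real assume h: "h \<noteq> 0"
    have "(\<gamma> h - \<gamma> 0) /\<^sub>R h - \<gamma>' 0 = (\<gamma> h - \<gamma> 0 - h *\<^sub>R \<gamma>' 0) /\<^sub>R h"
      using h by (simp add: scaleR_diff_right)
    then show "norm (\<gamma> (0 + h) - \<gamma> 0 - h *\<^sub>R \<gamma>' 0) / norm h = norm ((\<gamma> h - \<gamma> 0) /\<^sub>R h - \<gamma>' 0)"
      by (simp add: divide_inverse mult.commute)
  qed
  ultimately have "((\<lambda>h. norm ((\<gamma> h - \<gamma> 0) /\<^sub>R h - \<gamma>' 0)) \<longlongrightarrow> 0) (at 0)"
    by (rule Lim_transform_eventually)
  then have "((\<lambda>s. (\<gamma> s - \<gamma> 0) /\<^sub>R s) \<longlongrightarrow> \<gamma>' 0) (at 0)"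
    by (rule LIM_zero_cancel[OF tendsto_norm_zero_cancel])
  then have "((\<lambda>s. \<gamma>' s \<bullet> ((\<gamma> s - \<gamma> 0) /\<^sub>R s)) \<longlongrightarrow> \<gamma>' 0 \<bullet> \<gamma>' 0) (at 0)"
    by (intro tendsto_inner c)
  then have "\<forall>\<^sub>F s in at 0. \<gamma>' s \<bullet> ((\<gamma> s - \<gamma> 0) /\<^sub>R s) > 0"
    using order_tendstoD(1) nz by (metis inner_gt_zero_iff)
  then obtain d where d: "d > 0" "\<And>s. s \<noteq> 0 \<Longrightarrow> \<bar>s\<bar> < d \<Longrightarrow> \<gamma>' s \<bullet> ((\<gamma> s - \<gamma> 0) /\<^sub>R s) > 0"
    by (auto simp: eventually_at dist_real_def)
  define \<delta> where "\<delta> = min d r / 2"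
  have \<delta>: "0 < \<delta>" "\<delta> < r" "\<delta> < d" using d r by (auto simp: \<delta>_def min_def)
  have pos: "\<gamma>' s \<bullet> (\<gamma> s - \<gamma> 0) > 0" if "0 < s" "s \<le> \<delta>" for s
  proof -
    have "\<gamma>' s \<bullet> ((\<gamma> s - \<gamma> 0) /\<^sub>R s) > 0" using d(2)[of s] that \<delta> by auto
    then show ?thesis using that by (simp add: zero_less_mult_iff)
  qed
  \<comment> \<open>The squared distance from the starting point is differentiable throughout,
    unlike the distance itself.\<close>
  define N where "N s = (\<gamma> s - \<gamma> 0) \<bullet> (\<gamma> s - \<gamma> 0)" for s
  have DN: "(N has_real_derivative 2 * (\<gamma>' s \<bullet> (\<gamma> s - \<gamma> 0))) (at s)" if "\<bar>s\<bar> < r" for s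
  proof -
    have "(\<gamma> has_derivative (\<lambda>h. h *\<^sub>R \<gamma>' s)) (at s)" using D[OF that] by (simp add: has_vector_derivative_def)
    then have "((\<lambda>s. \<gamma> s - \<gamma> 0) has_derivative (\<lambda>h. h *\<^sub>R \<gamma>' s)) (at s)"
      by (auto intro!: derivative_eq_intros)
    from has_derivative_inner[OF this this] show ?thesis
      unfolding N_def[abs_def] has_field_derivative_def
      by (rule has_derivative_eq_rhs) (simp add: fun_eq_iff inner_commute[of "\<gamma> s - \<gamma> 0"])
  qed
  have Ncont: "continuous_on {0..\<delta>} N"
    by (rule DERIV_continuous_on[OF DERIV_subset[OF DN]]) (use \<delta> in auto)
  have mono: "N s < N s'" if "0 \<le> s" "s < s'" "s' \<le> \<delta>" for s s'
  proof (rule DERIV_pos_imp_increasing_open[OF that(2)])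
    show "\<exists>y. (N has_real_derivative y) (at t) \<and> 0 < y" if "s < t" "t < s'" for t
      using DN[of t] pos[of t] that \<open>0 \<le> s\<close> \<open>s' \<le> \<delta>\<close> \<delta> by (intro exI[of _ "2 * (\<gamma>' t \<bullet> (\<gamma> t - \<gamma> 0))"]) auto
    show "continuous_on {s..s'} N" by (rule continuous_on_subset[OF Ncont]) (use that in auto)
  qed
  have Nn: "N s = (norm (\<gamma> s - \<gamma> 0))\<^sup>2" for s by (simp add: N_def power2_norm_eq_inner)
  show thesis
  proof (rule that[OF \<delta>(1,2) pos])
    fix \<rho> assume \<rho>: "0 < \<rho>" "\<rho> < norm (\<gamma> \<delta> - \<gamma> 0)"
    then have "\<rho>\<^sup>2 < N \<delta>" unfolding Nn by (simp add: power_strict_mono)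
    then obtain s where s: "0 \<le> s" "s \<le> \<delta>" "N s = \<rho>\<^sup>2"
      using IVT'[of N 0 "\<rho>\<^sup>2" \<delta>] Ncont \<delta>(1) by (auto simp: N_def)
    have "s \<noteq> 0" "s \<noteq> \<delta>" using s(3) \<open>\<rho>\<^sup>2 < N \<delta>\<close> \<rho>(1) by (auto simp: N_def)
    moreover have "norm (\<gamma> s - \<gamma> 0) = \<rho>" using s(3) \<rho>(1) unfolding Nn by (simp add: power2_eq_iff_nonneg)
    ultimately show "\<exists>s. 0 < s \<and> s < \<delta> \<and> norm (\<gamma> s - \<gamma> 0) = \<rho>"
      using s by (intro exI[of _ s]) auto
  next
    fix s s' assume "0 < s" "s \<le> \<delta>" "0 < s'" "s' \<le> \<delta>" "norm (\<gamma> s - \<gamma> 0) = norm (\<gamma> s' - \<gamma> 0)"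
    then show "s = s'" using mono[of s s'] mono[of s' s] Nn by (metis less_eq_real_def less_irrefl linorder_less_linear)
  qed
qed

section \<open>Crossings of a small circle around a vertex\<close>

context riem_mesh
begin

text \<open>The boundary chart \<open>b\<close> straightens the edge at the vertex, while circles
  are drawn in the chart \<open>c\<close>. Read in \<open>c\<close>, the edge is a curve with
  nonzero velocity, to which \<open>radial_growth\<close> applies. The minus sign in the orientation
  relation is the factor of \<open>rel_orient_props\<close> at a vertex.\<close>

lemma edge_crossing:
  assumes F: "facet e v" and d: "cdim M e = 1" and x: "x \<in> v" and c: "c \<in> charts M" "x \<in> fst c"
  obtains b \<rho>0 where "cell_chart M e b" "\<rho>0 > 0"
    "\<And>\<rho>. 0 < \<rho> \<Longrightarrow> \<rho> < \<rho>0 \<Longrightarrow> \<exists>!p. p \<in> e \<inter> fst c \<and> norm (snd c p - snd c x) = \<rho>"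
    "\<And>p. p \<in> e \<inter> fst c \<Longrightarrow> 0 < norm (snd c p - snd c x) \<Longrightarrow> norm (snd c p - snd c x) < \<rho>0 \<Longrightarrow>
      p \<in> fst b \<and> dtr b c p (axis 1 1) \<bullet> (snd c p - snd c x) > 0 \<and> osgn e b p * osgn v c x = - rel_orient M e v"
proof -
  have d0: "cdim M v = 0" using facetD(4)[OF F] d by simp
  obtain b where b: "bdry_chart M e v b" "x \<in> fst b" "cell_chart M e b" "cell_chart M v b" by (rule facet_chart[OF F x])
  have bM: "b \<in> charts M" using b(3) cell_chart_in by blast
  have img: "chart_image b e = chart_range b \<inter> half_space 1" "chart_image b v = chart_range b \<inter> flat 0"
    using bdry_chart_images[OF b(1) facetD(4)[OF F]] d d0 by auto
  have bx: "snd b x = 0" using img(2) flat_0 x b(2) by blast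
  define z where "z s = chart_inv b (axis 1 s)" for s
  define \<gamma> where "\<gamma> s = snd c (z s)" for s
  define \<gamma>' where "\<gamma>' s = dtr b c (z s) (axis 1 1)" for s
  have "0 \<in> chart_image b (fst c)" using bx b(2) c(2) by force
  then obtain r where r: "r > 0" "ball 0 r \<subseteq> chart_image b (fst c)"
    using transition_open[OF bM c(1)] open_contains_ball by metis
  have dom: "axis 1 s \<in> chart_image b (fst c)" "axis 1 s \<in> chart_range b" "z s \<in> fst b" "z s \<in> fst c" "snd b (z s) = axis 1 s"
    if "\<bar>s\<bar> < r" for s
  proof -
    show 1: "axis 1 s \<in> chart_image b (fst c)" using r(2) that by (auto simp: norm_axis_2)
    then show 2: "axis 1 s \<in> chart_range b" by blast
    show "z s \<in> fst b" "snd b (z s) = axis 1 s"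
      using chart_inv_in[OF bM 2] chart_inv_right[OF bM 2] by (auto simp: z_def)
    show "z s \<in> fst c" using 1 unfolding chart_image_iff[OF bM] by (simp add: z_def)
  qed
  have ax: "axis 1 s = s *\<^sub>R (axis 1 1 :: real^2)" for s by (simp add: vec_eq_iff axis_def)
  have D: "(\<gamma> has_vector_derivative \<gamma>' s) (at s)" if s: "\<bar>s\<bar> < r" for s
  proof -
    have "((axis 1 :: real \<Rightarrow> real^2) has_derivative axis 1) (at s)"
      by (rule bounded_linear_imp_has_derivative[OF bounded_linear_axis_1])
    moreover have "((snd c \<circ> chart_inv b) has_derivative dtr b c (z s)) (at (axis 1 s))"
      using dtr_has_derivative[OF bM c(1) dom(3,4)[OF s]] dom(5)[OF s] by simp
    ultimately have der: "((\<lambda>t. (snd c \<circ> chart_inv b) (axis 1 t)) has_derivative (\<lambda>t. dtr b c (z s) (axis 1 t))) (at s)"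
      by (rule has_derivative_compose)
    have lin: "dtr b c (z s) (axis 1 t) = t *\<^sub>R dtr b c (z s) (axis 1 1)" for t
      by (rule trans[OF arg_cong[where f="dtr b c (z s)", OF ax[of t]] linear_scale[OF dtr_linear[OF bM c(1) dom(3,4)[OF s]]]])
    have eq: "(\<lambda>t. (snd c \<circ> chart_inv b) (axis 1 t)) = \<gamma>" by (rule ext) (simp add: \<gamma>_def z_def)
    have eq': "(\<lambda>t. dtr b c (z s) (axis 1 t)) = (\<lambda>t. t *\<^sub>R dtr b c (z s) (axis 1 1))" by (rule ext) (rule lin)
    show ?thesis
      using der unfolding has_vector_derivative_def \<gamma>'_def eq eq' .
  qed
  have "axis 1 0 = (0 :: real^2)" by (simp add: vec_eq_iff axis_def)
  then have z0: "z 0 = x" using chart_inv_left[OF bM b(2)] unfolding bx z_def by (simp only:)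
  have "continuous_on {-r<..<r} z"
    unfolding z_def[abs_def]
    by (rule continuous_on_compose2[OF chart_inv_cont[OF bM] linear_continuous_on[OF bounded_linear_axis_1]])
       (use dom(2) in auto)
  then have "continuous_on {-r<..<r} \<gamma>'"
    unfolding \<gamma>'_def[abs_def] by (rule continuous_on_compose2[OF dtr_continuous[OF bM c(1)]]) (use dom(3,4) in auto)
  moreover have "0 \<in> {-r<..<r}" using r(1) by simp
  ultimately have "(\<gamma>' \<longlongrightarrow> \<gamma>' 0) (at 0 within {-r<..<r})"
    unfolding continuous_on_def by (rule bspec)
  then have cont: "(\<gamma>' \<longlongrightarrow> \<gamma>' 0) (at 0)"
    using r(1) at_within_open[of 0 "{-r<..<r}"] by simp
  have nz: "\<gamma>' 0 \<noteq> 0"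
    using dtr_inj[OF bM c(1) b(2) c(2), of "axis 1 1"] by (auto simp: \<gamma>'_def z0 axis_eq_0_iff)
  obtain \<delta> where \<delta>: "0 < \<delta>" "\<delta> < r" "\<And>s. 0 < s \<Longrightarrow> s \<le> \<delta> \<Longrightarrow> \<gamma>' s \<bullet> (\<gamma> s - \<gamma> 0) > 0"
    "\<And>\<rho>. 0 < \<rho> \<Longrightarrow> \<rho> < norm (\<gamma> \<delta> - \<gamma> 0) \<Longrightarrow> \<exists>s. 0 < s \<and> s < \<delta> \<and> norm (\<gamma> s - \<gamma> 0) = \<rho>"
    "\<And>s s'. 0 < s \<Longrightarrow> s \<le> \<delta> \<Longrightarrow> 0 < s' \<Longrightarrow> s' \<le> \<delta> \<Longrightarrow> norm (\<gamma> s - \<gamma> 0) = norm (\<gamma> s' - \<gamma> 0) \<Longrightarrow> s = s'"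
    by (rule radial_growth[where \<gamma>=\<gamma> and \<gamma>'=\<gamma>', OF r(1) _ cont nz], rule D, assumption) (rule that; assumption)
  have \<gamma>0: "\<gamma> 0 = snd c x" by (simp add: \<gamma>_def z0)
  have "\<forall>\<^sub>F z in at x within e. osgn e b z * osgn v b x = - rel_orient M e v"
    using rel_orient_props(2)[OF F x b(1,2)] d0 by simp
  then obtain S where S: "open S" "x \<in> S" "\<And>z. z \<in> S \<Longrightarrow> z \<noteq> x \<Longrightarrow> z \<in> e \<Longrightarrow> osgn e b z * osgn v b x = - rel_orient M e v"
    unfolding eventually_at_topological by blast
  define N where "N = {z \<in> fst b. snd b z \<in> ball 0 \<delta>} \<inter> S"
  have N: "openin (top_of_set (pts M)) N"
    unfolding N_def by (rule openin_Int_open[OF chart_openin_preimage[OF bM open_ball] S(1)])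
  have xN: "x \<in> N" using S(2) b(2) bx \<delta>(1) by (simp add: N_def)
  have "snd c x \<in> chart_image c N" using xN c(2) by blast
  then obtain \<rho>1 where \<rho>1: "\<rho>1 > 0" "ball (snd c x) \<rho>1 \<subseteq> chart_image c N"
    using chart_openin_image[OF c(1) N] open_contains_ball by metis
  have near: "\<exists>s. 0 < s \<and> s < \<delta> \<and> p = z s \<and> p \<in> S" if p: "p \<in> e \<inter> fst c" "norm (snd c p - snd c x) < \<rho>1" for p
  proof -
    have "snd c p \<in> chart_image c N" using \<rho>1(2) p(2) by (auto simp: dist_norm norm_minus_commute)
    then have pN: "p \<in> N" using chart_inv_left[OF c(1)] p(1) unfolding chart_image_iff[OF c(1)] by simp
    then have pb: "p \<in> fst b" "norm (snd b p) < \<delta>" "p \<in> S" by (auto simp: N_def)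
    have "snd b p \<in> chart_image b e" using pb(1) p(1) by blast
    then have h: "snd b p \<in> flat (Suc 0)" "snd b p $ 1 > 0" unfolding img(1) half_space_def by auto
    have e: "snd b p = axis 1 (snd b p $ 1)" by (rule trans[OF flat_1_scale[OF h(1)] ax[symmetric]])
    then have "p = z (snd b p $ 1)" using chart_inv_left[OF bM pb(1)] by (simp add: z_def)
    moreover have "snd b p $ 1 < \<delta>" using pb(2) e h(2) by (metis abs_of_pos norm_axis_2)
    ultimately show ?thesis using h(2) pb(3) by blast
  qed
  have "z s \<in> e" if "0 < s" "s < r" for s
  proof -
    have "axis 1 s \<in> half_space 1" using that(1) axis_1_flat by (simp add: half_space_def axis_def)
    then have "axis 1 s \<in> chart_image b e" unfolding img(1) using dom(2)[of s] that by auto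
    then show ?thesis unfolding chart_image_iff[OF bM] by (simp add: z_def)
  qed
  note ze = this
  have pos: "norm (\<gamma> \<delta> - \<gamma> 0) > 0" using \<delta>(3)[of \<delta>] \<delta>(1) by auto
  \<comment> \<open>Below \<open>\<rho>1\<close> every point of the edge lies on the straightened
    curve before parameter \<open>\<delta>\<close> and in the region where the sign relation holds;
    below \<open>norm (\<gamma> \<delta> - \<gamma> 0)\<close> every radius is attained on that
    curve.\<close>
  show thesis
  proof (rule that[of b "min \<rho>1 (norm (\<gamma> \<delta> - \<gamma> 0))"])
    show "min \<rho>1 (norm (\<gamma> \<delta> - \<gamma> 0)) > 0" using \<rho>1(1) pos by simp
    show "cell_chart M e b" by (rule b(3))
    show "\<exists>!p. p \<in> e \<inter> fst c \<and> norm (snd c p - snd c x) = \<rho>" if \<rho>: "0 < \<rho>" "\<rho> < min \<rho>1 (norm (\<gamma> \<delta> - \<gamma> 0))" for \<rho>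
    proof -
      obtain s where s: "0 < s" "s < \<delta>" "norm (\<gamma> s - \<gamma> 0) = \<rho>" using \<delta>(4)[of \<rho>] \<rho> by auto
      have "z s \<in> e \<inter> fst c \<and> norm (snd c (z s) - snd c x) = \<rho>"
        using ze[of s] dom(4)[of s] s \<delta>(2) \<gamma>0 by (auto simp: \<gamma>_def)
      moreover have "p = z s" if p: "p \<in> e \<inter> fst c \<and> norm (snd c p - snd c x) = \<rho>" for p
      proof -
        obtain s' where s': "0 < s'" "s' < \<delta>" "p = z s'" using near[of p] p \<rho> by auto
        then have "s' = s" using \<delta>(5)[of s' s] s p \<gamma>0 by (auto simp: \<gamma>_def)
        then show ?thesis using s' by simp
      qed
      ultimately show ?thesis by blast
    qed
    show "p \<in> fst b \<and> dtr b c p (axis 1 1) \<bullet> (snd c p - snd c x) > 0 \<and> osgn e b p * osgn v c x = - rel_orient M e v"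
      if p: "p \<in> e \<inter> fst c" "0 < norm (snd c p - snd c x)" "norm (snd c p - snd c x) < min \<rho>1 (norm (\<gamma> \<delta> - \<gamma> 0))" for p
    proof -
      obtain s where s: "0 < s" "s < \<delta>" "p = z s" "p \<in> S" using near[of p] p by auto
      have "p \<noteq> x" using p(2) by auto
      then have "osgn e b p * osgn v b x = - rel_orient M e v" using S(3)[OF s(4)] p(1) by blast
      moreover have "osgn v b x = osgn v c x" using d0 by (simp add: osgn_def ebasis_simps)
      moreover have "dtr b c p (axis 1 1) \<bullet> (snd c p - snd c x) > 0"
        using \<delta>(3)[of s] s \<gamma>0 by (simp add: \<gamma>'_def \<gamma>_def)
      moreover have "p \<in> fst b" using dom(3)[of s] s \<delta>(2) by simp
      ultimately show ?thesis by simp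
    qed
  qed
qed

text \<open>In a boundary chart the sign of \<open>f\<close> near the edge is given by
  \<open>rel_orient\<close>. Passing to \<open>c\<close> multiplies it by the sign of the Jacobian
  determinant, which is constant near \<open>p\<close> by continuity.\<close>

lemma osgn_at_edge:
  assumes F: "facet f e" and d: "cdim M f = 2" and p: "p \<in> e" and c: "c \<in> charts M" "p \<in> fst c"
    and \<beta>: "bdry_chart M f e \<beta>" "p \<in> fst \<beta>"
  shows "\<forall>\<^sub>F z in at p within f. osgn f c z =
    sgn (cross2 (dtr \<beta> c p (axis 1 1)) (dtr \<beta> c p (axis 2 1))) * (rel_orient M f e * osgn e \<beta> p)"
proof -
  note f = facetD(1)[OF F] and e = facetD(2)[OF F]
  have de: "cdim M e = 1" using facetD(4)[OF F] d by simp
  have \<beta>M: "\<beta> \<in> charts M" using \<beta>(1) by (simp add: bdry_chart_def)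
  let ?P = "\<lambda>z. dtr \<beta> c z (axis 1 1)" and ?Q = "\<lambda>z. dtr \<beta> c z (axis 2 1)"
  have oN: "openin (top_of_set (pts M)) (fst \<beta> \<inter> fst c)" "p \<in> fst \<beta> \<inter> fst c"
    using chart_openin \<beta>M c \<beta>(2) by (auto simp: openin_Int)
  have lim: "((\<lambda>z. dtr \<beta> c z u) \<longlongrightarrow> dtr \<beta> c p u) (at p within f)" for u
    by (rule tendsto_within_cell[OF oN dtr_continuous[OF \<beta>M c(1)] cell_subset[OF f]])
  have D0: "cross2 (?P p) (?Q p) \<noteq> 0" by (rule cross2_dtr_nonzero[OF \<beta>M c(1) \<beta>(2) c(2)])
  have 1: "\<forall>\<^sub>F z in at p within f. sgn (cross2 (?P z) (?Q z)) = sgn (cross2 (?P p) (?Q p))"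
    by (rule eventually_sgn_eq[OF _ D0]) (unfold cross2_def, intro tendsto_intros lim)
  have 2: "\<forall>\<^sub>F z in at p within f. osgn f \<beta> z * osgn e \<beta> p = rel_orient M f e"
    using rel_orient_props(2)[OF F p \<beta>] de by simp
  have u: "osgn e \<beta> p * osgn e \<beta> p = 1"
    using osgn_unit[OF e bdry_chart_cell_charts(2)[OF \<beta>(1) facetD(4)[OF F]] p \<beta>(2)] de by auto
  have s: "sgn (cross2 (?P p) (?Q p)) * sgn (cross2 (?P p) (?Q p)) = 1" using D0 by (auto simp: sgn_if)
  from 1 2 eventually_within_cell[OF oN cell_subset[OF f]] show ?thesis
  proof eventually_elim
    case (elim z)
    then have "osgn f \<beta> z = sgn (cross2 (?P p) (?Q p)) * osgn f c z"
      using osgn_change_2[OF f d c(1) \<beta>M, of z] by auto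
    then have "rel_orient M f e * osgn e \<beta> p = sgn (cross2 (?P p) (?Q p)) * osgn f c z * (osgn e \<beta> p * osgn e \<beta> p)"
      using elim(2) by (simp add: mult.assoc)
    then show ?case unfolding u using s by (simp flip: mult.assoc)
  qed
qed

text \<open>Along a small positively oriented circle around the vertex \<open>x\<close>, the orientation sign of \<open>f\<close>,
  extended by \<open>0\<close> outside \<open>f\<close>, jumps exactly where the circle crosses an edge at \<open>x\<close>.
  The jumps are the products of relative orientations, up to one common sign.\<close>

lemma crossing_jump:
  assumes F: "facet f e" "facet e v" and d: "cdim M f = 2" and x: "x \<in> v" and c: "c \<in> charts M" "x \<in> fst c"
    and b: "cell_chart M e b" and p: "p \<in> e" "p \<in> fst c" "p \<in> fst b"
    and rad: "dtr b c p (axis 1 1) \<bullet> (snd c p - snd c x) > 0"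
    and os: "osgn e b p * osgn v c x = - rel_orient M e v"
    and \<rho>: "\<rho> > 0" and pc: "snd c p = circ (snd c x) \<rho> \<theta>"
    and range: "\<And>t. circ (snd c x) \<rho> t \<in> chart_range c"
  defines "zz \<equiv> \<lambda>t. chart_inv c (circ (snd c x) \<rho> t)"
  defines "g \<equiv> \<lambda>t. if zz t \<in> f then osgn f c (zz t) else 0"
  obtains l where "\<forall>\<^sub>F t in at_left \<theta>. g t = l"
    "\<forall>\<^sub>F t in at_right \<theta>. g t = l + (- osgn v c x * (rel_orient M f e * rel_orient M e v))"
proof -
  note f = facetD(1)[OF F(1)] and e = facetD(2)[OF F(1)] and v = facetD(2)[OF F(2)]
  have de: "cdim M e = 1" "cdim M v = 0" using facetD(4)[OF F(1)] facetD(4)[OF F(2)] d by auto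
  obtain \<beta> where \<beta>: "bdry_chart M f e \<beta>" "p \<in> fst \<beta>" "cell_chart M f \<beta>" "cell_chart M e \<beta>" by (rule facet_chart[OF F(1) p(1)])
  have \<beta>M: "\<beta> \<in> charts M" and bM: "b \<in> charts M" using \<beta>(3) b cell_chart_in by auto
  have img: "chart_image \<beta> f = chart_range \<beta> \<inter> half_space 2" "chart_image \<beta> e = chart_range \<beta> \<inter> flat 1"
    using bdry_chart_images[OF \<beta>(1) facetD(4)[OF F(1)]] d de by auto
  have zp: "zz \<theta> = p" using chart_inv_left[OF c(1) p(2)] pc by (simp add: zz_def)
  have zc: "zz t \<in> fst c" "snd c (zz t) = circ (snd c x) \<rho> t" for t
    using chart_inv_in[OF c(1) range] chart_inv_right[OF c(1) range] by (auto simp: zz_def)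
  have zz_cont: "continuous_on UNIV zz"
    unfolding zz_def by (rule continuous_on_compose2[OF chart_inv_cont[OF c(1)] circ_continuous]) (use range in blast)
  have zlim: "(zz \<longlongrightarrow> p) (at \<theta>)" using zz_cont zp by (auto simp: continuous_on_def)
  define \<tau> :: "real^2" where "\<tau> = (- \<rho> * sin \<theta>) *\<^sub>R axis 1 1 + (\<rho> * cos \<theta>) *\<^sub>R axis 2 1"
  \<comment> \<open>The height of the circle above the edge in the boundary chart: near the crossing
    the circle is in \<open>f\<close> exactly where \<open>k\<close> is positive.\<close>
  define k where "k t = (snd \<beta> \<circ> chart_inv c) (circ (snd c x) \<rho> t) $ 2" for t
  define K where "K = dtr c \<beta> p \<tau> $ 2"
  have Dk: "(k has_real_derivative K) (at \<theta>)"
  proof -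
    have "((snd \<beta> \<circ> chart_inv c) has_derivative dtr c \<beta> p) (at (circ (snd c x) \<rho> \<theta>))"
      using dtr_has_derivative[OF c(1) \<beta>M p(2) \<beta>(2)] pc by simp
    from has_derivative_compose[OF circ_derivative this]
    have "((\<lambda>t. (snd \<beta> \<circ> chart_inv c) (circ (snd c x) \<rho> t)) has_derivative (\<lambda>t. dtr c \<beta> p (t *\<^sub>R \<tau>))) (at \<theta>)"
      unfolding \<tau>_def .
    from bounded_linear.has_derivative[OF bounded_linear_vec_nth this, of 2] show ?thesis
      unfolding k_def[abs_def] K_def has_field_derivative_def
      by (simp add: linear_scale[OF dtr_linear[OF c(1) \<beta>M p(2) \<beta>(2)]] mult.commute[of _ "dtr c \<beta> p \<tau> $ 2"])
  qed
  have k0: "k \<theta> = 0"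
  proof -
    have "snd \<beta> p \<in> chart_image \<beta> e" using p(1) \<beta>(2) by blast
    then have "snd \<beta> p $ 2 = 0" unfolding img(2) using flat_1 by simp
    then show ?thesis using zp by (simp add: k_def zz_def)
  qed
  let ?P = "dtr \<beta> c p (axis 1 1)" and ?Q = "dtr \<beta> c p (axis 2 1)" and ?W = "dtr b c p (axis 1 1)"
  define \<alpha> where "\<alpha> = dtr \<beta> b p (axis 1 1) $ 1"
  note ch = osgn_change_1[OF e de(1) b \<beta>(4) p(1,3) \<beta>(2), folded \<alpha>_def]
  have PW: "?P = \<alpha> *\<^sub>R ?W"
  proof -
    have "dtr \<beta> b p (axis 1 1) = \<alpha> *\<^sub>R axis 1 1"
      using ch(2) by (simp add: \<alpha>_def vec_eq_iff forall_2 axis_def)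
    then show ?thesis
      using dtr_trans[OF \<beta>M bM c(1) \<beta>(2) p(3) p(2), of "axis 1 1"] linear_scale[OF dtr_linear[OF bM c(1) p(3,2)]] by simp
  qed
  define D where "D = cross2 ?P ?Q"
  \<comment> \<open>\<open>\<tau>\<close> is the radial vector turned by a quarter, so crossing any
    vector with \<open>\<tau>\<close> gives its product with the radial vector. Expanding
    \<open>\<tau>\<close> in the images of the boundary chart's basis leaves only its normal
    component \<open>K\<close>, times the Jacobian determinant \<open>D\<close>. The sign of
    \<open>K\<close> is thereby known from the edge leaving the vertex outwards.\<close>
  have KD: "K * D = \<alpha> * (?W \<bullet> (snd c p - snd c x))"
  proof -
    let ?y = "dtr c \<beta> p \<tau>"
    have "\<tau> = dtr \<beta> c p ((?y $ 1) *\<^sub>R axis 1 1 + (?y $ 2) *\<^sub>R axis 2 1)"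
      using dtr_trans[OF c(1) \<beta>M c(1) p(2) \<beta>(2) p(2), of \<tau>] dtr_self[OF c(1) p(2)] vec2_decomp[of ?y] by simp
    also have "\<dots> = (?y $ 1) *\<^sub>R ?P + (?y $ 2) *\<^sub>R ?Q"
      using dtr_linear[OF \<beta>M c(1) \<beta>(2) p(2)] by (simp only: linear_add linear_scale)
    finally have "cross2 ?P \<tau> = cross2 ?P ((?y $ 1) *\<^sub>R ?P + (?y $ 2) *\<^sub>R ?Q)" by (rule arg_cong)
    then have 1: "cross2 ?P \<tau> = K * D"
      by (simp add: cross2_def K_def D_def algebra_simps)
    have "snd c p - snd c x = (\<rho> * cos \<theta>) *\<^sub>R axis 1 1 + (\<rho> * sin \<theta>) *\<^sub>R axis 2 1"
      unfolding pc circ_def by simp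
    then have "?W \<bullet> (snd c p - snd c x) = cross2 ?W \<tau>"
      by (simp add: \<tau>_def cross2_def inner_vec_def sum_2 axis_def algebra_simps)
    moreover have "cross2 ?P \<tau> = \<alpha> * cross2 ?W \<tau>"
      unfolding PW by (simp add: cross2_def algebra_simps)
    ultimately show ?thesis using 1 by simp
  qed
  have K0: "K \<noteq> 0" using KD ch(3) rad by (metis less_irrefl mult_eq_0_iff)
  have sKD: "sgn K * sgn D = sgn \<alpha>" using arg_cong[OF KD, of sgn] rad by (simp add: sgn_mult)
  define q where "q = sgn D * (rel_orient M f e * osgn e \<beta> p)"
  have evo: "\<forall>\<^sub>F z in at p within f. osgn f c z = q"
    using osgn_at_edge[OF F(1) d p(1) c(1) p(2) \<beta>(1,2)] unfolding q_def D_def .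
  \<comment> \<open>The factor \<open>sgn \<alpha>\<close>, which compares the two charts of the
    edge, occurs twice and disappears.\<close>
  have J: "q * sgn K = - osgn v c x * (rel_orient M f e * rel_orient M e v)"
  proof -
    have "q * sgn K = (sgn K * sgn D) * (rel_orient M f e * (sgn \<alpha> * osgn e b p))"
      unfolding q_def ch(1) by (simp add: mult_ac)
    also have "\<dots> = (sgn \<alpha> * sgn \<alpha>) * (rel_orient M f e * osgn e b p)" unfolding sKD by (simp add: mult_ac)
    also have "sgn \<alpha> * sgn \<alpha> = 1" using ch(3) by (auto simp: sgn_if)
    also have "osgn e b p = - osgn v c x * rel_orient M e v"
      using os osgn_vertex[OF v de(2) x, of c] by auto
    finally show ?thesis by (simp add: mult_ac)
  qed
  have ev\<beta>: "\<forall>\<^sub>F t in at \<theta>. zz t \<in> fst \<beta>"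
  proof -
    obtain U where U: "open U" "fst \<beta> = pts M \<inter> U" using chart_openin[OF \<beta>M] by (auto simp: openin_open)
    have "\<forall>\<^sub>F t in at \<theta>. zz t \<in> U" using topological_tendstoD[OF zlim U(1)] U(2) \<beta>(2) by blast
    then show ?thesis
      by eventually_elim (use U(2) zc(1) chart_subset[OF c(1)] in blast)
  qed
  have zf: "zz t \<in> f \<longleftrightarrow> sgn (k t) = 1" if "zz t \<in> fst \<beta>" for t
  proof -
    have "zz t \<in> f \<longleftrightarrow> snd \<beta> (zz t) \<in> chart_image \<beta> f"
      using that chart_inv_left[OF \<beta>M that] unfolding chart_image_iff[OF \<beta>M] by auto
    also have "\<dots> \<longleftrightarrow> k t > 0"
      unfolding img(1) half_space_def using that by (auto simp: flat_2 k_def zz_def)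
    finally show ?thesis by (simp add: sgn_if)
  qed
  have ev\<beta>': "\<forall>\<^sub>F t in at_right \<theta>. zz t \<in> fst \<beta>" "\<forall>\<^sub>F t in at_left \<theta>. zz t \<in> fst \<beta>"
    using ev\<beta> eventually_at_split by blast+
  have zlim': "(zz \<longlongrightarrow> p) (at_right \<theta>)" "(zz \<longlongrightarrow> p) (at_left \<theta>)"
    using zlim filterlim_at_split by blast+
  have pf: "p \<notin> f" using facet_closure(2)[OF F(1)] p(1) by blast
  have inside: "\<forall>\<^sub>F t in G. g t = q" if "\<forall>\<^sub>F t in G. zz t \<in> f" "(zz \<longlongrightarrow> p) G" for G
  proof -
    have "\<forall>\<^sub>F t in G. zz t \<in> f \<and> zz t \<noteq> p" using that(1) by eventually_elim (use pf in auto)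
    then have "filterlim zz (at p within f) G" using that(2) by (simp add: filterlim_at)
    from eventually_compose_filterlim[OF evo this] that(1) show ?thesis
      by eventually_elim (simp add: g_def)
  qed
  note sg = sgn_near_zero[OF Dk k0 K0]
  \<comment> \<open>If \<open>K > 0\<close> the circle enters \<open>f\<close> and \<open>g\<close>
    jumps from 0 to \<open>q\<close>; if \<open>K < 0\<close> it leaves and \<open>g\<close> jumps
    from \<open>q\<close> to 0. In both cases the jump is \<open>q * sgn K\<close>.\<close>
  show thesis
  proof (cases "K > 0")
    case True
    from sg(2) ev\<beta>'(2) have l: "\<forall>\<^sub>F t in at_left \<theta>. g t = 0"
      by eventually_elim (use True zf in \<open>simp add: g_def\<close>)
    from sg(1) ev\<beta>'(1) have "\<forall>\<^sub>F t in at_right \<theta>. zz t \<in> f"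
      by eventually_elim (use True zf in simp)
    from inside[OF this zlim'(1)] have r: "\<forall>\<^sub>F t in at_right \<theta>. g t = 0 + q * sgn K" using True by simp
    show thesis using that[OF l] r unfolding J by blast
  next
    case False
    then have neg: "K < 0" using K0 by simp
    from sg(2) ev\<beta>'(2) have "\<forall>\<^sub>F t in at_left \<theta>. zz t \<in> f"
      by eventually_elim (use neg zf in simp)
    from inside[OF this zlim'(2)] have l: "\<forall>\<^sub>F t in at_left \<theta>. g t = q" .
    from sg(1) ev\<beta>'(1) have r: "\<forall>\<^sub>F t in at_right \<theta>. g t = q + q * sgn K"
      by eventually_elim (use neg zf in \<open>simp add: g_def\<close>)
    show thesis using that[OF l] r unfolding J by blast
  qed
qed

text \<open>The cell may occupy several sectors around the vertex, with different signs in the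
  chart, and these need not be listed: a function on the circle returns to its initial value after
  one turn, whatever the sectors. The vertex sign common to all jumps is a unit and is divided out
  at the end.\<close>

lemma boundary_of_boundary:
  assumes f: "f \<in> cells M" and d: "cdim M f = 2" and v: "v \<in> cells M" "cdim M v = 0"
  shows "(\<Sum>e | facet f e \<and> facet e v. rel_orient M f e * rel_orient M e v) = 0"
proof -
  define X where "X = {e. facet f e \<and> facet e v}"
  have fin_cells: "finite (cells M)" by (rule mesh_conj(1))
  have finX: "finite X" by (rule finite_subset[OF _ fin_cells]) (auto simp: X_def facet_def)
  have XF: "facet f e" "facet e v" if "e \<in> X" for e using that by (auto simp: X_def)
  have dX: "cdim M e = 1" if "e \<in> X" for e using facetD(4)[OF XF(1)[OF that]] d by simp
  obtain x where x: "x \<in> v" using cell_facts(1)[OF v(1)] by blast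
  have vx: "v = {x}" by (rule cell_0_singleton[OF v x])
  have xp: "x \<in> pts M" using cell_subset[OF v(1)] x by blast
  obtain c where c: "c \<in> charts M" "x \<in> fst c" using chart_exists[OF xp] by blast
  define Q where "Q e b \<rho>0 \<longleftrightarrow> cell_chart M e b \<and> \<rho>0 > 0 \<and>
    (\<forall>\<rho>. 0 < \<rho> \<longrightarrow> \<rho> < \<rho>0 \<longrightarrow> (\<exists>!p. p \<in> e \<inter> fst c \<and> norm (snd c p - snd c x) = \<rho>)) \<and>
    (\<forall>p. p \<in> e \<inter> fst c \<longrightarrow> 0 < norm (snd c p - snd c x) \<longrightarrow> norm (snd c p - snd c x) < \<rho>0 \<longrightarrow>
      p \<in> fst b \<and> dtr b c p (axis 1 1) \<bullet> (snd c p - snd c x) > 0 \<and> osgn e b p * osgn v c x = - rel_orient M e v)"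
    for e b and \<rho>0 :: real
  have "\<exists>b \<rho>0. Q e b \<rho>0" if e: "e \<in> X" for e
    by (rule edge_crossing[OF XF(2)[OF e] dX[OF e] x c], unfold Q_def) blast
  then obtain b \<rho>0 where Q: "\<And>e. e \<in> X \<Longrightarrow> Q e (b e) (\<rho>0 e)"
    by metis
  have b: "cell_chart M e (b e)" and \<rho>0: "\<rho>0 e > 0" if "e \<in> X" for e
    using Q[OF that] unfolding Q_def by blast+
  have uniq: "\<exists>!p. p \<in> e \<inter> fst c \<and> norm (snd c p - snd c x) = \<rho>" if "e \<in> X" "0 < \<rho>" "\<rho> < \<rho>0 e" for e \<rho>
    using Q[OF that(1)] that(2,3) unfolding Q_def by blast
  have cross: "p \<in> fst (b e) \<and> dtr (b e) c p (axis 1 1) \<bullet> (snd c p - snd c x) > 0 \<and> osgn e (b e) p * osgn v c x = - rel_orient M e v"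
    if "e \<in> X" "p \<in> e \<inter> fst c" "0 < norm (snd c p - snd c x)" "norm (snd c p - snd c x) < \<rho>0 e" for e p
    using Q[OF that(1)] that(2-4) unfolding Q_def by blast
  \<comment> \<open>A closed set missing \<open>x\<close>. Off it, the circle can only touch cells
    that have \<open>x\<close> in their closure.\<close>
  define Z where "Z = \<Union>(closure ` {f' \<in> cells M. x \<notin> closure f'})"
  have "closed Z" unfolding Z_def using fin_cells by (intro closed_Union) auto
  then have W: "openin (top_of_set (pts M)) (pts M - Z)" "x \<in> pts M - Z"
    using xp by (auto simp: openin_open Z_def intro!: exI[of _ "- Z"])
  then have "snd c x \<in> chart_image c (pts M - Z)" using c by blast
  then obtain R where R: "R > 0" "ball (snd c x) R \<subseteq> chart_image c (pts M - Z)"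
    using chart_openin_image[OF c(1) W(1)] open_contains_ball by metis
  \<comment> \<open>Including \<open>R\<close> keeps the minimum meaningful if no edge of
    \<open>f\<close> ends at \<open>v\<close>.\<close>
  define m where "m = Min (insert R (\<rho>0 ` X))"
  define \<rho> where "\<rho> = m / 2"
  have "m > 0" unfolding m_def using finX R(1) \<rho>0 by simp
  moreover have "m \<le> R" "\<And>e. e \<in> X \<Longrightarrow> m \<le> \<rho>0 e" unfolding m_def using finX by auto
  ultimately have \<rho>: "\<rho> > 0" "\<rho> < R" "\<And>e. e \<in> X \<Longrightarrow> \<rho> < \<rho>0 e" unfolding \<rho>_def by fastforce+
  define \<zeta> where "\<zeta> = circ (snd c x) \<rho>"
  define zz where "zz t = chart_inv c (\<zeta> t)" for t
  have \<zeta>W: "\<zeta> t \<in> chart_image c (pts M - Z)" for t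
    using R(2) circ_norm[OF \<rho>(1), of "snd c x" t] \<rho>(2) by (auto simp: \<zeta>_def dist_norm norm_minus_commute subset_iff)
  then have range: "\<zeta> t \<in> chart_range c" for t by blast
  have zz: "zz t \<in> fst c" "snd c (zz t) = \<zeta> t" "zz t \<notin> Z" "norm (snd c (zz t) - snd c x) = \<rho>" for t
    using chart_inv_in[OF c(1) range] chart_inv_right[OF c(1) range] \<zeta>W[of t, unfolded chart_image_iff[OF c(1)]]
      circ_norm[OF \<rho>(1)] by (auto simp: zz_def \<zeta>_def)
  obtain P where P: "\<And>e. e \<in> X \<Longrightarrow> P e \<in> e \<inter> fst c \<and> norm (snd c (P e) - snd c x) = \<rho>"
    and P_unique: "\<And>e p. e \<in> X \<Longrightarrow> p \<in> e \<inter> fst c \<Longrightarrow> norm (snd c p - snd c x) = \<rho> \<Longrightarrow> p = P e"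
    using uniq[OF _ \<rho>(1) \<rho>(3)] by metis
  have cont: "continuous_on UNIV zz"
    unfolding zz_def \<zeta>_def
    by (rule continuous_on_compose2[OF chart_inv_cont[OF c(1)] circ_continuous])
       (use range[unfolded \<zeta>_def] in blast)
  \<comment> \<open>A boundary point of \<open>f\<close> on the circle lies in a lower-dimensional
    cell with \<open>x\<close> in its closure. That cell is not a vertex, since it would be
    \<open>{x}\<close> and the circle avoids \<open>x\<close>; so it is an edge ending at
    \<open>v\<close>, met by the circle in one point.\<close>
  have bdry: "\<exists>e\<in>X. zz t = P e" if t: "zz t \<in> bdry f" for t
  proof -
    obtain e where e: "e \<in> cells M" "cdim M e < 2" "zz t \<in> e" using bdry_cover[OF f t] d by auto
    have "e \<subseteq> bdry f" using cell_touching[OF f e(1)] e(2,3) d t by (auto simp: bdry_def)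
    have xe: "x \<in> closure e" using zz(3)[of t] e(1,3) closure_subset unfolding Z_def by blast
    have "cdim M e \<noteq> 0"
    proof
      assume "cdim M e = 0"
      then have "e = {zz t}" using cell_0_singleton[OF e(1) _ e(3)] by blast
      then have "zz t = x" using xe by simp
      then show False using zz(4)[of t] \<rho>(1) by simp
    qed
    then have e1: "cdim M e = 1" using e(2) by simp
    have "v \<subseteq> bdry e" using cell_touching[OF e(1) v(1)] e1 v(2) xe x by auto
    then have "e \<in> X" using e1 e(1) f v d \<open>e \<subseteq> bdry f\<close> by (simp add: X_def facet_def)
    then show ?thesis using P_unique[of e "zz t"] e(3) zz(1,4) by blast
  qed
  define g where "g t = (if zz t \<in> f then osgn f c (zz t) else 0)" for t
  have cc: "cell_chart M f c" by (rule cell_chart_2[OF f d c(1)])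
  have g_const: "\<forall>\<^sub>F u in at t. g u = g t" if nb: "zz t \<notin> bdry f" for t
  proof (cases "zz t \<in> f")
    case True
    obtain U where U: "open U" "f = pts M \<inter> U" using open_2_cell[OF f d] by (auto simp: openin_open)
    have eqU: "zz u \<in> f \<longleftrightarrow> u \<in> zz -` U" for u using U(2) zz(1)[of u] chart_subset[OF c(1)] by blast
    have op: "open (zz -` U)" using open_vimage[OF U(1) cont] .
    let ?h = "\<lambda>z. orient M f z (map (tvec_of M c z) (ebasis (cdim M f)))"
    have "continuous_on (zz -` U) (\<lambda>u. ?h (zz u))"
      by (rule continuous_on_compose2[OF orient_continuous(2)[OF f cc] continuous_on_subset[OF cont]]) (use eqU zz(1) in auto)
    then have "((\<lambda>u. ?h (zz u)) \<longlongrightarrow> ?h (zz t)) (at t within zz -` U)"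
      using True eqU[of t] unfolding continuous_on_def by blast
    moreover have "at t within zz -` U = at t"
      using True eqU[of t] op by (intro at_within_open) blast+
    ultimately have "((\<lambda>u. ?h (zz u)) \<longlongrightarrow> ?h (zz t)) (at t)" by simp
    from eventually_sgn_eq[OF this orient_basis_nonzero[OF f cc True zz(1)]] d
    have "\<forall>\<^sub>F u in at t. osgn f c (zz u) = osgn f c (zz t)" by (simp add: osgn_def)
    moreover have "\<forall>\<^sub>F u in at t. u \<in> zz -` U" using eventually_at_in_open'[OF op] True eqU by blast
    ultimately show ?thesis by eventually_elim (use True eqU in \<open>simp add: g_def\<close>)
  next
    case False
    then have nc: "t \<in> zz -` (- closure f)" using nb by (simp add: bdry_def)
    have "open (zz -` (- closure f))" using open_vimage[OF _ cont] by blast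
    then have "\<forall>\<^sub>F u in at t. u \<in> zz -` (- closure f)" using eventually_at_in_open' nc by blast
    then show ?thesis by eventually_elim (use False closure_subset[of f] in \<open>auto simp: g_def\<close>)
  qed
  define w where "w e = - osgn v c x * (rel_orient M f e * rel_orient M e v)" for e
  have jump: "\<exists>l. (\<forall>\<^sub>F u in at_left t. g u = l) \<and> (\<forall>\<^sub>F u in at_right t. g u = l + w e)" if e: "e \<in> X" "zz t = P e" for e t
  proof -
    have Pe: "P e \<in> e" "P e \<in> fst c" "norm (snd c (P e) - snd c x) = \<rho>" using P[OF e(1)] by auto
    have cr: "P e \<in> fst (b e) \<and> dtr (b e) c (P e) (axis 1 1) \<bullet> (snd c (P e) - snd c x) > 0 \<and> osgn e (b e) (P e) * osgn v c x = - rel_orient M e v"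
      using cross[OF e(1), of "P e"] Pe \<rho>(1) \<rho>(3)[OF e(1)] by simp
    have ptc: "snd c (P e) = circ (snd c x) \<rho> t" using zz(2)[of t] e(2) by (simp add: \<zeta>_def)
    show ?thesis
      using crossing_jump[OF XF[OF e(1)] d x c b[OF e(1)] Pe(1,2) _ _ _ \<rho>(1) ptc range[unfolded \<zeta>_def]] cr
      unfolding g_def[abs_def] w_def zz_def \<zeta>_def by blast
  qed
  \<comment> \<open>The turn must start away from the crossings, so that all jumps are interior;
    there are finitely many crossings and infinitely many angles.\<close>
  have "\<exists>a\<in>{0..<2 * pi}. zz a \<notin> P ` X"
  proof (rule ccontr)
    assume "\<not> ?thesis"
    then have sub: "zz ` {0..<2 * pi} \<subseteq> P ` X" by blast
    have "inj_on zz {0..<2 * pi}"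
    proof (rule inj_onI)
      fix s t assume st: "s \<in> {0..<2 * pi}" "t \<in> {0..<2 * pi}" "zz s = zz t"
      then have "\<zeta> s = \<zeta> t" using zz(2) by metis
      then show "s = t" using circ_inj[OF \<rho>(1)] st unfolding \<zeta>_def by auto
    qed
    then have "finite {0..<2 * pi}" using finite_imageD finite_subset[OF sub] finX by blast
    then show False using infinite_Ico[of 0 "2 * pi"] by simp
  qed
  then obtain a where a: "0 \<le> a" "a < 2 * pi" "zz a \<notin> P ` X" by auto
  have per: "zz (t + 2 * pi) = zz t" for t by (simp add: zz_def \<zeta>_def circ_periodic)
  \<comment> \<open>Each crossing angle is moved by a full period, if necessary, into the turn
    beginning at \<open>a\<close>.\<close>
  have "\<exists>t. a < t \<and> t < a + 2 * pi \<and> zz t = P e" if e: "e \<in> X" for e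
  proof -
    obtain t where t: "0 \<le> t" "t < 2 * pi" "snd c (P e) = \<zeta> t"
      using circ_surj[OF \<rho>(1), of "snd c (P e)" "snd c x"] P[OF e] unfolding \<zeta>_def by blast
    then have zt: "zz t = P e" using P[OF e] chart_inv_left[OF c(1)] by (metis IntD2 zz_def)
    have "t \<noteq> a" using a(3) zt e by blast
    show ?thesis
    proof (cases "a < t")
      case True
      then show ?thesis using t a zt by (intro exI[of _ t]) auto
    next
      case False
      then show ?thesis using t a zt \<open>t \<noteq> a\<close> per[of t] by (intro exI[of _ "t + 2 * pi"]) auto
    qed
  qed
  then obtain \<theta> where \<theta>: "\<And>e. e \<in> X \<Longrightarrow> a < \<theta> e \<and> \<theta> e < a + 2 * pi \<and> zz (\<theta> e) = P e" by metis
  have P_inj: "e = e'" if "e \<in> X" "e' \<in> X" "P e = P e'" for e e'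
  proof (rule ccontr)
    assume "e \<noteq> e'"
    moreover have "e \<in> cells M" "e' \<in> cells M" using that XF facetD by blast+
    ultimately have "e \<inter> e' = {}" using mesh_conj(2) by (simp add: disjoint_def)
    then show False using P that by (metis IntD1 IntI empty_iff)
  qed
  have \<theta>_inj: "inj_on \<theta> X"
    by (rule inj_onI) (metis \<theta> P_inj)
  define S where "S = \<theta> ` X"
  define J where "J t = w (inv_into X \<theta> t)" for t
  have SX: "inv_into X \<theta> t \<in> X" "zz t = P (inv_into X \<theta> t)" if "t \<in> S" for t
    using that \<theta> unfolding S_def by (auto simp: inv_into_into \<theta>_inj)
  then have "\<forall>t. \<exists>l. t \<in> S \<longrightarrow> (\<forall>\<^sub>F u in at_left t. g u = l) \<and> (\<forall>\<^sub>F u in at_right t. g u = l + J t)"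
    using jump unfolding J_def by blast
  then obtain l where l: "\<And>t. t \<in> S \<Longrightarrow> (\<forall>\<^sub>F u in at_left t. g u = l t) \<and> (\<forall>\<^sub>F u in at_right t. g u = l t + J t)"
    by metis
  have "g (a + 2 * pi) - g a = (\<Sum>t\<in>S. J t)"
  proof (rule sum_of_jumps[where S=S and a=a and b="a + 2 * pi" and G=g and l=l and J=J])
    show "finite S" by (simp add: S_def finX)
    show "S \<subseteq> {a<..<a + 2 * pi}" using \<theta> by (auto simp: S_def)
    show "\<forall>\<^sub>F u in at t. g u = g t" if t: "t \<in> {a..a + 2 * pi}" "t \<notin> S" for t
    proof (rule g_const, rule notI)
      assume "zz t \<in> bdry f"
      then obtain e where e: "e \<in> X" "zz t = P e" using bdry by blast
      then have "\<zeta> t = \<zeta> (\<theta> e)" using \<theta>[OF e(1)] zz(2) by metis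
      moreover have "t \<noteq> a" "t \<noteq> a + 2 * pi" using e a(3) per[of a] by auto
      then have "\<bar>t - \<theta> e\<bar> < 2 * pi" using t(1) \<theta>[OF e(1)] by auto
      ultimately have "t = \<theta> e" using circ_inj[OF \<rho>(1)] unfolding \<zeta>_def by blast
      then show False using t(2) e(1) by (simp add: S_def)
    qed
  qed (use l in auto)
  moreover have "g (a + 2 * pi) = g a" by (simp add: g_def per)
  moreover have "(\<Sum>t\<in>S. J t) = (\<Sum>e\<in>X. w e)"
    unfolding S_def J_def by (simp add: sum.reindex[OF \<theta>_inj] inv_into_f_f[OF \<theta>_inj])
  ultimately have "(\<Sum>e\<in>X. w e) = 0" by simp
  then have "osgn v c x * (\<Sum>e\<in>X. rel_orient M f e * rel_orient M e v) = 0"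
    unfolding w_def by (simp add: sum_distrib_left[symmetric] sum_negf)
  then show ?thesis using osgn_vertex[OF v x, of c] unfolding X_def by auto
qed

end

section \<open>Polynomial spaces\<close>

locale ddr = riem_mesh M for M :: "('p::t2_space, 'z) ddr_surface_scheme" +
  fixes r :: int
  assumes ps: "polynomial_spaces M" and H: "hypothesis_H M" and T: "hypothesis_T M" and r: "r \<ge> 0"
begin

abbreviation d where "d \<equiv> ext_deriv M"
abbreviation \<kappa> where "\<kappa> \<equiv> kosz M"

lemma poly_facts:
  assumes "f \<in> cells M"
  shows "subspace (poly M f s l)" "\<exists>B. finite B \<and> span B = poly M f s l" "poly M f s l \<subseteq> Ck_cell_forms M 1 f l"
    "p \<in> poly M f s l \<Longrightarrow> d f p \<in> poly M f (s - 1) (l + 1)" "p \<in> poly M f s l \<Longrightarrow> \<kappa> f p \<in> poly M f (s + 1) (l - 1)"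
    "p \<in> poly M f s l \<Longrightarrow> \<kappa> f (\<kappa> f p) = 0" "lin_on (poly M f s l) (\<kappa> f)"
proof -
  note a = ps[unfolded polynomial_spaces_def, THEN bspec, OF assms, THEN spec, THEN spec, of s l]
  show "subspace (poly M f s l)" "\<exists>B. finite B \<and> span B = poly M f s l" "poly M f s l \<subseteq> Ck_cell_forms M 1 f l"
    using a by blast+
  show "p \<in> poly M f s l \<Longrightarrow> d f p \<in> poly M f (s - 1) (l + 1)" "p \<in> poly M f s l \<Longrightarrow> \<kappa> f p \<in> poly M f (s + 1) (l - 1)"
    "p \<in> poly M f s l \<Longrightarrow> \<kappa> f (\<kappa> f p) = 0"
    using a by blast+
  show "lin_on (poly M f s l) (\<kappa> f)" using a unfolding lin_on_def by blast
qed

context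
  fixes f assumes f: "f \<in> cells M"
begin

lemma poly_Ck: "p \<in> poly M f s l \<Longrightarrow> p \<in> Ck_cell_forms M 1 f l" "p \<in> poly M f s l \<Longrightarrow> p \<in> Ck_cell_forms M 0 f l"
    "p \<in> poly M f s l \<Longrightarrow> p \<in> cell_forms M f l"
  using poly_facts(3)[OF f, of s l] Ck_cell_forms_1_0[of f l] by (auto simp: Ck_cell_forms_iff[of _ 0])

lemma poly_d_lin: "lin_on (poly M f s l) (d f)"
  by (rule lin_on_mono[OF ext_deriv_lin[OF f] poly_facts(3)[OF f]])

lemma poly_0: "0 \<in> poly M f s l"
  by (rule subspace_0[OF poly_facts(1)[OF f]])

lemma kosz_0: "\<kappa> f 0 = 0"
  by (rule lin_on_0[OF poly_facts(1,7)[OF f]])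

lemma d_0: "d f 0 = 0"
  by (rule lin_on_0[OF poly_facts(1)[OF f] poly_d_lin])

lemma poly_negative_form: "l < 0 \<Longrightarrow> p \<in> poly M f s l \<Longrightarrow> p = 0"
  using cell_forms_negative poly_Ck(3) by blast

lemma decomposition:
  obtains Hs ev where "\<And>s l. subspace (Hs s l)" "\<And>s l. is_direct_sum_upto (poly M f s l) s (\<lambda>s. Hs s l)"
    "\<And>s l p. p \<in> Hs s l \<Longrightarrow> d f (\<kappa> f p) + \<kappa> f (d f p) = ev s l *\<^sub>R p"
    "\<And>s l. l \<in> {0..int (cdim M f)} \<Longrightarrow> s \<ge> 0 \<Longrightarrow> ev s l = 0 \<longleftrightarrow> s = 0 \<and> l = 0"
proof -
  obtain Hs ev where *: "homogeneous_decomposition M f Hs ev \<and>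
     (cdim M f > 0 \<longrightarrow> (\<forall>l\<in>{0..int (cdim M f)}. \<forall>s\<ge>0. \<forall>s'\<ge>0. ev s l = ev s' l \<longrightarrow> s = s')) \<and>
     (\<forall>l\<in>{0..int (cdim M f)}. \<forall>s\<ge>0. ev s l = 0 \<longleftrightarrow> s = 0 \<and> l = 0) \<and>
     (\<forall>s>0. \<forall>l\<in>{0..<int (cdim M f)}. ext_deriv M f ` Hs s l \<noteq> {0})"
    using bspec[OF H[unfolded hypothesis_H_def] f] by (elim exE) (rule that)
  note hd = conjunct1[OF *, unfolded homogeneous_decomposition_def]
  have 3: "\<forall>l\<in>{0..int (cdim M f)}. \<forall>s\<ge>0. ev s l = 0 \<longleftrightarrow> s = 0 \<and> l = 0"
    by (rule *[THEN conjunct2, THEN conjunct2, THEN conjunct1])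
  show thesis
  proof (rule that)
    show "subspace (Hs s l)" for s l using hd by blast
    show "is_direct_sum_upto (poly M f s l) s (\<lambda>s. Hs s l)" for s l using hd by blast
    show "d f (\<kappa> f p) + \<kappa> f (d f p) = ev s l *\<^sub>R p" if "p \<in> Hs s l" for s l p using hd that by blast
    show "ev s l = 0 \<longleftrightarrow> s = 0 \<and> l = 0" if "l \<in> {0..int (cdim M f)}" "s \<ge> 0" for s l using 3 that by blast
  qed
qed

lemma poly_negative_degree: "s < 0 \<Longrightarrow> p \<in> poly M f s l \<Longrightarrow> p = 0"
proof -
  assume s: "s < 0" and p: "p \<in> poly M f s l"
  obtain Hs ev where "\<And>s l. is_direct_sum_upto (poly M f s l) s (\<lambda>s. Hs s l)" by (rule decomposition) (rule that; assumption)
  then have "is_direct_sum_upto (poly M f s l) s (\<lambda>s. Hs s l)" .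
  then show "p = 0" using p s by (auto simp: is_direct_sum_upto_def)
qed

lemma poly_mono: "s \<le> s' \<Longrightarrow> poly M f s l \<subseteq> poly M f s' l"
proof
  fix p assume s: "s \<le> s'" and p: "p \<in> poly M f s l"
  obtain Hs ev where Hs: "\<And>s l. subspace (Hs s l)" "\<And>s l. is_direct_sum_upto (poly M f s l) s (\<lambda>s. Hs s l)"
    by (rule decomposition) (rule that; assumption)
  obtain h where h: "p = (\<Sum>i\<in>{0..s}. h i)" "\<forall>i\<in>{0..s}. h i \<in> Hs i l"
    using Hs(2)[of s l] p unfolding is_direct_sum_upto_def by blast
  define h' where "h' i = (if i \<le> s then h i else 0)" for i
  have "p = (\<Sum>i\<in>{0..s'}. h' i)"
    unfolding h(1) by (rule sum.mono_neutral_cong_left) (use s in \<open>auto simp: h'_def\<close>)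
  moreover have "\<forall>i\<in>{0..s'}. h' i \<in> Hs i l" using h(2) subspace_0[OF Hs(1)] by (auto simp: h'_def)
  ultimately show "p \<in> poly M f s' l" using Hs(2)[of s' l] unfolding is_direct_sum_upto_def by blast
qed

lemma d_poly: "p \<in> poly M f s l \<Longrightarrow> d f p \<in> poly M f s (l + 1)"
  using poly_facts(4)[OF f] poly_mono[of "s - 1" s "l + 1"] by auto

section \<open>The operator \<open>d \<kappa> + \<kappa> d\<close> and its inverse\<close>

definition Lap where "Lap p = d f (\<kappa> f p) + \<kappa> f (d f p)"

lemma Lap_terms:
  assumes "p \<in> poly M f s l"
  shows "d f (\<kappa> f p) \<in> poly M f s l" "\<kappa> f (d f p) \<in> poly M f s l"
  using poly_facts(4)[OF f poly_facts(5)[OF f assms]] poly_facts(5)[OF f poly_facts(4)[OF f assms]] by simp_all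

lemma Lap_poly: "p \<in> poly M f s l \<Longrightarrow> Lap p \<in> poly M f s l"
  unfolding Lap_def using Lap_terms subspace_add[OF poly_facts(1)[OF f]] by blast

lemma Lap_lin: "lin_on (poly M f s l) Lap"
proof -
  have 1: "lin_on (poly M f s l) (\<lambda>p. d f (\<kappa> f p))"
    by (rule lin_on_comp[OF poly_facts(7)[OF f] poly_d_lin]) (use poly_facts(5)[OF f] in blast)
  have 2: "lin_on (poly M f s l) (\<lambda>p. \<kappa> f (d f p))"
    by (rule lin_on_comp[OF poly_d_lin poly_facts(7)[OF f]]) (use poly_facts(4)[OF f] in blast)
  show ?thesis
    using 1 2 unfolding lin_on_def Lap_def by (simp add: algebra_simps)
qed

text \<open>Induction on the degree. If \<open>\<kappa> d \<kappa> w = 0\<close> then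
  \<open>\<kappa> (Lap w) = 0\<close>, because \<open>\<kappa> \<kappa> = 0\<close>. Subtracting
  from \<open>Lap w\<close> the multiple of \<open>w\<close> by its top eigenvalue lowers the
  degree, keeps the assumption, and changes \<open>\<kappa> w\<close> only by a nonzero factor. The
  argument stays within the filtered spaces, since \<open>\<kappa>\<close> is not given to respect
  the homogeneous components.\<close>

lemma kosz_d_kosz_injective:
  assumes l: "1 \<le> l" "l \<le> int (cdim M f)" and "w \<in> poly M f n l" "\<kappa> f (d f (\<kappa> f w)) = 0"
  shows "\<kappa> f w = 0"
proof -
  obtain Hs ev where Hs: "\<And>s l. subspace (Hs s l)" "\<And>s l. is_direct_sum_upto (poly M f s l) s (\<lambda>s. Hs s l)"
    "\<And>s l p. p \<in> Hs s l \<Longrightarrow> d f (\<kappa> f p) + \<kappa> f (d f p) = ev s l *\<^sub>R p"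
    "\<And>s l. l \<in> {0..int (cdim M f)} \<Longrightarrow> s \<ge> 0 \<Longrightarrow> ev s l = 0 \<longleftrightarrow> s = 0 \<and> l = 0"
    by (rule decomposition) (rule that; assumption)
  have Lev: "Lap p = ev s l *\<^sub>R p" if "p \<in> Hs s l" for p s l using Hs(3)[OF that] by (simp add: Lap_def)
  \<comment> \<open>\<open>m\<close> is the degree plus one, so the induction starts at degree
    \<open>-1\<close>, where the space is zero.\<close>
  have main: "\<kappa> f w = 0" if "w \<in> poly M f (int m - 1) l" "\<kappa> f (d f (\<kappa> f w)) = 0" for m w
    using that
  proof (induction m arbitrary: w)
    case 0
    then have "w \<in> poly M f (- 1) l" by simp
    then have "w = 0" by (rule poly_negative_degree[rotated]) simp
    then show ?case by (simp only: kosz_0)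
  next
    case (Suc m)
    let ?n = "int m"
    have w: "w \<in> poly M f ?n l" using Suc.prems by simp
    obtain h where h: "w = (\<Sum>i\<in>{0..?n}. h i)" "\<forall>i\<in>{0..?n}. h i \<in> Hs i l"
      using Hs(2)[of ?n l] w unfolding is_direct_sum_upto_def by blast
    have hp: "h i \<in> poly M f ?n l" if "i \<in> {0..?n}" for i
    proof -
      have "h i \<in> poly M f i l"
      proof -
        have "h i = (\<Sum>j\<in>{0..i}. if j = i then h i else 0)" using that by simp
        moreover have "\<forall>j\<in>{0..i}. (if j = i then h i else 0) \<in> Hs j l"
          using h(2) that subspace_0[OF Hs(1)] by auto
        ultimately show ?thesis using Hs(2)[of i l] unfolding is_direct_sum_upto_def by blast
      qed
      then show ?thesis using poly_mono[of i ?n l] that by auto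
    qed
    define e where "e = ev ?n l"
    have e: "e \<noteq> 0" using Hs(4)[of l ?n] l by (auto simp: e_def)
    have Lw: "Lap w = (\<Sum>i\<in>{0..?n}. ev i l *\<^sub>R h i)"
      unfolding h(1) by (rule trans[OF lin_on_sum[OF poly_facts(1)[OF f] Lap_lin hp] sum.cong[OF refl Lev]]) (use h(2) in blast)+
    \<comment> \<open>The homogeneous component of degree \<open>?n\<close> cancels, so
      \<open>w'\<close> has smaller degree.\<close>
    define w' where "w' = Lap w - e *\<^sub>R w"
    have "w' = (\<Sum>i\<in>{0..?n}. (ev i l - e) *\<^sub>R h i)"
      unfolding w'_def Lw unfolding h(1) by (simp add: scaleR_sum_right sum_subtractf scaleR_diff_left)
    also have "\<dots> = (\<Sum>i\<in>{0..?n - 1}. (ev i l - e) *\<^sub>R h i)"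
      by (rule sum.mono_neutral_right) (auto simp: e_def)
    finally have "w' = (\<Sum>i\<in>{0..?n - 1}. (ev i l - e) *\<^sub>R h i)" .
    moreover have "\<forall>i\<in>{0..?n - 1}. (ev i l - e) *\<^sub>R h i \<in> Hs i l"
      using h(2) subspace_scale[OF Hs(1)] by simp
    ultimately have w'p: "w' \<in> poly M f (?n - 1) l"
      using Hs(2)[of "?n - 1" l] unfolding is_direct_sum_upto_def by blast
    note sp = poly_facts(1)[OF f] and kl = poly_facts(7)[OF f]
    have p2: "\<kappa> f (d f (\<kappa> f w)) = 0" by (rule Suc.prems(2))
    have k1: "\<kappa> f (Lap w) = 0"
      unfolding Lap_def lin_on_add[OF sp kl Lap_terms[OF w]]
      by (simp only: p2 poly_facts(6)[OF f poly_facts(4)[OF f w]] add_0_left)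
    have kw': "\<kappa> f w' = - e *\<^sub>R \<kappa> f w"
      unfolding w'_def lin_on_diff[OF sp kl Lap_poly[OF w] subspace_scale[OF sp w]] k1 lin_on_scale[OF sp kl w] by simp
    have kwp: "\<kappa> f w \<in> poly M f (?n + 1) (l - 1)" by (rule poly_facts(5)[OF f w])
    have "\<kappa> f (d f (\<kappa> f w')) = - e *\<^sub>R \<kappa> f (d f (\<kappa> f w))"
      unfolding kw' lin_on_scale[OF sp poly_d_lin kwp] lin_on_scale[OF sp kl poly_facts(4)[OF f kwp]] ..
    then have "\<kappa> f (d f (\<kappa> f w')) = 0" by (simp only: p2 scaleR_zero_right)
    then have "\<kappa> f w' = 0" by (rule Suc.IH[OF w'p])
    then have "- e = 0 \<or> \<kappa> f w = 0" by (simp only: kw' scaleR_eq_0_iff)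
    then show ?case using e by (metis neg_equal_0_iff_equal)
  qed
  have "w \<in> poly M f (int (nat (n + 1)) - 1) l"
    using poly_mono[of n "int (nat (n + 1)) - 1" l] assms(3) by auto
  then show ?thesis using main assms(4) by blast
qed

text \<open>For forms of degree at least one all eigenvalues are nonzero, so the operator is
  inverted on each homogeneous component. Linearity of the inverse follows from injectivity, without
  choosing decompositions linearly.\<close>

lemma Lap_inverse:
  assumes l: "1 \<le> l" "l \<le> int (cdim M f)"
  obtains D where "lin_on (poly M f n l) D" "\<And>q. q \<in> poly M f n l \<Longrightarrow> D q \<in> poly M f n l \<and> Lap (D q) = q"
proof -
  obtain Hs ev where Hs: "\<And>s l. subspace (Hs s l)" "\<And>s l. is_direct_sum_upto (poly M f s l) s (\<lambda>s. Hs s l)"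
    "\<And>s l p. p \<in> Hs s l \<Longrightarrow> d f (\<kappa> f p) + \<kappa> f (d f p) = ev s l *\<^sub>R p"
    "\<And>s l. l \<in> {0..int (cdim M f)} \<Longrightarrow> s \<ge> 0 \<Longrightarrow> ev s l = 0 \<longleftrightarrow> s = 0 \<and> l = 0"
    by (rule decomposition) (rule that; assumption)
  have Lev: "Lap p = ev s l *\<^sub>R p" if "p \<in> Hs s l" for p s l using Hs(3)[OF that] by (simp add: Lap_def)
  have e: "ev i l \<noteq> 0" if "i \<in> {0..n}" for i using Hs(4)[of l i] l that by auto
  have sum_in: "(\<Sum>i\<in>{0..n}. h i) \<in> poly M f n l" if "\<And>i. i \<in> {0..n} \<Longrightarrow> h i \<in> Hs i l" for h
    using Hs(2)[of n l] that unfolding is_direct_sum_upto_def by blast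
  have hp: "h \<in> poly M f n l" if "i \<in> {0..n}" "h \<in> Hs i l" for i h
    using sum_in[of "\<lambda>j. if j = i then h else 0"] that subspace_0[OF Hs(1)] by auto
  have Lsum: "Lap (\<Sum>i\<in>{0..n}. h i) = (\<Sum>i\<in>{0..n}. ev i l *\<^sub>R h i)" if "\<And>i. i \<in> {0..n} \<Longrightarrow> h i \<in> Hs i l" for h
    by (rule trans[OF lin_on_sum[OF poly_facts(1)[OF f] Lap_lin hp] sum.cong[OF refl Lev]]) (use that in blast)+
  have ex: "\<exists>q'\<in>poly M f n l. Lap q' = q" if q: "q \<in> poly M f n l" for q
  proof -
    obtain h where h: "q = (\<Sum>i\<in>{0..n}. h i)" "\<forall>i\<in>{0..n}. h i \<in> Hs i l"
      using Hs(2)[of n l] q unfolding is_direct_sum_upto_def by blast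
    have "(\<Sum>i\<in>{0..n}. (1 / ev i l) *\<^sub>R h i) \<in> poly M f n l"
      by (rule sum_in) (use h(2) subspace_scale[OF Hs(1)] in blast)
    moreover have "Lap (\<Sum>i\<in>{0..n}. (1 / ev i l) *\<^sub>R h i) = q"
      using Lsum[of "\<lambda>i. (1 / ev i l) *\<^sub>R h i"] h subspace_scale[OF Hs(1)] e by simp
    ultimately show ?thesis by blast
  qed
  have inj: "q = q'" if q: "q \<in> poly M f n l" "q' \<in> poly M f n l" "Lap q = Lap q'" for q q'
  proof -
    have D: "q - q' \<in> poly M f n l" using q subspace_diff[OF poly_facts(1)[OF f]] by blast
    have L0: "Lap (q - q') = 0" using lin_on_diff[OF poly_facts(1)[OF f] Lap_lin q(1,2)] q(3) by simp
    obtain h where h: "q - q' = (\<Sum>i\<in>{0..n}. h i)" "\<forall>i\<in>{0..n}. h i \<in> Hs i l"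
      using Hs(2)[of n l] D unfolding is_direct_sum_upto_def by blast
    have "(\<Sum>i\<in>{0..n}. ev i l *\<^sub>R h i) = 0" using Lsum[of h] h L0 by simp
    moreover have "\<forall>i\<in>{0..n}. ev i l *\<^sub>R h i \<in> Hs i l" using h(2) subspace_scale[OF Hs(1)] by blast
    ultimately have "\<forall>i\<in>{0..n}. ev i l *\<^sub>R h i = 0"
      using Hs(2)[of n l, unfolded is_direct_sum_upto_def, THEN conjunct2, THEN spec[of _ "\<lambda>i. ev i l *\<^sub>R h i"]] by blast
    then have "q - q' = 0" using h(1) e by simp
    then show ?thesis by simp
  qed
  obtain D where D: "\<And>q. q \<in> poly M f n l \<Longrightarrow> D q \<in> poly M f n l \<and> Lap (D q) = q" using ex by metis
  have "D (s *\<^sub>R p + q) = s *\<^sub>R D p + D q" if p: "p \<in> poly M f n l" and q: "q \<in> poly M f n l" for s p q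
  proof (rule inj)
    note sc = subspace_comb[OF poly_facts(1)[OF f]]
    show "D (s *\<^sub>R p + q) \<in> poly M f n l" using D[OF sc[OF p q]] by blast
    show "s *\<^sub>R D p + D q \<in> poly M f n l" using D p q by (intro sc) auto
    show "Lap (D (s *\<^sub>R p + q)) = Lap (s *\<^sub>R D p + D q)"
      using D[OF sc[OF p q]] lin_onD[OF Lap_lin[of n l], of "D p" "D q"] D p q by simp
  qed
  then show thesis using that[of D] D by (simp add: lin_on_def)
qed

text \<open>Well-definedness of the potential's right-hand side. For
  \<open>q = d \<kappa> a + \<kappa> b\<close>, applying \<open>\<kappa>\<close> gives
  \<open>\<kappa> d \<kappa> a\<close>, and the same with \<open>D q\<close> in place of
  \<open>a\<close>; by \<open>kosz_d_kosz_injective\<close> this forces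
  \<open>\<kappa> a = \<kappa> (D q)\<close>. The rest of \<open>q\<close> is then
  \<open>\<kappa> b = \<kappa> d (D q)\<close>. So both depend linearly on \<open>q\<close>
  alone.\<close>

lemma koszul_functional:
  fixes \<psi> \<theta> :: "'p form \<Rightarrow> real"
  assumes cd: "cdim M f \<ge> 1" and \<psi>: "lin_on (poly M f (n + 1) 0) \<psi>" and \<theta>: "lin_on (poly M f n 1) \<theta>"
  obtains \<Phi> where "lin_on (poly M f n 1) \<Phi>"
    "\<And>a b. a \<in> poly M f n 1 \<Longrightarrow> b \<in> poly M f (n - 1) 2 \<Longrightarrow> \<Phi> (d f (\<kappa> f a) + \<kappa> f b) = \<psi> (\<kappa> f a) + \<theta> (\<kappa> f b)"
    "\<And>q. q \<in> poly M f n 1 \<Longrightarrow> \<exists>a\<in>poly M f n 1. \<exists>b\<in>poly M f (n - 1) 2. q = d f (\<kappa> f a) + \<kappa> f b"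
proof -
  have l: "1 \<le> (1::int)" "1 \<le> int (cdim M f)" using cd by auto
  obtain D where D: "lin_on (poly M f n 1) D" "\<And>q. q \<in> poly M f n 1 \<Longrightarrow> D q \<in> poly M f n 1 \<and> Lap (D q) = q"
    using Lap_inverse[OF l] by metis
  note sp = poly_facts(1)[OF f] and kl = poly_facts(7)[OF f]
  \<comment> \<open>The prescribed values, evaluated on the canonical representatives
    \<open>a = D q\<close> and \<open>b = d f (D q)\<close>.\<close>
  define \<Phi> where "\<Phi> q = \<psi> (\<kappa> f (D q)) + \<theta> (\<kappa> f (d f (D q)))" for q
  have kp: "\<kappa> f p \<in> poly M f (n + 1) 0" if "p \<in> poly M f n 1" for p using poly_facts(5)[OF f that] by simp
  have dp: "d f p \<in> poly M f (n - 1) 2" if "p \<in> poly M f n 1" for p using poly_facts(4)[OF f that] by simp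
  have kdp: "\<kappa> f (d f p) \<in> poly M f n 1" if "p \<in> poly M f n 1" for p using poly_facts(5)[OF f dp[OF that]] by simp
  show thesis
  proof (rule that[of \<Phi>])
    show "lin_on (poly M f n 1) \<Phi>"
      unfolding lin_on_def
    proof (intro ballI allI)
      fix p q s assume pq: "p \<in> poly M f n 1" "q \<in> poly M f n 1"
      then have Dp: "D p \<in> poly M f n 1" "D q \<in> poly M f n 1" using D(2) by auto
      show "\<Phi> (s *\<^sub>R p + q) = s *\<^sub>R \<Phi> p + \<Phi> q"
        unfolding \<Phi>_def lin_onD[OF D(1) pq] lin_onD[OF kl Dp] lin_onD[OF poly_d_lin Dp]
          lin_onD[OF kl dp[OF Dp(1)] dp[OF Dp(2)]] lin_onD[OF \<psi> kp[OF Dp(1)] kp[OF Dp(2)]]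
          lin_onD[OF \<theta> kdp[OF Dp(1)] kdp[OF Dp(2)]] by (simp add: algebra_simps)
    qed
    show "\<exists>a\<in>poly M f n 1. \<exists>b\<in>poly M f (n - 1) 2. q = d f (\<kappa> f a) + \<kappa> f b" if q: "q \<in> poly M f n 1" for q
      using D(2)[OF q] dp unfolding Lap_def by metis
    fix a b assume a: "a \<in> poly M f n 1" and b: "b \<in> poly M f (n - 1) 2"
    define q where "q = d f (\<kappa> f a) + \<kappa> f b"
    have kb: "\<kappa> f b \<in> poly M f n 1" using poly_facts(5)[OF f b] by simp
    have q: "q \<in> poly M f n 1" unfolding q_def using subspace_add[OF sp Lap_terms(1)[OF a] kb] .
    have Dq: "D q \<in> poly M f n 1" "Lap (D q) = q" using D(2)[OF q] by auto
    have k1: "\<kappa> f q = \<kappa> f (d f (\<kappa> f a))"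
      unfolding q_def lin_on_add[OF sp kl Lap_terms(1)[OF a] kb] using poly_facts(6)[OF f b] by simp
    have k2: "\<kappa> f q = \<kappa> f (d f (\<kappa> f (D q)))"
      unfolding Dq(2)[symmetric, unfolded Lap_def, THEN arg_cong[where f="\<kappa> f"], simplified]
      using lin_on_add[OF sp kl Lap_terms[OF Dq(1)]] poly_facts(6)[OF f dp[OF Dq(1)]] Dq(2) unfolding Lap_def by simp
    have w: "D q - a \<in> poly M f n 1" using subspace_diff[OF sp Dq(1) a] .
    have "\<kappa> f (d f (\<kappa> f (D q - a))) = 0"
      unfolding lin_on_diff[OF sp kl Dq(1) a] lin_on_diff[OF sp poly_d_lin kp[OF Dq(1)] kp[OF a]]
        lin_on_diff[OF sp kl Lap_terms(1)[OF Dq(1)] Lap_terms(1)[OF a]] using k1 k2 by simp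
    then have "\<kappa> f (D q - a) = 0" by (rule kosz_d_kosz_injective[OF l w])
    then have e1: "\<kappa> f (D q) = \<kappa> f a" using lin_on_diff[OF sp kl Dq(1) a] by simp
    then have e2: "\<kappa> f (d f (D q)) = \<kappa> f b" using Dq(2) unfolding Lap_def q_def by simp
    show "\<Phi> (d f (\<kappa> f a) + \<kappa> f b) = \<psi> (\<kappa> f a) + \<theta> (\<kappa> f b)"
      unfolding q_def[symmetric] \<Phi>_def e1 e2 ..
  qed
qed

text \<open>On 0-forms \<open>\<kappa>\<close> vanishes, so \<open>\<kappa> d\<close> acts by the
  eigenvalue, which is nonzero in positive degree: those components are images of
  \<open>\<kappa>\<close>. What remains has degree 0, and its derivative has degree
  \<open>-1\<close>, hence is zero.\<close>

lemma poly_0_decomp: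
  assumes m: "m \<in> poly M f r 0"
  obtains h a where "h \<in> poly M f r 0" "d f h = 0" "a \<in> poly M f r 1" "m = h + \<kappa> f a"
proof -
  obtain Hs ev where Hs: "\<And>s l. subspace (Hs s l)" "\<And>s l. is_direct_sum_upto (poly M f s l) s (\<lambda>s. Hs s l)"
    "\<And>s l p. p \<in> Hs s l \<Longrightarrow> d f (\<kappa> f p) + \<kappa> f (d f p) = ev s l *\<^sub>R p"
    "\<And>s l. l \<in> {0..int (cdim M f)} \<Longrightarrow> s \<ge> 0 \<Longrightarrow> ev s l = 0 \<longleftrightarrow> s = 0 \<and> l = 0"
    by (rule decomposition) (rule that; assumption)
  have Hp: "h \<in> poly M f i l" if "0 \<le> i" "h \<in> Hs i l" for i l h
  proof -
    have "h = (\<Sum>j\<in>{0..i}. if j = i then h else 0)" using that by simp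
    moreover have "\<forall>j\<in>{0..i}. (if j = i then h else 0) \<in> Hs j l" using that subspace_0[OF Hs(1)] by auto
    ultimately show ?thesis using Hs(2)[of i l] unfolding is_direct_sum_upto_def by blast
  qed
  obtain h where h: "m = (\<Sum>i\<in>{0..r}. h i)" "\<forall>i\<in>{0..r}. h i \<in> Hs i 0"
    using Hs(2)[of r 0] m unfolding is_direct_sum_upto_def by blast
  have hp: "h i \<in> poly M f i 0" if "i \<in> {0..r}" for i using Hp h(2) that by auto
  have h0: "h 0 \<in> poly M f 0 0" using hp r by simp
  have dh0: "d f (h 0) = 0" using poly_negative_degree[of "-1"] poly_facts(4)[OF f h0] by simp
  have dhp: "d f (h i) \<in> poly M f r 1" if "i \<in> {1..r}" for i
    using poly_facts(4)[OF f hp[of i]] poly_mono[of "i - 1" r 1] that by auto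
  have kh: "\<kappa> f (d f (h i)) = ev i 0 *\<^sub>R h i" if i: "i \<in> {1..r}" for i
  proof -
    have "\<kappa> f (h i) = 0" using poly_negative_form[of "-1"] poly_facts(5)[OF f hp[of i]] i by simp
    then show ?thesis using Hs(3)[of "h i" i 0] h(2) i d_0 by simp
  qed
  \<comment> \<open>Each positive-degree component is recovered by \<open>\<kappa>\<close> from its
    derivative, divided by the eigenvalue.\<close>
  define a where "a = (\<Sum>i\<in>{1..r}. (1 / ev i 0) *\<^sub>R d f (h i))"
  have ap: "(1 / ev i 0) *\<^sub>R d f (h i) \<in> poly M f r 1" if "i \<in> {1..r}" for i
    using subspace_scale[OF poly_facts(1)[OF f] dhp[OF that]] .
  have "\<kappa> f a = (\<Sum>i\<in>{1..r}. \<kappa> f ((1 / ev i 0) *\<^sub>R d f (h i)))"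
    unfolding a_def by (rule lin_on_sum[OF poly_facts(1,7)[OF f] ap])
  also have "\<dots> = (\<Sum>i\<in>{1..r}. h i)"
  proof (rule sum.cong[OF refl])
    fix i assume i: "i \<in> {1..r}"
    have "ev i 0 \<noteq> 0" using Hs(4)[of 0 i] i by auto
    then show "\<kappa> f ((1 / ev i 0) *\<^sub>R d f (h i)) = h i"
      using lin_on_scale[OF poly_facts(1,7)[OF f] dhp[OF i]] kh[OF i] by simp
  qed
  finally have "\<kappa> f a = (\<Sum>i\<in>{1..r}. h i)" .
  moreover have "{0..r} = insert 0 {1..r}" using r by auto
  ultimately have "m = h 0 + \<kappa> f a" unfolding h(1) by simp
  moreover have "a \<in> poly M f r 1" unfolding a_def by (rule subspace_sum[OF poly_facts(1)[OF f] ap])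
  moreover have "h 0 \<in> poly M f r 0" using h0 poly_mono[of 0 r 0] r by auto
  ultimately show thesis using that dh0 by blast
qed

lemma trimmed_subset: "trimmed M f r l \<subseteq> poly M f r l"
proof (cases "l \<le> 0")
  case False
  have "d f p + \<kappa> f q \<in> poly M f r l" if "p \<in> poly M f r (l - 1)" "q \<in> poly M f (r - 1) (l + 1)" for p q
    using d_poly[OF that(1)] poly_facts(5)[OF f that(2)] subspace_add[OF poly_facts(1)[OF f]] by simp
  then show ?thesis using False by (auto simp: trimmed_def)
qed (simp add: trimmed_def)

lemma trimmed_subspace: "subspace (trimmed M f r l)"
proof (cases "l \<le> 0")
  case True
  then show ?thesis by (simp add: trimmed_def poly_facts(1)[OF f])
next
  case False
  have "trimmed M f r l = {x + y | x y. x \<in> d f ` poly M f r (l - 1) \<and> y \<in> \<kappa> f ` poly M f (r - 1) (l + 1)}"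
    using False by (auto simp: trimmed_def)
  moreover have "subspace (d f ` poly M f r (l - 1))" "subspace (\<kappa> f ` poly M f (r - 1) (l + 1))"
    by (rule subspace_image_lin_on[OF poly_facts(1)[OF f] poly_d_lin])
       (rule subspace_image_lin_on[OF poly_facts(1,7)[OF f]])
  ultimately show ?thesis by (simp only: subspace_sums)
qed

lemma d_trimmed:
  assumes "p \<in> poly M f r 0"
  shows "d f p \<in> trimmed M f r 1"
proof -
  have "d f p = d f p + \<kappa> f 0" by (simp only: kosz_0 add_0_right)
  then have "d f p \<in> {d f p + \<kappa> f q | p q. p \<in> poly M f r (1 - 1) \<and> q \<in> poly M f (r - 1) (1 + 1)}"
    using assms poly_0[of "r - 1" "1 + 1"] by (intro CollectI exI[of _ p] exI[of _ 0]) simp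
  then show ?thesis by (simp add: trimmed_def)
qed

lemma finite_basis:
  assumes "subspace S" "S \<subseteq> poly M f s l"
  obtains C where "finite C" "C \<subseteq> S" "S \<subseteq> span C"
proof -
  obtain B where "finite B" "span B = poly M f s l" using poly_facts(2)[OF f, of s l] by blast
  then show thesis using subspace_finite_basis[OF assms(1), of B] assms(2) that by auto
qed

end

text \<open>In form degree 0 the trimmed space is the full polynomial space, so the trace hypothesis
  applies directly.\<close>

lemma trace_poly_0:
  assumes F: "facet f e" and "\<mu> \<in> poly M f r 0"
  shows "trace M 0 f e \<mu> \<in> poly M e r 0"
proof -
  have "e \<in> faces M (cdim M e) f" using facetD[OF F] by (simp add: faces_def cells_of_dim_def)
  moreover have "cdim M e \<le> cdim M f" using facetD(4)[OF F] by simp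
  ultimately have "trace M 0 f e ` trimmed M f r 0 \<subseteq> trimmed M e r 0"
    using T[unfolded hypothesis_T_def, THEN spec, of 0, THEN bspec, OF facetD(1)[OF F]] r by blast
  then show ?thesis using assms(2) by (auto simp: trimmed_def)
qed

end

section \<open>Discrete derivatives and potentials\<close>

lemma lin_on_cong:
  assumes "subspace S" "lin_on S G" "\<And>p. p \<in> S \<Longrightarrow> F p = G p"
  shows "lin_on S F"
  unfolding lin_on_def
proof (intro ballI allI)
  fix p q s assume pq: "p \<in> S" "q \<in> S"
  show "F (s *\<^sub>R p + q) = s *\<^sub>R F p + F q"
    unfolding assms(3)[OF pq(1)] assms(3)[OF pq(2)] assms(3)[OF subspace_comb[OF assms(1) pq]]
    by (rule lin_onD[OF assms(2) pq])
qed

lemma lin_on_pointwise_diff: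
  assumes "lin_on S F" "lin_on S G"
  shows "lin_on S (\<lambda>p. F p - G p)"
  using assms unfolding lin_on_def by (simp add: algebra_simps)

lemma wedge_0_right: "wedge a 0 = 0"
  by (rule ext) (simp add: wedge_def)

lemma wedge_add_right: "wedge a (s *\<^sub>R \<mu> + \<nu>) = s *\<^sub>R wedge a \<mu> + wedge a \<nu>"
  by (rule ext) (simp only: wedge_def plus_fun_apply scaleR_fun_apply alt_wedge_add_right)

lemma flat_integral_0: "flat_integral n A (\<lambda>y. 0) = 0"
  unfolding flat_integral_def set_lebesgue_integral_def scaleR_zero_right Bochner_Integration.integral_zero
    sum.neutral_const if_cancel ..

lemma cell_integral_0: "cell_integral M f 0 = 0"
  unfolding cell_integral_def Let_def case_prod_beta zero_fun_apply mult_zero_left flat_integral_0 sum.neutral_const ..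

text \<open>In dimension 0 the integral is a sum of point values, so it is linear on arbitrary
  forms, with no regularity to check.\<close>

lemma vertex_integral_lin:
  assumes "cdim M v = 0"
  shows "lin_on S (\<lambda>\<mu>. cell_integral M v (wedge a \<mu>))"
  unfolding lin_on_def wedge_add_right cell_integral_def flat_integral_def assms
  by (simp add: case_prod_beta Let_def sum_distrib_left sum.distrib[symmetric] algebra_simps)

context ddr
begin

text \<open>The condition is put on the star because integrals of wedge products become L2 products
  with the star. The class contains the components of discrete families, the local derivatives and
  potentials, and the traces of potentials on edges.\<close>

definition star_regular :: "'p set \<Rightarrow> nat \<Rightarrow> 'p form set" where
  "star_regular f k = {\<omega> \<in> cell_forms M f (int k). star M f k \<omega> \<in> regular_forms f (int (cdim M f) - int k)}"

context
  fixes f k assumes f: "f \<in> cells M" and cd: "cdim M f = 1 \<or> cdim M f = 2" and k: "k \<le> cdim M f"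
begin

abbreviation codim where "codim \<equiv> int (cdim M f) - int k"

lemma star_regularD:
  assumes "\<omega> \<in> star_regular f k"
  shows "\<omega> \<in> cell_forms M f (int k)" "star M f k \<omega> \<in> regular_forms f codim"
  using assms by (auto simp: star_regular_def)

lemma star_0: "star M f k 0 = 0"
  by (rule lin_on_0[OF subspace_cell_forms star_lin[OF f cd k]])

lemma star_inv_0: "star_inv M f k 0 = 0"
  by (rule lin_on_0[OF subspace_cell_forms star_inv_lin[OF f cd k]])

lemma star_lin_regular: "lin_on (star_regular f k) (star M f k)"
  by (rule lin_on_mono[OF star_lin[OF f cd k]]) (auto simp: star_regular_def)

lemma star_regular_comb:
  assumes "\<omega> \<in> star_regular f k" "\<eta> \<in> star_regular f k"
  shows "s *\<^sub>R \<omega> + \<eta> \<in> star_regular f k"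
  unfolding star_regular_def
proof (intro CollectI conjI)
  show "s *\<^sub>R \<omega> + \<eta> \<in> cell_forms M f (int k)"
    by (rule subspace_comb[OF subspace_cell_forms assms[THEN star_regularD(1)]])
  show "star M f k (s *\<^sub>R \<omega> + \<eta>) \<in> regular_forms f codim"
    unfolding lin_onD[OF star_lin[OF f cd k] assms[THEN star_regularD(1)]]
    by (rule subspace_comb[OF subspace_regular_forms assms[THEN star_regularD(2)]])
qed

lemma star_regular_0: "0 \<in> star_regular f k"
  unfolding star_regular_def star_0 mem_Collect_eq
  by (intro conjI subspace_0[OF subspace_cell_forms] subspace_0[OF subspace_regular_forms])

lemma subspace_star_regular: "subspace (star_regular f k)"
proof (rule subspaceI)
  show "0 \<in> star_regular f k" by (rule star_regular_0)
  show "x + y \<in> star_regular f k" if "x \<in> star_regular f k" "y \<in> star_regular f k" for x y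
    using star_regular_comb[OF that, of 1] by simp
  show "c *\<^sub>R x \<in> star_regular f k" if "x \<in> star_regular f k" for x c
    using star_regular_comb[OF that star_regular_0, of c] by (simp only: add_0_right)
qed

lemma star_inv_regular:
  assumes "p \<in> regular_forms f codim"
  shows "star_inv M f k p \<in> star_regular f k" "star M f k (star_inv M f k p) = p"
proof -
  have p: "p \<in> cell_forms M f codim" using regular_cell_forms assms by blast
  show "star M f k (star_inv M f k p) = p" by (rule star_star_inv[OF f cd k p])
  then show "star_inv M f k p \<in> star_regular f k"
    using star_inv_in[OF f cd k p] assms by (simp add: star_regular_def)
qed

lemma integral_lin_left:
  assumes "\<mu> \<in> regular_forms f codim"
  shows "lin_on (star_regular f k) (\<lambda>\<omega>. cell_integral M f (wedge \<omega> \<mu>))"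
proof (rule lin_on_cong[OF subspace_star_regular])
  show "lin_on (star_regular f k) (\<lambda>\<omega>. L2_inner M f (star M f k \<omega>) \<mu>)"
    by (rule lin_on_comp[OF star_lin_regular L2_lin_left[OF f cd assms]]) (use star_regularD(2) in blast)
  show "cell_integral M f (wedge \<omega> \<mu>) = L2_inner M f (star M f k \<omega>) \<mu>" if "\<omega> \<in> star_regular f k" for \<omega>
    by (rule integral_wedge[OF f cd k star_regularD(1)[OF that]]) (use regular_cell_forms assms in blast)
qed

lemma integral_lin_right:
  assumes "\<omega> \<in> star_regular f k"
  shows "lin_on (regular_forms f codim) (\<lambda>\<mu>. cell_integral M f (wedge \<omega> \<mu>))"
proof (rule lin_on_cong[OF subspace_regular_forms])
  show "lin_on (regular_forms f codim) (L2_inner M f (star M f k \<omega>))"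
    by (rule L2_lin_right[OF f cd star_regularD(2)[OF assms]])
  show "cell_integral M f (wedge \<omega> \<mu>) = L2_inner M f (star M f k \<omega>) \<mu>" if "\<mu> \<in> regular_forms f codim" for \<mu>
    by (rule integral_wedge[OF f cd k star_regularD(1)[OF assms]]) (use regular_cell_forms that in blast)
qed

lemma poly_regular: "poly M f s l \<subseteq> regular_forms f l"
  using poly_Ck(2)[OF f] Ck_cell_forms_regular[OF f cd] by blast

lemma star_inv_poly_regular: "star_inv M f k ` poly M f s codim \<subseteq> star_regular f k"
  using star_inv_regular(1) poly_regular by blast

lemma subspace_star_inv_poly: "subspace (star_inv M f k ` poly M f s codim)"
  by (rule subspace_image_lin_on[OF poly_facts(1)[OF f] lin_on_mono[OF star_inv_lin[OF f cd k]]]) (use poly_Ck(3)[OF f] in blast)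

lemma L2_riesz:
  assumes S: "subspace S" "S \<subseteq> poly M f s l" and l: "l \<le> int (cdim M f)" and \<phi>: "lin_on S \<phi>"
  shows "\<exists>!p. p \<in> S \<and> (\<forall>q\<in>S. L2_inner M f p q = \<phi> q)"
proof -
  obtain C where C: "finite C" "C \<subseteq> S" "S \<subseteq> span C" by (rule finite_basis[OF f S])
  have SR: "S \<subseteq> regular_forms f l" using S(2) poly_regular by blast
  show ?thesis
  proof (rule riesz_finite_dim[OF C S(1) _ _ _ \<phi>])
    show "lin_on S (\<lambda>p. L2_inner M f p q)" if "q \<in> S" for q
      by (rule lin_on_mono[OF L2_lin_left[OF f cd] SR]) (rule subsetD[OF SR that])
    show "L2_inner M f p q = L2_inner M f q p" for p q by (rule L2_sym[OF f cd])
    show "0 < L2_inner M f p p" if "p \<in> S" "p \<noteq> 0" for p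
      by (rule L2_pos[OF f cd subsetD[OF SR that(1)] l that(2)])
  qed
qed

text \<open>Through the star this is the Riesz problem on the polynomial space. It solves both the
  equation of the local derivative and, after \<open>koszul_functional\<close>, that of the
  potential.\<close>

lemma wedge_riesz:
  assumes \<phi>: "lin_on (poly M f s codim) \<phi>"
  shows "\<exists>!\<delta>. \<delta> \<in> star_inv M f k ` poly M f s codim \<and> (\<forall>\<mu>\<in>poly M f s codim. cell_integral M f (wedge \<delta> \<mu>) = \<phi> \<mu>)"
proof -
  let ?S = "poly M f s codim"
  have l: "codim \<le> int (cdim M f)" by simp
  have i: "cell_integral M f (wedge (star_inv M f k p) \<mu>) = L2_inner M f p \<mu>" if "p \<in> ?S" "\<mu> \<in> ?S" for p \<mu>
  proof -
    have p: "p \<in> cell_forms M f codim" "\<mu> \<in> cell_forms M f codim" using poly_Ck(3)[OF f] that by auto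
    show ?thesis unfolding integral_wedge[OF f cd k star_inv_in[OF f cd k p(1)] p(2)] star_star_inv[OF f cd k p(1)] ..
  qed
  have ex: "\<exists>!p. p \<in> ?S \<and> (\<forall>q\<in>?S. L2_inner M f p q = \<phi> q)"
    by (rule L2_riesz[OF poly_facts(1)[OF f] order_refl l \<phi>])
  then obtain p where p: "p \<in> ?S" "\<forall>q\<in>?S. L2_inner M f p q = \<phi> q" by blast
  show ?thesis
  proof (rule ex1I[of _ "star_inv M f k p"])
    show "star_inv M f k p \<in> star_inv M f k ` ?S \<and> (\<forall>\<mu>\<in>?S. cell_integral M f (wedge (star_inv M f k p) \<mu>) = \<phi> \<mu>)"
      using p i by simp
    fix \<delta> assume \<delta>: "\<delta> \<in> star_inv M f k ` ?S \<and> (\<forall>\<mu>\<in>?S. cell_integral M f (wedge \<delta> \<mu>) = \<phi> \<mu>)"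
    then obtain p' where p': "p' \<in> ?S" "\<delta> = star_inv M f k p'" by blast
    have "\<forall>q\<in>?S. L2_inner M f p' q = \<phi> q" using \<delta> i[OF p'(1)] unfolding p'(2) by simp
    then have "p' = p" using ex p p'(1) by blast
    then show "\<delta> = star_inv M f k p" using p'(2) by simp
  qed
qed

end

lemma trimmed_proj:
  assumes f: "f \<in> cells M" and cd: "cdim M f = 1 \<or> cdim M f = 2" and l: "l \<le> int (cdim M f)"
    and \<omega>: "\<omega> \<in> regular_forms f l"
  shows "trimmed_proj M f r l \<omega> \<in> trimmed M f r l"
    "q \<in> trimmed M f r l \<Longrightarrow> L2_inner M f (trimmed_proj M f r l \<omega>) q = L2_inner M f \<omega> q"
    "\<omega> \<in> trimmed M f r l \<Longrightarrow> trimmed_proj M f r l \<omega> = \<omega>"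
proof -
  let ?S = "trimmed M f r l"
  have SR: "?S \<subseteq> regular_forms f l" using trimmed_subset[OF f] poly_regular[OF f cd] by blast
  have ex: "\<exists>!p. p \<in> ?S \<and> (\<forall>q\<in>?S. L2_inner M f p q = L2_inner M f \<omega> q)"
    by (rule L2_riesz[OF f cd le0 trimmed_subspace[OF f] trimmed_subset[OF f] l lin_on_mono[OF L2_lin_right[OF f cd \<omega>] SR]])
  have "L2_inner M f (\<omega> - p) q = 0 \<longleftrightarrow> L2_inner M f p q = L2_inner M f \<omega> q" if "p \<in> ?S" "q \<in> ?S" for p q
    using lin_on_diff[OF subspace_regular_forms L2_lin_left[OF f cd subsetD[OF SR that(2)]] \<omega> subsetD[OF SR that(1)]] by auto
  then have "(p \<in> ?S \<and> (\<forall>q\<in>?S. L2_inner M f (\<omega> - p) q = 0)) = (p \<in> ?S \<and> (\<forall>q\<in>?S. L2_inner M f p q = L2_inner M f \<omega> q))" for p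
    by blast
  then have eq: "trimmed_proj M f r l \<omega> = (THE p. p \<in> ?S \<and> (\<forall>q\<in>?S. L2_inner M f p q = L2_inner M f \<omega> q))"
    unfolding trimmed_proj_def by simp
  have P: "trimmed_proj M f r l \<omega> \<in> ?S \<and> (\<forall>q\<in>?S. L2_inner M f (trimmed_proj M f r l \<omega>) q = L2_inner M f \<omega> q)"
    unfolding eq by (rule theI'[OF ex])
  then show "trimmed_proj M f r l \<omega> \<in> ?S" "q \<in> ?S \<Longrightarrow> L2_inner M f (trimmed_proj M f r l \<omega>) q = L2_inner M f \<omega> q"
    by blast+
  show "\<omega> \<in> ?S \<Longrightarrow> trimmed_proj M f r l \<omega> = \<omega>" using ex P by blast
qed

lemma bdry_integral_facets:
  assumes "f \<in> cells M" "cdim M f > 0"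
  shows "bdry_integral M f P l \<mu> =
    (\<Sum>e | facet f e. rel_orient M f e * cell_integral M e (wedge (P e) (trace M l f e \<mu>)))"
  unfolding bdry_integral_def faces_eq_facets[OF assms] ..

lemma bdry_integral_lin:
  assumes "f \<in> cells M" "cdim M f > 0"
    and L: "\<And>e. facet f e \<Longrightarrow> lin_on (Ck_cell_forms M 0 e l) (\<lambda>\<mu>. cell_integral M e (wedge (P e) \<mu>))"
  shows "lin_on (Ck_cell_forms M 0 f l) (bdry_integral M f P l)"
  unfolding bdry_integral_facets[OF assms(1,2), abs_def]
proof (rule lin_on_sum_fun)
  fix e assume "e \<in> {e. facet f e}"
  then have F: "facet f e" by simp
  show "lin_on (Ck_cell_forms M 0 f l) (\<lambda>\<mu>. cell_integral M e (wedge (P e) (trace M l f e \<mu>)))"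
    by (rule lin_on_comp[OF lin_on_mono[OF trace_lin[OF F]] L[OF F]])
       (use Ck_cell_forms_traceable[OF F] trace_Ck[OF F, of _ 0] in auto)
qed

lemma facet_dim:
  assumes "f \<in> cells M" "cdim M f = 1 \<or> cdim M f = 2" "facet f e"
  shows "cdim M e = cdim M f - 1" "cdim M e = 0 \<or> cdim M e = 1"
  using facetD(4)[OF assms(3)] assms(2) by auto

text \<open>Vertices are exempt: there \<open>vertex_integral_lin\<close> gives linearity for any
  form.\<close>

definition facet_regular :: "'p set \<Rightarrow> nat \<Rightarrow> ('p set \<Rightarrow> 'p form) \<Rightarrow> bool" where
  "facet_regular f k P \<longleftrightarrow> (\<forall>e. facet f e \<and> cdim M e = 1 \<longrightarrow> P e \<in> star_regular e k)"

lemma bdry_integral_lin_regular: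
  assumes f: "f \<in> cells M" and cd: "cdim M f = 1 \<or> cdim M f = 2" and k: "k < cdim M f" and P: "facet_regular f k P"
    and l: "l = int (cdim M f) - int k - 1"
  shows "lin_on (Ck_cell_forms M 0 f l) (bdry_integral M f P l)"
proof (rule bdry_integral_lin[OF f])
  show "0 < cdim M f" using cd by auto
  fix e assume F: "facet f e"
  show "lin_on (Ck_cell_forms M 0 e l) (\<lambda>\<mu>. cell_integral M e (wedge (P e) \<mu>))"
  proof (cases "cdim M e = 0")
    case True
    then show ?thesis by (rule vertex_integral_lin)
  next
    case False
    then have e: "cdim M e = 1" using facet_dim(2)[OF f cd F] by simp
    have ke: "k \<le> cdim M e" using k facetD(4)[OF F] by simp
    have le: "l = int (cdim M e) - int k" using l facetD(4)[OF F] by simp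
    have "P e \<in> star_regular e k" using P F e unfolding facet_regular_def by blast
    then show ?thesis unfolding le
      by (rule lin_on_mono[OF integral_lin_right[OF facetD(2)[OF F] disjI1[OF e] ke]
        Ck_cell_forms_regular[OF facetD(2)[OF F] disjI1[OF e]]])
  qed
qed

definition is_local_deriv where
  "is_local_deriv k f P \<omega> \<delta> \<longleftrightarrow> (let m = int (cdim M f) - int k - 1 in
     \<delta> \<in> star_inv M f (k + 1) ` poly M f r m \<and>
     (\<forall>\<mu>\<in>poly M f r m. cell_integral M f (wedge \<delta> \<mu>) =
        (-1) ^ (k + 1) * cell_integral M f (wedge (\<omega> f) (ext_deriv M f \<mu>)) + bdry_integral M f P m \<mu>))"

lemma ex1_local_deriv:
  assumes f: "f \<in> cells M" and cd: "cdim M f = 1 \<or> cdim M f = 2" and k: "k < cdim M f" and P: "facet_regular f k P"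
    and \<omega>: "\<omega> f \<in> star_regular f k"
  shows "\<exists>!\<delta>. is_local_deriv k f P \<omega> \<delta>"
proof -
  define m where "m = int (cdim M f) - int k - 1"
  have m: "m = int (cdim M f) - int (k + 1)" "m + 1 = int (cdim M f) - int k" by (auto simp: m_def)
  have "lin_on (poly M f r m) (\<lambda>\<mu>. cell_integral M f (wedge (\<omega> f) (d f \<mu>)))"
    by (rule lin_on_comp[OF poly_d_lin[OF f] integral_lin_right[OF f cd _ \<omega>, folded m(2)]])
      (use k subsetD[OF poly_regular[OF f cd le0] d_poly[OF f]] in auto)
  moreover have "lin_on (poly M f r m) (bdry_integral M f P m)"
    by (rule lin_on_mono[OF bdry_integral_lin_regular[OF f cd k P m_def]]) (use poly_Ck(2)[OF f] in blast)
  ultimately have "lin_on (poly M f r m) (\<lambda>\<mu>. (-1) ^ (k + 1) * cell_integral M f (wedge (\<omega> f) (d f \<mu>)) + 1 * bdry_integral M f P m \<mu>)"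
    by (rule lin_on_combine)
  moreover have "k + 1 \<le> cdim M f" using k by simp
  ultimately show ?thesis
    using wedge_riesz[OF f cd, of "k + 1" r, folded m(1)] unfolding is_local_deriv_def Let_def m_def[symmetric] mult_1 by blast
qed

lemma local_deriv_from_spec:
  assumes "f \<in> cells M" "cdim M f = 1 \<or> cdim M f = 2" "k < cdim M f" "facet_regular f k P" "\<omega> f \<in> star_regular f k"
  shows "is_local_deriv k f P \<omega> (local_deriv_from M k r f P \<omega>)"
    "is_local_deriv k f P \<omega> \<delta> \<Longrightarrow> local_deriv_from M k r f P \<omega> = \<delta>"
proof -
  note ex = ex1_local_deriv[of f k P \<omega>, OF assms]
  have eq: "local_deriv_from M k r f P \<omega> = (THE \<delta>. is_local_deriv k f P \<omega> \<delta>)"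
    unfolding local_deriv_from_def is_local_deriv_def Let_def ..
  show "is_local_deriv k f P \<omega> (local_deriv_from M k r f P \<omega>)" unfolding eq by (rule theI'[OF ex])
  show "is_local_deriv k f P \<omega> \<delta> \<Longrightarrow> local_deriv_from M k r f P \<omega> = \<delta>" unfolding eq by (rule the1_equality[OF ex])
qed

lemma local_deriv_from_cong:
  assumes "f \<in> cells M" "cdim M f > 0" "\<And>e. facet f e \<Longrightarrow> P e = Q e"
  shows "local_deriv_from M k r f P \<omega> = local_deriv_from M k r f Q \<omega>"
proof -
  have "bdry_integral M f P l \<mu> = bdry_integral M f Q l \<mu>" for l \<mu>
    unfolding bdry_integral_facets[OF assms(1,2)] by (rule sum.cong) (auto simp: assms(3))
  then show ?thesis unfolding local_deriv_from_def by simp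
qed

lemma potential_top: "cdim M f = k \<Longrightarrow> potential M k r f \<omega> = \<omega> f"
  unfolding potential_def by (cases k) auto

lemma local_deriv_eq:
  assumes "f \<in> cells M" "cdim M f = Suc k"
  shows "local_deriv M k r f \<omega> = local_deriv_from M k r f \<omega> \<omega>"
  unfolding local_deriv_def
  by (rule local_deriv_from_cong[OF assms(1)]) (use assms(2) facetD(4) potential_top in auto)

text \<open>The condition defining the potential on a cell of dimension \<open>k + 1\<close>, multiplied by \<open>(-1)\<^sup>k\<^sup>+\<^sup>1\<close>.
  On the facets the potential is \<open>\<omega>\<close> itself.\<close>

definition is_potential where
  "is_potential k f \<omega> p \<longleftrightarrow> p \<in> star_inv M f k ` poly M f r 1 \<and>
     (\<forall>a\<in>poly M f r 1. \<forall>b\<in>poly M f (r - 1) 2.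
        cell_integral M f (wedge p (d f (\<kappa> f a) + \<kappa> f b)) =
          (-1) ^ (k + 1) * (cell_integral M f (wedge (local_deriv M k r f \<omega>) (\<kappa> f a)) - bdry_integral M f \<omega> 0 (\<kappa> f a))
          + cell_integral M f (wedge (\<omega> f) (\<kappa> f b)))"

lemma potential_eq:
  assumes f: "f \<in> cells M" "cdim M f = Suc k" and k: "k \<le> 1"
  shows "potential M k r f \<omega> = (THE p. is_potential k f \<omega> p)"
proof -
  have P: "potential_dim M k r k \<omega> = \<omega>" by (rule ext) (use k in \<open>cases k; simp\<close>)
  have sgn: "(-1) ^ (k + 1) * x = A - B + (-1) ^ (k + 1) * C \<longleftrightarrow> x = (-1) ^ (k + 1) * (A - B) + C" for x A B C :: real
    using k by (cases "k = 0") (auto simp: le_Suc_eq)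
  have m: "int (Suc k) - int k = 1" "int (Suc k) - int k - 1 = 0" "int (Suc k) - int k + 1 = 2" by auto
  have "\<not> Suc k \<le> k" by simp
  then show ?thesis
    unfolding potential_def f(2) potential_dim.simps if_not_P[OF \<open>\<not> Suc k \<le> k\<close>] Let_def P m sgn is_potential_def ball_simps
      local_deriv_eq[OF f] by (simp add: ball_simps)
qed

text \<open>By \<open>koszul_functional\<close> the test forms exhaust the polynomial 1-forms and
  the right-hand side is a linear functional of the test form, so the defining condition is a Riesz
  problem. The star of the potential is a 1-form in both cases that occur: \<open>k = 0\<close> on
  edges and \<open>k = 1\<close> on 2-cells.\<close>

lemma ex1_potential:
  assumes f: "f \<in> cells M" "cdim M f = Suc k" and k: "k \<le> 1" and P: "facet_regular f k \<omega>" and \<omega>: "\<omega> f \<in> star_regular f k"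
  shows "\<exists>!p. is_potential k f \<omega> p"
proof -
  have cd: "cdim M f = 1 \<or> cdim M f = 2" using f(2) k by auto
  have kd: "k < cdim M f" "k \<le> cdim M f" "k + 1 \<le> cdim M f" using f(2) by auto
  have m: "int (cdim M f) - int k = 1" "int (cdim M f) - int k - 1 = 0" "int (cdim M f) - int (k + 1) = 0" using f(2) by auto
  let ?\<delta> = "local_deriv M k r f \<omega>"
  have "is_local_deriv k f \<omega> \<omega> ?\<delta>"
    unfolding local_deriv_eq[OF f] by (rule local_deriv_from_spec(1)[of f k \<omega> \<omega>, OF f(1) cd kd(1) P \<omega>])
  then have "?\<delta> \<in> star_inv M f (k + 1) ` poly M f r 0" unfolding is_local_deriv_def Let_def m diff_self by blast
  then have \<delta>: "?\<delta> \<in> star_regular f (k + 1)" using star_inv_poly_regular[OF f(1) cd kd(3), of r] unfolding m by blast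
  \<comment> \<open>Degree \<open>r + 1\<close>, because the functional is evaluated at
    \<open>\<kappa> f a\<close>, one degree above \<open>a\<close>.\<close>
  have "lin_on (poly M f (r + 1) 0) (\<lambda>\<mu>. cell_integral M f (wedge ?\<delta> \<mu>))"
    by (rule lin_on_mono[OF integral_lin_right[OF f(1) cd kd(3) \<delta>, unfolded m] poly_regular[OF f(1) cd le0]])
  moreover have "lin_on (poly M f (r + 1) 0) (bdry_integral M f \<omega> 0)"
    by (rule lin_on_mono[OF bdry_integral_lin_regular[OF f(1) cd kd(1) P]]) (use poly_Ck(2)[OF f(1)] m in auto)
  ultimately have \<psi>: "lin_on (poly M f (r + 1) 0) (\<lambda>\<mu>. (-1) ^ (k + 1) * (cell_integral M f (wedge ?\<delta> \<mu>) - bdry_integral M f \<omega> 0 \<mu>))"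
    unfolding lin_on_def by (simp add: algebra_simps)
  have \<theta>: "lin_on (poly M f r 1) (\<lambda>\<nu>. cell_integral M f (wedge (\<omega> f) \<nu>))"
    by (rule lin_on_mono[OF integral_lin_right[OF f(1) cd kd(2) \<omega>, unfolded m] poly_regular[OF f(1) cd le0]])
  have c1: "cdim M f \<ge> 1" using f(2) by simp
  obtain \<Phi> where \<Phi>: "lin_on (poly M f r 1) \<Phi>"
    "\<And>a b. a \<in> poly M f r 1 \<Longrightarrow> b \<in> poly M f (r - 1) 2 \<Longrightarrow> \<Phi> (d f (\<kappa> f a) + \<kappa> f b) =
        (-1) ^ (k + 1) * (cell_integral M f (wedge ?\<delta> (\<kappa> f a)) - bdry_integral M f \<omega> 0 (\<kappa> f a)) + cell_integral M f (wedge (\<omega> f) (\<kappa> f b))"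
    "\<And>q. q \<in> poly M f r 1 \<Longrightarrow> \<exists>a\<in>poly M f r 1. \<exists>b\<in>poly M f (r - 1) 2. q = d f (\<kappa> f a) + \<kappa> f b"
    by (rule koszul_functional[OF f(1) c1 \<psi> \<theta>]) (rule that; assumption)
  have in1: "d f (\<kappa> f a) + \<kappa> f b \<in> poly M f r 1" if "a \<in> poly M f r 1" "b \<in> poly M f (r - 1) 2" for a b
  proof -
    have "\<kappa> f b \<in> poly M f r 1" using poly_facts(5)[OF f(1) that(2)] by simp
    then show ?thesis by (rule subspace_add[OF poly_facts(1)[OF f(1)] Lap_terms(1)[OF f(1) that(1)]])
  qed
  have "(\<forall>q\<in>poly M f r 1. cell_integral M f (wedge p q) = \<Phi> q) \<longleftrightarrow>
    (\<forall>a\<in>poly M f r 1. \<forall>b\<in>poly M f (r - 1) 2. cell_integral M f (wedge p (d f (\<kappa> f a) + \<kappa> f b)) =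
       \<Phi> (d f (\<kappa> f a) + \<kappa> f b))" for p
    using \<Phi>(3) in1 by metis
  then have "is_potential k f \<omega> = (\<lambda>p. p \<in> star_inv M f k ` poly M f r 1 \<and> (\<forall>q\<in>poly M f r 1. cell_integral M f (wedge p q) = \<Phi> q))"
    unfolding is_potential_def using \<Phi>(2) by (intro ext) simp
  then show ?thesis using wedge_riesz[OF f(1) cd kd(2), of r \<Phi>, unfolded m, OF \<Phi>(1)] by simp
qed

lemma potential_spec:
  assumes "f \<in> cells M" "cdim M f = Suc k" "k \<le> 1" "facet_regular f k \<omega>" "\<omega> f \<in> star_regular f k"
  shows "is_potential k f \<omega> (potential M k r f \<omega>)" "is_potential k f \<omega> p \<Longrightarrow> potential M k r f \<omega> = p"
  unfolding potential_eq[OF assms(1-3)]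
  by (rule theI'[OF ex1_potential[OF assms]]) (rule the1_equality[OF ex1_potential[OF assms]])

lemma potential_poly:
  assumes "f \<in> cells M" "cdim M f = Suc k" "k \<le> 1" "facet_regular f k \<omega>" "\<omega> f \<in> star_regular f k"
  shows "potential M k r f \<omega> \<in> star_inv M f k ` poly M f r 1" "potential M k r f \<omega> \<in> star_regular f k"
proof -
  show *: "potential M k r f \<omega> \<in> star_inv M f k ` poly M f r 1"
    using potential_spec(1)[OF assms] unfolding is_potential_def by blast
  have "cdim M f = 1 \<or> cdim M f = 2" "k \<le> cdim M f" "int (cdim M f) - int k = 1" using assms(2,3) by auto
  then show "potential M k r f \<omega> \<in> star_regular f k" using * star_inv_poly_regular[OF assms(1), of k r] by auto
qed

end

context ddr
begin

lemma discrete_space_cell: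
  assumes "\<omega> \<in> discrete_space M k r" "f \<in> cells M" "k \<le> cdim M f"
  shows "\<omega> f \<in> star_inv M f k ` trimmed M f r (int (cdim M f) - int k)"
  using assms(1)[unfolded discrete_space_def, THEN CollectD, THEN spec, of f] assms(2,3) by simp

lemma discrete_space_regular:
  assumes "\<omega> \<in> discrete_space M k r" "f \<in> cells M" "cdim M f = 1 \<or> cdim M f = 2" "k \<le> cdim M f"
  shows "\<omega> f \<in> star_regular f k"
  using discrete_space_cell[OF assms(1,2,4)] trimmed_subset[OF assms(2)] star_inv_poly_regular[OF assms(2-4), of r] by blast

lemma discrete_space_facet_regular:
  assumes "\<omega> \<in> discrete_space M k r" "k \<le> 1"
  shows "facet_regular f k \<omega>"
  unfolding facet_regular_def
proof (intro allI impI, elim conjE)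
  fix e assume F: "facet f e" and e: "cdim M e = 1"
  show "\<omega> e \<in> star_regular e k"
    by (rule discrete_space_regular[OF assms(1) facetD(2)[OF F] disjI1[OF e]]) (simp only: e assms(2))
qed

lemma subspace_discrete_space_1: "subspace (discrete_space M 1 r)"
proof -
  have S: "subspace (star_inv M f 1 ` trimmed M f r (int (cdim M f) - int 1))" if f: "f \<in> cells M" "1 \<le> cdim M f" for f
  proof -
    have cd: "cdim M f = 1 \<or> cdim M f = 2" using f cell_facts(3)[OF f(1)] by auto
    show ?thesis
      by (rule subspace_image_lin_on[OF trimmed_subspace[OF f(1)] lin_on_mono[OF star_inv_lin[OF f(1) cd f(2)]]])
        (use trimmed_subset[OF f(1)] poly_Ck(3)[OF f(1)] in blast)
  qed
  have all_if: "(\<forall>f. if P f then Q f else R f) = ((\<forall>f. P f \<longrightarrow> Q f) \<and> (\<forall>f. \<not> P f \<longrightarrow> R f))" for P Q R :: "'p set \<Rightarrow> bool"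
    by (meson if_bool_eq_conj)
  have mem: "x \<in> discrete_space M 1 r \<longleftrightarrow>
    (\<forall>f. f \<in> cells M \<and> 1 \<le> cdim M f \<longrightarrow> x f \<in> star_inv M f 1 ` trimmed M f r (int (cdim M f) - int 1)) \<and>
    (\<forall>f. \<not> (f \<in> cells M \<and> 1 \<le> cdim M f) \<longrightarrow> x f = 0)" for x
    unfolding discrete_space_def mem_Collect_eq by (rule all_if)
  show ?thesis
  proof (rule subspaceI)
    show "0 \<in> discrete_space M 1 r"
      unfolding discrete_space_def using subspace_0[OF S] by simp
    show "x + y \<in> discrete_space M 1 r" if xy: "x \<in> discrete_space M 1 r" "y \<in> discrete_space M 1 r" for x y
    proof -
      note X = xy(1)[unfolded mem] and Y = xy(2)[unfolded mem]
      have 1: "(x + y) f \<in> star_inv M f 1 ` trimmed M f r (int (cdim M f) - int 1)" if f: "f \<in> cells M \<and> 1 \<le> cdim M f" for f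
        unfolding plus_fun_apply[of x y]
        by (rule subspace_add[OF S[OF conjunct1[OF f] conjunct2[OF f]] X[THEN conjunct1, rule_format, OF f] Y[THEN conjunct1, rule_format, OF f]])
      have 2: "(x + y) f = 0" if f: "\<not> (f \<in> cells M \<and> 1 \<le> cdim M f)" for f
        unfolding plus_fun_apply[of x y] X[THEN conjunct2, THEN spec, THEN mp, OF f] Y[THEN conjunct2, THEN spec, THEN mp, OF f] by (rule add_0_left)
      show ?thesis unfolding mem using 1 2 by blast
    qed
    show "c *\<^sub>R x \<in> discrete_space M 1 r" if x: "x \<in> discrete_space M 1 r" for x c
    proof -
      note X = x[unfolded mem]
      have 1: "(c *\<^sub>R x) f \<in> star_inv M f 1 ` trimmed M f r (int (cdim M f) - int 1)" if f: "f \<in> cells M \<and> 1 \<le> cdim M f" for f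
        unfolding scaleR_fun_apply[of c x]
        by (rule subspace_scale[OF S[OF conjunct1[OF f] conjunct2[OF f]] X[THEN conjunct1, rule_format, OF f]])
      have 2: "(c *\<^sub>R x) f = 0" if f: "\<not> (f \<in> cells M \<and> 1 \<le> cdim M f)" for f
        unfolding scaleR_fun_apply[of c x] X[THEN conjunct2, THEN spec, THEN mp, OF f] by (rule scaleR_zero_right)
      show ?thesis unfolding mem using 1 2 by blast
    qed
  qed
qed

section \<open>Linearity of the derivative and the potential of discrete 1-forms on a 2-cell\<close>

context
  fixes f assumes f: "f \<in> cells M" "cdim M f = 2"
begin

lemma two_cell: "cdim M f = 1 \<or> cdim M f = 2" "cdim M f = Suc 1" "1 < cdim M f" "(1::nat) \<le> cdim M f" "2 \<le> cdim M f"
    "0 < cdim M f" "int (cdim M f) - int 1 = 1" "int (cdim M f) - int 1 - 1 = 0" "int (cdim M f) - int 2 = 0" "int (cdim M f) - int (1 + 1) = 0"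
  using f(2) by auto

lemma facet_edge:
  assumes "facet f e"
  shows "e \<in> cells M" "cdim M e = 1" "cdim M e = 1 \<or> cdim M e = 2" "1 \<le> cdim M e" "int (cdim M e) - int 1 = 0"
  using facetD(2,4)[OF assms] f(2) by auto

lemma bdry_integral_lin_left:
  assumes \<mu>: "\<mu> \<in> Ck_cell_forms M 0 f 0"
  shows "lin_on (discrete_space M 1 r) (\<lambda>\<omega>. bdry_integral M f \<omega> 0 \<mu>)"
  unfolding bdry_integral_facets[OF f(1) two_cell(6), abs_def]
proof (rule lin_on_sum_fun)
  fix e assume "e \<in> {e. facet f e}"
  then have F: "facet f e" by simp
  note e = facet_edge[OF F]
  have "trace M 0 f e \<mu> \<in> regular_forms e 0"
    using trace_Ck[OF F \<mu>] Ck_cell_forms_regular[OF e(1,3)] by blast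
  then have "lin_on (star_regular e 1) (\<lambda>\<omega>. cell_integral M e (wedge \<omega> (trace M 0 f e \<mu>)))"
    using integral_lin_left[OF e(1,3,4)] e(5) by simp
  then show "lin_on (discrete_space M 1 r) (\<lambda>\<omega>. cell_integral M e (wedge (\<omega> e) (trace M 0 f e \<mu>)))"
    unfolding lin_on_def plus_fun_apply scaleR_fun_apply using discrete_space_regular[OF _ e(1,3,4)] by blast
qed

lemma local_deriv_1_spec:
  assumes "\<omega> \<in> discrete_space M 1 r"
  shows "is_local_deriv 1 f \<omega> \<omega> \<delta> \<longleftrightarrow> \<delta> \<in> star_inv M f 2 ` poly M f r 0 \<and>
      (\<forall>\<mu>\<in>poly M f r 0. cell_integral M f (wedge \<delta> \<mu>) = cell_integral M f (wedge (\<omega> f) (d f \<mu>)) + bdry_integral M f \<omega> 0 \<mu>)"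
    "is_local_deriv 1 f \<omega> \<omega> (local_deriv M 1 r f \<omega>)"
    "is_local_deriv 1 f \<omega> \<omega> \<delta> \<Longrightarrow> local_deriv M 1 r f \<omega> = \<delta>"
proof -
  show "is_local_deriv 1 f \<omega> \<omega> \<delta> \<longleftrightarrow> \<delta> \<in> star_inv M f 2 ` poly M f r 0 \<and>
      (\<forall>\<mu>\<in>poly M f r 0. cell_integral M f (wedge \<delta> \<mu>) = cell_integral M f (wedge (\<omega> f) (d f \<mu>)) + bdry_integral M f \<omega> 0 \<mu>)"
    unfolding is_local_deriv_def Let_def two_cell(8) by (simp add: numeral_2_eq_2)
  note s = local_deriv_from_spec[of f 1 \<omega> \<omega>, OF f(1) two_cell(1,3) discrete_space_facet_regular[OF assms order_refl]
      discrete_space_regular[OF assms f(1) two_cell(1,4)], folded local_deriv_eq[OF f(1) two_cell(2)]]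
  show "is_local_deriv 1 f \<omega> \<omega> (local_deriv M 1 r f \<omega>)" by (rule s(1))
  show "is_local_deriv 1 f \<omega> \<omega> \<delta> \<Longrightarrow> local_deriv M 1 r f \<omega> = \<delta>" by (rule s(2))
qed

lemma local_deriv_1_regular: "\<omega> \<in> discrete_space M 1 r \<Longrightarrow> local_deriv M 1 r f \<omega> \<in> star_regular f 2"
  using local_deriv_1_spec(1,2) star_inv_poly_regular[OF f(1) two_cell(1,5), of r] unfolding two_cell(9) by blast

lemma cell_integral_lin_left:
  assumes \<mu>: "\<mu> \<in> poly M f s 1"
  shows "lin_on (discrete_space M 1 r) (\<lambda>\<omega>. cell_integral M f (wedge (\<omega> f) \<mu>))"
proof -
  have "lin_on (star_regular f 1) (\<lambda>\<omega>. cell_integral M f (wedge \<omega> \<mu>))"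
    using integral_lin_left[OF f(1) two_cell(1,4)] poly_regular[OF f(1) two_cell(1) le0] \<mu> two_cell(7) by auto
  then show ?thesis
    unfolding lin_on_def plus_fun_apply scaleR_fun_apply using discrete_space_regular[OF _ f(1) two_cell(1,4)] by blast
qed

lemma local_deriv_1_lin: "lin_on (discrete_space M 1 r) (local_deriv M 1 r f)"
  unfolding lin_on_def
proof (intro ballI allI)
  fix p q s assume p: "p \<in> discrete_space M 1 r" and q: "q \<in> discrete_space M 1 r"
  note pq = subspace_comb[OF subspace_discrete_space_1 p q, of s]
  let ?\<delta> = "local_deriv M 1 r f"
  have P: "?\<delta> p \<in> star_inv M f 2 ` poly M f r 0" "\<And>\<mu>. \<mu> \<in> poly M f r 0 \<Longrightarrow>
      cell_integral M f (wedge (?\<delta> p) \<mu>) = cell_integral M f (wedge (p f) (d f \<mu>)) + bdry_integral M f p 0 \<mu>"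
    if "p \<in> discrete_space M 1 r" for p
    using local_deriv_1_spec(2)[OF that] unfolding local_deriv_1_spec(1)[OF that] by blast+
  show "?\<delta> (s *\<^sub>R p + q) = s *\<^sub>R ?\<delta> p + ?\<delta> q"
  proof (rule local_deriv_1_spec(3)[OF pq], unfold local_deriv_1_spec(1)[OF pq], intro conjI ballI)
    show "s *\<^sub>R ?\<delta> p + ?\<delta> q \<in> star_inv M f 2 ` poly M f r 0"
      by (rule subspace_comb[OF subspace_star_inv_poly[OF f(1) two_cell(1,5), of r, unfolded two_cell(9)] P(1)[OF p] P(1)[OF q]])
    fix \<mu> assume \<mu>: "\<mu> \<in> poly M f r 0"
    have \<mu>r: "\<mu> \<in> regular_forms f (int (cdim M f) - int 2)"
      unfolding two_cell(9) using poly_regular[OF f(1) two_cell(1) le0] \<mu> by blast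
    have d\<mu>: "d f \<mu> \<in> poly M f r 1" using d_poly[OF f(1) \<mu>] by simp
    show "cell_integral M f (wedge (s *\<^sub>R ?\<delta> p + ?\<delta> q) \<mu>) =
        cell_integral M f (wedge ((s *\<^sub>R p + q) f) (d f \<mu>)) + bdry_integral M f (s *\<^sub>R p + q) 0 \<mu>"
      unfolding lin_onD[OF integral_lin_left[OF f(1) two_cell(1,5) \<mu>r] local_deriv_1_regular[OF p] local_deriv_1_regular[OF q]]
        lin_onD[OF bdry_integral_lin_left[OF poly_Ck(2)[OF f(1) \<mu>]] p q] lin_onD[OF cell_integral_lin_left[OF d\<mu>] p q]
        P(2)[OF p \<mu>] P(2)[OF q \<mu>] by (simp add: algebra_simps)
  qed
qed

lemma potential_1_spec:
  assumes "\<omega> \<in> discrete_space M 1 r"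
  shows "is_potential 1 f \<omega> (potential M 1 r f \<omega>)" "is_potential 1 f \<omega> p \<Longrightarrow> potential M 1 r f \<omega> = p"
    "potential M 1 r f \<omega> \<in> star_inv M f 1 ` poly M f r 1" "potential M 1 r f \<omega> \<in> star_regular f 1"
proof -
  note a = f(1) two_cell(2) order_refl discrete_space_facet_regular[OF assms order_refl] discrete_space_regular[of \<omega>, OF assms f(1) two_cell(1,4)]
  show "is_potential 1 f \<omega> (potential M 1 r f \<omega>)" by (rule potential_spec(1)[of f 1 \<omega>, OF a])
  show "is_potential 1 f \<omega> p \<Longrightarrow> potential M 1 r f \<omega> = p" by (rule potential_spec(2)[of f 1 \<omega>, OF a])
  show "potential M 1 r f \<omega> \<in> star_inv M f 1 ` poly M f r 1" by (rule potential_poly(1)[of f 1 \<omega>, OF a])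
  show "potential M 1 r f \<omega> \<in> star_regular f 1" by (rule potential_poly(2)[of f 1 \<omega>, OF a])
qed

lemma potential_1_lin: "lin_on (discrete_space M 1 r) (potential M 1 r f)"
  unfolding lin_on_def
proof (intro ballI allI)
  fix p q s assume p: "p \<in> discrete_space M 1 r" and q: "q \<in> discrete_space M 1 r"
  note pq = subspace_comb[OF subspace_discrete_space_1 p q, of s]
  let ?P = "potential M 1 r f"
  note P = potential_1_spec(1)[THEN is_potential_def[THEN iffD1], THEN conjunct2, rule_format]
  show "?P (s *\<^sub>R p + q) = s *\<^sub>R ?P p + ?P q"
  proof (rule potential_1_spec(2)[OF pq], unfold is_potential_def, intro conjI ballI)
    show "s *\<^sub>R ?P p + ?P q \<in> star_inv M f 1 ` poly M f r 1"
      by (rule subspace_comb[OF subspace_star_inv_poly[OF f(1) two_cell(1,4), of r, unfolded two_cell(7)] potential_1_spec(3)[OF p] potential_1_spec(3)[OF q]])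
    fix a b assume a: "a \<in> poly M f r 1" and b: "b \<in> poly M f (r - 1) 2"
    have \<kappa>a: "\<kappa> f a \<in> poly M f (r + 1) 0" using poly_facts(5)[OF f(1) a] by simp
    have \<kappa>b: "\<kappa> f b \<in> poly M f r 1" using poly_facts(5)[OF f(1) b] by simp
    have \<kappa>ar: "\<kappa> f a \<in> regular_forms f (int (cdim M f) - int 2)"
      unfolding two_cell(9) using poly_regular[OF f(1) two_cell(1) le0] \<kappa>a by blast
    have "d f (\<kappa> f a) + \<kappa> f b \<in> poly M f r 1"
      by (rule subspace_add[OF poly_facts(1)[OF f(1)] Lap_terms(1)[OF f(1) a] \<kappa>b])
    then have qr: "d f (\<kappa> f a) + \<kappa> f b \<in> regular_forms f (int (cdim M f) - int 1)"
      unfolding two_cell(7) using poly_regular[OF f(1) two_cell(1) le0] by blast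
    show "cell_integral M f (wedge (s *\<^sub>R ?P p + ?P q) (d f (\<kappa> f a) + \<kappa> f b)) =
        (-1) ^ (1 + 1) * (cell_integral M f (wedge (local_deriv M 1 r f (s *\<^sub>R p + q)) (\<kappa> f a)) - bdry_integral M f (s *\<^sub>R p + q) 0 (\<kappa> f a))
        + cell_integral M f (wedge ((s *\<^sub>R p + q) f) (\<kappa> f b))"
      unfolding lin_onD[OF integral_lin_left[OF f(1) two_cell(1,4) qr] potential_1_spec(4)[OF p] potential_1_spec(4)[OF q]]
        lin_onD[OF local_deriv_1_lin p q]
        lin_onD[OF integral_lin_left[OF f(1) two_cell(1,5) \<kappa>ar] local_deriv_1_regular[OF p] local_deriv_1_regular[OF q]]
        lin_onD[OF bdry_integral_lin_left[OF poly_Ck(2)[OF f(1) \<kappa>a]] p q] lin_onD[OF cell_integral_lin_left[OF \<kappa>b] p q]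
        P[OF p a b] P[OF q a b] by (simp add: algebra_simps)
  qed
qed

text \<open>The potential is the inverse star of a polynomial 1-form, so
  \<open>star_inv_trace\<close> applies; this makes the boundary terms of the inner product
  integrable.\<close>

lemma potential_1_trace:
  assumes F: "facet f e" and \<omega>: "\<omega> \<in> discrete_space M 1 r"
  shows "traceable 1 f e (potential M 1 r f \<omega>)" "trace M 1 f e (potential M 1 r f \<omega>) \<in> star_regular e 1"
proof -
  obtain p where p: "p \<in> poly M f r 1" "potential M 1 r f \<omega> = star_inv M f 1 p"
    using potential_1_spec(3)[OF \<omega>] by blast
  note t = star_inv_trace[OF F f(2) poly_Ck(2)[OF f(1) p(1)], folded p(2)]
  show "traceable 1 f e (potential M 1 r f \<omega>)" by (rule t(1))
  then show "trace M 1 f e (potential M 1 r f \<omega>) \<in> star_regular e 1"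
    using trace_cell_forms[OF F t(1)] t(2) facet_edge(5)[OF F] unfolding star_regular_def by simp
qed

end

lemma discrete_inner_1_lin:
  assumes \<mu>: "\<mu> \<in> discrete_space M 1 r"
  shows "lin_on (discrete_space M 1 r) (\<lambda>\<omega>. discrete_inner M 1 r \<omega> \<mu>)"
proof -
  let ?X = "discrete_space M 1 r" and ?P = "potential M 1 r"
  define edge where "edge f e \<omega> = ?P e \<omega> - trace M 1 f e (?P f \<omega>)" for f e \<omega>
  \<comment> \<open>For \<open>k = 1\<close> only edges occur, with the cell size to the first
    power. The factors 1 bring the sums into the shape handled by \<open>lin_on_sum_fun\<close> and
    \<open>lin_on_combine\<close>.\<close>
  have eq: "discrete_inner M 1 r \<omega> \<mu> = (\<Sum>f\<in>cells_of_dim M 2. 1 *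
      (1 * cell_integral M f (wedge (?P f \<omega>) (star M f 1 (?P f \<mu>))) +
       1 * (\<Sum>e | facet f e. cell_size M f * cell_integral M e (wedge (edge f e \<omega>) (star M e 1 (edge f e \<mu>))))))" for \<omega>
  proof -
    have "{1..<2::nat} = {1}" by auto
    moreover have "faces M 1 f = {e. facet f e}" if "f \<in> cells_of_dim M 2" for f
      using faces_eq_facets[of f] that by (simp add: cells_of_dim_def)
    ultimately show ?thesis unfolding discrete_inner_def edge_def by (simp add: sum_distrib_left cong: sum.cong)
  qed
  have cell: "lin_on ?X (\<lambda>\<omega>. cell_integral M f (wedge (?P f \<omega>) (star M f 1 (?P f \<mu>))))" if f: "f \<in> cells M" "cdim M f = 2" for f
  proof (rule lin_on_comp[OF potential_1_lin[OF f]])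
    show "lin_on (star_regular f 1) (\<lambda>\<omega>. cell_integral M f (wedge \<omega> (star M f 1 (?P f \<mu>))))"
      by (rule integral_lin_left[OF f(1) two_cell(1,4)[OF f] star_regularD(2)[OF f(1) two_cell(1,4)[OF f] potential_1_spec(4)[OF f \<mu>]]])
    show "?P f ` ?X \<subseteq> star_regular f 1" using potential_1_spec(4)[OF f] by blast
  qed
  have edge: "lin_on ?X (\<lambda>\<omega>. cell_integral M e (wedge (edge f e \<omega>) (star M e 1 (edge f e \<mu>))))"
    if f: "f \<in> cells M" "cdim M f = 2" and F: "facet f e" for f e
  proof (rule lin_on_comp[where G="\<lambda>\<eta>. cell_integral M e (wedge \<eta> (star M e 1 (edge f e \<mu>)))"])
    note e = facet_edge[OF f F]
    have R: "edge f e \<omega> \<in> star_regular e 1" if "\<omega> \<in> ?X" for \<omega>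
      unfolding edge_def potential_top[OF e(2)]
      by (rule subspace_diff[OF subspace_star_regular[OF e(1,3,4)] discrete_space_regular[OF that e(1,3,4)] potential_1_trace(2)[OF f F that]])
    show "edge f e ` ?X \<subseteq> star_regular e 1" using R by blast
    show "lin_on (star_regular e 1) (\<lambda>\<eta>. cell_integral M e (wedge \<eta> (star M e 1 (edge f e \<mu>))))"
      by (rule integral_lin_left[OF e(1,3,4) star_regularD(2)[OF e(1,3,4) R[OF \<mu>]]])
    have "lin_on ?X (\<lambda>\<omega>. \<omega> e)" unfolding lin_on_def by simp
    moreover have "lin_on ?X (\<lambda>\<omega>. trace M 1 f e (?P f \<omega>))"
      by (rule lin_on_comp[OF potential_1_lin[OF f] trace_lin[OF F]]) (use potential_1_trace(1)[OF f F] in blast)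
    ultimately show "lin_on ?X (edge f e)"
      unfolding edge_def[abs_def] potential_top[OF e(2)] by (rule lin_on_pointwise_diff)
  qed
  show ?thesis
    unfolding eq
    by (intro lin_on_sum_fun lin_on_combine) (use cell edge in \<open>auto simp: cells_of_dim_def\<close>)
qed

text \<open>For \<open>k = 2\<close> no lower-dimensional terms occur, and the second factor is the
  star of 0. The first argument may be arbitrary, so no linearity of this product is needed.\<close>

lemma discrete_inner_2_0: "discrete_inner M 2 r \<omega> 0 = 0"
proof -
  have "star M f 2 (potential M 2 r f 0) = 0" if "f \<in> cells_of_dim M 2" for f
  proof -
    have f: "f \<in> cells M" "cdim M f = 2" using that by (auto simp: cells_of_dim_def)
    have "potential M 2 r f 0 = 0" by (rule trans[OF potential_top[OF f(2)] zero_fun_apply])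
    then show ?thesis using star_0[OF f(1) two_cell(1,5)[OF f]] by (simp only:)
  qed
  then show ?thesis unfolding discrete_inner_def by (simp add: wedge_0_right cell_integral_0)
qed

end

section \<open>The discrete complex property\<close>

context ddr
begin

context
  fixes v assumes v: "v \<in> discrete_space M 0 r"
begin

abbreviation dv where "dv \<equiv> discrete_deriv M 0 r v"

lemma v_regular:
  assumes "f \<in> cells M" "cdim M f = 1 \<or> cdim M f = 2"
  shows "v f \<in> star_regular f 0" "facet_regular f 0 v"
  by (rule discrete_space_regular[OF v assms le0]) (rule discrete_space_facet_regular[OF v le0])

section \<open>The discrete derivative of a 0-form on an edge\<close>

context
  fixes e assumes e: "e \<in> cells M" "cdim M e = 1"
begin

lemma one_cell: "cdim M e = 1 \<or> cdim M e = 2" "cdim M e = Suc 0" "0 < cdim M e" "1 \<le> cdim M e" "0 + 1 \<le> cdim M e"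
    "int (cdim M e) - int 0 = 1" "int (cdim M e) - int 0 - 1 = 0" "int (cdim M e) - int 1 = 0" "int (cdim M e) - int (0 + 1) = 0"
  using e(2) by auto

text \<open>The star of a 1-form on an edge is a 0-form, and in degree 0 the trimmed and full
  polynomial spaces coincide. Hence the projection in the discrete derivative is the identity on
  edges.\<close>

lemma edge_deriv:
  shows "local_deriv M 0 r e v \<in> star_inv M e 1 ` poly M e r 0"
    "\<mu> \<in> poly M e r 0 \<Longrightarrow> cell_integral M e (wedge (local_deriv M 0 r e v) \<mu>) =
       - cell_integral M e (wedge (v e) (d e \<mu>)) + bdry_integral M e v 0 \<mu>"
    "local_deriv M 0 r e v \<in> star_regular e 1"
    "dv e = local_deriv M 0 r e v"
proof -
  have "is_local_deriv 0 e v v (local_deriv M 0 r e v)"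
    unfolding local_deriv_eq[OF e(1) one_cell(2)]
    by (rule local_deriv_from_spec(1)[of e 0 v v, OF e(1) one_cell(1,3) v_regular(2,1)[OF e(1) one_cell(1)]])
  then have *: "local_deriv M 0 r e v \<in> star_inv M e (0 + 1) ` poly M e r 0 \<and>
     (\<forall>\<mu>\<in>poly M e r 0. cell_integral M e (wedge (local_deriv M 0 r e v) \<mu>) =
        (-1) ^ (0 + 1) * cell_integral M e (wedge (v e) (ext_deriv M e \<mu>)) + bdry_integral M e v 0 \<mu>)"
    unfolding is_local_deriv_def Let_def one_cell(7) .
  then show **: "local_deriv M 0 r e v \<in> star_inv M e 1 ` poly M e r 0" by simp
  show "\<mu> \<in> poly M e r 0 \<Longrightarrow> cell_integral M e (wedge (local_deriv M 0 r e v) \<mu>) =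
       - cell_integral M e (wedge (v e) (d e \<mu>)) + bdry_integral M e v 0 \<mu>"
    using * by simp
  show "local_deriv M 0 r e v \<in> star_regular e 1"
    using ** star_inv_poly_regular[OF e(1) one_cell(1,4), of r] unfolding one_cell(8) by blast
  obtain p where p: "p \<in> poly M e r 0" "local_deriv M 0 r e v = star_inv M e 1 p" using ** by blast
  have pr: "p \<in> regular_forms e 0" using poly_regular[OF e(1) one_cell(1) le0] p(1) by blast
  have "star M e 1 (local_deriv M 0 r e v) = p"
    unfolding p(2) using star_inv_regular(2)[OF e(1) one_cell(1,4)] pr one_cell(8) by simp
  moreover have "trimmed_proj M e r 0 p = p"
    by (rule trimmed_proj(3)[OF e(1) one_cell(1) _ pr]) (use p(1) in \<open>auto simp: trimmed_def\<close>)
  ultimately show "dv e = local_deriv M 0 r e v"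
    unfolding discrete_deriv_def star_proj_def using e p(2) by simp
qed

text \<open>The defining equation is tested with \<open>b = 0\<close>, which removes the term
  containing the component of \<open>v\<close> on the edge.\<close>

lemma edge_potential:
  shows "potential M 0 r e v \<in> star_regular e 0"
    "a \<in> poly M e r 1 \<Longrightarrow> cell_integral M e (wedge (potential M 0 r e v) (d e (\<kappa> e a))) =
       - (cell_integral M e (wedge (local_deriv M 0 r e v) (\<kappa> e a)) - bdry_integral M e v 0 (\<kappa> e a))"
proof -
  note a = e(1) one_cell(2) le0 v_regular(2,1)[OF e(1) one_cell(1)]
  show "potential M 0 r e v \<in> star_regular e 0" by (rule potential_poly(2)[of e 0 v, OF a])
  assume "a \<in> poly M e r 1"
  then have "cell_integral M e (wedge (potential M 0 r e v) (d e (\<kappa> e a) + \<kappa> e 0)) =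
      (-1) ^ (0 + 1) * (cell_integral M e (wedge (local_deriv M 0 r e v) (\<kappa> e a)) - bdry_integral M e v 0 (\<kappa> e a))
      + cell_integral M e (wedge (v e) (\<kappa> e 0))"
    using potential_spec(1)[of e 0 v, OF a] poly_0[OF e(1), of "r - 1" 2] unfolding is_potential_def by blast
  then show "cell_integral M e (wedge (potential M 0 r e v) (d e (\<kappa> e a))) =
      - (cell_integral M e (wedge (local_deriv M 0 r e v) (\<kappa> e a)) - bdry_integral M e v 0 (\<kappa> e a))"
    unfolding kosz_0[OF e(1)] wedge_0_right cell_integral_0 add_0_right by simp
qed

text \<open>Integration by parts with the potential in place of \<open>v\<close>. Split
  \<open>m\<close> by \<open>poly_0_decomp\<close>: for \<open>\<kappa> e a\<close> it is the
  equation of the potential, and for the closed part \<open>h\<close> it is the equation of the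
  derivative, where the interior term contains \<open>d e h = 0\<close>.\<close>

lemma edge_stokes:
  assumes m: "m \<in> poly M e r 0"
  shows "cell_integral M e (wedge (potential M 0 r e v) (d e m)) + cell_integral M e (wedge (dv e) m) = bdry_integral M e v 0 m"
proof -
  obtain h a where h: "h \<in> poly M e r 0" "d e h = 0" and a: "a \<in> poly M e r 1" and m: "m = h + \<kappa> e a"
    by (rule poly_0_decomp[OF e(1) m]) (rule that; assumption)
  have \<kappa>a: "\<kappa> e a \<in> poly M e (r + 1) 0" using poly_facts(5)[OF e(1) a] by simp
  have h': "h \<in> poly M e (r + 1) 0" using poly_mono[OF e(1), of r "r + 1" 0] h(1) by auto
  have "d e m = d e (\<kappa> e a)"
    unfolding m lin_on_add[OF poly_facts(1)[OF e(1)] poly_d_lin[OF e(1)] h' \<kappa>a] h(2) by (rule add_0_left)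
  moreover have "cell_integral M e (wedge (dv e) m) = cell_integral M e (wedge (dv e) h) + cell_integral M e (wedge (dv e) (\<kappa> e a))"
    unfolding m edge_deriv(4)
    by (rule lin_on_add[OF subspace_regular_forms integral_lin_right[OF e(1) one_cell(1,4) edge_deriv(3)]])
       (use h(1) \<kappa>a poly_regular[OF e(1) one_cell(1) le0] one_cell(8) in auto)
  moreover have "lin_on (Ck_cell_forms M 0 e 0) (bdry_integral M e v 0)"
    by (rule bdry_integral_lin_regular[OF e(1) one_cell(1,3) v_regular(2)[OF e(1) one_cell(1)] one_cell(7)[symmetric]])
  then have "lin_on (poly M e (r + 1) 0) (bdry_integral M e v 0)"
    by (rule lin_on_mono) (use poly_Ck(2)[OF e(1)] in blast)
  then have "bdry_integral M e v 0 m = bdry_integral M e v 0 h + bdry_integral M e v 0 (\<kappa> e a)"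
    unfolding m by (rule lin_on_add[OF poly_facts(1)[OF e(1)] _ h' \<kappa>a])
  moreover have "cell_integral M e (wedge (dv e) h) = bdry_integral M e v 0 h"
    using edge_deriv(2)[OF h(1)] unfolding h(2) wedge_0_right cell_integral_0 edge_deriv(4) by simp
  ultimately show ?thesis using edge_potential(2)[OF a] unfolding edge_deriv(4) by simp
qed

end

section \<open>The discrete derivative of a 0-form on a 2-cell\<close>

context
  fixes f assumes f: "f \<in> cells M" "cdim M f = 2"
begin

text \<open>\<open>d f \<mu>\<close> is itself trimmed, so the projection in the discrete derivative
  is invisible when paired with it, and the unprojected local derivative may be used. Of its
  defining equation only the boundary term is left.\<close>

lemma face_deriv:
  shows "dv f \<in> star_inv M f 1 ` trimmed M f r 1"
    "\<mu> \<in> poly M f r 0 \<Longrightarrow> cell_integral M f (wedge (dv f) (d f \<mu>)) = bdry_integral M f (\<lambda>e. potential M 0 r e v) 1 (d f \<mu>)"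
proof -
  let ?\<delta> = "local_deriv M 0 r f v" and ?P = "\<lambda>e. potential M 0 r e v"
  have n: "0 < cdim M f" "int (cdim M f) - int 0 - 1 = 1" using f(2) by auto
  have P: "facet_regular f 0 ?P"
    unfolding facet_regular_def using edge_potential(1) facetD(2) by blast
  have "is_local_deriv 0 f ?P v ?\<delta>"
    unfolding local_deriv_def
    by (rule local_deriv_from_spec(1)[of f 0 ?P v, OF f(1) two_cell(1)[OF f] n(1) P v_regular(1)[OF f(1) two_cell(1)[OF f]]])
  then have *: "?\<delta> \<in> star_inv M f (0 + 1) ` poly M f r 1 \<and>
     (\<forall>\<mu>\<in>poly M f r 1. cell_integral M f (wedge ?\<delta> \<mu>) =
        (-1) ^ (0 + 1) * cell_integral M f (wedge (v f) (ext_deriv M f \<mu>)) + bdry_integral M f ?P 1 \<mu>)"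
    unfolding is_local_deriv_def Let_def n(2) .
  then obtain p where p: "p \<in> poly M f r 1" "?\<delta> = star_inv M f 1 p" by auto
  note cd = two_cell(1)[OF f] and k1 = two_cell(4)[OF f]
  have l: "(1::int) \<le> int (cdim M f)" using f(2) by simp
  have pr: "p \<in> regular_forms f 1" using poly_regular[OF f(1) cd le0] p(1) by blast
  have sp: "star M f 1 ?\<delta> = p"
    unfolding p(2) using star_inv_regular(2)[OF f(1) cd k1] pr two_cell(7)[OF f] by simp
  define q where "q = trimmed_proj M f r 1 p"
  have q: "q \<in> trimmed M f r 1" unfolding q_def by (rule trimmed_proj(1)[OF f(1) cd l pr])
  have dvf: "dv f = star_inv M f 1 q"
    unfolding discrete_deriv_def star_proj_def q_def using f sp by simp
  show "dv f \<in> star_inv M f 1 ` trimmed M f r 1" unfolding dvf using q by blast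
  have qr: "q \<in> regular_forms f 1" using trimmed_subset[OF f(1)] poly_regular[OF f(1) cd le0] q by blast
  assume \<mu>: "\<mu> \<in> poly M f r 0"
  have d\<mu>: "d f \<mu> \<in> poly M f r 1" "d f \<mu> \<in> trimmed M f r 1" using d_poly[OF f(1) \<mu>] d_trimmed[OF f(1) \<mu>] by auto
  have "d f (d f \<mu>) \<in> poly M f r 2" using d_poly[OF f(1) d\<mu>(1)] by simp
  then have dd: "d f (d f \<mu>) = 0"
    by (intro ext_deriv_ext_deriv[OF f poly_Ck(1)[OF f(1) \<mu>] poly_Ck(1)[OF f(1) d\<mu>(1)]] poly_Ck(3)[OF f(1)])
  have wedge_L2: "cell_integral M f (wedge (star_inv M f 1 s) (d f \<mu>)) = L2_inner M f s (d f \<mu>)" if "s \<in> regular_forms f 1" for s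
  proof -
    have s: "s \<in> regular_forms f (int (cdim M f) - int 1)" using that two_cell(7)[OF f] by simp
    have "d f \<mu> \<in> cell_forms M f (int (cdim M f) - int 1)" using poly_Ck(3)[OF f(1) d\<mu>(1)] two_cell(7)[OF f] by simp
    then show ?thesis
      using integral_wedge[OF f(1) cd k1 star_regularD(1)[OF f(1) cd k1 star_inv_regular(1)[OF f(1) cd k1 s]]]
        star_inv_regular(2)[OF f(1) cd k1 s] by simp
  qed
  have "cell_integral M f (wedge (dv f) (d f \<mu>)) = L2_inner M f q (d f \<mu>)" unfolding dvf by (rule wedge_L2[OF qr])
  also have "\<dots> = L2_inner M f p (d f \<mu>)" unfolding q_def by (rule trimmed_proj(2)[OF f(1) cd l pr d\<mu>(2)])
  also have "\<dots> = cell_integral M f (wedge ?\<delta> (d f \<mu>))" unfolding p(2) by (rule wedge_L2[OF pr, symmetric])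
  also have "\<dots> = (-1) ^ (0 + 1) * cell_integral M f (wedge (v f) (d f (d f \<mu>))) + bdry_integral M f ?P 1 (d f \<mu>)"
    using * d\<mu>(1) by blast
  also have "\<dots> = bdry_integral M f ?P 1 (d f \<mu>)" unfolding dd wedge_0_right cell_integral_0 by simp
  finally show "cell_integral M f (wedge (dv f) (d f \<mu>)) = bdry_integral M f ?P 1 (d f \<mu>)" .
qed

end

lemma deriv_in_discrete_space: "dv \<in> discrete_space M 1 r"
proof -
  have "dv f \<in> star_inv M f 1 ` trimmed M f r (int (cdim M f) - int 1)" if f: "f \<in> cells M" "1 \<le> cdim M f" for f
  proof (cases "cdim M f = 1")
    case True
    then show ?thesis using edge_deriv(1,4)[OF f(1)] by (simp add: trimmed_def)
  next
    case False
    then have "cdim M f = 2" using f cell_facts(3)[OF f(1)] by simp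
    then show ?thesis using face_deriv(1)[OF f(1)] by simp
  qed
  note in_cell = this
  have out: "dv f = 0" if "\<not> (f \<in> cells M \<and> 1 \<le> cdim M f)" for f
    unfolding discrete_deriv_def add_0_left by (rule if_not_P[OF that])
  show ?thesis
    unfolding discrete_space_def
  proof (intro CollectI allI)
    fix f
    show "if f \<in> cells M \<and> 1 \<le> cdim M f
      then dv f \<in> star_inv M f 1 ` trimmed M f r (int (cdim M f) - int 1) else dv f = 0"
    proof (cases "f \<in> cells M \<and> 1 \<le> cdim M f")
      case True
      show ?thesis unfolding if_P[OF True] by (rule in_cell[OF conjunct1[OF True] conjunct2[OF True]])
    next
      case False
      show ?thesis unfolding if_not_P[OF False] by (rule out[OF False])
    qed
  qed
qed

text \<open>Both iterated traces are the pullback of one local extension of \<open>\<mu>\<close> at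
  the vertex.\<close>

lemma vertex_trace:
  assumes F: "facet f e" "facet e x" "facet f e'" "facet e' x" and \<mu>: "\<mu> \<in> Ck_cell_forms M 0 f 0"
  shows "trace M 0 e x (trace M 0 f e \<mu>) = trace M 0 e' x (trace M 0 f e' \<mu>)"
proof
  fix y
  have out: "trace M 0 e x (trace M 0 f e \<mu>) y = 0" if "facet f e" "facet e x" "y \<notin> x" for e
    by (rule trace_props(1)[OF that(2) Ck_cell_forms_traceable[OF that(2) trace_Ck[OF that(1) \<mu>]] that(3)]) simp
  show "trace M 0 e x (trace M 0 f e \<mu>) y = trace M 0 e' x (trace M 0 f e' \<mu>) y"
  proof (cases "y \<in> x")
    case False
    then show ?thesis using out F by simp
  next
    case True
    have "x \<subseteq> closure e" "e \<subseteq> closure f" using facetD(3)[OF F(1)] facetD(3)[OF F(2)] by (auto simp: bdry_def)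
    then have "y \<in> closure f" using True closure_minimal[of e "closure f"] by blast
    then obtain W \<eta> where "extends 0 0 f \<mu> y W \<eta>" using \<mu> unfolding Ck_cell_forms_iff by blast
    then show ?thesis using trace_trace[OF F(1,2) \<mu> True] trace_trace[OF F(3,4) \<mu> True] by simp
  qed
qed

text \<open>By \<open>vertex_trace\<close> the integral at a vertex does not depend on the edge
  through which it is reached. It factors out after the sums are interchanged, leaving the sum of
  products of signs.\<close>

lemma bdry_bdry_integral:
  assumes f: "f \<in> cells M" "cdim M f = 2" and \<mu>: "\<mu> \<in> Ck_cell_forms M 0 f 0"
  shows "(\<Sum>e | facet f e. rel_orient M f e * bdry_integral M e v 0 (trace M 0 f e \<mu>)) = 0"
proof -
  let ?V = "{x \<in> cells M. cdim M x = 0}" and ?F = "{e. facet f e}"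
  have fin: "finite (cells M)" by (rule mesh_conj(1))
  have finF: "finite ?F" by (rule finite_subset[OF _ fin]) (use facetD(2) in blast)
  \<comment> \<open>The common value at the vertex \<open>x\<close>, written with an arbitrary edge
    between \<open>f\<close> and \<open>x\<close>; its value at vertices not in the boundary is
    irrelevant, as it is multiplied by an empty sum.\<close>
  define c where "c x = cell_integral M x (wedge (v x) (trace M 0 (SOME e. facet f e \<and> facet e x) x (trace M 0 f (SOME e. facet f e \<and> facet e x) \<mu>)))" for x
  have c: "cell_integral M x (wedge (v x) (trace M 0 e x (trace M 0 f e \<mu>))) = c x" if "facet f e" "facet e x" for e x
  proof -
    have s: "facet f (SOME e. facet f e \<and> facet e x) \<and> facet (SOME e. facet f e \<and> facet e x) x"
      by (rule someI[of _ e]) (use that in blast)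
    show ?thesis unfolding c_def vertex_trace[OF that s[THEN conjunct1] s[THEN conjunct2] \<mu>] ..
  qed
  have inner: "bdry_integral M e v 0 (trace M 0 f e \<mu>) = (\<Sum>x\<in>?V. if facet e x then rel_orient M e x * c x else 0)" if F: "facet f e" for e
  proof -
    note e = facet_edge[OF f F]
    have "cdim M e > 0" using e(2) by simp
    have "{x. facet e x} = {x \<in> ?V. facet e x}" using facetD(2,4) e(2) by fastforce
    then have "bdry_integral M e v 0 (trace M 0 f e \<mu>) = (\<Sum>x\<in>{x \<in> ?V. facet e x}. rel_orient M e x * c x)"
      unfolding bdry_integral_facets[OF e(1) \<open>cdim M e > 0\<close>] using c[OF F] by (intro sum.cong) auto
    also have "\<dots> = (\<Sum>x\<in>?V. if facet e x then rel_orient M e x * c x else 0)"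
      by (rule sum.inter_filter) (use fin in simp)
    finally show ?thesis .
  qed
  have "(\<Sum>e\<in>?F. rel_orient M f e * bdry_integral M e v 0 (trace M 0 f e \<mu>)) =
      (\<Sum>e\<in>?F. \<Sum>x\<in>?V. c x * (if facet e x then rel_orient M f e * rel_orient M e x else 0))"
    by (rule sum.cong[OF refl]) (auto simp: inner sum_distrib_left intro!: sum.cong)
  also have "\<dots> = (\<Sum>x\<in>?V. c x * (\<Sum>e\<in>?F. if facet e x then rel_orient M f e * rel_orient M e x else 0))"
    unfolding sum_distrib_left by (rule sum.swap)
  also have "\<dots> = 0"
  proof (rule sum.neutral, rule ballI)
    fix x assume x: "x \<in> ?V"
    have "(\<Sum>e\<in>?F. if facet e x then rel_orient M f e * rel_orient M e x else 0) =
        (\<Sum>e | facet f e \<and> facet e x. rel_orient M f e * rel_orient M e x)"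
      using sum.inter_filter[OF finF, of "\<lambda>e. rel_orient M f e * rel_orient M e x" "\<lambda>e. facet e x"] by simp
    also have "\<dots> = 0" by (rule boundary_of_boundary[OF f]) (use x in auto)
    finally show "c x * (\<Sum>e\<in>?F. if facet e x then rel_orient M f e * rel_orient M e x else 0) = 0" by simp
  qed
  finally show ?thesis .
qed

text \<open>By uniqueness it suffices that 0 solves the defining equation. On each edge,
  \<open>edge_stokes\<close> merges the potential coming from the interior term with the component
  of the discrete derivative into boundary values of \<open>v\<close>.\<close>

lemma local_deriv_deriv:
  assumes f: "f \<in> cells M" "cdim M f = 2"
  shows "local_deriv M 1 r f dv = 0"
proof (rule local_deriv_1_spec(3)[OF f deriv_in_discrete_space], unfold local_deriv_1_spec(1)[OF f deriv_in_discrete_space], intro conjI ballI)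
  show "0 \<in> star_inv M f 2 ` poly M f r 0"
    using subspace_0[OF subspace_star_inv_poly[OF f(1) two_cell(1,5)[OF f], of r]] unfolding two_cell(9)[OF f] .
  fix \<mu> assume \<mu>: "\<mu> \<in> poly M f r 0"
  have d\<mu>: "d f \<mu> \<in> poly M f r 1" using d_poly[OF f(1) \<mu>] by simp
  let ?P = "\<lambda>e. potential M 0 r e v"
  have "cell_integral M f (wedge (dv f) (d f \<mu>)) + bdry_integral M f dv 0 \<mu> =
      (\<Sum>e | facet f e. rel_orient M f e * bdry_integral M e v 0 (trace M 0 f e \<mu>))"
    unfolding face_deriv(2)[OF f \<mu>] bdry_integral_facets[OF f(1) two_cell(6)[OF f]] sum.distrib[symmetric]
  proof (rule sum.cong[OF refl])
    fix e assume "e \<in> {e. facet f e}"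
    then have F: "facet f e" by simp
    note e = facet_edge[OF f F]
    have m: "trace M 0 f e \<mu> \<in> poly M e r 0" by (rule trace_poly_0[OF F \<mu>])
    have "d e (trace M 0 f e \<mu>) \<in> poly M e r 1" using d_poly[OF e(1) m] by simp
    then have t: "trace M 1 f e (d f \<mu>) = d e (trace M 0 f e \<mu>)"
      by (intro trace_ext_deriv[OF F _ poly_Ck(1)[OF f(1) \<mu>] poly_Ck(2)[OF f(1) d\<mu>]] poly_Ck(3)[OF e(1)]) (simp add: e(2))
    show "rel_orient M f e * cell_integral M e (wedge (?P e) (trace M 1 f e (d f \<mu>))) +
        rel_orient M f e * cell_integral M e (wedge (dv e) (trace M 0 f e \<mu>)) =
        rel_orient M f e * bdry_integral M e v 0 (trace M 0 f e \<mu>)"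
      unfolding t distrib_left[symmetric] edge_stokes[OF e(1,2) m] ..
  qed
  also have "\<dots> = 0" by (rule bdry_bdry_integral[OF f poly_Ck(2)[OF f(1) \<mu>]])
  finally have z: "cell_integral M f (wedge (dv f) (d f \<mu>)) + bdry_integral M f dv 0 \<mu> = 0" .
  have \<mu>r: "\<mu> \<in> regular_forms f (int (cdim M f) - int 2)"
    unfolding two_cell(9)[OF f] using poly_regular[OF f(1) two_cell(1)[OF f] le0] \<mu> by blast
  have "cell_integral M f (wedge 0 \<mu>) = 0"
    by (rule lin_on_0[OF subspace_star_regular[OF f(1) two_cell(1,5)[OF f]] integral_lin_left[OF f(1) two_cell(1,5)[OF f] \<mu>r]])
  then show "cell_integral M f (wedge 0 \<mu>) = cell_integral M f (wedge (dv f) (d f \<mu>)) + bdry_integral M f dv 0 \<mu>"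
    unfolding z .
qed

theorem discrete_deriv_discrete_deriv: "discrete_deriv M 1 r dv = 0"
proof
  fix f
  have "star_proj M r (1 + 1) f (local_deriv M 1 r f dv) = 0" if f: "f \<in> cells M" "1 + 1 \<le> cdim M f"
  proof -
    have f2: "cdim M f = 2" using f cell_facts(3)[OF f(1)] by simp
    note tc = two_cell[OF f(1) f2]
    have t0: "trimmed_proj M f r 0 0 = 0"
      by (rule trimmed_proj(3)[OF f(1) tc(1) _ subspace_0[OF subspace_regular_forms] subspace_0[OF trimmed_subspace[OF f(1)]]]) simp
    have s0: "star M f (1 + 1) 0 = 0" "star_inv M f (1 + 1) 0 = 0"
      by (rule star_0[OF f(1) tc(1) f(2)]) (rule star_inv_0[OF f(1) tc(1) f(2)])
    show ?thesis unfolding star_proj_def local_deriv_deriv[OF f(1) f2] s0(1) tc(10) t0 s0(2) ..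
  qed
  note z = this
  show "discrete_deriv M 1 r dv f = 0 f"
  proof (cases "f \<in> cells M \<and> 1 + 1 \<le> cdim M f")
    case True
    show ?thesis unfolding discrete_deriv_def[of M 1] if_P[OF True] zero_fun_apply[of f] by (rule z[OF conjunct1[OF True] conjunct2[OF True]])
  next
    case False
    show ?thesis unfolding discrete_deriv_def[of M 1] if_not_P[OF False] zero_fun_apply[of f] ..
  qed
qed

end

end

section \<open>Integration in time\<close>

theorem proposition28:
  fixes M :: "'p::t2_space ddr_surface"
    and r :: int and T :: real
    and J :: "real \<Rightarrow> 'p form"
    and E E' B B' \<rho> \<rho>' :: "real \<Rightarrow> 'p set \<Rightarrow> 'p form"
  assumes "riemannian_surface M" and "compact (pts M)"
    and "mesh M" and "polynomial_spaces M" and "hypothesis_H M" and "hypothesis_T M"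
    and "r \<ge> 0" and "T > 0"
    and "continuous_time_forms M T 1 J"
    and "C1_curve T (discrete_space M 1 r) E E'"
    and "C1_curve T (discrete_space M 2 r) B B'"
    and "\<And>t v. t \<in> {0<..<T} \<Longrightarrow> v \<in> discrete_space M 2 r \<Longrightarrow>
           discrete_inner M 2 r (discrete_deriv M 1 r (E t)) v = - discrete_inner M 2 r (B' t) v"
    and "\<And>t v. t \<in> {0<..<T} \<Longrightarrow> v \<in> discrete_space M 1 r \<Longrightarrow>
           discrete_inner M 2 r (B t) (discrete_deriv M 1 r v) =
             discrete_inner M 1 r (interpolator M 1 r (J t)) v + discrete_inner M 1 r (E' t) v"
    and "C1_curve T (discrete_space M 0 r) \<rho> \<rho>'"
    and "\<And>t v. t \<in> {0..T} \<Longrightarrow> v \<in> discrete_space M 0 r \<Longrightarrow>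
           discrete_inner M 0 r (\<rho> t) v =
             - discrete_inner M 1 r (E 0) (discrete_deriv M 0 r v)
             + integral {0..t} (\<lambda>s. discrete_inner M 1 r (interpolator M 1 r (J s)) (discrete_deriv M 0 r v))"
  shows "\<forall>t\<in>{0..T}. \<forall>v\<in>discrete_space M 0 r.
           discrete_inner M 1 r (E t) (discrete_deriv M 0 r v) = - discrete_inner M 0 r (\<rho> t) v"
proof (intro ballI)
  fix t v assume t: "t \<in> {0..T}" and v: "v \<in> discrete_space M 0 r"
  interpret ddr M r by unfold_locales (use assms(1-7) in auto)
  define w where "w = discrete_deriv M 0 r v"
  have w: "w \<in> discrete_space M 1 r" unfolding w_def by (rule deriv_in_discrete_space[OF v])
  let ?L = "\<lambda>u. discrete_inner M 1 r u w"
  define h where "h s = ?L (interpolator M 1 r (J s))" for s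
  note L = discrete_inner_1_lin[OF w] and X = subspace_discrete_space_1
  \<comment> \<open>Coordinates in finitely many discrete forms: linearity of the inner product then
    reduces its time derivative to real functions, and no topology on the space of families is
    used.\<close>
  obtain A a a' where A: "A \<subseteq> discrete_space M 1 r"
      and a: "\<And>b s. b \<in> A \<Longrightarrow> s \<in> {0..T} \<Longrightarrow> (a b has_real_derivative a' b s) (at s within {0..T})"
      and E: "\<And>s. s \<in> {0..T} \<Longrightarrow> E s = (\<Sum>b\<in>A. a b s *\<^sub>R b)" "\<And>s. s \<in> {0..T} \<Longrightarrow> E' s = (\<Sum>b\<in>A. a' b s *\<^sub>R b)"
    using assms(10) unfolding C1_curve_def by blast
  have Lsum: "?L (\<Sum>b\<in>A. c b *\<^sub>R b) = (\<Sum>b\<in>A. c b * ?L b)" for c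
  proof -
    have "?L (\<Sum>b\<in>A. c b *\<^sub>R b) = (\<Sum>b\<in>A. ?L (c b *\<^sub>R b))"
      by (rule lin_on_sum[OF X L]) (use A subspace_scale[OF X] in blast)
    also have "\<dots> = (\<Sum>b\<in>A. c b * ?L b)"
      by (rule sum.cong[OF refl]) (use lin_on_scale[OF X L] A in auto)
    finally show ?thesis .
  qed
  have sub: "{0..t} \<subseteq> {0..T}" using t by auto
  have "((\<lambda>s. ?L (E' s)) has_integral (?L (E t) - ?L (E 0))) {0..t}"
  proof (rule fundamental_theorem_of_calculus)
    show "0 \<le> t" using t by simp
    fix s assume s: "s \<in> {0..t}"
    then have sT: "s \<in> {0..T}" using sub by blast
    have "((\<lambda>s. \<Sum>b\<in>A. a b s * ?L b) has_real_derivative (\<Sum>b\<in>A. a' b s * ?L b)) (at s within {0..T})"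
      by (rule DERIV_sum) (rule DERIV_cmult_right[OF a[OF _ sT]])
    then have "((\<lambda>s. \<Sum>b\<in>A. a b s * ?L b) has_vector_derivative ?L (E' s)) (at s within {0..t})"
      unfolding E(2)[OF sT] Lsum has_real_derivative_iff_has_vector_derivative
      by (rule has_vector_derivative_within_subset[OF _ sub])
    then show "((\<lambda>s. ?L (E s)) has_vector_derivative ?L (E' s)) (at s within {0..t})"
      by (rule has_vector_derivative_transform[OF s, rotated]) (use sub E(1) Lsum in auto)
  qed
  \<comment> \<open>The left side of the second equation vanishes since the test family is a
    discrete derivative. The scheme is available only at interior times, hence the exclusion of the
    end points.\<close>
  moreover have "- h s = ?L (E' s)" if s: "s \<in> {0..t} - {0, T}" for s
  proof -
    have "s \<in> {0<..<T}" using s t by auto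
    then have "discrete_inner M 2 r (B s) 0 = h s + ?L (E' s)"
      using assms(13)[OF _ w, of s] unfolding h_def w_def discrete_deriv_discrete_deriv[OF v] by simp
    then show ?thesis unfolding discrete_inner_2_0 by simp
  qed
  \<comment> \<open>Changing the integrand at two points does not affect the integral. This also
    supplies integrability of the source term \<open>h\<close>, taken over from the derivative of
    the electric field.\<close>
  ultimately have "((\<lambda>s. - h s) has_integral (?L (E t) - ?L (E 0))) {0..t}"
    using has_integral_spike_finite[of "{0, T}" "{0..t}" "\<lambda>s. - h s" "\<lambda>s. ?L (E' s)"] by simp
  then have "(h has_integral - (?L (E t) - ?L (E 0))) {0..t}"
    by (rule has_integral_neg[THEN has_integral_eq[rotated]]) simp
  then have "integral {0..t} h = - (?L (E t) - ?L (E 0))" by (rule integral_unique)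
  then show "discrete_inner M 1 r (E t) (discrete_deriv M 0 r v) = - discrete_inner M 0 r (\<rho> t) v"
    using assms(15)[OF t v] unfolding h_def[abs_def] w_def by simp
qed

end
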